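(* Let $N$ be a compact connected orientable smooth 2-manifold with trivial tangent bundle and finitely many (possibly zero) boundary circles labelled by $\ell$. Fix a base point $\bar x\in N$, an angular coordinate $\phi$ of period $2\pi$ on each boundary circle, and for each $\ell$ a boundary family $\phi\mapsto\alpha_{\ell,\phi}\in\widetilde N$. Then there is a one-to-one map from the set of physical field configurations $\{\omega_i(x),\gamma_i(x),u(\phi),v(\phi)\}$ on $N$ onto the set of all data $\{\tilde g(\alpha),f(\alpha),b_\ell,c_\ell\}$, where $(\tilde g,f):\widetilde N\to\widetilde{\mathsf{ISO}}(1,2)$ is a (smooth) normalized quasiperiodic function and, for each boundary $\ell$, $b_\ell\in\mathsf{SL}(2)$ and $c_\ell\in\mathfrak{sl}(2)$. It is explicitly given by $$\tilde g(\alpha)=\widetilde U_\alpha,\qquad b_\ell=U_{\alpha_{\ell,\phi}}\,u^{-1}(\phi),$$ $$f(\alpha)=V_\alpha,\qquad c_\ell=V_{\alpha_{\ell,\phi}}-U_{\alpha_{\ell,\phi}}\,u^{-1}(\phi)\,v(\phi)\,u(\phi)\,U_{\alpha_{\ell,\phi}}^{-1},$$ where the right hand sides of the formulas for $b_\ell$ and $c_\ell$ are independent of $\phi$. The inverse map reads $$\omega_i(x)=g^{-1}\partial_i g(\alpha_x),\qquad u(\phi)=b_\ell^{-1}\,g(\alpha_{\ell,\phi}),$$ $$\gamma_i(x)=g^{-1}\,\partial_i f\, g(\alpha_x),\qquad v(\phi)=b_\ell^{-1}\big(f(\alpha_{\ell,\phi})-c_\ell\big)\,b_\ell,$$ where $g:\widetilde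 N\to\mathsf{SL}(2)$ is the projection of $\tilde g$, and $\alpha_x\in\widetilde N$ is any point with $\pi(\alpha_x)=x\in N$.
   Context: Groups. $\mathsf{SL}(2)=\mathsf{SL}(2,\mathbb R)$ with Lie algebra $\mathfrak{sl}(2)$ (traceless real $2\times2$ matrices). $\widetilde{\mathsf{SL}}(2)$ is the universal covering group of $\mathsf{SL}(2)$, realized as homotopy classes (with fixed end points) of paths in $\mathsf{SL}(2)$ starting at $\mathbf 1$, with pointwise multiplication; dropping the tilde denotes the projection $\tilde g\mapsto g\in\mathsf{SL}(2)$ (end point of the path). $\widetilde{\mathsf{ISO}}(1,2)=\widetilde{\mathsf{SL}}(2)\times\mathfrak{sl}(2)$ with multiplication $(\tilde g,f)(\tilde g',f')=(\tilde g\tilde g',\,f+g f' g^{-1})$. Covering manifold. $\widetilde N$ is the set of homotopy classes (with fixed end points) of paths $\alpha:[0,1]\to N$ with $\alpha(0)=\bar x$, i.e. the universal cover, with projection $\pi(\alpha)=\alpha(1)$, locally carrying the same coordinates as $N$. $\alpha\bullet\beta$ denotes the path $\alpha$ followed by $\beta$. The loop group $\Upsilon=\pi^{-1}(\bar x)\subset\widetilde N$ is the group of classes of loops at $\bar x$ with product $\bullet$; its unit $\eta$ is the constant loop. Functions on $N$ are identified with their pullbacks to $\widetilde N$. Quasiperiodic functions. For a group $G$, a map $F:\widetilde N\to G$ is quasiperiodic if there are elements $F_\lambda\in G$ with $F(\lambda\bullet\alpha)=F_\lambda F(\alpha)$ for all $\lambda\in\Upsilon$, $\alpha\in\widetilde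 N$; it is normalized if moreover $F_\lambda=F(\lambda)$ for all $\lambda\in\Upsilon$, equivalently if $F(\eta)$ is the unit of $G$. Boundary family. For a boundary circle $\ell$, a boundary family is a continuous map $\mathbb R\to\widetilde N$, $\phi\mapsto\alpha_{\ell,\phi}$, such that $\pi(\alpha_{\ell,\phi})$ is the point of the circle $\ell$ with coordinate $\phi$ (mod $2\pi$); thus there is a loop $\lambda_\ell\in\Upsilon$ with $\alpha_{\ell,\phi+2\pi}=\lambda_\ell\bullet\alpha_{\ell,\phi}$. Fields. A field configuration consists of two smooth $\mathfrak{sl}(2)$-valued one-forms $\omega_i$, $\gamma_i$ on $N$ (smooth up to the boundary) and, for each boundary circle $\ell$, a pair of smooth functions $u:\mathbb R\to\mathsf{SL}(2)$, $v:\mathbb R\to\mathfrak{sl}(2)$ of $\phi$ which is quasiperiodic: there are constants $u_\ell\in\mathsf{SL}(2)$, $v_\ell\in\mathfrak{sl}(2)$ with $u(\phi+2\pi)=u_\ell u(\phi)$ and $v(\phi+2\pi)=v_\ell+u_\ell v(\phi)u_\ell^{-1}$. (The index $\ell$ on $u,v$ is suppressed.) It is physical if it satisfies the constraints: $$\partial_i\omega_j-\partial_j\omega_i+[\omega_i,\omega_j]=0,\qquad \epsilon^{ij}\big(\partial_i\gamma_j+[\omega_i,\gamma_j]\big)=0\quad\text{on }N,$$ and on every boundary circle $u^{-1}\partial_\phi u=\omega_\phi$, $u^{-1}(\partial_\phi v)\,u=\gamma_\phi$, where $\omega_\phi,\gamma_\phi$ are the components tangent to the boundary. Transport operator and distance.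 For a path $\alpha$ in $N$, $U_\alpha(a,s)\in\mathsf{SL}(2)$ is defined by $U_\alpha(a,a)=\mathbf 1$, $\partial_sU_\alpha(a,s)=U_\alpha(a,s)\,\omega_i(\alpha(s))\,\alpha'^i(s)$; $U_\alpha=U_\alpha(0,1)$; $\widetilde U_\alpha\in\widetilde{\mathsf{SL}}(2)$ is the class of the path $s\mapsto U_\alpha(0,s)$; and $V_\alpha=\int_0^1 ds\,U_\alpha(0,s)\,\gamma_i(\alpha(s))\,\alpha'^i(s)\,U_\alpha(s,0)\in\mathfrak{sl}(2)$. For physical configurations these depend only on the homotopy class of $\alpha$ with fixed end points. *)

theory Defs
  imports "HOL-Analysis.Analysis" "HOL-Algebra.Group"
begin

section \<open>Smooth functions\<close>

text \<open>
  Iterated Frechet differentiability, with derivatives taken within the domain. It is only applied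
  to relatively open subsets of a closed half-plane or of an interval with non-empty interior,
  where derivatives are unique; there it means that all derivatives exist in the interior and
  extend continuously to the boundary (smoothness up to the boundary).
\<close>

primrec Ck_on :: "nat \<Rightarrow> 'a::real_normed_vector set \<Rightarrow> ('a \<Rightarrow> 'b::real_normed_vector) \<Rightarrow> bool" where
  "Ck_on 0 S f \<longleftrightarrow> continuous_on S f"
| "Ck_on (Suc k) S f \<longleftrightarrow>
     (\<exists>f'. (\<forall>x\<in>S. (f has_derivative f' x) (at x within S)) \<and> (\<forall>v. Ck_on k S (\<lambda>x. f' x v)))"

definition smooth_on :: "'a::real_normed_vector set \<Rightarrow> ('a \<Rightarrow> 'b::real_normed_vector) \<Rightarrow> bool" where
  "smooth_on S f \<longleftrightarrow> (\<forall>k. Ck_on k S f)"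


section \<open>Smooth surfaces with boundary\<close>

text \<open>A chart is a coordinate domain together with a coordinate map into the closed half-plane;
  the values of the coordinate map outside the domain are irrelevant.\<close>

type_synonym 'p chart = "'p set \<times> ('p \<Rightarrow> real^2)"

definition half_plane :: "(real^2) set" where
  "half_plane = {z. z $ 2 \<ge> 0}"

definition is_chart :: "'p topology \<Rightarrow> 'p chart \<Rightarrow> bool" where
  "is_chart X c \<longleftrightarrow>
     openin X (fst c) \<and> openin (top_of_set half_plane) (snd c ` fst c) \<and>
     homeomorphic_map (subtopology X (fst c)) (top_of_set (snd c ` fst c)) (snd c)"

definition smooth_atlas :: "'p topology \<Rightarrow> 'p chart set \<Rightarrow> bool" where
  "smooth_atlas X A \<longleftrightarrow>
     (\<forall>c\<in>A. is_chart X c) \<and> topspace X = (\<Union>c\<in>A. fst c) \<and>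
     (\<forall>c\<in>A. \<forall>d\<in>A. smooth_on (snd c ` (fst c \<inter> fst d)) (snd d \<circ> inv_into (fst c) (snd c)))"

definition smooth_surface :: "'p topology \<Rightarrow> 'p chart set \<Rightarrow> bool" where
  "smooth_surface X A \<longleftrightarrow> Hausdorff_space X \<and> second_countable X \<and> smooth_atlas X A"

definition surface_boundary :: "'p chart set \<Rightarrow> 'p set" where
  "surface_boundary A = {x. \<exists>c\<in>A. x \<in> fst c \<and> snd c x $ 2 = 0}"

definition smooth_in_chart :: "'p chart \<Rightarrow> ('p \<Rightarrow> 'b::real_normed_vector) \<Rightarrow> bool" where
  "smooth_in_chart c F \<longleftrightarrow> smooth_on (snd c ` fst c) (F \<circ> inv_into (fst c) (snd c))"

text \<open>The coordinate derivative $\partial_i F(x)$ in the chart \<open>c\<close>, one-sided at boundary points.\<close>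

definition chart_deriv :: "'p chart \<Rightarrow> 2 \<Rightarrow> ('p \<Rightarrow> 'b::real_normed_vector) \<Rightarrow> 'p \<Rightarrow> 'b" where
  "chart_deriv c i F x =
     frechet_derivative (F \<circ> inv_into (fst c) (snd c)) (at (snd c x) within snd c ` fst c) (axis i 1)"

text \<open>Jacobian matrix at \<open>x\<close> of the change from the coordinates \<open>c\<close> to the coordinates \<open>d\<close>.\<close>

definition jacobian_matrix :: "'p chart \<Rightarrow> 'p chart \<Rightarrow> 'p \<Rightarrow> real^2^2" where
  "jacobian_matrix c d x = (\<chi> j i. chart_deriv (fst c \<inter> fst d, snd c) i (\<lambda>y. snd d y $ j) x)"

definition orientable :: "'p topology \<Rightarrow> 'p chart set \<Rightarrow> bool" where
  "orientable X A \<longleftrightarrow>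
     (\<exists>B. smooth_atlas X B \<and> smooth_atlas X (A \<union> B) \<and>
        (\<forall>c\<in>B. \<forall>d\<in>B. \<forall>x\<in>fst c \<inter> fst d. det (jacobian_matrix c d x) > 0))"

text \<open>A trivialization, i.e. a smooth vector bundle isomorphism from the product with $\mathbb{R}^2$
  to the tangent bundle: \<open>T c x\<close> is the matrix of its restriction to the fibre over \<open>x\<close>, with
  respect to the basis of coordinate vector fields of the chart \<open>c\<close>.\<close>

definition trivial_tangent_bundle :: "'p chart set \<Rightarrow> bool" where
  "trivial_tangent_bundle A \<longleftrightarrow>
     (\<exists>T :: 'p chart \<Rightarrow> 'p \<Rightarrow> real^2^2.
        (\<forall>c\<in>A. smooth_in_chart c (T c) \<and> (\<forall>x\<in>fst c. invertible (T c x))) \<and>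
        (\<forall>c\<in>A. \<forall>d\<in>A. \<forall>x\<in>fst c \<inter> fst d. T d x = jacobian_matrix c d x ** T c x))"


section \<open>The groups\<close>

definition SL2 :: "(real^2^2) set" where
  "SL2 = {M. det M = 1}"

definition sl2 :: "(real^2^2) set" where
  "sl2 = {M. trace M = 0}"

definition comm :: "real^2^2 \<Rightarrow> real^2^2 \<Rightarrow> real^2^2" where
  "comm M M' = M ** M' - M' ** M"

text \<open>\<open>ucover S x\<close> is the set of homotopy classes (with fixed end points) of paths in \<open>S\<close> starting
  at \<open>x\<close>. It is used both for the surface and for the group $SL(2)$.\<close>

definition hclass :: "'a::topological_space set \<Rightarrow> (real \<Rightarrow> 'a) \<Rightarrow> (real \<Rightarrow> 'a) set" where
  "hclass S p = {q. homotopic_paths S p q}"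

definition ucover :: "'a::topological_space set \<Rightarrow> 'a \<Rightarrow> (real \<Rightarrow> 'a) set set" where
  "ucover S x = {hclass S p | p. path p \<and> path_image p \<subseteq> S \<and> pathstart p = x}"

definition endpt :: "(real \<Rightarrow> 'a::topological_space) set \<Rightarrow> 'a" where
  "endpt \<alpha> = the_elem (pathfinish ` \<alpha>)"

text \<open>The usual topology of the universal cover: a basic open set consists of the classes
  obtained from a given \<open>\<alpha>\<close> by appending paths that stay in a given open set \<open>U\<close>.\<close>

definition ucover_topology :: "'a::topological_space set \<Rightarrow> 'a \<Rightarrow> (real \<Rightarrow> 'a) set topology" where
  "ucover_topology S x = topology_generated_by
     {{hclass S (p +++ q) | p q. p \<in> \<alpha> \<and> path q \<and> path_image q \<subseteq> U \<and> pathstart q = pathfinish p}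
      | \<alpha> U. \<alpha> \<in> ucover S x \<and> openin (top_of_set S) U}"

definition SLt_mult ::
  "(real \<Rightarrow> real^2^2) set \<Rightarrow> (real \<Rightarrow> real^2^2) set \<Rightarrow> (real \<Rightarrow> real^2^2) set" where
  "SLt_mult a a' = (\<Union>p\<in>a. \<Union>q\<in>a'. hclass SL2 (\<lambda>s. p s ** q s))"

definition ISOt :: "((real \<Rightarrow> real^2^2) set \<times> (real^2^2)) monoid" where
  "ISOt = \<lparr>carrier = ucover SL2 (mat 1) \<times> sl2,
           mult = (\<lambda>(a, f) (a', f'). (SLt_mult a a', f + endpt a ** f' ** matrix_inv (endpt a))),
           one = (hclass SL2 (\<lambda>s. mat 1), 0)\<rparr>"


section \<open>Quasiperiodic functions on the universal cover\<close>

definition loops :: "'a::topological_space set \<Rightarrow> 'a \<Rightarrow> (real \<Rightarrow> 'a) set set" where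
  "loops N x0 = {\<kappa>\<in>ucover N x0. endpt \<kappa> = x0}"

definition concat_class ::
  "'a::topological_space set \<Rightarrow> (real \<Rightarrow> 'a) set \<Rightarrow> (real \<Rightarrow> 'a) set \<Rightarrow> (real \<Rightarrow> 'a) set" where
  "concat_class N \<alpha> \<beta> = (\<Union>p\<in>\<alpha>. \<Union>q\<in>\<beta>. hclass N (p +++ q))"

definition quasiperiodic_with ::
  "'a::topological_space set \<Rightarrow> 'a \<Rightarrow> ('g, 'm) monoid_scheme \<Rightarrow>
     ((real \<Rightarrow> 'a) set \<Rightarrow> 'g) \<Rightarrow> ((real \<Rightarrow> 'a) set \<Rightarrow> 'g) \<Rightarrow> bool" where
  "quasiperiodic_with N x0 G F Fl \<longleftrightarrow>
     F \<in> ucover N x0 \<rightarrow> carrier G \<and> Fl \<in> loops N x0 \<rightarrow> carrier G \<and>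
     (\<forall>\<kappa>\<in>loops N x0. \<forall>\<alpha>\<in>ucover N x0. F (concat_class N \<kappa> \<alpha>) = Fl \<kappa> \<otimes>\<^bsub>G\<^esub> F \<alpha>)"

definition normalized_quasiperiodic ::
  "'a::topological_space set \<Rightarrow> 'a \<Rightarrow> ('g, 'm) monoid_scheme \<Rightarrow> ((real \<Rightarrow> 'a) set \<Rightarrow> 'g) \<Rightarrow> bool"
where
  "normalized_quasiperiodic N x0 G F \<longleftrightarrow>
     (\<exists>Fl. quasiperiodic_with N x0 G F Fl \<and> (\<forall>\<kappa>\<in>loops N x0. Fl \<kappa> = F \<kappa>))"

text \<open>The charts of the universal cover that carry the coordinates of a chart \<open>c\<close> of \<open>N\<close>: the
  sheets \<open>W\<close> over open subsets of its domain.\<close>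

definition lifted_charts ::
  "'p::topological_space set \<Rightarrow> 'p \<Rightarrow> 'p chart \<Rightarrow> (real \<Rightarrow> 'p) set chart set" where
  "lifted_charts N x0 c =
     {(W, snd c \<circ> endpt) | W.
        openin (ucover_topology N x0) W \<and>
        openin (top_of_set N) (endpt ` W) \<and> endpt ` W \<subseteq> fst c \<and>
        homeomorphic_map (subtopology (ucover_topology N x0) W) (top_of_set (endpt ` W)) endpt}"

definition smooth_on_cover ::
  "'p::topological_space set \<Rightarrow> 'p chart set \<Rightarrow> 'p \<Rightarrow>
     ((real \<Rightarrow> 'p) set \<Rightarrow> 'b::real_normed_vector) \<Rightarrow> bool" where
  "smooth_on_cover N A x0 F \<longleftrightarrow> (\<forall>c\<in>A. \<forall>C\<in>lifted_charts N x0 c. smooth_in_chart C F)"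

text \<open>The universal cover of $SL(2)$ has the smooth structure for which the projection to the
  embedded submanifold $SL(2)$ of the space of matrices is a local diffeomorphism. Hence a map
  into it is smooth iff it is continuous and its projection is a smooth matrix-valued map.\<close>

definition smooth_ISOt_valued ::
  "'p::topological_space set \<Rightarrow> 'p chart set \<Rightarrow> 'p \<Rightarrow>
     ((real \<Rightarrow> 'p) set \<Rightarrow> (real \<Rightarrow> real^2^2) set \<times> (real^2^2)) \<Rightarrow> bool" where
  "smooth_ISOt_valued N A x0 F \<longleftrightarrow>
     continuous_map (ucover_topology N x0) (ucover_topology SL2 (mat 1)) (\<lambda>\<alpha>. fst (F \<alpha>)) \<and>
     smooth_on_cover N A x0 (\<lambda>\<alpha>. endpt (fst (F \<alpha>))) \<and>
     smooth_on_cover N A x0 (\<lambda>\<alpha>. snd (F \<alpha>))"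


section \<open>Boundary circles\<close>

text \<open>\<open>circ l \<phi>\<close> is the point with angular coordinate \<open>\<phi>\<close> on the boundary circle labelled \<open>l\<close>.\<close>

definition boundary_circles :: "'p chart set \<Rightarrow> 'l set \<Rightarrow> ('l \<Rightarrow> real \<Rightarrow> 'p) \<Rightarrow> bool" where
  "boundary_circles A L circ \<longleftrightarrow>
     finite L \<and> surface_boundary A = (\<Union>l\<in>L. range (circ l)) \<and>
     (\<forall>l\<in>L. \<forall>m\<in>L. l \<noteq> m \<longrightarrow> range (circ l) \<inter> range (circ m) = {}) \<and>
     (\<forall>l\<in>L. \<forall>s t. circ l s = circ l t \<longleftrightarrow> (\<exists>n::int. s - t = 2 * pi * of_int n)) \<and>
     (\<forall>l\<in>L. \<forall>c\<in>A. open {\<phi>. circ l \<phi> \<in> fst c} \<and>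
        smooth_on {\<phi>. circ l \<phi> \<in> fst c} (snd c \<circ> circ l) \<and>
        (\<forall>\<phi>. circ l \<phi> \<in> fst c \<longrightarrow> vector_derivative (snd c \<circ> circ l) (at \<phi>) \<noteq> 0))"

definition boundary_family ::
  "'p::topological_space set \<Rightarrow> 'p \<Rightarrow> (real \<Rightarrow> 'p) \<Rightarrow> (real \<Rightarrow> (real \<Rightarrow> 'p) set) \<Rightarrow> bool" where
  "boundary_family N x0 k a \<longleftrightarrow>
     continuous_map euclideanreal (ucover_topology N x0) a \<and> (\<forall>\<phi>. endpt (a \<phi>) = k \<phi>)"


section \<open>Fields\<close>

text \<open>A matrix-valued one-form is given by its components \<open>\<omega> c i x\<close> in all charts \<open>c\<close> of the atlas,
  which transform covariantly, and which have the value \<open>undefined\<close> where they are meaningless.\<close>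

type_synonym 'p mform = "'p chart \<Rightarrow> 2 \<Rightarrow> 'p \<Rightarrow> real^2^2"

definition sl2_form :: "'p chart set \<Rightarrow> 'p mform \<Rightarrow> bool" where
  "sl2_form A \<omega> \<longleftrightarrow>
     (\<forall>c i x. \<not> (c \<in> A \<and> x \<in> fst c) \<longrightarrow> \<omega> c i x = undefined) \<and>
     (\<forall>c\<in>A. \<forall>i. smooth_in_chart c (\<omega> c i) \<and> (\<forall>x\<in>fst c. \<omega> c i x \<in> sl2)) \<and>
     (\<forall>c\<in>A. \<forall>d\<in>A. \<forall>x\<in>fst c \<inter> fst d. \<forall>i.
        \<omega> c i x = (\<Sum>j\<in>UNIV. jacobian_matrix c d x $ j $ i *\<^sub>R \<omega> d j x))"

text \<open>The component $\omega_i(p(s))\,p'^i(s)$ of a one-form along a curve \<open>p\<close> with parameter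
  domain \<open>I\<close>, computed in an arbitrary chart around \<open>p s\<close>.\<close>

definition form_along :: "'p chart set \<Rightarrow> 'p mform \<Rightarrow> real set \<Rightarrow> (real \<Rightarrow> 'p) \<Rightarrow> real \<Rightarrow> real^2^2" where
  "form_along A \<omega> I p s =
     (let c = (SOME c. c \<in> A \<and> p s \<in> fst c)
      in \<Sum>i\<in>UNIV. vector_derivative (snd c \<circ> p) (at s within I) $ i *\<^sub>R \<omega> c i (p s))"

definition levi_civita :: "2 \<Rightarrow> 2 \<Rightarrow> real" where
  "levi_civita i j = (if i = 1 \<and> j = 2 then 1 else if i = 2 \<and> j = 1 then -1 else 0)"

definition field_configs ::
  "'p chart set \<Rightarrow> 'l set \<Rightarrow>
     ('p mform \<times> 'p mform \<times> ('l \<Rightarrow> real \<Rightarrow> real^2^2) \<times> ('l \<Rightarrow> real \<Rightarrow> real^2^2)) set" where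
  "field_configs A L = {(\<omega>, \<gamma>, u, v).
     sl2_form A \<omega> \<and> sl2_form A \<gamma> \<and>
     u \<in> extensional L \<and> v \<in> extensional L \<and>
     (\<forall>l\<in>L. (\<forall>\<phi>. u l \<phi> \<in> SL2) \<and> (\<forall>\<phi>. v l \<phi> \<in> sl2) \<and> smooth_on UNIV (u l) \<and> smooth_on UNIV (v l) \<and>
        (\<exists>ul\<in>SL2. \<exists>vl\<in>sl2. \<forall>\<phi>.
           u l (\<phi> + 2 * pi) = ul ** u l \<phi> \<and>
           v l (\<phi> + 2 * pi) = vl + ul ** v l \<phi> ** matrix_inv ul))}"

definition physical_configs ::
  "'p chart set \<Rightarrow> 'l set \<Rightarrow> ('l \<Rightarrow> real \<Rightarrow> 'p) \<Rightarrow>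
     ('p mform \<times> 'p mform \<times> ('l \<Rightarrow> real \<Rightarrow> real^2^2) \<times> ('l \<Rightarrow> real \<Rightarrow> real^2^2)) set" where
  "physical_configs A L circ = {(\<omega>, \<gamma>, u, v).
     (\<omega>, \<gamma>, u, v) \<in> field_configs A L \<and>
     (\<forall>c\<in>A. \<forall>x\<in>fst c. \<forall>i j.
        chart_deriv c i (\<omega> c j) x - chart_deriv c j (\<omega> c i) x + comm (\<omega> c i x) (\<omega> c j x) = 0) \<and>
     (\<forall>c\<in>A. \<forall>x\<in>fst c.
        (\<Sum>i\<in>UNIV. \<Sum>j\<in>UNIV. levi_civita i j *\<^sub>R
           (chart_deriv c i (\<gamma> c j) x + comm (\<omega> c i x) (\<gamma> c j x))) = 0) \<and>
     (\<forall>l\<in>L. \<forall>\<phi>.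
        matrix_inv (u l \<phi>) ** vector_derivative (u l) (at \<phi>) = form_along A \<omega> UNIV (circ l) \<phi> \<and>
        matrix_inv (u l \<phi>) ** vector_derivative (v l) (at \<phi>) ** u l \<phi>
          = form_along A \<gamma> UNIV (circ l) \<phi>)}"


section \<open>Transport operator and distance\<close>

definition piecewise_C1_path :: "'p::topological_space set \<Rightarrow> 'p chart set \<Rightarrow> (real \<Rightarrow> 'p) \<Rightarrow> bool" where
  "piecewise_C1_path N A p \<longleftrightarrow>
     path p \<and> path_image p \<subseteq> N \<and>
     (\<exists>T. finite T \<and> {0, 1} \<subseteq> T \<and> T \<subseteq> {0..1} \<and>
        (\<forall>a\<in>T. \<forall>b\<in>T. a < b \<and> {a<..<b} \<inter> T = {} \<longrightarrow>
           (\<forall>c\<in>A. Ck_on 1 {s\<in>{a..b}. p s \<in> fst c} (snd c \<circ> p))))"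

text \<open>The differential equation is required outside a finite set, because \<open>p\<close> may have corners;
  with continuity in \<open>s\<close> this determines the values on the unit square uniquely.\<close>

definition transport :: "'p chart set \<Rightarrow> 'p mform \<Rightarrow> (real \<Rightarrow> 'p) \<Rightarrow> real \<Rightarrow> real \<Rightarrow> real^2^2" where
  "transport A \<omega> p =
     (SOME U. \<forall>a\<in>{0..1}. U a a = mat 1 \<and> continuous_on {0..1} (U a) \<and>
        (\<exists>S. finite S \<and> (\<forall>s\<in>{0..1} - S.
           (U a has_vector_derivative U a s ** form_along A \<omega> {0..1} p s) (at s within {0..1}))))"

definition dist_V :: "'p chart set \<Rightarrow> 'p mform \<Rightarrow> 'p mform \<Rightarrow> (real \<Rightarrow> 'p) \<Rightarrow> real^2^2" where
  "dist_V A \<omega> \<gamma> p =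
     integral {0..1}
       (\<lambda>s. transport A \<omega> p 0 s ** form_along A \<gamma> {0..1} p s ** transport A \<omega> p s 0)"


section \<open>The data on the universal cover\<close>

definition cover_data ::
  "'p::topological_space set \<Rightarrow> 'p chart set \<Rightarrow> 'p \<Rightarrow> 'l set \<Rightarrow>
     (((real \<Rightarrow> 'p) set \<Rightarrow> (real \<Rightarrow> real^2^2) set \<times> (real^2^2)) \<times>
      ('l \<Rightarrow> real^2^2) \<times> ('l \<Rightarrow> real^2^2)) set" where
  "cover_data N A x0 L = {(F, b, c).
     F \<in> extensional (ucover N x0) \<and> normalized_quasiperiodic N x0 ISOt F \<and>
     smooth_ISOt_valued N A x0 F \<and>
     b \<in> L \<rightarrow>\<^sub>E SL2 \<and> c \<in> L \<rightarrow>\<^sub>E sl2}"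

end

theory Submission
  imports Defs
begin

text \<open>
  Over the dual numbers a pair \<open>(g, f)\<close> becomes the single matrix \<open>G = g + \<epsilon> f g\<close> and a configuration
  becomes the one-form \<open>\<Omega> = \<omega> + \<epsilon> \<gamma>\<close>. The two constraints together say that \<open>\<Omega>\<close> is flat, and the boundary
  conditions say that \<open>u + \<epsilon> v u\<close> is parallel along the boundary circles. A flat form has local
  primitives, unique up to a constant left factor; continuing them along arbitrary continuous paths
  gives a homotopy invariant transport and thereby \<open>G\<close> on the universal cover, while \<open>b\<close> and \<open>c\<close> form
  the constant quotient of two parallel functions along a circle. Conversely, quasiperiodicity makes
  the logarithmic derivative of \<open>G\<close> independent of the sheet, so that it descends to a form on the
  surface, which is flat because second derivatives are symmetric. By uniqueness its transport is \<open>G\<close>,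
  and the component in the universal cover of $SL(2)$ is recovered by unique path lifting.
\<close>

section \<open>Calculus of iterated differentiability\<close>

text \<open>Points of the cover are classes of merely continuous paths, along which the transport
  equation has no meaning. So no differential equation is solved along a path: each point
  \<open>x\<close> receives a primitive \<open>T x\<close> defined near \<open>x\<close>, and
  transport is the continuation of these germs, for which only a cocycle identity near each point
  matters. Derivatives return through the charts of the cover, through piecewise C1 representatives
  and along the boundary circles. Boundary points force all calculus to be done within relatively
  open sets of a half-plane.

  The inverse is replaced by the adjugate. It agrees with the inverse on determinant one and is
  linear, so it passes through derivatives and smoothness without a quotient rule. The group becomes
  \<open>X * dadj X = 1\<close>, its Lie algebra \<open>dadj X = - X\<close>, and if
  \<open>P\<close> and \<open>Q\<close> have the same logarithmic derivative, then
  \<open>P * dadj Q\<close> has derivative zero; this compares primitives on patches and parallel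
  functions along circles.

  One thing the matrices do not see: \<open>G\<close> records only the end point of the component in
  the cover of SL(2), so surjectivity needs a separate argument for the homotopy class.\<close>

definition ample :: "'a::euclidean_space set \<Rightarrow> bool" where
  "ample S \<longleftrightarrow> (\<forall>x\<in>S. \<forall>i\<in>Basis. \<forall>e>0. \<exists>d. 0 < \<bar>d\<bar> \<and> \<bar>d\<bar> < e \<and> x + d *\<^sub>R i \<in> S)"

text \<open>\<open>ample\<close> asks for nearby points of \<open>S\<close> in every coordinate
  direction, on one side at least. One-sidedness admits the boundary of the half-plane and still
  determines the derivative on each basis vector.\<close>

lemma ample_unique:
  assumes "ample S" "x \<in> S" "(f has_derivative f') (at x within S)" "(f has_derivative f'') (at x within S)"
  shows "f' = f''"
  using frechet_derivative_unique_within[OF assms(3,4)] assms(1,2) unfolding ample_def by blast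

lemma ample_frechet_derivative:
  assumes "ample S" "x \<in> S" "(f has_derivative f') (at x within S)"
  shows "frechet_derivative f (at x within S) = f'"
proof -
  have "f differentiable (at x within S)"
    using assms(3) by (auto simp: differentiable_def)
  then show ?thesis
    using ample_unique[OF assms(1,2) _ assms(3)] frechet_derivative_works by blast
qed

lemma ample_Int_open:
  assumes "ample S" "open T"
  shows "ample (S \<inter> T)"
  unfolding ample_def
proof (intro ballI allI impI)
  fix x i :: 'a and e :: real
  assume x: "x \<in> S \<inter> T" and i: "i \<in> Basis" and e: "e > 0"
  then obtain r where r: "r > 0" "ball x r \<subseteq> T"
    using \<open>open T\<close> openE by blast
  have "min e r > 0" using e r by simp
  then obtain d where d: "0 < \<bar>d\<bar>" "\<bar>d\<bar> < min e r" "x + d *\<^sub>R i \<in> S"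
    using assms(1) x i unfolding ample_def by blast
  have "x + d *\<^sub>R i \<in> ball x r"
    using d i by (simp add: dist_norm norm_Basis)
  with r d show "\<exists>d. 0 < \<bar>d\<bar> \<and> \<bar>d\<bar> < e \<and> x + d *\<^sub>R i \<in> S \<inter> T"
    by auto
qed

lemma ample_UNIV: "ample UNIV"
  unfolding ample_def
proof (intro ballI allI impI)
  fix x i :: 'a and e :: real
  assume "e > 0"
  then show "\<exists>d. 0 < \<bar>d\<bar> \<and> \<bar>d\<bar> < e \<and> x + d *\<^sub>R i \<in> UNIV"
    by (intro exI[of _ "e / 2"]) auto
qed

lemma Ck_on_cong_imp:
  assumes "Ck_on k S f" "\<And>x. x \<in> S \<Longrightarrow> g x = f x"
  shows "Ck_on k S g"
proof (cases k)
  case 0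
  then show ?thesis using assms continuous_on_cong[of S S g f] by simp
next
  case (Suc n)
  then obtain f' where f': "\<forall>x\<in>S. (f has_derivative f' x) (at x within S)" "\<forall>v. Ck_on n S (\<lambda>x. f' x v)"
    using assms(1) by auto
  have "\<forall>x\<in>S. (g has_derivative f' x) (at x within S)"
    using f'(1) assms(2) has_derivative_transform by blast
  then show ?thesis using f'(2) Suc by auto
qed

lemma Ck_on_cong:
  assumes "\<And>x. x \<in> S \<Longrightarrow> f x = g x"
  shows "Ck_on k S f \<longleftrightarrow> Ck_on k S g"
  using Ck_on_cong_imp assms by metis

lemma Ck_on_SucI:
  assumes "\<And>x. x \<in> S \<Longrightarrow> (f has_derivative f' x) (at x within S)" "\<And>v. Ck_on k S (\<lambda>x. f' x v)"
  shows "Ck_on (Suc k) S f"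
  using assms by auto

lemma Ck_on_subset:
  assumes "Ck_on k S f" "T \<subseteq> S"
  shows "Ck_on k T f"
  using assms(1)
proof (induction k arbitrary: f)
  case 0
  then show ?case using assms(2) continuous_on_subset by auto
next
  case (Suc k)
  then obtain f' where f': "\<forall>x\<in>S. (f has_derivative f' x) (at x within S)" "\<forall>v. Ck_on k S (\<lambda>x. f' x v)"
    by auto
  have "(f has_derivative f' x) (at x within T)" if "x \<in> T" for x
    using f'(1) that assms(2) has_derivative_subset by blast
  moreover have "Ck_on k T (\<lambda>x. f' x v)" for v
    using f'(2) Suc.IH by blast
  ultimately show ?case by auto
qed

lemma Ck_on_SucD: "Ck_on (Suc k) S f \<Longrightarrow> Ck_on k S f"
proof (induction k arbitrary: f)
  case 0
  then obtain f' where "\<forall>x\<in>S. (f has_derivative f' x) (at x within S)" by auto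
  then show ?case
    using has_derivative_continuous_on[of S f f'] by simp
next
  case (Suc k)
  then show ?case by (metis Ck_on.simps(2))
qed

lemma Ck_on_continuous: "Ck_on k S f \<Longrightarrow> continuous_on S f"
proof (induction k)
  case (Suc k)
  then show ?case using Ck_on_SucD by blast
qed auto

lemma smooth_onD: "smooth_on S f \<Longrightarrow> Ck_on k S f"
  by (simp add: smooth_on_def)

lemma smooth_on_subset: "smooth_on S f \<Longrightarrow> T \<subseteq> S \<Longrightarrow> smooth_on T f"
  unfolding smooth_on_def using Ck_on_subset[of _ S f T] by blast

lemma smooth_on_cong: "(\<And>x. x \<in> S \<Longrightarrow> f x = g x) \<Longrightarrow> smooth_on S f \<longleftrightarrow> smooth_on S g"
  unfolding smooth_on_def using Ck_on_cong[of S f g] by blast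

lemma Ck_on_const: "Ck_on k S (\<lambda>x. c)"
proof (induction k arbitrary: c)
  case (Suc k)
  show ?case by (rule Ck_on_SucI[where f' = "\<lambda>x h. 0"]) (auto intro: Suc)
qed auto

lemma Ck_on_linear: "bounded_linear h \<Longrightarrow> Ck_on k S h"
proof (cases k)
  case 0
  then show "bounded_linear h \<Longrightarrow> ?thesis"
    using linear_continuous_on by auto
next
  case (Suc n)
  then show "bounded_linear h \<Longrightarrow> ?thesis"
    by (auto intro!: Ck_on_SucI[where f' = "\<lambda>x. h"] bounded_linear_imp_has_derivative Ck_on_const simp del: Ck_on.simps(2))
qed

lemma Ck_on_bounded_linear:
  assumes "bounded_linear h" "Ck_on k S f"
  shows "Ck_on k S (\<lambda>x. h (f x))"
  using assms(2)
proof (induction k arbitrary: f)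
  case 0
  then show ?case
    using bounded_linear.continuous_on[OF assms(1)] by auto
next
  case (Suc k)
  then obtain f' where f': "\<forall>x\<in>S. (f has_derivative f' x) (at x within S)" "\<forall>v. Ck_on k S (\<lambda>x. f' x v)"
    by auto
  show ?case
    by (rule Ck_on_SucI[where f' = "\<lambda>x v. h (f' x v)"])
       (use f' Suc.IH bounded_linear.has_derivative[OF assms(1)] in blast)+
qed

lemma Ck_on_add:
  assumes "Ck_on k S f" "Ck_on k S g"
  shows "Ck_on k S (\<lambda>x. f x + g x)"
  using assms
proof (induction k arbitrary: f g)
  case 0
  then show ?case by (auto intro: continuous_intros)
next
  case (Suc k)
  then obtain f' g' where f': "\<forall>x\<in>S. (f has_derivative f' x) (at x within S)" "\<forall>v. Ck_on k S (\<lambda>x. f' x v)"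
    and g': "\<forall>x\<in>S. (g has_derivative g' x) (at x within S)" "\<forall>v. Ck_on k S (\<lambda>x. g' x v)"
    by (auto simp del: )
  show ?case
    by (rule Ck_on_SucI[where f' = "\<lambda>x v. f' x v + g' x v"])
       (use f' g' Suc.IH in \<open>auto intro: has_derivative_add\<close>)
qed

lemma Ck_on_sum:
  assumes "\<And>i. i \<in> I \<Longrightarrow> Ck_on k S (f i)"
  shows "Ck_on k S (\<lambda>x. \<Sum>i\<in>I. f i x)"
  using assms by (induction I rule: infinite_finite_induct) (auto intro: Ck_on_const Ck_on_add)

lemma Ck_on_bilinear:
  assumes "bounded_bilinear h" "Ck_on k S f" "Ck_on k S g"
  shows "Ck_on k S (\<lambda>x. h (f x) (g x))"
  using assms(2,3)
proof (induction k arbitrary: f g)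
  case 0
  then show ?case
    using bounded_bilinear.continuous_on[OF assms(1)] by auto
next
  case (Suc k)
  then obtain f' g' where f': "\<forall>x\<in>S. (f has_derivative f' x) (at x within S)" "\<forall>v. Ck_on k S (\<lambda>x. f' x v)"
    and g': "\<forall>x\<in>S. (g has_derivative g' x) (at x within S)" "\<forall>v. Ck_on k S (\<lambda>x. g' x v)"
    by auto
  have fg: "Ck_on k S f" "Ck_on k S g" using Suc.prems by (auto dest: Ck_on_SucD simp del: Ck_on.simps(2))
  show ?case
  proof (rule Ck_on_SucI[where f' = "\<lambda>x v. h (f x) (g' x v) + h (f' x v) (g x)"])
    show "((\<lambda>x. h (f x) (g x)) has_derivative (\<lambda>v. h (f x) (g' x v) + h (f' x v) (g x))) (at x within S)"
      if "x \<in> S" for x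
      using bounded_bilinear.FDERIV[OF assms(1)] f'(1) g'(1) that by blast
    show "Ck_on k S (\<lambda>x. h (f x) (g' x v) + h (f' x v) (g x))" for v
      by (intro Ck_on_add Suc.IH fg) (use f' g' in auto)
  qed
qed

lemma Ck_on_compose:
  fixes f :: "'a::real_normed_vector \<Rightarrow> 'b::euclidean_space" and g :: "'b \<Rightarrow> 'c::real_normed_vector"
  assumes "Ck_on k S f" "Ck_on k T g" "f ` S \<subseteq> T"
  shows "Ck_on k S (\<lambda>x. g (f x))"
  using assms(1,2)
proof (induction k arbitrary: g)
  case 0
  then show ?case using continuous_on_compose2[of T g S f] assms(3) by auto
next
  case (Suc k)
  then obtain f' g' where f': "\<forall>x\<in>S. (f has_derivative f' x) (at x within S)" "\<forall>v. Ck_on k S (\<lambda>x. f' x v)"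
    and g': "\<forall>x\<in>T. (g has_derivative g' x) (at x within T)" "\<forall>v. Ck_on k T (\<lambda>x. g' x v)"
    by auto
  have f: "Ck_on k S f" using Suc.prems(1) by (rule Ck_on_SucD)
  show ?case
  proof (rule Ck_on_SucI[where f' = "\<lambda>x v. g' (f x) (f' x v)"])
    show "((\<lambda>x. g (f x)) has_derivative (\<lambda>v. g' (f x) (f' x v))) (at x within S)" if "x \<in> S" for x
      using has_derivative_in_compose2[of T g g' f S x "f' x"] f'(1) g'(1) assms(3) that by blast
    fix v
    \<comment> \<open>The direction \<open>f' x v\<close> varies with \<open>x\<close>, whereas
      \<open>Ck_on\<close> controls \<open>g'\<close> only in fixed directions. Expansion in the
      basis leaves finitely many fixed directions with smooth coefficients.\<close>
    have "Ck_on k S (\<lambda>x. \<Sum>i\<in>Basis. (f' x v \<bullet> i) *\<^sub>R g' (f x) i)"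
      by (intro Ck_on_sum Ck_on_bilinear[OF bounded_bilinear_scaleR]
            Ck_on_bounded_linear[OF bounded_linear_inner_left] Suc.IH f)
         (use f' g' in auto)
    moreover have "g' (f x) (f' x v) = (\<Sum>i\<in>Basis. (f' x v \<bullet> i) *\<^sub>R g' (f x) i)" if "x \<in> S" for x
    proof -
      have "linear (g' (f x))"
        using g'(1) that assms(3) has_derivative_linear by blast
      then have "g' (f x) (\<Sum>i\<in>Basis. (f' x v \<bullet> i) *\<^sub>R i) = (\<Sum>i\<in>Basis. (f' x v \<bullet> i) *\<^sub>R g' (f x) i)"
        by (simp add: linear_sum linear_cmul o_def)
      then show ?thesis by (simp add: euclidean_representation)
    qed
    ultimately show "Ck_on k S (\<lambda>x. g' (f x) (f' x v))"
      by (rule Ck_on_cong_imp)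
  qed
qed

lemma at_within_Int_open: "open T \<Longrightarrow> x \<in> T \<Longrightarrow> at x within S \<inter> T = at x within S"
  by (rule at_within_nhd[of x T]) auto

text \<open>Each neighbourhood supplies its own derivative by an existential. Ampleness identifies
  all of them with the one function \<open>frechet_derivative f (at x within S)\<close>, which can
  therefore be used on the whole of \<open>S\<close>.\<close>

lemma Ck_on_local:
  fixes f :: "'a::euclidean_space \<Rightarrow> 'b::real_normed_vector"
  assumes "ample S" "\<And>x. x \<in> S \<Longrightarrow> \<exists>T. open T \<and> x \<in> T \<and> Ck_on k (S \<inter> T) f"
  shows "Ck_on k S f"
  using assms(2)
proof (induction k arbitrary: f)
  case 0
  show ?case
    unfolding Ck_on.simps continuous_on_eq_continuous_within
  proof
    fix x assume x: "x \<in> S"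
    then obtain T where T: "open T" "x \<in> T" "Ck_on 0 (S \<inter> T) f" using 0 by blast
    then have "continuous (at x within S \<inter> T) f"
      using x by (simp add: continuous_on_eq_continuous_within)
    then show "continuous (at x within S) f"
      using T x by (simp add: at_within_Int_open)
  qed
next
  case (Suc k)
  let ?D = "\<lambda>x. frechet_derivative f (at x within S)"
  have at: "at x within S \<inter> T = at x within S" if "open T" "x \<in> T" for x and T :: "'a set"
    using that by (rule at_within_Int_open)
  have D: "(f has_derivative f') (at x within S) \<Longrightarrow> ?D x = f'" if "x \<in> S" for x f'
    using ample_frechet_derivative[OF assms(1) that] .
  show ?case
  proof (rule Ck_on_SucI[where f' = ?D])
    fix x assume x: "x \<in> S"
    then obtain T where T: "open T" "x \<in> T" "Ck_on (Suc k) (S \<inter> T) f" using Suc.prems by blast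
    then obtain f' where "(f has_derivative f') (at x within S \<inter> T)"
      using x by auto
    then show "(f has_derivative ?D x) (at x within S)"
      using at T D x by metis
  next
    fix v
    show "Ck_on k S (\<lambda>x. ?D x v)"
    proof (rule Suc.IH)
      fix x assume x: "x \<in> S"
      then obtain T where T: "open T" "x \<in> T" "Ck_on (Suc k) (S \<inter> T) f" using Suc.prems by blast
      then obtain f' where f': "\<forall>x\<in>S \<inter> T. (f has_derivative f' x) (at x within S \<inter> T)"
         "\<forall>v. Ck_on k (S \<inter> T) (\<lambda>x. f' x v)"
        by auto
      have "?D y v = f' y v" if "y \<in> S \<inter> T" for y
        using f'(1) that at[OF T(1)] D by (metis IntD1 IntD2)
      then have "Ck_on k (S \<inter> T) (\<lambda>x. ?D x v)"
        by (rule Ck_on_cong_imp[OF f'(2)[rule_format, of v]])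
      then show "\<exists>T. open T \<and> x \<in> T \<and> Ck_on k (S \<inter> T) (\<lambda>x. ?D x v)"
        using T by blast
    qed
  qed
qed

text \<open>Both mixed derivatives are the limit of the same second difference quotient.\<close>

lemma second_difference_bound:
  fixes f :: "'a::real_normed_vector \<Rightarrow> 'b::real_normed_vector"
  assumes r: "r > 0" and R: "R = (\<lambda>(s, t). x + s *\<^sub>R h + t *\<^sub>R k) ` ({0..r} \<times> {0..r})" and "R \<subseteq> S"
    and f': "\<And>y. y \<in> S \<Longrightarrow> (f has_derivative f' y) (at y within S)"
    and f'': "\<And>y. y \<in> S \<Longrightarrow> ((\<lambda>y. f' y h) has_derivative f'' y) (at y within S)"
    and e: "\<And>y. y \<in> R \<Longrightarrow> norm (f'' y k - B) \<le> e"
  shows "norm (f (x + r *\<^sub>R h + r *\<^sub>R k) - f (x + r *\<^sub>R h) - f (x + r *\<^sub>R k) + f x - (r * r) *\<^sub>R B) \<le> r * r * e"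
proof -
  have mem: "x + s *\<^sub>R h + t *\<^sub>R k \<in> R" if "s \<in> {0..r}" "t \<in> {0..r}" for s t
    using that by (auto simp: R)
  \<comment> \<open>The mean value inequality is used twice: here in \<open>t\<close>, for the
    derivative in direction \<open>h\<close> with its expected growth \<open>t *\<^sub>R B\<close>
    subtracted, and below in \<open>s\<close>, with the present bound as the estimate of the
    derivative.\<close>
  have inner: "norm ((f' (x + s *\<^sub>R h + r *\<^sub>R k) h - f' (x + s *\<^sub>R h) h) - r *\<^sub>R B) \<le> r * e" if s: "s \<in> {0..r}" for s
  proof -
    let ?\<psi> = "\<lambda>t. f' (x + s *\<^sub>R h + t *\<^sub>R k) h - t *\<^sub>R B"
    have d: "(?\<psi> has_derivative (\<lambda>\<tau>. \<tau> *\<^sub>R (f'' (x + s *\<^sub>R h + t *\<^sub>R k) k - B))) (at t within {0..r})"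
      if t: "t \<in> {0..r}" for t
    proof -
      have y: "x + s *\<^sub>R h + t *\<^sub>R k \<in> S" using mem[OF s t] \<open>R \<subseteq> S\<close> by auto
      have i: "((\<lambda>t. x + s *\<^sub>R h + t *\<^sub>R k) has_derivative (\<lambda>\<tau>. \<tau> *\<^sub>R k)) (at t within {0..r})"
        by (auto intro!: derivative_eq_intros)
      have "((\<lambda>t. f' (x + s *\<^sub>R h + t *\<^sub>R k) h) has_derivative (\<lambda>\<tau>. f'' (x + s *\<^sub>R h + t *\<^sub>R k) (\<tau> *\<^sub>R k)))
             (at t within {0..r})"
        by (rule has_derivative_in_compose2[OF f'' _ t i])
           (use mem[OF s] \<open>R \<subseteq> S\<close> in auto)
      moreover have "linear (f'' (x + s *\<^sub>R h + t *\<^sub>R k))"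
        using f''[OF y] has_derivative_linear by blast
      ultimately have "((\<lambda>t. f' (x + s *\<^sub>R h + t *\<^sub>R k) h) has_derivative (\<lambda>\<tau>. \<tau> *\<^sub>R f'' (x + s *\<^sub>R h + t *\<^sub>R k) k))
             (at t within {0..r})"
        by (simp add: linear_cmul)
      then show ?thesis
        by (auto intro!: derivative_eq_intros simp: algebra_simps)
    qed
    have "norm (?\<psi> r - ?\<psi> 0) \<le> e * norm (r - 0)"
    proof (rule differentiable_bound[OF convex_real_interval(5) d])
      fix t assume t: "t \<in> {0..r}"
      show "onorm (\<lambda>\<tau>. \<tau> *\<^sub>R (f'' (x + s *\<^sub>R h + t *\<^sub>R k) k - B)) \<le> e"
        using e[OF mem[OF s t]] by (intro onorm_bound) (auto simp: mult.commute[of e] intro: mult_left_mono order_trans[OF norm_ge_zero])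
    qed (use r in auto)
    then show ?thesis using r by (simp add: algebra_simps)
  qed
  let ?\<phi> = "\<lambda>s. f (x + s *\<^sub>R h + r *\<^sub>R k) - f (x + s *\<^sub>R h) - (s * r) *\<^sub>R B"
  have d1: "((\<lambda>s. f (x + s *\<^sub>R h + t *\<^sub>R k)) has_derivative (\<lambda>\<tau>. \<tau> *\<^sub>R f' (x + s *\<^sub>R h + t *\<^sub>R k) h)) (at s within {0..r})"
    if s: "s \<in> {0..r}" and t: "t \<in> {0..r}" for s t
  proof -
    have y: "x + s *\<^sub>R h + t *\<^sub>R k \<in> S" using mem[OF s t] \<open>R \<subseteq> S\<close> by auto
    have i: "((\<lambda>s. x + s *\<^sub>R h + t *\<^sub>R k) has_derivative (\<lambda>\<tau>. \<tau> *\<^sub>R h)) (at s within {0..r})"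
      by (auto intro!: derivative_eq_intros)
    have "((\<lambda>s. f (x + s *\<^sub>R h + t *\<^sub>R k)) has_derivative (\<lambda>\<tau>. f' (x + s *\<^sub>R h + t *\<^sub>R k) (\<tau> *\<^sub>R h))) (at s within {0..r})"
      by (rule has_derivative_in_compose2[OF f' _ s i]) (use mem[OF _ t] \<open>R \<subseteq> S\<close> in auto)
    moreover have "linear (f' (x + s *\<^sub>R h + t *\<^sub>R k))"
      using f'[OF y] has_derivative_linear by blast
    ultimately show ?thesis by (simp add: linear_cmul)
  qed
  have "norm (?\<phi> r - ?\<phi> 0) \<le> (r * e) * norm (r - 0)"
  proof (rule differentiable_bound[OF convex_real_interval(5)])
    fix s assume s: "s \<in> {0..r}"
    have "((\<lambda>s. f (x + s *\<^sub>R h)) has_derivative (\<lambda>\<tau>. \<tau> *\<^sub>R f' (x + s *\<^sub>R h) h)) (at s within {0..r})"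
      using d1[OF s, of 0] r by simp
    then show "(?\<phi> has_derivative (\<lambda>\<tau>. \<tau> *\<^sub>R ((f' (x + s *\<^sub>R h + r *\<^sub>R k) h - f' (x + s *\<^sub>R h) h) - r *\<^sub>R B))) (at s within {0..r})"
      using d1[OF s, of r] r by (auto intro!: derivative_eq_intros simp: algebra_simps)
    show "onorm (\<lambda>\<tau>. \<tau> *\<^sub>R ((f' (x + s *\<^sub>R h + r *\<^sub>R k) h - f' (x + s *\<^sub>R h) h) - r *\<^sub>R B)) \<le> r * e"
      using inner[OF s] by (intro onorm_bound) (auto simp: mult.commute[of "r * e"] intro: mult_left_mono order_trans[OF norm_ge_zero])
  qed (use r in auto)
  then show ?thesis using r by (simp add: algebra_simps)
qed

text \<open>Only a square with corner \<open>x\<close> has to lie in \<open>S\<close>, not a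
  neighbourhood of \<open>x\<close>. The statement thus covers boundary points of the
  half-plane.\<close>

lemma mixed_derivatives_eq:
  fixes f :: "'a::real_normed_vector \<Rightarrow> 'b::real_normed_vector"
  assumes x: "x \<in> S"
    and corner: "r0 > 0" "\<And>s t. s \<in> {0..r0} \<Longrightarrow> t \<in> {0..r0} \<Longrightarrow> x + s *\<^sub>R h + t *\<^sub>R k \<in> S"
    and f': "\<And>y. y \<in> S \<Longrightarrow> (f has_derivative f' y) (at y within S)"
    and fh: "\<And>y. y \<in> S \<Longrightarrow> ((\<lambda>y. f' y h) has_derivative fh y) (at y within S)"
    and fk: "\<And>y. y \<in> S \<Longrightarrow> ((\<lambda>y. f' y k) has_derivative fk y) (at y within S)"
    and ch: "continuous_on S (\<lambda>y. fh y k)" and ck: "continuous_on S (\<lambda>y. fk y h)"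
  shows "fh x k = fk x h"
proof (rule ccontr)
  assume ne: "fh x k \<noteq> fk x h"
  \<comment> \<open>Each of the two approximations below costs \<open>e\<close>, so the two values
    differ by at most \<open>2 * e\<close>, against the assumed distance
    \<open>3 * e\<close>.\<close>
  define e where "e = norm (fh x k - fk x h) / 3"
  have e: "e > 0" using ne by (simp add: e_def)
  obtain d1 where d1: "d1 > 0" "\<And>y. y \<in> S \<Longrightarrow> dist y x < d1 \<Longrightarrow> dist (fh y k) (fh x k) < e"
    using ch x e unfolding continuous_on_iff by meson
  obtain d2 where d2: "d2 > 0" "\<And>y. y \<in> S \<Longrightarrow> dist y x < d2 \<Longrightarrow> dist (fk y h) (fk x h) < e"
    using ck x e unfolding continuous_on_iff by meson
  define d where "d = min d1 d2"
  \<comment> \<open>Every point of the square of side \<open>r\<close> has distance at most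
    \<open>r * (norm h + norm k)\<close> from \<open>x\<close>, which is at most
    \<open>d / 2\<close>. The summand 1 keeps the denominator positive.\<close>
  define r where "r = min r0 (d / (2 * (norm h + norm k + 1)))"
  have d: "d > 0" using d1 d2 by (simp add: d_def)
  have np: "norm h + norm k + 1 > 0" using norm_ge_zero[of h] norm_ge_zero[of k] by linarith
  have r: "r > 0" using corner d np by (simp add: r_def)
  have close: "dist (x + s *\<^sub>R h + t *\<^sub>R k) x < d" if "s \<in> {0..r}" "t \<in> {0..r}" for s t
  proof -
    have "norm (s *\<^sub>R h + t *\<^sub>R k) \<le> s * norm h + t * norm k"
      using norm_triangle_ineq[of "s *\<^sub>R h" "t *\<^sub>R k"] that by simp
    also have "\<dots> \<le> r * norm h + r * norm k"
      using that by (intro add_mono mult_right_mono) auto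
    also have "\<dots> < r * (norm h + norm k + 1)" using r by (simp add: algebra_simps)
    also have "\<dots> \<le> d / (2 * (norm h + norm k + 1)) * (norm h + norm k + 1)"
      using np by (intro mult_right_mono) (auto simp: r_def)
    also have "\<dots> = d / 2" using np by (simp add: field_simps)
    finally show ?thesis using d by (simp add: dist_norm add.assoc)
  qed
  have inS: "x + s *\<^sub>R h + t *\<^sub>R k \<in> S" if "s \<in> {0..r}" "t \<in> {0..r}" for s t
    using that corner(2)[of s t] by (auto simp: r_def)
  have inS': "x + s *\<^sub>R k + t *\<^sub>R h \<in> S" if "s \<in> {0..r}" "t \<in> {0..r}" for s t
    using inS[OF that(2,1)] by (simp add: add.assoc add.commute[of "_ *\<^sub>R k"])
  define \<Delta> where "\<Delta> = f (x + r *\<^sub>R h + r *\<^sub>R k) - f (x + r *\<^sub>R h) - f (x + r *\<^sub>R k) + f x"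
  have "norm (\<Delta> - (r * r) *\<^sub>R fh x k) \<le> r * r * e"
    unfolding \<Delta>_def
  proof (rule second_difference_bound[OF r refl _ f' fh])
    show "(\<lambda>(s, t). x + s *\<^sub>R h + t *\<^sub>R k) ` ({0..r} \<times> {0..r}) \<subseteq> S"
      using inS by auto
    show "norm (fh y k - fh x k) \<le> e" if "y \<in> (\<lambda>(s, t). x + s *\<^sub>R h + t *\<^sub>R k) ` ({0..r} \<times> {0..r})" for y
    proof -
      obtain s t where st: "s \<in> {0..r}" "t \<in> {0..r}" "y = x + s *\<^sub>R h + t *\<^sub>R k" using \<open>y \<in> _\<close> by auto
      then have "dist (fh y k) (fh x k) < e"
        using d1(2)[of y] inS[OF st(1,2)] close[OF st(1,2)] by (simp add: d_def)
      then show ?thesis by (simp add: dist_norm)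
    qed
  qed
  moreover have "norm (f (x + r *\<^sub>R k + r *\<^sub>R h) - f (x + r *\<^sub>R k) - f (x + r *\<^sub>R h) + f x - (r * r) *\<^sub>R fk x h) \<le> r * r * e"
  proof (rule second_difference_bound[OF r refl _ f' fk])
    show "(\<lambda>(s, t). x + s *\<^sub>R k + t *\<^sub>R h) ` ({0..r} \<times> {0..r}) \<subseteq> S"
      using inS' by auto
    show "norm (fk y h - fk x h) \<le> e" if "y \<in> (\<lambda>(s, t). x + s *\<^sub>R k + t *\<^sub>R h) ` ({0..r} \<times> {0..r})" for y
    proof -
      obtain s t where st: "s \<in> {0..r}" "t \<in> {0..r}" "y = x + s *\<^sub>R h + t *\<^sub>R k"
        using \<open>y \<in> _\<close> by (auto simp: add.assoc add.commute[of "_ *\<^sub>R k"])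
      then have "dist (fk y h) (fk x h) < e"
        using d2(2)[of y] inS[OF st(1,2)] close[OF st(1,2)] by (simp add: d_def)
      then show ?thesis by (simp add: dist_norm)
    qed
  qed
  moreover have \<Delta>': "f (x + r *\<^sub>R k + r *\<^sub>R h) - f (x + r *\<^sub>R k) - f (x + r *\<^sub>R h) + f x = \<Delta>"
    by (simp add: \<Delta>_def add.assoc add.commute[of "_ *\<^sub>R k"])
  ultimately have "norm (\<Delta> - (r * r) *\<^sub>R fh x k) \<le> r * r * e" "norm (\<Delta> - (r * r) *\<^sub>R fk x h) \<le> r * r * e"
    by (simp_all only: \<Delta>')
  then have "norm ((\<Delta> - (r * r) *\<^sub>R fk x h) - (\<Delta> - (r * r) *\<^sub>R fh x k)) \<le> r * r * e + r * r * e"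
    using norm_triangle_ineq4[of "\<Delta> - (r * r) *\<^sub>R fk x h" "\<Delta> - (r * r) *\<^sub>R fh x k"] by linarith
  moreover have "(\<Delta> - (r * r) *\<^sub>R fk x h) - (\<Delta> - (r * r) *\<^sub>R fh x k) = (r * r) *\<^sub>R (fh x k - fk x h)"
    by (simp add: scaleR_diff_right)
  ultimately have "norm ((r * r) *\<^sub>R (fh x k - fk x h)) \<le> r * r * e + r * r * e"
    by metis
  then have "(r * r) * norm (fh x k - fk x h) \<le> r * r * e + r * r * e"
    using r by simp
  then have "(r * r) * norm (fh x k - fk x h) \<le> (r * r) * (2 * e)"
    by (metis distrib_left mult_2)
  moreover have "0 < r * r" using r by simp
  ultimately have "norm (fh x k - fk x h) \<le> 2 * e"
    by (rule mult_left_le_imp_le)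
  then show False using ne by (simp add: e_def)
qed

section \<open>Primitives of flat one-forms with values in a Banach algebra\<close>

lemma vector_derivative_norm_bound:
  fixes f :: "real \<Rightarrow> 'a::real_normed_vector"
  assumes "\<And>t. t \<in> {a..b} \<Longrightarrow> (f has_vector_derivative f' t) (at t within {a..b})"
    and "\<And>t. t \<in> {a..b} \<Longrightarrow> norm (f' t) \<le> B" and "a \<le> b"
  shows "norm (f b - f a) \<le> B * (b - a)"
proof -
  have "norm (f b - f a) \<le> B * norm (b - a)"
  proof (rule differentiable_bound[OF convex_real_interval(5)])
    fix t assume t: "t \<in> {a..b}"
    show "(f has_derivative (\<lambda>h. h *\<^sub>R f' t)) (at t within {a..b})"
      using assms(1)[OF t] by (simp add: has_vector_derivative_def)
    show "onorm (\<lambda>h. h *\<^sub>R f' t) \<le> B"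
      using assms(2)[OF t]
      by (intro onorm_bound) (auto simp: mult.commute[of B] intro: mult_left_mono order_trans[OF norm_ge_zero])
  qed (use assms(3) in auto)
  then show ?thesis using assms(3) by simp
qed

text \<open>Since primitives are only needed near a point, the coefficient may be taken so small that
  Picard's operator is a contraction on the whole unit interval.\<close>

lemma linear_ode_small:
  fixes A :: "real \<Rightarrow> 'a::{real_algebra_1, real_normed_algebra, banach}"
  assumes contA: "continuous_on {0..1} A" and small: "\<And>t. t \<in> {0..1} \<Longrightarrow> norm (A t) \<le> 1 / 2"
  obtains U where "U 0 = 1"
    "\<And>t. t \<in> {0..1} \<Longrightarrow> (U has_vector_derivative U t * A t) (at t within {0..1})"
    "\<And>t. t \<in> {0..1} \<Longrightarrow> norm (U t) \<le> 2 * norm (1::'a)"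
proof -
  \<comment> \<open>Clamping to the unit interval extends the Picard operator to bounded continuous
    functions on the whole line, a complete metric type on which the fixed point theorem can be
    applied directly.\<close>
  define c :: "real \<Rightarrow> real" where "c t = max 0 (min 1 t)" for t
  have c: "c t \<in> {0..1}" for t by (auto simp: c_def)
  have c_id: "c t = t" if "t \<in> {0..1}" for t using that by (auto simp: c_def)
  have contc: "continuous_on UNIV c" unfolding c_def by (intro continuous_intros)
  define I where "I U t = 1 + integral {0..c t} (\<lambda>s. apply_bcontfun U s * A s)" for U :: "real \<Rightarrow>\<^sub>C 'a" and t
  have contUA: "continuous_on {0..1} (\<lambda>s. apply_bcontfun U s * A s)" for U
    by (intro continuous_intros contA) auto
  have contUA': "continuous_on {0..c t} (\<lambda>s. apply_bcontfun U s * A s)" for U t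
    by (rule continuous_on_subset[OF contUA]) (use c[of t] in auto)
  have nUA: "norm (apply_bcontfun U s * A s) \<le> norm U / 2" if "s \<in> {0..1}" for U :: "real \<Rightarrow>\<^sub>C 'a" and s
  proof -
    have "norm (apply_bcontfun U s * A s) \<le> norm (apply_bcontfun U s) * norm (A s)"
      by (rule norm_mult_ineq)
    also have "\<dots> \<le> norm U * (1 / 2)"
      by (rule mult_mono) (use small[OF that] norm_bounded in auto)
    finally show ?thesis by simp
  qed
  have nI: "norm (integral {0..c t} (\<lambda>s. apply_bcontfun U s * A s)) \<le> norm U / 2" for U t
  proof -
    have "norm (integral {0..c t} (\<lambda>s. apply_bcontfun U s * A s)) \<le> norm U / 2 * (c t - 0)"
      by (rule integral_bound[OF _ contUA']) (use c[of t] nUA[of _ U] in auto)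
    also have "\<dots> \<le> norm U / 2 * 1" using c[of t] by (intro mult_left_mono) auto
    finally show ?thesis by simp
  qed
  have bI: "I U \<in> bcontfun" for U
  proof (rule bcontfun_normI)
    have "continuous_on {0..1} (\<lambda>x. integral {0..x} (\<lambda>s. apply_bcontfun U s * A s))"
      by (intro indefinite_integral_continuous_1 integrable_continuous_real contUA)
    then have "continuous_on UNIV (\<lambda>t. integral {0..c t} (\<lambda>s. apply_bcontfun U s * A s))"
      by (rule continuous_on_compose2[OF _ contc]) (use c in auto)
    then show "continuous_on UNIV (I U)"
      unfolding I_def[abs_def] by (intro continuous_intros)
    show "norm (I U t) \<le> norm (1::'a) + norm U / 2" for t
      unfolding I_def by (rule order_trans[OF norm_triangle_ineq]) (use nI in auto)
  qed
  define \<Phi> where "\<Phi> U = Bcontfun (I U)" for U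
  have \<Phi>: "apply_bcontfun (\<Phi> U) = I U" for U
    unfolding \<Phi>_def using bI by (rule Bcontfun_inverse)
  have "\<exists>!U. \<Phi> U = U"
  proof (rule banach_fix_type[of "1/2"]; (intro allI)?)
    fix U V
    show "dist (\<Phi> U) (\<Phi> V) \<le> 1 / 2 * dist U V"
    proof (rule dist_bound)
      fix t
      have "I U t - I V t = integral {0..c t} (\<lambda>s. apply_bcontfun (U - V) s * A s)"
        unfolding I_def by (simp add: left_diff_distrib integral_diff integrable_continuous_real contUA')
      then show "dist (apply_bcontfun (\<Phi> U) t) (apply_bcontfun (\<Phi> V) t) \<le> 1 / 2 * dist U V"
        using nI[of t "U - V"] by (simp add: \<Phi> dist_norm)
    qed
  qed auto
  then obtain U where U: "\<Phi> U = U" by blast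
  have AU: "apply_bcontfun U t = I U t" for t using \<Phi>[of U] unfolding U by metis
  have U_eq: "apply_bcontfun U t = 1 + integral {0..t} (\<lambda>s. apply_bcontfun U s * A s)" if "t \<in> {0..1}" for t
    by (rule trans[OF AU]) (simp add: I_def c_id[OF that])
  have "norm U \<le> norm (1::'a) + norm U / 2"
  proof (rule norm_bound)
    fix t
    have "norm (I U t) \<le> norm (1::'a) + norm U / 2"
      unfolding I_def using nI[of t U] norm_triangle_ineq[of 1 "integral {0..c t} (\<lambda>s. apply_bcontfun U s * A s)"]
      by linarith
    then show "norm (apply_bcontfun U t) \<le> norm (1::'a) + norm U / 2"
      by (simp only: AU)
  qed
  then have nU: "norm U \<le> 2 * norm (1::'a)" by simp
  show ?thesis
  proof (rule that[of "apply_bcontfun U"])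
    show "apply_bcontfun U 0 = 1" by (rule trans[OF U_eq]) simp_all
    show "norm (apply_bcontfun U t) \<le> 2 * norm (1::'a)" for t
      using norm_bounded[of U t] nU by linarith
    fix t :: real assume t: "t \<in> {0..1}"
    have "((\<lambda>t. 1 + integral {0..t} (\<lambda>s. apply_bcontfun U s * A s)) has_vector_derivative apply_bcontfun U t * A t)
        (at t within {0..1})"
      using has_vector_derivative_add[OF has_vector_derivative_const integral_has_vector_derivative[OF contUA t]]
      by simp
    then show "(apply_bcontfun U has_vector_derivative apply_bcontfun U t * A t) (at t within {0..1})"
      by (rule has_vector_derivative_transform[OF t, rotated]) (rule U_eq)
  qed
qed

text \<open>At a maximum \<open>m\<close> of \<open>norm (D t)\<close> integration gives
  \<open>norm (D m) \<le> norm (D m) / 2 + e\<close>, and the first term is absorbed on the left.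
  The smallness of \<open>A\<close> thus takes the place of a Gronwall estimate.\<close>

lemma linear_ode_estimate:
  fixes D :: "real \<Rightarrow> 'a::real_normed_algebra"
  assumes D': "\<And>t. t \<in> {0..1} \<Longrightarrow> (D has_vector_derivative D t * A t + R t) (at t within {0..1})"
    and "D 0 = 0" and A: "\<And>t. t \<in> {0..1} \<Longrightarrow> norm (A t) \<le> 1 / 2"
    and R: "\<And>t. t \<in> {0..1} \<Longrightarrow> norm (R t) \<le> e"
  shows "norm (D 1) \<le> 2 * e"
proof -
  have cont: "continuous_on {0..1} (\<lambda>t. norm (D t))"
    by (rule continuous_on_norm[OF continuous_on_vector_derivative[OF D']])
  obtain m where m: "m \<in> {0..1}" "\<And>t. t \<in> {0..1} \<Longrightarrow> norm (D t) \<le> norm (D m)"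
    using continuous_attains_sup[OF compact_Icc _ cont] by auto
  have e: "0 \<le> e" by (rule order_trans[OF norm_ge_zero R[of 0]]) simp
  have "norm (D m - D 0) \<le> (norm (D m) / 2 + e) * (m - 0)"
  proof (rule vector_derivative_norm_bound)
    fix t assume t: "t \<in> {0..m}"
    then have t1: "t \<in> {0..1}" using m by auto
    show "(D has_vector_derivative D t * A t + R t) (at t within {0..m})"
      by (rule has_vector_derivative_within_subset[OF D'[OF t1]]) (use m in auto)
    have "norm (D t * A t) \<le> norm (D t) * norm (A t)" by (rule norm_mult_ineq)
    also have "\<dots> \<le> norm (D m) * (1 / 2)" by (rule mult_mono) (use m A t1 in auto)
    finally show "norm (D t * A t + R t) \<le> norm (D m) / 2 + e"
      using norm_triangle_ineq[of "D t * A t" "R t"] R[OF t1] by linarith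
  qed (use m in auto)
  also have "\<dots> \<le> (norm (D m) / 2 + e) * 1"
    using m e by (intro mult_left_mono) auto
  finally have "norm (D m) \<le> 2 * e" using \<open>D 0 = 0\<close> by simp
  then show ?thesis using m(2)[of 1] by auto
qed

text \<open>The parallel transport \<open>U z\<close> along the ray from \<open>z0\<close> to \<open>z\<close> is compared with its expected first
  order variation: by flatness the difference solves the transport equation up to a term of
  order \<open>o(h)\<close>.\<close>

lemma flat_primitive_radial:
  fixes w :: "'v::real_normed_vector \<Rightarrow> 'v \<Rightarrow> 'a::{real_algebra_1, real_normed_algebra, banach}"
  assumes S: "convex S" "z0 \<in> S"
    and unit: "\<And>z. z \<in> S \<Longrightarrow> norm (z - z0) \<le> 1"
    and lin: "\<And>z. z \<in> S \<Longrightarrow> bounded_linear (w z)"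
    and small: "\<And>y z. y \<in> S \<Longrightarrow> z \<in> S \<Longrightarrow> norm (w y (z - z0)) \<le> 1 / 2"
    and B: "\<And>z h. z \<in> S \<Longrightarrow> norm (w z h) \<le> B * norm h"
    and Dw: "\<And>z k. z \<in> S \<Longrightarrow> ((\<lambda>z. w z k) has_derivative Dw z k) (at z within S)"
    and flat: "\<And>z h k. z \<in> S \<Longrightarrow> Dw z k h - Dw z h k + w z h * w z k - w z k * w z h = 0"
    and unif: "\<And>e. e > 0 \<Longrightarrow> \<exists>d>0. \<forall>z\<in>S. \<forall>z'\<in>S. norm (z' - z) < d \<longrightarrow>
        (\<forall>k. norm (w z' k - w z k - Dw z k (z' - z)) \<le> e * norm k * norm (z' - z) \<and>
             norm (w z' k - w z k) \<le> e * norm k)"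
  obtains g where "g z0 = 1" "\<And>z. z \<in> S \<Longrightarrow> (g has_derivative (\<lambda>h. g z * w z h)) (at z within S)"
proof -
  define ray where "ray z t = z0 + t *\<^sub>R (z - z0)" for z and t :: real
  have ray: "ray z t \<in> S" if "z \<in> S" "t \<in> {0..1}" for z t
  proof -
    have "ray z t = (1 - t) *\<^sub>R z0 + t *\<^sub>R z" by (simp add: ray_def algebra_simps)
    then show ?thesis using S that by (auto simp: convex_alt)
  qed
  have rayD: "(ray z has_vector_derivative (z - z0)) (at t within {0..1})" for z t
    unfolding ray_def by (auto intro!: derivative_eq_intros)
  have wray: "((\<lambda>t. w (ray z t) k) has_vector_derivative Dw (ray z t) k (z - z0)) (at t within {0..1})"
    if "z \<in> S" "t \<in> {0..1}" for z t k
  proof -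
    have "((\<lambda>t. w (ray z t) k) has_derivative (\<lambda>x. Dw (ray z t) k (x *\<^sub>R (z - z0)))) (at t within {0..1})"
      by (rule has_derivative_in_compose2[where t = S and g' = "\<lambda>z. Dw z k"])
        (use Dw ray that rayD in \<open>auto simp: has_vector_derivative_def\<close>)
    moreover have "linear (Dw (ray z t) k)" using Dw[OF ray[OF that]] has_derivative_linear by blast
    ultimately show ?thesis by (simp add: has_vector_derivative_def linear_cmul)
  qed
  have "\<exists>U. U 0 = 1 \<and> (\<forall>t\<in>{0..1}. (U has_vector_derivative U t * w (ray z t) (z - z0)) (at t within {0..1})) \<and>
      (\<forall>t\<in>{0..1}. norm (U t) \<le> 2 * norm (1::'a))" if z: "z \<in> S" for z
  proof -
    have c: "continuous_on {0..1} (\<lambda>t. w (ray z t) (z - z0))"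
      by (rule continuous_on_vector_derivative[OF wray[OF z]])
    show ?thesis
      by (rule linear_ode_small[OF c]) (use small[OF ray[OF z] z] in blast)+
  qed
  then obtain U where U0: "\<And>z. z \<in> S \<Longrightarrow> U z 0 = 1"
    and U': "\<And>z t. z \<in> S \<Longrightarrow> t \<in> {0..1} \<Longrightarrow> (U z has_vector_derivative U z t * w (ray z t) (z - z0)) (at t within {0..1})"
    and Ub: "\<And>z t. z \<in> S \<Longrightarrow> t \<in> {0..1} \<Longrightarrow> norm (U z t) \<le> 2 * norm (1::'a)"
    by metis
  define g where "g z = U z 1" for z
  \<comment> \<open>Nonnegativity of \<open>B\<close> follows from the bound on \<open>w\<close>
    only if a nonzero vector exists; the increment \<open>z' - z\<close> will provide one.\<close>
  have B0: "B \<ge> 0" if "h \<noteq> 0" for h :: 'v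
    using order_trans[OF norm_ge_zero B[OF S(2), of h]] that by (simp add: zero_le_mult_iff)
  \<comment> \<open>The constant 4 is 2 from the bound on \<open>U z\<close> times 2 from
    \<open>linear_ode_estimate\<close>. The factor \<open>2 + B + B * B\<close> collects the three
    parts of the remainder \<open>R\<close>.\<close>
  have key: "norm (g z' - g z - g z * w z (z' - z)) \<le> 4 * norm (1::'a) * ((2 + B + B * B) * e) * norm (z' - z)"
    if z: "z \<in> S" "z' \<in> S" and e: "e > 0" and he: "norm (z' - z) \<le> e"
      and d: "\<And>y y'. y \<in> S \<Longrightarrow> y' \<in> S \<Longrightarrow> norm (y' - y) \<le> norm (z' - z) \<Longrightarrow>
        (\<forall>k. norm (w y' k - w y k - Dw y k (y' - y)) \<le> e * norm k * norm (y' - y) \<and>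
             norm (w y' k - w y k) \<le> e * norm k)" for z z' e
  proof (cases "z' = z")
    case True
    then show ?thesis using lin[OF z(1)] by (simp add: linear_simps)
  next
    case False
    define h where "h = z' - z"
    have B0: "B \<ge> 0" using B0[of h] False by (simp add: h_def)
    define x where "x = z - z0"
    define a where "a t = w (ray z t) x" for t
    define a' where "a' t = w (ray z' t) (x + h)" for t
    define D where "D t = U z' t - U z t * (1 + t *\<^sub>R w (ray z t) h)" for t
    \<comment> \<open>The summands are the Taylor remainder of \<open>w\<close> in the radial slot,
      the variation of \<open>w\<close> in the slot \<open>h\<close>, and a product of two small
      factors. Each is bounded by a multiple of \<open>e * norm h\<close>.\<close>
    define R where "R t = (w (ray z' t) x - w (ray z t) x - Dw (ray z t) x (t *\<^sub>R h))
        + (w (ray z' t) h - w (ray z t) h) + t *\<^sub>R (w (ray z t) h * (a' t - a t))" for t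
    have xh: "x + h = z' - z0" by (simp add: x_def h_def)
    have rr: "ray z' t - ray z t = t *\<^sub>R h" for t
      by (simp add: ray_def h_def algebra_simps)
    have nx: "norm x \<le> 1" using unit z by (simp add: x_def)
    have DR: "(D has_vector_derivative D t * a' t + U z t * R t) (at t within {0..1})" if t: "t \<in> {0..1}" for t
    proof -
      let ?w = "w (ray z t)"
      have lint: "linear (Dw (ray z t) x)" using Dw[OF ray[OF z(1) t]] has_derivative_linear by blast
      have linw: "linear ?w" "linear (w (ray z' t))" 
        using lin[OF ray[OF z(1) t]] lin[OF ray[OF z(2) t]] bounded_linear.linear by auto
      have "((\<lambda>t. 1 + t *\<^sub>R w (ray z t) h) has_vector_derivative (?w h + t *\<^sub>R Dw (ray z t) h x)) (at t within {0..1})"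
        using wray[OF z(1) t, of h] unfolding x_def
        by (auto intro!: derivative_eq_intros simp: has_vector_derivative_def algebra_simps)
      note UM = has_vector_derivative_mult[OF U'[OF z(1) t] this]
      have "(U z' has_vector_derivative U z' t * a' t) (at t within {0..1})"
        using U'[OF z(2) t] by (simp add: a'_def xh)
      from has_vector_derivative_diff[OF this UM]
      have "(D has_vector_derivative U z' t * a' t - (U z t * (?w h + t *\<^sub>R Dw (ray z t) h x)
          + U z t * a t * (1 + t *\<^sub>R ?w h))) (at t within {0..1})"
        by (simp add: D_def[abs_def] a_def x_def)
      moreover have "U z' t * a' t - (U z t * (?w h + t *\<^sub>R Dw (ray z t) h x) + U z t * a t * (1 + t *\<^sub>R ?w h))
          = D t * a' t + U z t * R t"
      proof -
        \<comment> \<open>Flatness exchanges the two slots: differentiating the prediction produces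
          the derivative of \<open>w\<close> along the ray evaluated at \<open>h\<close>, while the
          Taylor remainder in \<open>R\<close> contains the derivative along \<open>h\<close>
          evaluated at the ray.\<close>
        have f: "t *\<^sub>R Dw (ray z t) h x = t *\<^sub>R Dw (ray z t) x h + t *\<^sub>R (?w h * ?w x - ?w x * ?w h)"
          using flat[OF ray[OF z(1) t], of x h] by (simp add: algebra_simps flip: scaleR_add_right scaleR_diff_right)
        have "(1 + t *\<^sub>R ?w h) * a' t - a t * (1 + t *\<^sub>R ?w h) - ?w h - t *\<^sub>R Dw (ray z t) h x = R t"
          unfolding f R_def a_def a'_def
          by (simp add: linear_add[OF linw(2)] linear_cmul[OF lint] algebra_simps)
        then show ?thesis
          by (simp add: D_def algebra_simps flip: \<open>_ = R t\<close>)
      qed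
      ultimately show ?thesis by simp
    qed
    have Rb: "norm (U z t * R t) \<le> 2 * norm (1::'a) * ((2 + B + B * B) * e * norm h)" if t: "t \<in> {0..1}" for t
    proof -
      have y: "ray z t \<in> S" "ray z' t \<in> S" "norm (ray z' t - ray z t) \<le> norm (z' - z)"
        using ray z t by (auto simp: rr h_def mult_left_le_one_le)
      note d = d[OF y]
      have th: "norm (t *\<^sub>R h) \<le> norm h" using t by (auto simp: mult_left_le_one_le)
      have "norm (w (ray z' t) x - w (ray z t) x - Dw (ray z t) x (t *\<^sub>R h)) \<le> e * norm x * norm (t *\<^sub>R h)"
        using d rr by metis
      also have "\<dots> \<le> e * 1 * norm h" using nx th e by (intro mult_mono) auto
      finally have 1: "norm (w (ray z' t) x - w (ray z t) x - Dw (ray z t) x (t *\<^sub>R h)) \<le> e * norm h" by simp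
      have 2: "norm (w (ray z' t) h - w (ray z t) h) \<le> e * norm h" using d by blast
      have "a' t - a t = (w (ray z' t) x - w (ray z t) x) + w (ray z' t) h"
        using bounded_linear.linear[OF lin[OF y(2)]] by (simp add: a_def a'_def linear_add)
      then have "norm (a' t - a t) \<le> e * norm x + B * norm h"
        using d B[OF y(2), of h] norm_triangle_ineq[of "w (ray z' t) x - w (ray z t) x" "w (ray z' t) h"] 
        by (metis (no_types, lifting) add_mono order_trans)
      also have "\<dots> \<le> e * 1 + B * e" using nx e he B0 by (intro add_mono mult_left_mono) (auto simp: h_def)
      finally have 3: "norm (a' t - a t) \<le> e + B * e" by simp
      have "norm (t *\<^sub>R (w (ray z t) h * (a' t - a t))) \<le> norm (w (ray z t) h * (a' t - a t))"
        using t by (auto simp: mult_left_le_one_le)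
      also have "\<dots> \<le> norm (w (ray z t) h) * norm (a' t - a t)" by (rule norm_mult_ineq)
      also have "\<dots> \<le> (B * norm h) * (e + B * e)"
        using B[OF y(1), of h] 3 B0 by (intro mult_mono) auto
      finally have "norm (R t) \<le> e * norm h + e * norm h + (B * norm h) * (e + B * e)"
        unfolding R_def using 1 2 by (intro norm_triangle_le add_mono) auto
      also have "\<dots> = (2 + B + B * B) * e * norm h" by (simp add: algebra_simps)
      finally have "norm (R t) \<le> (2 + B + B * B) * e * norm h" .
      then have "norm (U z t) * norm (R t) \<le> 2 * norm (1::'a) * ((2 + B + B * B) * e * norm h)"
        using Ub[OF z(1) t] by (intro mult_mono) auto
      then show ?thesis using norm_mult_ineq order_trans by blast
    qed
    have "norm (D 1) \<le> 2 * (2 * norm (1::'a) * ((2 + B + B * B) * e * norm h))"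
    proof (rule linear_ode_estimate[OF DR])
      show "D 0 = 0" using U0 z by (simp add: D_def)
      show "norm (a' t) \<le> 1 / 2" if "t \<in> {0..1}" for t
        using small[OF ray[OF z(2) that] z(2)] by (simp add: a'_def xh)
    qed (use Rb in auto)
    moreover have "D 1 = g z' - g z - g z * w z (z' - z)"
      by (simp add: D_def g_def ray_def h_def algebra_simps)
    ultimately show ?thesis by (simp add: h_def algebra_simps)
  qed
  show ?thesis
  proof (rule that[of g])
    have "ray z0 t = z0" for t by (simp add: ray_def)
    moreover have "w z0 0 = 0" using lin[OF S(2)] by (simp add: linear_simps)
    ultimately have "(U z0 has_vector_derivative 0) (at t within {0..1})" if "t \<in> {0..1}" for t
      using U'[OF S(2) that] by simp
    then have "norm (U z0 1 - U z0 0) \<le> 0 * (1 - 0)"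
      by (intro vector_derivative_norm_bound[where f' = "\<lambda>_. 0"]) auto
    then show "g z0 = 1" using U0[OF S(2)] by (simp add: g_def)
    fix z assume z: "z \<in> S"
    show "(g has_derivative (\<lambda>h. g z * w z h)) (at z within S)"
      unfolding has_derivative_within_alt2
    proof (intro conjI allI impI)
      show "bounded_linear (\<lambda>h. g z * w z h)"
        by (rule bounded_linear_const_mult[OF lin[OF z]])
      fix e :: real assume e: "e > 0"
      \<comment> \<open>With accuracy \<open>e / C\<close> the estimate \<open>key\<close> has the
        factor \<open>(C - 1) * (e / C)\<close>, which is below \<open>e\<close>. The final
        \<open>+ 1\<close> makes \<open>C\<close> positive.\<close>
      define C where "C = 4 * norm (1::'a) * (2 + \<bar>B\<bar> + \<bar>B\<bar> * \<bar>B\<bar>) + 1"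
      have C: "C > 0" unfolding C_def by (simp add: add_nonneg_pos)
      then have "e / C > 0" using e by simp
      then obtain d where d: "d > 0" "\<forall>z\<in>S. \<forall>z'\<in>S. norm (z' - z) < d \<longrightarrow>
        (\<forall>k. norm (w z' k - w z k - Dw z k (z' - z)) \<le> e / C * norm k * norm (z' - z) \<and>
             norm (w z' k - w z k) \<le> e / C * norm k)"
        using unif by blast
      show "\<forall>\<^sub>F y in at z within S. norm (g y - g z - g z * w z (y - z)) \<le> e * norm (y - z)"
        unfolding eventually_at
      proof (intro exI[of _ "min d (e / C)"] conjI ballI impI)
        show "min d (e / C) > 0" using d \<open>e / C > 0\<close> by simp
        fix y assume y: "y \<in> S" and "y \<noteq> z \<and> dist y z < min d (e / C)"
        then have ny: "norm (y - z) < d" "norm (y - z) \<le> e / C" "y - z \<noteq> 0" by (auto simp: dist_norm)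
        have "B \<ge> 0" using B0 ny by blast
        have "norm (g y - g z - g z * w z (y - z)) \<le> 4 * norm (1::'a) * ((2 + B + B * B) * (e / C)) * norm (y - z)"
          by (rule key[OF z y \<open>e / C > 0\<close> ny(2)]) (use d ny in auto)
        also have "\<dots> = (C - 1) * (e / C) * norm (y - z)"
          using \<open>B \<ge> 0\<close> by (simp add: C_def)
        also have "\<dots> \<le> C * (e / C) * norm (y - z)"
          using \<open>e / C > 0\<close> by (intro mult_right_mono) auto
        also have "\<dots> = e * norm (y - z)" using C by simp
        finally show "norm (g y - g z - g z * w z (y - z)) \<le> e * norm (y - z)" .
      qed
    qed
  qed
qed


text \<open>In filter form, the moduli of continuity of finitely many functions can be merged by
  \<open>eventually_all_finite\<close> without choosing a minimum.\<close>

lemma uniformly_continuous_eventually: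
  assumes "uniformly_continuous_on S f" "e > 0"
  shows "\<forall>\<^sub>F d in at_right 0. \<forall>z\<in>S. \<forall>z'\<in>S. dist z' z < d \<longrightarrow> dist (f z') (f z) < e"
proof -
  obtain d where d: "d > 0" "\<forall>x\<in>S. \<forall>x'\<in>S. dist x' x < d \<longrightarrow> dist (f x') (f x) < e"
    using assms unfolding uniformly_continuous_on_def by meson
  show ?thesis
    unfolding eventually_at_right_field
    using d by (intro exI[of _ d]) (auto intro: less_trans)
qed

text \<open>Along the segment from \<open>z\<close> to \<open>z'\<close> the derivative differs from
  \<open>W' z\<close> by at most \<open>e\<close>, by uniform continuity on the compact set, so the
  mean value inequality gives a remainder that is uniform in \<open>z\<close>. Continuity is known
  for fixed directions only; the two basis directions get \<open>e / 2\<close> each.\<close>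

lemma uniform_linearization:
  fixes W :: "real^2 \<Rightarrow> 'a::real_normed_vector"
  assumes S: "compact S" "convex S"
    and W': "\<And>z. z \<in> S \<Longrightarrow> (W has_derivative W' z) (at z within S)"
    and cont: "\<And>v. continuous_on S (\<lambda>z. W' z v)" and e: "e > 0"
  shows "\<forall>\<^sub>F d in at_right 0. \<forall>z\<in>S. \<forall>z'\<in>S. norm (z' - z) < d \<longrightarrow>
    norm (W z' - W z - W' z (z' - z)) \<le> e * norm (z' - z) \<and> norm (W z' - W z) \<le> e"
proof -
  have "uniformly_continuous_on S (\<lambda>z. W' z (axis j 1))" for j
    using compact_uniformly_continuous cont S by blast
  then have "\<forall>\<^sub>F d in at_right 0. \<forall>z\<in>S. \<forall>z'\<in>S. dist z' z < d \<longrightarrow> dist (W' z' (axis j 1)) (W' z (axis j 1)) < e / 2" for j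
    by (rule uniformly_continuous_eventually) (use e in simp)
  then have 1: "\<forall>\<^sub>F d in at_right 0. \<forall>j. \<forall>z\<in>S. \<forall>z'\<in>S. dist z' z < d \<longrightarrow> dist (W' z' (axis j 1)) (W' z (axis j 1)) < e / 2"
    by (rule eventually_all_finite)
  have "continuous_on S W" by (rule has_derivative_continuous_on[OF W'])
  then have 2: "\<forall>\<^sub>F d in at_right 0. \<forall>z\<in>S. \<forall>z'\<in>S. dist z' z < d \<longrightarrow> dist (W z') (W z) < e"
    by (intro uniformly_continuous_eventually compact_uniformly_continuous S(1) e)
  show ?thesis
    using 1 2
  proof eventually_elim
    case (elim d)
    show ?case
    proof (intro ballI impI conjI)
      fix z z' assume z: "z \<in> S" "z' \<in> S" and d: "norm (z' - z) < d"
      show "norm (W z' - W z) \<le> e"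
        using elim z d by (auto simp: dist_norm intro: less_imp_le)
      define S' where "S' = S \<inter> cball z (norm (z' - z))"
      have "norm (W z' - W z - W' z (z' - z)) \<le> norm (z' - z) * e"
      proof (rule differentiable_bound_linearization[where S = S'])
        show "z \<in> S'" using z by (simp add: S'_def)
        fix t :: real assume t: "t \<in> {0..1}"
        have "z + t *\<^sub>R (z' - z) = (1 - t) *\<^sub>R z + t *\<^sub>R z'" by (simp add: algebra_simps)
        then have "z + t *\<^sub>R (z' - z) \<in> S" using S z t by (auto simp: convex_alt)
        then show "z + t *\<^sub>R (z' - z) \<in> S'"
          using t by (auto simp: S'_def dist_norm mult_left_le_one_le)
      next
        fix y assume "y \<in> S'"
        then have y: "y \<in> S" "dist y z < d" using d by (auto simp: S'_def dist_commute dist_norm)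
        show "(W has_derivative W' y) (at y within S')"
          by (rule has_derivative_subset[OF W'[OF y(1)]]) (auto simp: S'_def)
        have ly: "linear (W' y)" "linear (W' z)" using W' y z has_derivative_linear by blast+
        show "onorm (W' y - W' z) \<le> e"
        proof (rule onorm_bound)
          fix h :: "real^2"
          have h: "h = h $ 1 *\<^sub>R axis 1 1 + h $ 2 *\<^sub>R axis 2 1"
            by (simp add: vec_eq_iff forall_2 axis_def)
          define a where "a j = W' y (axis j 1) - W' z (axis j 1)" for j
          have a: "norm (a j) \<le> e / 2" for j
            using elim(1) y z by (auto simp: a_def dist_norm intro: less_imp_le)
          have "(W' y - W' z) h = h $ 1 *\<^sub>R a 1 + h $ 2 *\<^sub>R a 2"
            by (subst h) (simp add: a_def linear_add[OF ly(1)] linear_add[OF ly(2)] linear_cmul[OF ly(1)]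
                linear_cmul[OF ly(2)] algebra_simps)
          moreover have "norm (h $ i *\<^sub>R a i) \<le> norm h * (e / 2)" for i
            unfolding norm_scaleR using a[of i] component_le_norm_cart[of h i] by (intro mult_mono) auto
          ultimately have "norm ((W' y - W' z) h) \<le> norm h * (e / 2) + norm h * (e / 2)"
            by (metis norm_triangle_le add_mono)
          then show "norm ((W' y - W' z) h) \<le> e * norm h" by simp
        qed (use e in auto)
      qed
      then show "norm (W z' - W z - W' z (z' - z)) \<le> e * norm (z' - z)" by (simp add: mult.commute)
    qed
  qed
qed

text \<open>A restriction to a small ball provides all bounds that the radial construction requires,
  and compactness makes the differentiability of the coefficients uniform.\<close>

lemma flat_primitive:
  fixes W :: "2 \<Rightarrow> real^2 \<Rightarrow> 'a::{real_algebra_1, real_normed_algebra, banach}"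
  assumes S: "compact S" "convex S" "z0 \<in> S"
    and W': "\<And>i z. z \<in> S \<Longrightarrow> (W i has_derivative W' i z) (at z within S)"
    and cont: "\<And>i v. continuous_on S (\<lambda>z. W' i z v)"
    and flat: "\<And>z. z \<in> S \<Longrightarrow> W' 2 z (axis 1 1) - W' 1 z (axis 2 1) + W 1 z * W 2 z - W 2 z * W 1 z = 0"
  obtains r g where "r > 0" "g z0 = 1"
    "\<And>z. z \<in> S \<inter> cball z0 r \<Longrightarrow>
      (g has_derivative (\<lambda>h. g z * (\<Sum>i\<in>UNIV. h $ i *\<^sub>R W i z))) (at z within S \<inter> cball z0 r)"
proof -
  have contW: "continuous_on S (W i)" for i by (rule has_derivative_continuous_on[OF W'])
  have "\<exists>b. \<forall>z\<in>S. norm (W i z) \<le> b" for i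
    using compact_imp_bounded[OF compact_continuous_image[OF contW S(1)], of i]
    by (auto simp: bounded_iff)
  then obtain b where b: "\<And>i z. z \<in> S \<Longrightarrow> norm (W i z) \<le> b i" by metis
  define B where "B = \<bar>b 1\<bar> + \<bar>b 2\<bar> + 1"
  have B: "B > 0" by (simp add: B_def)
  \<comment> \<open>On the ball of radius \<open>r\<close> the coefficient along a ray is at most
    \<open>B * r\<close>, hence at most 1/2; the bound 1 ensures
    \<open>norm (z - z0) \<le> 1\<close>.\<close>
  define r where "r = min 1 (1 / (2 * B))"
  have r: "r > 0" "r \<le> 1" "B * r \<le> 1 / 2"
    using B by (auto simp: r_def min_def field_simps)
  define S' where "S' = S \<inter> cball z0 r"
  have S': "compact S'" "convex S'" "z0 \<in> S'" "S' \<subseteq> S"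
    using S r by (auto simp: S'_def compact_Int_closed convex_Int)
  define w where "w z h = (\<Sum>i\<in>UNIV. h $ i *\<^sub>R W i z)" for z and h :: "real^2"
  define Dw where "Dw z k h = (\<Sum>i\<in>UNIV. k $ i *\<^sub>R W' i z h)" for z h and k :: "real^2"
  have Bw: "norm (w z h) \<le> B * norm h" if "z \<in> S" for z h
  proof -
    have "norm (h $ i *\<^sub>R W i z) \<le> norm h * \<bar>b i\<bar>" for i
      unfolding norm_scaleR using b[OF that, of i] component_le_norm_cart[of h i] by (intro mult_mono) auto
    note n = this
    have "norm (w z h) \<le> norm h * \<bar>b 1\<bar> + norm h * \<bar>b 2\<bar>"
      unfolding w_def sum_2 by (intro norm_triangle_le add_mono n)
    also have "\<dots> \<le> norm h * \<bar>b 1\<bar> + norm h * \<bar>b 2\<bar> + norm h" by simp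
    finally show ?thesis by (simp add: B_def algebra_simps)
  qed
  have W'S': "(W i has_derivative W' i z) (at z within S')" if "z \<in> S'" for i z
    by (rule has_derivative_subset[OF W']) (use that S' in auto)
  obtain g where g: "g z0 = 1" "\<And>z. z \<in> S' \<Longrightarrow> (g has_derivative (\<lambda>h. g z * w z h)) (at z within S')"
  proof (rule flat_primitive_radial[OF S'(2,3), of w B Dw])
    fix z k assume z: "z \<in> S'"
    show "norm (z - z0) \<le> 1" using z r by (auto simp: S'_def dist_norm norm_minus_commute)
    show "bounded_linear (w z)" unfolding w_def
      by (intro bounded_linear_sum bounded_linear_compose[OF bounded_linear_scaleR_left] bounded_linear_vec_nth)
    show "norm (w z h) \<le> B * norm h" for h using Bw z S' by auto
    show "norm (w z (y - z0)) \<le> 1 / 2" if "y \<in> S'" for y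
    proof -
      have "norm (w z (y - z0)) \<le> B * norm (y - z0)" using Bw z S' by auto
      also have "\<dots> \<le> B * r" using that B by (intro mult_left_mono) (auto simp: S'_def dist_norm norm_minus_commute)
      finally show ?thesis using r by simp
    qed
    show "((\<lambda>z. w z k) has_derivative Dw z k) (at z within S')"
      unfolding w_def Dw_def by (intro has_derivative_sum has_derivative_scaleR_right W'S' z)
    fix h :: "real^2"
    have l: "linear (W' i z)" for i using W'S'[OF z] has_derivative_linear by blast
    have W'e: "W' i z v = v $ 1 *\<^sub>R W' i z (axis 1 1) + v $ 2 *\<^sub>R W' i z (axis 2 1)" for i v
    proof -
      have v: "v = v $ 1 *\<^sub>R axis 1 1 + v $ 2 *\<^sub>R axis 2 1" by (simp add: vec_eq_iff forall_2 axis_def)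
      show ?thesis by (subst v) (simp only: linear_add[OF l] linear_cmul[OF l])
    qed
    have f: "W' 2 z (axis 1 1) = W' 1 z (axis 2 1) - W 1 z * W 2 z + W 2 z * W 1 z"
      using flat[of z] z S' by (auto simp: algebra_simps)
    show "Dw z k h - Dw z h k + w z h * w z k - w z k * w z h = 0"
      unfolding Dw_def w_def sum_2 W'e[of _ h] W'e[of _ k] f by (simp add: algebra_simps)
  next
    fix e :: real assume "e > 0"
    then have e2: "e / 2 > 0" by simp
    have c: "continuous_on S' (\<lambda>z. W' i z v)" for i v
      using cont S'(4) continuous_on_subset by blast
    have "\<forall>\<^sub>F d in at_right 0. \<forall>i. \<forall>z\<in>S'. \<forall>z'\<in>S'. norm (z' - z) < d \<longrightarrow>
        norm (W i z' - W i z - W' i z (z' - z)) \<le> e / 2 * norm (z' - z) \<and> norm (W i z' - W i z) \<le> e / 2"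
      by (intro eventually_all_finite uniform_linearization[OF S'(1,2) W'S' c e2])
    then obtain d0 where d0: "d0 > 0" "\<forall>y>0. y < d0 \<longrightarrow> (\<forall>i. \<forall>z\<in>S'. \<forall>z'\<in>S'. norm (z' - z) < y \<longrightarrow>
        norm (W i z' - W i z - W' i z (z' - z)) \<le> e / 2 * norm (z' - z) \<and> norm (W i z' - W i z) \<le> e / 2)"
      unfolding eventually_at_right_field by blast
    define d where "d = d0 / 2"
    have d: "d > 0" "\<And>i z z'. z\<in>S' \<Longrightarrow> z'\<in>S' \<Longrightarrow> norm (z' - z) < d \<Longrightarrow>
        norm (W i z' - W i z - W' i z (z' - z)) \<le> e / 2 * norm (z' - z) \<and> norm (W i z' - W i z) \<le> e / 2"
      using d0(1) d0(2)[rule_format, of d] by (simp_all add: d_def)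
    show "\<exists>d>0. \<forall>z\<in>S'. \<forall>z'\<in>S'. norm (z' - z) < d \<longrightarrow>
        (\<forall>k. norm (w z' k - w z k - Dw z k (z' - z)) \<le> e * norm k * norm (z' - z) \<and>
             norm (w z' k - w z k) \<le> e * norm k)"
    proof (intro exI[of _ d] conjI ballI impI allI d(1))
      fix z z' k assume z: "z \<in> S'" "z' \<in> S'" and zd: "norm (z' - z) < d"
      have eq: "w z' k - w z k - Dw z k (z' - z) = (\<Sum>i\<in>UNIV. k $ i *\<^sub>R (W i z' - W i z - W' i z (z' - z)))"
        "w z' k - w z k = (\<Sum>i\<in>UNIV. k $ i *\<^sub>R (W i z' - W i z))"
        by (simp_all add: w_def Dw_def sum_subtractf scaleR_diff_right)
      have "norm (k $ i *\<^sub>R (W i z' - W i z - W' i z (z' - z))) \<le> norm k * (e / 2 * norm (z' - z))"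
        "norm (k $ i *\<^sub>R (W i z' - W i z)) \<le> norm k * (e / 2)" for i
        unfolding norm_scaleR using d(2)[OF z zd, of i] component_le_norm_cart[of k i]
        by (blast intro: mult_mono abs_ge_zero norm_ge_zero)+
      note n = this
      show "norm (w z' k - w z k - Dw z k (z' - z)) \<le> e * norm k * norm (z' - z)"
        unfolding eq(1) sum_2
        by (rule order_trans[OF norm_triangle_le[OF add_mono[OF n(1) n(1)]]]) (simp add: algebra_simps)
      show "norm (w z' k - w z k) \<le> e * norm k"
        unfolding eq(2) sum_2
        by (rule order_trans[OF norm_triangle_le[OF add_mono[OF n(2) n(2)]]]) (simp add: algebra_simps)
    qed
  qed (rule that, assumption+)
  show ?thesis
    by (rule that[of r g]) (use r(1) g in \<open>simp_all add: S'_def w_def\<close>)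
qed

section \<open>Matrices over the dual numbers\<close>

text \<open>The pair \<open>(g, f)\<close> of the group $\widetilde{ISO}(1,2)$ is encoded as the matrix
  \<open>g + \<epsilon> f g\<close> over the dual numbers; this turns the product of pairs into matrix
  multiplication, and both constraints into flatness of the single one-form \<open>\<omega> + \<epsilon> \<gamma>\<close>.\<close>

typedef dmat = "UNIV :: ((real^2^2) \<times> (real^2^2)) set" ..

definition DM :: "real^2^2 \<Rightarrow> real^2^2 \<Rightarrow> dmat" where "DM a b = Abs_dmat (a, b)"
definition dre :: "dmat \<Rightarrow> real^2^2" where "dre X = fst (Rep_dmat X)"
definition deps :: "dmat \<Rightarrow> real^2^2" where "deps X = snd (Rep_dmat X)"

lemma dre_DM [simp]: "dre (DM a b) = a" and deps_DM [simp]: "deps (DM a b) = b"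
  by (simp_all add: DM_def dre_def deps_def Abs_dmat_inverse)

lemma DM_dre_deps [simp]: "DM (dre X) (deps X) = X"
  by (simp add: DM_def dre_def deps_def Rep_dmat_inverse)

lemma dmat_eq_iff: "X = Y \<longleftrightarrow> dre X = dre Y \<and> deps X = deps Y"
  by (metis DM_dre_deps)

lemma matrix2_distribs:
  "(A + B) ** C = A ** C + B ** C" "A ** (B + C) = A ** B + A ** C"
  "(A - B) ** C = A ** C - B ** C" "A ** (B - C) = A ** B - A ** C"
  "(r *\<^sub>R A) ** B = r *\<^sub>R (A ** B)" "A ** (r *\<^sub>R B) = r *\<^sub>R (A ** B)"
  "A ** 0 = 0" "0 ** A = 0" "(- A) ** B = - (A ** B)" "A ** (- B) = - (A ** B)"
  for A B C :: "real^2^2"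
  by (simp_all add: vec_eq_iff matrix_matrix_mult_def sum_2 algebra_simps)

lemma bounded_bilinear_matrix_mult:
  "bounded_bilinear ((**) :: real^2^2 \<Rightarrow> real^2^2 \<Rightarrow> real^2^2)"
  by (subst bilinear_conv_bounded_bilinear[symmetric])
     (auto simp: bilinear_def matrix2_distribs intro!: linearI)

text \<open>The matrix norm is submultiplicative only up to a factor. As a weight in the norm of
  \<open>dmat\<close>, this factor is absorbed, as \<open>real_normed_algebra\<close>
  demands.\<close>

definition matrix_mult_bound :: real where
  "matrix_mult_bound = (SOME K. 0 < K \<and> (\<forall>(A :: real^2^2) (B :: real^2^2). norm (A ** B) \<le> norm A * norm B * K))"

lemma matrix_mult_bound: "0 < matrix_mult_bound"
  "norm ((A :: real^2^2) ** (B :: real^2^2)) \<le> norm A * norm B * matrix_mult_bound"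
proof -
  have "\<exists>K. 0 < K \<and> (\<forall>(A :: real^2^2) (B :: real^2^2). norm (A ** B) \<le> norm A * norm B * K)"
    using bounded_bilinear.pos_bounded[OF bounded_bilinear_matrix_mult] by auto
  from someI_ex[OF this] show "0 < matrix_mult_bound"
    "norm ((A :: real^2^2) ** (B :: real^2^2)) \<le> norm A * norm B * matrix_mult_bound"
    unfolding matrix_mult_bound_def by auto
qed

instantiation dmat :: real_normed_algebra
begin

definition "0 = DM 0 0"
definition "X + Y = DM (dre X + dre Y) (deps X + deps Y)"
definition "X - Y = DM (dre X - dre Y) (deps X - deps Y)"
definition "- X = DM (- dre X) (- deps X)"
definition "X * Y = DM (dre X ** dre Y) (dre X ** deps Y + deps X ** dre Y)"
definition "r *\<^sub>R X = DM (r *\<^sub>R dre X) (r *\<^sub>R deps X)"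
definition "norm X = matrix_mult_bound * (norm (dre X) + norm (deps X))"
definition "dist X Y = norm (X - Y)" for X Y :: dmat
definition "sgn X = inverse (norm X) *\<^sub>R X" for X :: dmat
definition "uniformity = (INF e\<in>{0<..}. principal {(x, y :: dmat). dist x y < e})"
definition "open U \<longleftrightarrow> (\<forall>x\<in>U. eventually (\<lambda>(x', y). x' = x \<longrightarrow> y \<in> U) uniformity)" for U :: "dmat set"

lemma dmat_sel [simp]:
  "dre 0 = 0" "deps 0 = 0" "dre (X + Y) = dre X + dre Y" "deps (X + Y) = deps X + deps Y"
  "dre (X - Y) = dre X - dre Y" "deps (X - Y) = deps X - deps Y" "dre (- X) = - dre X" "deps (- X) = - deps X"
  "dre (X * Y) = dre X ** dre Y" "deps (X * Y) = dre X ** deps Y + deps X ** dre Y"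
  "dre (r *\<^sub>R X) = r *\<^sub>R dre X" "deps (r *\<^sub>R X) = r *\<^sub>R deps X"
  by (simp_all add: zero_dmat_def plus_dmat_def minus_dmat_def uminus_dmat_def times_dmat_def scaleR_dmat_def)

instance
proof
  fix X Y Z :: dmat and r s :: real
  note [simp] = dmat_eq_iff matrix_mul_assoc matrix2_distribs algebra_simps
  show "X + Y + Z = X + (Y + Z)" "X + Y = Y + X" "0 + X = X" "- X + X = 0" "X - Y = X + - Y"
    "r *\<^sub>R (X + Y) = r *\<^sub>R X + r *\<^sub>R Y" "(r + s) *\<^sub>R X = r *\<^sub>R X + s *\<^sub>R X"
    "r *\<^sub>R s *\<^sub>R X = (r * s) *\<^sub>R X" "1 *\<^sub>R X = X"
    by simp_all
  show "X * Y * Z = X * (Y * Z)" "(X + Y) * Z = X * Z + Y * Z" "X * (Y + Z) = X * Y + X * Z"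
    by simp_all
  show "r *\<^sub>R X * Y = r *\<^sub>R (X * Y)" "X * r *\<^sub>R Y = r *\<^sub>R (X * Y)"
    by simp_all
next
  fix X Y :: dmat and r :: real
  let ?K = matrix_mult_bound
  note K = matrix_mult_bound(1)
  show "norm X = 0 \<longleftrightarrow> X = 0"
    using K by (auto simp: norm_dmat_def dmat_eq_iff add_nonneg_eq_0_iff)
  have "norm (dre X + dre Y) + norm (deps X + deps Y) \<le> (norm (dre X) + norm (deps X)) + (norm (dre Y) + norm (deps Y))"
    using norm_triangle_ineq[of "dre X" "dre Y"] norm_triangle_ineq[of "deps X" "deps Y"] by linarith
  from mult_left_mono[OF this] K show "norm (X + Y) \<le> norm X + norm Y"
    by (simp add: norm_dmat_def algebra_simps)
  show "norm (r *\<^sub>R X) = \<bar>r\<bar> * norm X"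
    by (simp add: norm_dmat_def algebra_simps)
  have "norm (dre X ** deps Y + deps X ** dre Y) \<le> norm (dre X) * norm (deps Y) * ?K + norm (deps X) * norm (dre Y) * ?K"
    by (intro norm_triangle_le add_mono matrix_mult_bound(2))
  \<comment> \<open>Since the square of epsilon is zero, the product of the two epsilon norms on the
    right has no counterpart on the left; it is a nonnegative surplus.\<close>
  then have "norm (dre (X * Y)) + norm (deps (X * Y))
      \<le> ?K * ((norm (dre X) + norm (deps X)) * (norm (dre Y) + norm (deps Y)))"
    using matrix_mult_bound(2)[of "dre X" "dre Y"] K
      mult_nonneg_nonneg[OF less_imp_le[OF K] mult_nonneg_nonneg[OF norm_ge_zero[of "deps X"] norm_ge_zero[of "deps Y"]]]
    by (simp only: dmat_sel distrib_left distrib_right mult_ac)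
  from mult_left_mono[OF this less_imp_le[OF K]] show "norm (X * Y) \<le> norm X * norm Y"
    by (simp add: norm_dmat_def mult_ac)
qed (fact dist_dmat_def sgn_dmat_def uniformity_dmat_def open_dmat_def)+

end

instantiation dmat :: real_algebra_1
begin

definition "1 = DM (mat 1) 0"

instance
proof
  show "(0::dmat) \<noteq> 1"
    by (simp add: one_dmat_def dmat_eq_iff mat_def vec_eq_iff)
qed (simp_all add: one_dmat_def dmat_eq_iff matrix2_distribs)

end

lemma dmat_one [simp]: "dre 1 = mat 1" "deps 1 = 0"
  by (simp_all add: one_dmat_def)

lemma bounded_linear_dre: "bounded_linear dre" and bounded_linear_deps: "bounded_linear deps"
proof -
  have *: "norm (dre X) \<le> norm X * inverse matrix_mult_bound" "norm (deps X) \<le> norm X * inverse matrix_mult_bound" for X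
    using matrix_mult_bound(1) by (auto simp: norm_dmat_def field_simps)
  show "bounded_linear dre" "bounded_linear deps"
    using * by (auto intro!: bounded_linear_intro)
qed

lemma bounded_linear_DM: "bounded_linear (\<lambda>p. DM (fst p) (snd p))"
proof (rule bounded_linear_intro)
  show "norm (DM (fst p) (snd p)) \<le> norm p * (2 * matrix_mult_bound)" for p
    using mult_left_mono[OF add_mono[OF norm_fst_le[of "fst p" "snd p"] norm_snd_le[of "snd p" "fst p"]]
        less_imp_le[OF matrix_mult_bound(1)]]
    by (simp add: norm_dmat_def algebra_simps)
qed (simp_all add: dmat_eq_iff)

lemma tendsto_DM: "(f \<longlongrightarrow> a) F \<Longrightarrow> (g \<longlongrightarrow> b) F \<Longrightarrow> ((\<lambda>x. DM (f x) (g x)) \<longlongrightarrow> DM a b) F"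
  using bounded_linear.tendsto[OF bounded_linear_DM tendsto_Pair[of f a F g b]] by simp

lemma has_derivative_DM:
  "(f has_derivative f') (at x within S) \<Longrightarrow> (g has_derivative g') (at x within S) \<Longrightarrow>
     ((\<lambda>x. DM (f x) (g x)) has_derivative (\<lambda>h. DM (f' h) (g' h))) (at x within S)"
  using bounded_linear.has_derivative[OF bounded_linear_DM has_derivative_Pair[of f f' x S g g']] by simp

lemma Ck_on_Pair: "Ck_on k S f \<Longrightarrow> Ck_on k S g \<Longrightarrow> Ck_on k S (\<lambda>x. (f x, g x))"
proof (induction k arbitrary: f g)
  case 0
  then show ?case by (auto intro: continuous_on_Pair)
next
  case (Suc k)
  then obtain f' g' where "\<forall>x\<in>S. (f has_derivative f' x) (at x within S)" "\<forall>v. Ck_on k S (\<lambda>x. f' x v)"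
    and "\<forall>x\<in>S. (g has_derivative g' x) (at x within S)" "\<forall>v. Ck_on k S (\<lambda>x. g' x v)"
    by auto
  then show ?case
    by (auto intro!: exI[of _ "\<lambda>x v. (f' x v, g' x v)"] has_derivative_Pair Suc.IH)
qed

instance dmat :: banach
proof
  fix X :: "nat \<Rightarrow> dmat" assume X: "Cauchy X"
  obtain a b where "(\<lambda>n. dre (X n)) \<longlonglongrightarrow> a" "(\<lambda>n. deps (X n)) \<longlonglongrightarrow> b"
    using bounded_linear.Cauchy[OF bounded_linear_dre X] bounded_linear.Cauchy[OF bounded_linear_deps X]
    by (metis Cauchy_convergent convergent_def)
  from tendsto_DM[OF this] show "convergent X" by (auto simp: convergent_def)
qed

text \<open>The adjugate of a two by two matrix, in the form given by the Cayley-Hamilton theorem;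
  linearity is visible here.\<close>

definition adj2 :: "real^2^2 \<Rightarrow> real^2^2" where "adj2 A = trace A *\<^sub>R mat 1 - A"

lemmas matrix2_simps = vec_eq_iff forall_2 matrix_matrix_mult_def sum_2 trace_def mat_def adj2_def det_2

lemma adj2_mult: "adj2 (A ** B) = adj2 B ** adj2 A"
  by (simp add: matrix2_simps algebra_simps)

lemma adj2_adj2 [simp]: "adj2 (adj2 A) = A"
  by (simp add: matrix2_simps algebra_simps)

lemma adj2_add: "adj2 (A + B) = adj2 A + adj2 B" and adj2_scaleR: "adj2 (r *\<^sub>R A) = r *\<^sub>R adj2 A"
  and adj2_one: "adj2 (mat 1) = mat 1" and adj2_zero [simp]: "adj2 0 = 0"
  by (simp_all add: matrix2_simps algebra_simps)

lemma mult_adj2: "A ** adj2 A = det A *\<^sub>R mat 1" and adj2_mult_self: "adj2 A ** A = det A *\<^sub>R mat 1"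
  by (simp_all add: matrix2_simps algebra_simps)

text \<open>Polarization of \<open>mult_adj2\<close> and \<open>adj2_mult_self\<close>; the scalar
  is the polar form of the determinant, which is symmetric and hence the same on both sides.\<close>

lemma adj2_polarized: "A ** adj2 B + B ** adj2 A = trace (B ** adj2 A) *\<^sub>R mat 1"
  "adj2 A ** B + adj2 B ** A = trace (B ** adj2 A) *\<^sub>R mat 1"
  by (simp_all add: matrix2_simps algebra_simps)

lemma matrix_inv_SL2: "A \<in> SL2 \<Longrightarrow> matrix_inv A = adj2 A"
proof -
  assume "A \<in> SL2"
  then have "A ** adj2 A = mat 1" "adj2 A ** A = mat 1"
    by (simp_all add: SL2_def mult_adj2 adj2_mult_self)
  moreover from this have "A ** matrix_inv A = mat 1 \<and> matrix_inv A ** A = mat 1"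
    unfolding matrix_inv_def using someI[of "\<lambda>B. A ** B = mat 1 \<and> B ** A = mat 1" "adj2 A"] by simp
  ultimately show ?thesis by (metis matrix_mul_assoc matrix_mul_lid matrix_mul_rid)
qed

text \<open>The adjugate extended linearly over the dual numbers: a linear anti-automorphism of
  order two that serves as the inverse on \<open>dgroup\<close>.\<close>

definition dadj :: "dmat \<Rightarrow> dmat" where "dadj X = DM (adj2 (dre X)) (adj2 (deps X))"

lemma dadj_sel [simp]: "dre (dadj X) = adj2 (dre X)" "deps (dadj X) = adj2 (deps X)"
  by (simp_all add: dadj_def)

lemma dadj_mult: "dadj (X * Y) = dadj Y * dadj X"
  by (simp add: dmat_eq_iff adj2_mult adj2_add add.commute)

lemma dadj_dadj [simp]: "dadj (dadj X) = X"
  by (simp add: dmat_eq_iff)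

lemma dadj_one [simp]: "dadj 1 = 1"
  by (simp add: dmat_eq_iff adj2_one)

lemma bounded_linear_dadj: "bounded_linear dadj"
proof -
  have "linear adj2" by (intro linearI) (simp_all add: adj2_add adj2_scaleR)
  then have "bounded_linear adj2" by (rule linear_conv_bounded_linear[THEN iffD1])
  then have "bounded_linear (\<lambda>X. DM (fst (adj2 (dre X), adj2 (deps X))) (snd (adj2 (dre X), adj2 (deps X))))"
    by (intro bounded_linear_compose[OF bounded_linear_DM] bounded_linear_Pair
        bounded_linear_compose[OF _ bounded_linear_dre] bounded_linear_compose[OF _ bounded_linear_deps])
  then show ?thesis by (simp add: dadj_def[abs_def])
qed

text \<open>Matrices of determinant one over the dual numbers, that is, the tangent bundle of SL(2)
  with its group structure.\<close>

definition dgroup :: "dmat set" where "dgroup = {X. X * dadj X = 1}"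

lemma dgroup_iff: "X \<in> dgroup \<longleftrightarrow> dre X \<in> SL2 \<and> deps X ** adj2 (dre X) \<in> sl2"
proof -
  have "c *\<^sub>R mat 1 = (mat 1 :: real^2^2) \<longleftrightarrow> c = 1" "c *\<^sub>R mat 1 = (0 :: real^2^2) \<longleftrightarrow> c = 0" for c
    by (auto simp: matrix2_simps)
  then show ?thesis
    by (simp add: dgroup_def dmat_eq_iff mult_adj2 adj2_polarized SL2_def sl2_def)
qed

lemma dgroup_left: "X \<in> dgroup \<Longrightarrow> X * dadj X = 1"
  by (simp add: dgroup_def)

lemma dgroup_right: "X \<in> dgroup \<Longrightarrow> dadj X * X = 1"
  by (auto simp: dgroup_iff dmat_eq_iff adj2_mult_self adj2_polarized SL2_def sl2_def)

lemma dgroup_mult: "X \<in> dgroup \<Longrightarrow> Y \<in> dgroup \<Longrightarrow> X * Y \<in> dgroup"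
  unfolding dgroup_def mem_Collect_eq dadj_mult by (metis mult.assoc mult_1_left mult_1_right)

lemma dgroup_dadj: "X \<in> dgroup \<Longrightarrow> dadj X \<in> dgroup"
  using dgroup_right by (simp add: dgroup_def)

lemma dgroup_one [simp]: "1 \<in> dgroup"
  by (simp add: dgroup_def)

lemma dgroup_cancel: "X \<in> dgroup \<Longrightarrow> dadj X * (X * Y) = Y" "X \<in> dgroup \<Longrightarrow> X * (dadj X * Y) = Y"
  by (simp_all add: dgroup_left dgroup_right flip: mult.assoc)

text \<open>The condition is the linearization of \<open>X * dadj X = 1\<close> at the unit, so this
  describes the Lie algebra of \<open>dgroup\<close>.\<close>

lemma dadj_eq_minus_iff: "dadj X = - X \<longleftrightarrow> dre X \<in> sl2 \<and> deps X \<in> sl2"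
proof -
  have "adj2 A = - A \<longleftrightarrow> A \<in> sl2" for A
    by (auto simp: adj2_def sl2_def matrix2_simps)
  then show ?thesis by (simp add: dmat_eq_iff)
qed

definition dpair :: "real^2^2 \<Rightarrow> real^2^2 \<Rightarrow> dmat" where "dpair g f = DM g (f ** g)"

lemma dpair_dgroup: "g \<in> SL2 \<Longrightarrow> f \<in> sl2 \<Longrightarrow> dpair g f \<in> dgroup"
  by (simp add: dgroup_iff dpair_def mult_adj2 SL2_def flip: matrix_mul_assoc)

definition dtrans :: "dmat \<Rightarrow> real^2^2" where "dtrans X = deps X ** adj2 (dre X)"

lemma dtrans_dpair [simp]: "g \<in> SL2 \<Longrightarrow> dtrans (dpair g f) = f"
  by (simp add: dtrans_def dpair_def mult_adj2 SL2_def flip: matrix_mul_assoc)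

lemma dre_dpair [simp]: "dre (dpair g f) = g"
  by (simp add: dpair_def)

lemma dpair_dtrans: "X \<in> dgroup \<Longrightarrow> dpair (dre X) (dtrans X) = X"
  by (simp add: dpair_def dtrans_def dgroup_iff dmat_eq_iff adj2_mult_self SL2_def flip: matrix_mul_assoc)

lemma dgroup_dre: "X \<in> dgroup \<Longrightarrow> dre X \<in> SL2" and dgroup_dtrans: "X \<in> dgroup \<Longrightarrow> dtrans X \<in> sl2"
  by (simp_all add: dgroup_iff dtrans_def)

text \<open>This is the second component of the product in \<open>ISOt\<close>, with the adjugate in
  place of the inverse.\<close>

lemma dtrans_mult: "X \<in> dgroup \<Longrightarrow> Y \<in> dgroup \<Longrightarrow> dtrans (X * Y) = dtrans X + dre X ** dtrans Y ** adj2 (dre X)"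
proof -
  assume X: "X \<in> dgroup" and Y: "Y \<in> dgroup"
  have "dre Y ** adj2 (dre Y) = mat 1" using dgroup_dre[OF Y] by (simp add: mult_adj2 SL2_def)
  then have "deps X ** dre Y ** (adj2 (dre Y) ** adj2 (dre X)) = deps X ** adj2 (dre X)"
    by (metis matrix_mul_assoc matrix_mul_rid)
  then show ?thesis
    by (simp add: dtrans_def adj2_mult matrix2_distribs matrix_mul_assoc)
qed

lemma SL2_mult: "A \<in> SL2 \<Longrightarrow> B \<in> SL2 \<Longrightarrow> A ** B \<in> SL2" and SL2_adj2: "A \<in> SL2 \<Longrightarrow> adj2 A \<in> SL2"
  and SL2_one [simp]: "mat 1 \<in> SL2"
  by (simp_all add: SL2_def det_mul) (simp add: matrix2_simps algebra_simps)

section \<open>The universal cover\<close>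

lemma homotopic_paths_convex_image:
  fixes H :: "'z::real_normed_vector \<Rightarrow> 'a::topological_space"
  assumes "convex Z" "continuous_on Z H" "H ` Z \<subseteq> S"
    and "path p" "path_image p \<subseteq> Z" "path q" "path_image q \<subseteq> Z"
    and "pathstart q = pathstart p" "pathfinish q = pathfinish p"
  shows "homotopic_paths S (H \<circ> p) (H \<circ> q)"
proof -
  have "homotopic_paths Z p q"
    using convex_imp_simply_connected[OF assms(1)] assms(4-)
    unfolding simply_connected_eq_homotopic_paths by blast
  then show ?thesis
    by (rule homotopic_paths_continuous_image) (use assms in auto)
qed

lemma homotopic_paths_linepath_image:
  fixes H :: "'z::real_normed_vector \<Rightarrow> 'a::topological_space"
  assumes "convex Z" "continuous_on Z H" "H ` Z \<subseteq> S" "a \<in> Z" "b \<in> Z" "c \<in> Z"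
  shows "homotopic_paths S ((H \<circ> linepath a b) +++ (H \<circ> linepath b c)) (H \<circ> linepath a c)"
proof -
  have seg: "closed_segment x y \<subseteq> Z" if "x \<in> Z" "y \<in> Z" for x y
    using that by (rule closed_segment_subset[OF _ _ assms(1)])
  show ?thesis
    unfolding path_compose_join[symmetric]
    by (rule homotopic_paths_convex_image[OF assms(1-3)])
       (use seg assms in \<open>auto simp: path_image_join intro!: path_join_imp\<close>)
qed

lemma path_compose_linepath:
  fixes H :: "'z::real_normed_vector \<Rightarrow> 'a::topological_space"
  assumes "convex Z" "continuous_on Z H" "a \<in> Z" "b \<in> Z"
  shows "path (H \<circ> linepath a b)" "path_image (H \<circ> linepath a b) \<subseteq> H ` Z"
    "pathstart (H \<circ> linepath a b) = H a" "pathfinish (H \<circ> linepath a b) = H b"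
proof -
  have seg: "closed_segment a b \<subseteq> Z" using closed_segment_subset assms by blast
  then have "continuous_on (path_image (linepath a b)) H"
    using assms(2) continuous_on_subset by (metis path_image_linepath)
  then show "path (H \<circ> linepath a b)" by (intro path_continuous_image) auto
  show "path_image (H \<circ> linepath a b) \<subseteq> H ` Z" using seg by (simp add: path_image_compose image_mono)
qed (simp_all add: pathstart_compose pathfinish_compose)

lemma path_eq_linepath: "p \<circ> linepath 0 1 = p"
  by (auto simp: linepath_def o_def)

lemma homotopic_paths_const_right:
  fixes p :: "real \<Rightarrow> 'a::topological_space"
  assumes "path p" "path_image p \<subseteq> S"
  shows "homotopic_paths S (p +++ (\<lambda>_. pathfinish p)) p"
proof -
  have "homotopic_paths S ((p \<circ> linepath 0 1) +++ (p \<circ> linepath 1 1)) (p \<circ> linepath 0 1)"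
    using assms by (intro homotopic_paths_linepath_image[of "{0..1}"]) (auto simp: path_def path_image_def)
  moreover have "p \<circ> linepath 1 1 = (\<lambda>_. pathfinish p)"
    by (auto simp: linepath_def pathfinish_def o_def algebra_simps)
  ultimately show ?thesis by (simp add: path_eq_linepath)
qed

lemma homotopic_paths_reverse_right:
  fixes p :: "real \<Rightarrow> 'a::topological_space"
  assumes "path p" "path_image p \<subseteq> S"
  shows "homotopic_paths S (p +++ reversepath p) (\<lambda>_. pathstart p)"
proof -
  have "homotopic_paths S ((p \<circ> linepath 0 1) +++ (p \<circ> linepath 1 0)) (p \<circ> linepath 0 0)"
    using assms by (intro homotopic_paths_linepath_image[of "{0..1}"]) (auto simp: path_def path_image_def)
  moreover have "p \<circ> linepath 1 0 = reversepath p"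
    by (auto simp: linepath_def reversepath_def o_def)
  moreover have "p \<circ> linepath 0 0 = (\<lambda>_. pathstart p)"
    by (auto simp: linepath_def pathstart_def o_def)
  ultimately show ?thesis by (simp add: path_eq_linepath)
qed

section \<open>Homotopy classes and their extension by paths\<close>

lemma hclass_eqI: "homotopic_paths S p q \<Longrightarrow> hclass S p = hclass S q"
  unfolding hclass_def using homotopic_paths_trans homotopic_paths_sym by blast

lemma hclass_eqD: "hclass S p = hclass S q \<Longrightarrow> path p \<Longrightarrow> path_image p \<subseteq> S \<Longrightarrow> homotopic_paths S p q"
  unfolding hclass_def using homotopic_paths_refl homotopic_paths_sym by blast

lemma hclass_self: "path p \<Longrightarrow> path_image p \<subseteq> S \<Longrightarrow> p \<in> hclass S p"
  by (simp add: hclass_def)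

lemma hclass_in_ucover: "path p \<Longrightarrow> path_image p \<subseteq> S \<Longrightarrow> pathstart p = x \<Longrightarrow> hclass S p \<in> ucover S x"
  by (auto simp: ucover_def)

lemma endpt_hclass: "path p \<Longrightarrow> path_image p \<subseteq> S \<Longrightarrow> endpt (hclass S p) = pathfinish p"
proof -
  assume p: "path p" "path_image p \<subseteq> S"
  have "pathfinish ` hclass S p = {pathfinish p}"
    using hclass_self[OF p] homotopic_paths_imp_pathfinish by (force simp: hclass_def)
  then show ?thesis by (simp add: endpt_def)
qed

lemma ucoverD:
  assumes "\<alpha> \<in> ucover S x" "p \<in> \<alpha>"
  shows "path p" "path_image p \<subseteq> S" "pathstart p = x" "\<alpha> = hclass S p" "endpt \<alpha> = pathfinish p"
proof -
  obtain q where q: "\<alpha> = hclass S q" "path q" "path_image q \<subseteq> S" "pathstart q = x"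
    using assms(1) by (auto simp: ucover_def)
  have h: "homotopic_paths S q p" using assms(2) q by (simp add: hclass_def)
  show p: "path p" "path_image p \<subseteq> S" "pathstart p = x"
    using homotopic_paths_imp_path[OF h] homotopic_paths_imp_subset[OF h] homotopic_paths_imp_pathstart[OF h] q by auto
  show "\<alpha> = hclass S p" using hclass_eqI[OF h] q by simp
  then show "endpt \<alpha> = pathfinish p" using endpt_hclass p by metis
qed

lemma ucover_nonempty:
  assumes "\<alpha> \<in> ucover S x" obtains p where "p \<in> \<alpha>"
proof -
  obtain p where "\<alpha> = hclass S p" "path p" "path_image p \<subseteq> S" using assms by (auto simp: ucover_def)
  then show ?thesis using that[of p] hclass_self[of p S] by simp
qed

lemma endpt_in:
  assumes "\<alpha> \<in> ucover S x" shows "endpt \<alpha> \<in> S"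
proof -
  obtain p where p: "p \<in> \<alpha>" using assms by (rule ucover_nonempty)
  show ?thesis using ucoverD[OF assms p] pathfinish_in_path_image[of p] by auto
qed

lemma hclass_join_cong:
  assumes "homotopic_paths S p p'" "homotopic_paths S q q'" "pathfinish p = pathstart q"
  shows "hclass S (p +++ q) = hclass S (p' +++ q')"
  by (intro hclass_eqI homotopic_paths_join assms)

text \<open>The class is entered through one chosen representative; by \<open>extend_eq\<close>
  every representative gives the same result.\<close>

definition extend :: "'a::topological_space set \<Rightarrow> (real \<Rightarrow> 'a) set \<Rightarrow> (real \<Rightarrow> 'a) \<Rightarrow> (real \<Rightarrow> 'a) set" where
  "extend S \<alpha> q = hclass S ((SOME p. p \<in> \<alpha>) +++ q)"

definition admissible :: "'a::topological_space set \<Rightarrow> (real \<Rightarrow> 'a) set \<Rightarrow> (real \<Rightarrow> 'a) \<Rightarrow> bool" where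
  "admissible S \<alpha> q \<longleftrightarrow> path q \<and> path_image q \<subseteq> S \<and> pathstart q = endpt \<alpha>"

lemma extend_eq:
  assumes "\<alpha> \<in> ucover S x" "p \<in> \<alpha>" "admissible S \<alpha> q"
  shows "extend S \<alpha> q = hclass S (p +++ q)"
proof -
  have s: "(SOME p. p \<in> \<alpha>) \<in> \<alpha>" using someI[of "\<lambda>p. p \<in> \<alpha>", OF assms(2)] .
  have "homotopic_paths S (SOME p. p \<in> \<alpha>) p"
    using hclass_eqD ucoverD[OF assms(1) s] ucoverD[OF assms(1,2)] by metis
  then show ?thesis
    unfolding extend_def using assms(3) ucoverD[OF assms(1) s]
    by (intro hclass_join_cong) (auto simp: admissible_def)
qed

lemma extend_in_ucover:
  assumes "\<alpha> \<in> ucover S x" "admissible S \<alpha> q"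
  shows "extend S \<alpha> q \<in> ucover S x" "endpt (extend S \<alpha> q) = pathfinish q"
proof -
  obtain p where p: "p \<in> \<alpha>" using assms(1) by (rule ucover_nonempty)
  note pD = ucoverD[OF assms(1) p]
  have j: "path (p +++ q)" "path_image (p +++ q) \<subseteq> S"
    using pD assms(2) by (auto simp: admissible_def path_image_join)
  show "extend S \<alpha> q \<in> ucover S x" "endpt (extend S \<alpha> q) = pathfinish q"
    unfolding extend_eq[OF assms(1) p assms(2)]
    using hclass_in_ucover[OF j] endpt_hclass[OF j] pD by auto
qed

lemma extend_hclass:
  assumes "path p" "path_image p \<subseteq> S" "path q" "path_image q \<subseteq> S" "pathfinish p = pathstart q"
  shows "extend S (hclass S p) q = hclass S (p +++ q)"
  using assms by (intro extend_eq[OF hclass_in_ucover]) (auto simp: hclass_self admissible_def endpt_hclass)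

lemma extend_cong:
  assumes "\<alpha> \<in> ucover S x" "admissible S \<alpha> q" "homotopic_paths S q r"
  shows "extend S \<alpha> q = extend S \<alpha> r"
proof -
  obtain p where p: "p \<in> \<alpha>" using assms(1) by (rule ucover_nonempty)
  have r: "admissible S \<alpha> r"
    using assms(2,3) homotopic_paths_imp_path homotopic_paths_imp_subset homotopic_paths_imp_pathstart
    unfolding admissible_def by metis
  show ?thesis
    unfolding extend_eq[OF assms(1) p assms(2)] extend_eq[OF assms(1) p r]
    using ucoverD[OF assms(1) p] assms by (intro hclass_join_cong) (auto simp: admissible_def)
qed

lemma extend_extend:
  assumes "\<alpha> \<in> ucover S x" "admissible S \<alpha> q" "path r" "path_image r \<subseteq> S" "pathstart r = pathfinish q"
  shows "extend S (extend S \<alpha> q) r = extend S \<alpha> (q +++ r)"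
proof -
  obtain p where p: "p \<in> \<alpha>" using assms(1) by (rule ucover_nonempty)
  note pD = ucoverD[OF assms(1) p]
  have j: "path (p +++ q)" "path_image (p +++ q) \<subseteq> S"
    using pD assms(2) by (auto simp: admissible_def path_image_join)
  have qr: "admissible S \<alpha> (q +++ r)"
    using assms by (auto simp: admissible_def path_image_join)
  have "extend S (extend S \<alpha> q) r = hclass S ((p +++ q) +++ r)"
    unfolding extend_eq[OF assms(1) p assms(2)] using assms by (intro extend_hclass j) auto
  also have "\<dots> = hclass S (p +++ (q +++ r))"
    by (intro hclass_eqI homotopic_paths_sym[OF homotopic_paths_assoc])
       (use assms pD in \<open>auto simp: admissible_def\<close>)
  finally show ?thesis unfolding extend_eq[OF assms(1) p qr] .
qed

lemma extend_const:
  assumes "\<alpha> \<in> ucover S x"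
  shows "extend S \<alpha> (\<lambda>_. endpt \<alpha>) = \<alpha>"
proof -
  obtain p where p: "p \<in> \<alpha>" using assms(1) by (rule ucover_nonempty)
  note pD = ucoverD[OF assms(1) p]
  have "admissible S \<alpha> (\<lambda>_. endpt \<alpha>)"
    using endpt_in[OF assms] by (auto simp: admissible_def path_def path_image_def pathstart_def)
  then show ?thesis
    using extend_eq[OF assms p] hclass_eqI[OF homotopic_paths_const_right[OF pD(1,2)]] pD by simp
qed

lemma extend_reverse:
  assumes "\<alpha> \<in> ucover S x" "admissible S \<alpha> q"
  shows "extend S (extend S \<alpha> q) (reversepath q) = \<alpha>"
proof -
  have q: "path q" "path_image q \<subseteq> S" "pathstart q = endpt \<alpha>" using assms by (auto simp: admissible_def)
  have "extend S (extend S \<alpha> q) (reversepath q) = extend S \<alpha> (q +++ reversepath q)"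
    using q by (intro extend_extend[OF assms]) auto
  also have "\<dots> = extend S \<alpha> (\<lambda>_. pathstart q)"
    using q by (intro extend_cong[OF assms(1)] homotopic_paths_reverse_right) (auto simp: admissible_def path_image_join)
  finally show ?thesis using extend_const[OF assms(1)] q by simp
qed

section \<open>The topology of the universal cover\<close>

definition cover_nbhd :: "'a::topological_space set \<Rightarrow> (real \<Rightarrow> 'a) set \<Rightarrow> 'a set \<Rightarrow> (real \<Rightarrow> 'a) set set" where
  "cover_nbhd S \<alpha> U = {extend S \<alpha> q | q. path q \<and> path_image q \<subseteq> U \<and> pathstart q = endpt \<alpha>}"

lemma cover_nbhd_eq:
  assumes "\<alpha> \<in> ucover S x" "U \<subseteq> S"
  shows "{hclass S (p +++ q) | p q. p \<in> \<alpha> \<and> path q \<and> path_image q \<subseteq> U \<and> pathstart q = pathfinish p} = cover_nbhd S \<alpha> U"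
    (is "?L = _")
proof -
  have e: "hclass S (p +++ q) = extend S \<alpha> q" if "p \<in> \<alpha>" "path q" "path_image q \<subseteq> U" "pathstart q = endpt \<alpha>" for p q
    using extend_eq[OF assms(1) that(1), of q] that assms(2) by (auto simp: admissible_def)
  obtain p0 where p0: "p0 \<in> \<alpha>" using assms(1) by (rule ucover_nonempty)
  show ?thesis
  proof
    show "?L \<subseteq> cover_nbhd S \<alpha> U"
    proof clarify
      fix p q assume q: "p \<in> \<alpha>" "path q" "path_image q \<subseteq> U" "pathstart q = pathfinish p"
      then have "pathstart q = endpt \<alpha>" using ucoverD(5)[OF assms(1) q(1)] by simp
      then show "hclass S (p +++ q) \<in> cover_nbhd S \<alpha> U"
        unfolding cover_nbhd_def mem_Collect_eq using e[OF q(1-3)] q by (intro exI[of _ q]) simp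
    qed
    show "cover_nbhd S \<alpha> U \<subseteq> ?L"
    proof
      fix \<beta> assume "\<beta> \<in> cover_nbhd S \<alpha> U"
      then obtain q where q: "\<beta> = extend S \<alpha> q" "path q" "path_image q \<subseteq> U" "pathstart q = endpt \<alpha>"
        unfolding cover_nbhd_def by blast
      then show "\<beta> \<in> ?L"
        unfolding mem_Collect_eq
        using e[OF p0 q(2-4)] ucoverD(5)[OF assms(1) p0] p0 by (intro exI[of _ p0] exI[of _ q]) simp
    qed
  qed
qed

lemma admissible_subset: "path q \<Longrightarrow> path_image q \<subseteq> U \<Longrightarrow> U \<subseteq> S \<Longrightarrow> pathstart q = endpt \<alpha> \<Longrightarrow> admissible S \<alpha> q"
  by (auto simp: admissible_def)

lemma cover_nbhd_subset: "\<alpha> \<in> ucover S x \<Longrightarrow> U \<subseteq> S \<Longrightarrow> cover_nbhd S \<alpha> U \<subseteq> ucover S x"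
  unfolding cover_nbhd_def using extend_in_ucover(1) admissible_subset by blast

lemma cover_nbhd_self: "\<alpha> \<in> ucover S x \<Longrightarrow> endpt \<alpha> \<in> U \<Longrightarrow> \<alpha> \<in> cover_nbhd S \<alpha> U"
  unfolding cover_nbhd_def
  by (rule CollectI, rule exI[of _ "\<lambda>_. endpt \<alpha>"])
     (auto simp: extend_const path_def path_image_def pathstart_def)

lemma cover_nbhd_mono: "U \<subseteq> V \<Longrightarrow> cover_nbhd S \<alpha> U \<subseteq> cover_nbhd S \<alpha> V"
  unfolding cover_nbhd_def by blast

text \<open>Concatenating two paths inside \<open>U\<close> stays inside \<open>U\<close>. Together
  with \<open>cover_nbhd_sym\<close>, which reverses paths, this makes being joined inside
  \<open>U\<close> an equivalence of classes.\<close>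

lemma cover_nbhd_trans:
  assumes "\<alpha> \<in> ucover S x" "U \<subseteq> S" "\<beta> \<in> cover_nbhd S \<alpha> U"
  shows "cover_nbhd S \<beta> U \<subseteq> cover_nbhd S \<alpha> U"
proof
  fix \<gamma> assume "\<gamma> \<in> cover_nbhd S \<beta> U"
  then obtain r where r: "\<gamma> = extend S \<beta> r" "path r" "path_image r \<subseteq> U" "pathstart r = endpt \<beta>"
    unfolding cover_nbhd_def by blast
  obtain q where q: "\<beta> = extend S \<alpha> q" "path q" "path_image q \<subseteq> U" "pathstart q = endpt \<alpha>"
    using assms(3) unfolding cover_nbhd_def by blast
  have aq: "admissible S \<alpha> q" using admissible_subset q assms by blast
  have e: "endpt \<beta> = pathfinish q" unfolding q(1) using extend_in_ucover(2)[OF assms(1) aq] .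
  have "\<gamma> = extend S \<alpha> (q +++ r)"
    unfolding r(1) q(1) using r q e assms(2) by (intro extend_extend[OF assms(1) aq]) auto
  then show "\<gamma> \<in> cover_nbhd S \<alpha> U"
    unfolding cover_nbhd_def using q r e by (auto intro!: exI[of _ "q +++ r"] simp: path_image_join)
qed

lemma cover_nbhd_sym:
  assumes "\<alpha> \<in> ucover S x" "U \<subseteq> S" "\<beta> \<in> cover_nbhd S \<alpha> U"
  shows "\<alpha> \<in> cover_nbhd S \<beta> U"
proof -
  obtain q where q: "\<beta> = extend S \<alpha> q" "path q" "path_image q \<subseteq> U" "pathstart q = endpt \<alpha>"
    using assms(3) unfolding cover_nbhd_def by blast
  have aq: "admissible S \<alpha> q" using admissible_subset q assms by blast
  have e: "endpt \<beta> = pathfinish q" unfolding q(1) using extend_in_ucover(2)[OF assms(1) aq] .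
  have "\<alpha> = extend S \<beta> (reversepath q)" using extend_reverse[OF assms(1) aq] q by simp
  then show ?thesis
    unfolding cover_nbhd_def using q e by (auto intro!: exI[of _ "reversepath q"])
qed

lemma ucover_topology_eq:
  "ucover_topology S x = topology_generated_by {cover_nbhd S \<alpha> U | \<alpha> U. \<alpha> \<in> ucover S x \<and> openin (top_of_set S) U}"
proof -
  have *: "{hclass S (p +++ q) | p q. p \<in> \<alpha> \<and> path q \<and> path_image q \<subseteq> U \<and> pathstart q = pathfinish p} = cover_nbhd S \<alpha> U"
    if "\<alpha> \<in> ucover S x" "openin (top_of_set S) U" for \<alpha> U
    using cover_nbhd_eq[OF that(1) openin_imp_subset[OF that(2)]] .
  have "(s = {hclass S (p +++ q) | p q. p \<in> \<alpha> \<and> path q \<and> path_image q \<subseteq> U \<and> pathstart q = pathfinish p}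
      \<and> \<alpha> \<in> ucover S x \<and> openin (top_of_set S) U) \<longleftrightarrow>
    (s = cover_nbhd S \<alpha> U \<and> \<alpha> \<in> ucover S x \<and> openin (top_of_set S) U)" for s \<alpha> U
    by (cases "\<alpha> \<in> ucover S x \<and> openin (top_of_set S) U") (auto simp only: *)
  then have "{{hclass S (p +++ q) | p q. p \<in> \<alpha> \<and> path q \<and> path_image q \<subseteq> U \<and> pathstart q = pathfinish p}
      | \<alpha> U. \<alpha> \<in> ucover S x \<and> openin (top_of_set S) U}
    = {cover_nbhd S \<alpha> U | \<alpha> U. \<alpha> \<in> ucover S x \<and> openin (top_of_set S) U}"
    by (simp only:)
  then show ?thesis by (simp only: ucover_topology_def)
qed

lemma topspace_ucover [simp]: "topspace (ucover_topology S x) = ucover S x"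
proof -
  have "\<Union> {cover_nbhd S \<alpha> U | \<alpha> U. \<alpha> \<in> ucover S x \<and> openin (top_of_set S) U} = ucover S x"
  proof
    show "\<Union> {cover_nbhd S \<alpha> U | \<alpha> U. \<alpha> \<in> ucover S x \<and> openin (top_of_set S) U} \<subseteq> ucover S x"
    proof (rule Union_least)
      fix W assume "W \<in> {cover_nbhd S \<alpha> U | \<alpha> U. \<alpha> \<in> ucover S x \<and> openin (top_of_set S) U}"
      then obtain \<alpha> U where "W = cover_nbhd S \<alpha> U" "\<alpha> \<in> ucover S x" "openin (top_of_set S) U" by blast
      then show "W \<subseteq> ucover S x" using cover_nbhd_subset[of \<alpha> S x U] openin_imp_subset by blast
    qed
    show "ucover S x \<subseteq> \<Union> {cover_nbhd S \<alpha> U | \<alpha> U. \<alpha> \<in> ucover S x \<and> openin (top_of_set S) U}"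
    proof
      fix \<alpha> assume \<alpha>: "\<alpha> \<in> ucover S x"
      have "\<alpha> \<in> cover_nbhd S \<alpha> S" by (rule cover_nbhd_self[OF \<alpha> endpt_in[OF \<alpha>]])
      moreover have "openin (top_of_set S) S" by simp
      ultimately show "\<alpha> \<in> \<Union> {cover_nbhd S \<alpha> U | \<alpha> U. \<alpha> \<in> ucover S x \<and> openin (top_of_set S) U}"
        using \<alpha> by blast
    qed
  qed
  then show ?thesis by (simp add: ucover_topology_eq)
qed

lemma openin_cover_nbhd:
  "\<alpha> \<in> ucover S x \<Longrightarrow> openin (top_of_set S) U \<Longrightarrow> openin (ucover_topology S x) (cover_nbhd S \<alpha> U)"
  unfolding ucover_topology_eq by (rule topology_generated_by_Basis) blast

text \<open>The generators form a basis and not only a subbasis: by \<open>cover_nbhd_trans\<close>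
  a generator contains the neighbourhood over the same \<open>U\<close> around each of its
  points.\<close>

lemma openin_ucover_iff:
  "openin (ucover_topology S x) W \<longleftrightarrow> W \<subseteq> ucover S x \<and>
     (\<forall>\<alpha>\<in>W. \<exists>U. openin (top_of_set S) U \<and> endpt \<alpha> \<in> U \<and> cover_nbhd S \<alpha> U \<subseteq> W)"
proof (intro iffI conjI)
  assume W: "openin (ucover_topology S x) W"
  then show "W \<subseteq> ucover S x" using openin_subset by fastforce
  have "generate_topology_on {cover_nbhd S \<alpha> U | \<alpha> U. \<alpha> \<in> ucover S x \<and> openin (top_of_set S) U} W"
    using W unfolding ucover_topology_eq by (rule openin_topology_generated_by)
  then show "\<forall>\<alpha>\<in>W. \<exists>U. openin (top_of_set S) U \<and> endpt \<alpha> \<in> U \<and> cover_nbhd S \<alpha> U \<subseteq> W"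
  proof induction
    case (Int a b)
    show ?case
    proof
      fix \<alpha> assume "\<alpha> \<in> a \<inter> b"
      then obtain U where "openin (top_of_set S) U" "endpt \<alpha> \<in> U" "cover_nbhd S \<alpha> U \<subseteq> a"
        using bspec[OF Int.IH(1), of \<alpha>] by auto
      moreover obtain V where "openin (top_of_set S) V" "endpt \<alpha> \<in> V" "cover_nbhd S \<alpha> V \<subseteq> b"
        using bspec[OF Int.IH(2), of \<alpha>] \<open>\<alpha> \<in> a \<inter> b\<close> by auto
      ultimately show "\<exists>U. openin (top_of_set S) U \<and> endpt \<alpha> \<in> U \<and> cover_nbhd S \<alpha> U \<subseteq> a \<inter> b"
        using cover_nbhd_mono[of "U \<inter> V" U S \<alpha>] cover_nbhd_mono[of "U \<inter> V" V S \<alpha>]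
        by (intro exI[of _ "U \<inter> V"]) auto
    qed
  next
    case (UN K)
    show ?case
    proof
      fix \<alpha> assume "\<alpha> \<in> \<Union> K"
      then obtain k where k: "k \<in> K" "\<alpha> \<in> k" by blast
      then obtain U where "openin (top_of_set S) U" "endpt \<alpha> \<in> U" "cover_nbhd S \<alpha> U \<subseteq> k"
        using bspec[OF UN.IH[OF k(1)], of \<alpha>] by auto
      then show "\<exists>U. openin (top_of_set S) U \<and> endpt \<alpha> \<in> U \<and> cover_nbhd S \<alpha> U \<subseteq> \<Union> K"
        using k(1) by (intro exI[of _ U]) auto
    qed
  next
    case (Basis s)
    then obtain \<alpha> U where s: "s = cover_nbhd S \<alpha> U" "\<alpha> \<in> ucover S x" "openin (top_of_set S) U" by blast
    have US: "U \<subseteq> S" using s openin_imp_subset by blast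
    show ?case
    proof
      fix \<beta> assume \<beta>: "\<beta> \<in> s"
      then obtain q where q: "\<beta> = extend S \<alpha> q" "path q" "path_image q \<subseteq> U" "pathstart q = endpt \<alpha>"
        unfolding s cover_nbhd_def by blast
      then have "endpt \<beta> = pathfinish q"
        using extend_in_ucover(2)[OF s(2)] admissible_subset US by blast
      then have "endpt \<beta> \<in> U" using q by auto
      then show "\<exists>U. openin (top_of_set S) U \<and> endpt \<beta> \<in> U \<and> cover_nbhd S \<beta> U \<subseteq> s"
        using cover_nbhd_trans[OF s(2) US] \<beta> s by blast
    qed
  qed auto
next
  assume W: "W \<subseteq> ucover S x \<and> (\<forall>\<alpha>\<in>W. \<exists>U. openin (top_of_set S) U \<and> endpt \<alpha> \<in> U \<and> cover_nbhd S \<alpha> U \<subseteq> W)"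
  show "openin (ucover_topology S x) W"
    unfolding openin_subopen[of _ W]
  proof
    fix \<alpha> assume \<alpha>: "\<alpha> \<in> W"
    then obtain U where U: "openin (top_of_set S) U" "endpt \<alpha> \<in> U" "cover_nbhd S \<alpha> U \<subseteq> W" using W by blast
    have "\<alpha> \<in> ucover S x" using \<alpha> W by blast
    then show "\<exists>T. openin (ucover_topology S x) T \<and> \<alpha> \<in> T \<and> T \<subseteq> W"
      using openin_cover_nbhd[OF _ U(1)] cover_nbhd_self[OF _ U(2)] U(3) by (intro exI[of _ "cover_nbhd S \<alpha> U"]) auto
  qed
qed

lemma continuous_map_endpt: "continuous_map (ucover_topology S x) (top_of_set S) endpt"
  unfolding continuous_map_def
proof (intro conjI allI impI)
  show "endpt \<in> topspace (ucover_topology S x) \<rightarrow> topspace (top_of_set S)"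
    using endpt_in by auto
  fix U assume U: "openin (top_of_set S) U"
  show "openin (ucover_topology S x) {\<alpha> \<in> topspace (ucover_topology S x). endpt \<alpha> \<in> U}"
    unfolding openin_ucover_iff
  proof (intro conjI ballI exI[of _ U] U)
    fix \<alpha> assume "\<alpha> \<in> {\<alpha> \<in> topspace (ucover_topology S x). endpt \<alpha> \<in> U}"
    then have \<alpha>: "\<alpha> \<in> ucover S x" "endpt \<alpha> \<in> U" by auto
    show "endpt \<alpha> \<in> U" by fact
    have US: "U \<subseteq> S" using U openin_imp_subset by blast
    show "cover_nbhd S \<alpha> U \<subseteq> {\<alpha> \<in> topspace (ucover_topology S x). endpt \<alpha> \<in> U}"
    proof
      fix \<beta> assume \<beta>: "\<beta> \<in> cover_nbhd S \<alpha> U"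
      then obtain q where q: "\<beta> = extend S \<alpha> q" "path q" "path_image q \<subseteq> U" "pathstart q = endpt \<alpha>"
        unfolding cover_nbhd_def by blast
      then have "endpt \<beta> = pathfinish q"
        using extend_in_ucover(2)[OF \<alpha>(1)] admissible_subset US by blast
      then show "\<beta> \<in> {\<alpha> \<in> topspace (ucover_topology S x). endpt \<alpha> \<in> U}"
        using q \<beta> cover_nbhd_subset[OF \<alpha>(1) US] by auto
    qed
  qed auto
qed

lemma continuous_map_into_ucover:
  assumes "\<And>z. z \<in> topspace X \<Longrightarrow> f z \<in> ucover S x"
    and "\<And>z U. z \<in> topspace X \<Longrightarrow> openin (top_of_set S) U \<Longrightarrow> endpt (f z) \<in> U \<Longrightarrow>
        \<exists>T. openin X T \<and> z \<in> T \<and> f ` T \<subseteq> cover_nbhd S (f z) U"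
  shows "continuous_map X (ucover_topology S x) f"
  unfolding continuous_map_def
proof (intro conjI allI impI)
  show "f \<in> topspace X \<rightarrow> topspace (ucover_topology S x)" using assms(1) by auto
  fix W assume W: "openin (ucover_topology S x) W"
  show "openin X {z \<in> topspace X. f z \<in> W}"
    unfolding openin_subopen[of _ "{z \<in> topspace X. f z \<in> W}"]
  proof
    fix z assume z: "z \<in> {z \<in> topspace X. f z \<in> W}"
    then obtain U where "openin (top_of_set S) U" "endpt (f z) \<in> U" "cover_nbhd S (f z) U \<subseteq> W"
      using W unfolding openin_ucover_iff by blast
    moreover from this obtain T where "openin X T" "z \<in> T" "f ` T \<subseteq> cover_nbhd S (f z) U"
      using assms(2)[of z U] z by blast
    ultimately show "\<exists>T. openin X T \<and> z \<in> T \<and> T \<subseteq> {z \<in> topspace X. f z \<in> W}"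
      using openin_subset[of X] by (intro exI[of _ T]) blast
  qed
qed

section \<open>Lifting of paths, and sheets of the cover\<close>

definition path_lift :: "'a::topological_space set \<Rightarrow> (real \<Rightarrow> 'a) \<Rightarrow> real \<Rightarrow> (real \<Rightarrow> 'a) set" where
  "path_lift S p s = hclass S (p \<circ> linepath 0 s)"

text \<open>The clause with \<open>extend\<close> compares the classes at two parameters by the
  piece of \<open>p\<close> between them, in either direction. Continuity of the lift and later
  inductions along \<open>p\<close> rest on it.\<close>

lemma path_lift:
  assumes p: "path p" "path_image p \<subseteq> S"
  shows "s \<in> {0..1} \<Longrightarrow> path_lift S p s \<in> ucover S (pathstart p)"
    and "s \<in> {0..1} \<Longrightarrow> endpt (path_lift S p s) = p s"
    and "path_lift S p 0 = hclass S (\<lambda>_. pathstart p)"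
    and "path_lift S p 1 = hclass S p"
    and "\<And>s t. s \<in> {0..1} \<Longrightarrow> t \<in> {0..1} \<Longrightarrow> path_lift S p t = extend S (path_lift S p s) (p \<circ> linepath s t)"
    and "continuous_map (top_of_set {0..1}) (ucover_topology S (pathstart p)) (path_lift S p)"
proof -
  have c: "continuous_on {0..1} p" "p ` {0..1} \<subseteq> S" using p by (auto simp: path_def path_image_def)
  have l: "path (p \<circ> linepath s t)" "path_image (p \<circ> linepath s t) \<subseteq> S"
    "pathstart (p \<circ> linepath s t) = p s" "pathfinish (p \<circ> linepath s t) = p t"
    if "s \<in> {0..1}" "t \<in> {0..1}" for s t
    using path_compose_linepath[OF convex_real_interval(5) c(1) that] c(2) by auto
  have p0: "p 0 = pathstart p" by (simp add: pathstart_def)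
  have z: "0 \<in> {0..1::real}" by simp
  show m: "path_lift S p s \<in> ucover S (pathstart p)" "endpt (path_lift S p s) = p s" if "s \<in> {0..1}" for s
    unfolding path_lift_def using l[OF z that] p0 hclass_in_ucover endpt_hclass by metis+
  show "path_lift S p 0 = hclass S (\<lambda>_. pathstart p)"
    by (simp add: path_lift_def o_def linepath_def pathstart_def)
  show "path_lift S p 1 = hclass S p"
    by (simp add: path_lift_def path_eq_linepath)
  show e: "path_lift S p t = extend S (path_lift S p s) (p \<circ> linepath s t)" if st: "s \<in> {0..1}" "t \<in> {0..1}" for s t
  proof -
    have "extend S (path_lift S p s) (p \<circ> linepath s t) = hclass S ((p \<circ> linepath 0 s) +++ (p \<circ> linepath s t))"
      unfolding path_lift_def using l[OF z st(1)] l[OF st] by (intro extend_hclass) auto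
    also have "\<dots> = path_lift S p t"
      unfolding path_lift_def
      by (intro hclass_eqI homotopic_paths_linepath_image[OF convex_real_interval(5) c]) (use st in auto)
    finally show ?thesis by simp
  qed
  show "continuous_map (top_of_set {0..1}) (ucover_topology S (pathstart p)) (path_lift S p)"
  proof (rule continuous_map_into_ucover)
    fix s U assume s: "s \<in> topspace (top_of_set {0..1::real})" and U: "openin (top_of_set S) U" "endpt (path_lift S p s) \<in> U"
    then have s: "s \<in> {0..1}" and pU: "p s \<in> U" using m by auto
    have "openin (top_of_set {0..1}) ({0..1} \<inter> p -` U)"
      using continuous_openin_preimage[OF c(1) _ U(1)] c(2) by auto
    then obtain e where e0: "e > 0" "ball s e \<inter> {0..1} \<subseteq> {0..1} \<inter> p -` U"
      unfolding openin_contains_ball using s pU by blast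
    show "\<exists>T. openin (top_of_set {0..1}) T \<and> s \<in> T \<and> path_lift S p ` T \<subseteq> cover_nbhd S (path_lift S p s) U"
    proof (intro exI[of _ "ball s e \<inter> {0..1}"] conjI)
      show "openin (top_of_set {0..1}) (ball s e \<inter> {0..1})"
        using openin_open_Int[of "ball s e" "{0..1}"] by (simp add: Int_commute)
      show "path_lift S p ` (ball s e \<inter> {0..1}) \<subseteq> cover_nbhd S (path_lift S p s) U"
      proof clarify
        fix t assume t: "t \<in> ball s e" "t \<in> {0..1}"
        have "convex (ball s e \<inter> {0..1})" by (intro convex_Int) auto
        moreover have "continuous_on (ball s e \<inter> {0..1}) p" using c(1) continuous_on_subset by blast
        ultimately have "path_image (p \<circ> linepath s t) \<subseteq> p ` (ball s e \<inter> {0..1})"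
          by (rule path_compose_linepath(2)) (use s t e0 in auto)
        then have "path_image (p \<circ> linepath s t) \<subseteq> U" using e0 by auto
        then show "path_lift S p t \<in> cover_nbhd S (path_lift S p s) U"
          unfolding cover_nbhd_def using e[OF s t(2)] l[OF s t(2)] m(2)[OF s] by auto
      qed
    qed (use s e0 in auto)
  qed (use m in auto)
qed

text \<open>A form of semilocal simple connectedness: the homotopy may leave \<open>U\<close> but
  not \<open>S\<close>.\<close>

definition thin :: "'a::topological_space set \<Rightarrow> 'a set \<Rightarrow> bool" where
  "thin S U \<longleftrightarrow> (\<forall>q r. path q \<and> path_image q \<subseteq> U \<and> path r \<and> path_image r \<subseteq> U \<and>
      pathstart q = pathstart r \<and> pathfinish q = pathfinish r \<longrightarrow> homotopic_paths S q r)"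

lemma thinD: "thin S U \<Longrightarrow> path q \<Longrightarrow> path_image q \<subseteq> U \<Longrightarrow> path r \<Longrightarrow> path_image r \<subseteq> U \<Longrightarrow>
    pathstart q = pathstart r \<Longrightarrow> pathfinish q = pathfinish r \<Longrightarrow> homotopic_paths S q r"
  by (simp add: thin_def)

text \<open>Both classes extend \<open>\<alpha>\<close> by paths in \<open>U\<close> with common end
  points, and thinness makes these paths homotopic.\<close>

lemma cover_nbhd_inj:
  assumes "\<alpha> \<in> ucover S x" "U \<subseteq> S" "thin S U"
    and \<beta>: "\<beta> \<in> cover_nbhd S \<alpha> U" "\<gamma> \<in> cover_nbhd S \<alpha> U" "endpt \<beta> = endpt \<gamma>"
  shows "\<beta> = \<gamma>"
proof -
  obtain q where q: "\<beta> = extend S \<alpha> q" "path q" "path_image q \<subseteq> U" "pathstart q = endpt \<alpha>"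
    using \<beta>(1) unfolding cover_nbhd_def by blast
  obtain r where r: "\<gamma> = extend S \<alpha> r" "path r" "path_image r \<subseteq> U" "pathstart r = endpt \<alpha>"
    using \<beta>(2) unfolding cover_nbhd_def by blast
  have a: "admissible S \<alpha> q" "admissible S \<alpha> r" using admissible_subset q r assms(2) by blast+
  have "homotopic_paths S q r"
    using q r \<beta>(3) extend_in_ucover(2)[OF assms(1) a(1)] extend_in_ucover(2)[OF assms(1) a(2)]
    by (intro thinD[OF assms(3)]) auto
  then show ?thesis unfolding q(1) r(1) by (rule extend_cong[OF assms(1) a(1)])
qed

text \<open>Near a parameter \<open>s\<close> each lift stays in the neighbourhood of its own value
  over one thin set. There, equality at one parameter is equivalent to equality at \<open>s\<close>,
  so equality spreads over the connected interval.\<close>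

lemma ucover_lift_unique:
  fixes a b :: "real \<Rightarrow> (real \<Rightarrow> 'a::topological_space) set"
  assumes thin: "\<And>y. y \<in> S \<Longrightarrow> \<exists>U. openin (top_of_set S) U \<and> y \<in> U \<and> thin S U"
    and a: "continuous_map (top_of_set {0..1}) (ucover_topology S x) a"
    and b: "continuous_map (top_of_set {0..1}) (ucover_topology S x) b"
    and e: "\<And>s. s \<in> {0..1} \<Longrightarrow> endpt (a s) = endpt (b s)" and "a 0 = b 0" and t: "t \<in> {0..1}"
  shows "a t = b t"
proof (rule connected_induction_simple[of "{0..1}" 0 t "\<lambda>s. a s = b s"])
  fix s :: real assume s: "s \<in> {0..1}"
  have m: "a s \<in> ucover S x" "b s \<in> ucover S x" if "s \<in> {0..1}" for s
    using continuous_map_image_subset_topspace[OF a] continuous_map_image_subset_topspace[OF b] that by auto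
  obtain U where U: "openin (top_of_set S) U" "endpt (a s) \<in> U" "thin S U"
    using thin[OF endpt_in[OF m(1)[OF s]]] by blast
  have US: "U \<subseteq> S" using U openin_imp_subset by blast
  define T where "T = {r \<in> {0..1}. a r \<in> cover_nbhd S (a s) U} \<inter> {r \<in> {0..1}. b r \<in> cover_nbhd S (b s) U}"
  have T: "openin (top_of_set {0..1}) T"
    unfolding T_def
    using openin_continuous_map_preimage[OF a openin_cover_nbhd[OF m(1)[OF s] U(1)]]
      openin_continuous_map_preimage[OF b openin_cover_nbhd[OF m(2)[OF s] U(1)]]
    by (intro openin_Int) auto
  have sT: "s \<in> T" using cover_nbhd_self[OF m(1)[OF s] U(2)] cover_nbhd_self[OF m(2)[OF s], of U] s U e[OF s] by (auto simp: T_def)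
  have iff: "a r = b r \<longleftrightarrow> a s = b s" if r: "r \<in> T" for r
  proof
    have ar: "a r \<in> cover_nbhd S (a s) U" "b r \<in> cover_nbhd S (b s) U" "r \<in> {0..1}" using r by (auto simp: T_def)
    show "a r = b r" if "a s = b s"
      using cover_nbhd_inj[OF m(1)[OF s] US U(3) ar(1)] ar that e by metis
    show "a s = b s" if "a r = b r"
      using cover_nbhd_inj[OF m(1)[OF ar(3)] US U(3)] cover_nbhd_sym[OF m(1)[OF s] US ar(1)]
        cover_nbhd_sym[OF m(2)[OF s] US ar(2)] e[OF s] that by metis
  qed
  have imp: "a y = b y" if "x \<in> T" "y \<in> T" "a x = b x" for x y
    using iff[OF that(1)] iff[OF that(2)] that(3) by metis
  show "\<exists>T. openin (top_of_set {0..1}) T \<and> s \<in> T \<and> (\<forall>x\<in>T. \<forall>y\<in>T. a x = b x \<longrightarrow> a y = b y)"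
    by (intro exI[of _ T] conjI T sT ballI impI) (rule imp)
qed (use assms in auto)

definition nice :: "'a::topological_space set \<Rightarrow> 'a set \<Rightarrow> bool" where
  "nice S U \<longleftrightarrow> openin (top_of_set S) U \<and> path_connected U \<and> thin S U"

lemma endpt_cover_nbhd:
  assumes "\<alpha> \<in> ucover S x" "U \<subseteq> S"
  shows "endpt ` cover_nbhd S \<alpha> U \<subseteq> U" "path_connected U \<Longrightarrow> endpt \<alpha> \<in> U \<Longrightarrow> endpt ` cover_nbhd S \<alpha> U = U"
proof -
  have e: "endpt (extend S \<alpha> q) = pathfinish q" if "path q" "path_image q \<subseteq> U" "pathstart q = endpt \<alpha>" for q
    using extend_in_ucover(2)[OF assms(1)] admissible_subset that assms(2) by blast
  show 1: "endpt ` cover_nbhd S \<alpha> U \<subseteq> U"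
  proof clarify
    fix \<beta> assume "\<beta> \<in> cover_nbhd S \<alpha> U"
    then obtain q where q: "\<beta> = extend S \<alpha> q" "path q" "path_image q \<subseteq> U" "pathstart q = endpt \<alpha>"
      unfolding cover_nbhd_def by blast
    then show "endpt \<beta> \<in> U" using e[OF q(2-4)] pathfinish_in_path_image[of q] by auto
  qed
  assume "path_connected U" "endpt \<alpha> \<in> U"
  have "U \<subseteq> endpt ` cover_nbhd S \<alpha> U"
  proof
    fix y assume "y \<in> U"
    then obtain q where q: "path q" "path_image q \<subseteq> U" "pathstart q = endpt \<alpha>" "pathfinish q = y"
      using \<open>path_connected U\<close> \<open>endpt \<alpha> \<in> U\<close> unfolding path_connected_def by blast
    then show "y \<in> endpt ` cover_nbhd S \<alpha> U"
      using e[OF q(1-3)] unfolding cover_nbhd_def by (intro image_eqI[of _ _ "extend S \<alpha> q"]) auto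
  qed
  with 1 show "endpt ` cover_nbhd S \<alpha> U = U" by blast
qed

text \<open>Path connectedness of a small \<open>U\<close> lets every point of \<open>U\<close> be
  reached by extending \<open>\<alpha>\<close>, so the image of a neighbourhood contains
  \<open>U\<close>.\<close>

lemma open_map_endpt:
  assumes lc: "\<And>y V. y \<in> S \<Longrightarrow> openin (top_of_set S) V \<Longrightarrow> y \<in> V \<Longrightarrow> \<exists>U\<subseteq>V. nice S U \<and> y \<in> U"
    and W: "openin (ucover_topology S x) W"
  shows "openin (top_of_set S) (endpt ` W)"
  unfolding openin_subopen[of _ "endpt ` W"]
proof
  fix y assume "y \<in> endpt ` W"
  then obtain \<alpha> where \<alpha>: "\<alpha> \<in> W" "y = endpt \<alpha>" by blast
  then obtain V where V: "openin (top_of_set S) V" "endpt \<alpha> \<in> V" "cover_nbhd S \<alpha> V \<subseteq> W" and a: "\<alpha> \<in> ucover S x"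
    using W unfolding openin_ucover_iff by blast
  obtain U where U: "U \<subseteq> V" "nice S U" "y \<in> U" using lc[OF endpt_in[OF a] V(1,2)] \<alpha> by blast
  have "U \<subseteq> S" using U V openin_imp_subset by blast
  then have "U = endpt ` cover_nbhd S \<alpha> U"
    using endpt_cover_nbhd(2)[OF a] U \<alpha> by (simp add: nice_def)
  also have "\<dots> \<subseteq> endpt ` W" using V(3) cover_nbhd_mono[OF U(1)] by blast
  finally show "\<exists>T. openin (top_of_set S) T \<and> y \<in> T \<and> T \<subseteq> endpt ` W"
    using U by (auto simp: nice_def)
qed

text \<open>The covering property: onto \<open>U\<close> by path connectedness, injective by
  thinness, open by \<open>open_map_endpt\<close>.\<close>

lemma sheet_homeomorphic:
  assumes lc: "\<And>y V. y \<in> S \<Longrightarrow> openin (top_of_set S) V \<Longrightarrow> y \<in> V \<Longrightarrow> \<exists>U\<subseteq>V. nice S U \<and> y \<in> U"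
    and \<alpha>: "\<alpha> \<in> ucover S x" and U: "nice S U" "endpt \<alpha> \<in> U"
  shows "homeomorphic_map (subtopology (ucover_topology S x) (cover_nbhd S \<alpha> U)) (top_of_set U) endpt"
proof -
  let ?W = "cover_nbhd S \<alpha> U"
  have o: "openin (top_of_set S) U" and US: "U \<subseteq> S" using U openin_imp_subset by (auto simp: nice_def)
  have W: "openin (ucover_topology S x) ?W" "?W \<subseteq> ucover S x"
    using openin_cover_nbhd[OF \<alpha> o] cover_nbhd_subset[OF \<alpha> US] by auto
  have im: "endpt ` ?W = U" using endpt_cover_nbhd(2)[OF \<alpha> US] U by (simp add: nice_def)
  have ts: "topspace (subtopology (ucover_topology S x) ?W) = ?W" using W by auto
  show ?thesis
  proof (rule bijective_open_imp_homeomorphic_map)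
    have "continuous_map (subtopology (ucover_topology S x) ?W) (top_of_set S) endpt"
      by (rule continuous_map_from_subtopology[OF continuous_map_endpt])
    then have "continuous_map (subtopology (ucover_topology S x) ?W) (subtopology (top_of_set S) U) endpt"
      using im ts by (simp only: continuous_map_in_subtopology) blast
    then show "continuous_map (subtopology (ucover_topology S x) ?W) (top_of_set U) endpt"
      using US by (simp add: subtopology_subtopology Int_absorb1)
    show "open_map (subtopology (ucover_topology S x) ?W) (top_of_set U) endpt"
      unfolding open_map_def
    proof (intro allI impI)
      fix V assume "openin (subtopology (ucover_topology S x) ?W) V"
      then have V: "openin (ucover_topology S x) V" "V \<subseteq> ?W" using W openin_open_subtopology by blast+
      have "openin (top_of_set S) (endpt ` V)" using open_map_endpt[OF lc V(1)] by blast
      moreover have "endpt ` V \<subseteq> U" using V(2) im by blast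
      ultimately show "openin (top_of_set U) (endpt ` V)"
        using US openin_subset_trans by blast
    qed
    show "inj_on endpt (topspace (subtopology (ucover_topology S x) ?W))"
      unfolding ts using cover_nbhd_inj[OF \<alpha> US] U by (auto simp: inj_on_def nice_def)
  qed (use im ts in auto)
qed

section \<open>Parallel transport along continuous paths\<close>

text \<open>The point itself is included, unlike in the filter \<open>at z within Z\<close>. In
  nested uses the inner neighbourhood may depend on the outer point, which is all that primitives
  with different domains can offer.\<close>

definition near :: "'a::topological_space set \<Rightarrow> 'a \<Rightarrow> ('a \<Rightarrow> bool) \<Rightarrow> bool" where
  "near Z z P \<longleftrightarrow> (\<exists>V. openin (top_of_set Z) V \<and> z \<in> V \<and> (\<forall>w\<in>V. P w))"

lemma nearI: "openin (top_of_set Z) V \<Longrightarrow> z \<in> V \<Longrightarrow> (\<And>w. w \<in> V \<Longrightarrow> P w) \<Longrightarrow> near Z z P"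
  by (auto simp: near_def)

lemma near_mono: "near Z z P \<Longrightarrow> (\<And>w. w \<in> Z \<Longrightarrow> P w \<Longrightarrow> Q w) \<Longrightarrow> near Z z Q"
  unfolding near_def using openin_imp_subset by (metis subsetD)

lemma near_conj: "near Z z P \<Longrightarrow> near Z z Q \<Longrightarrow> near Z z (\<lambda>w. P w \<and> Q w)"
  unfolding near_def by (metis IntE IntI openin_Int)

lemma near_all: "z \<in> Z \<Longrightarrow> (\<And>w. w \<in> Z \<Longrightarrow> P w) \<Longrightarrow> near Z z P"
  by (rule nearI[of Z Z]) auto

lemma near_compose:
  assumes "near Y (f z) P" "continuous_on Z f" "f ` Z \<subseteq> Y" "z \<in> Z"
  shows "near Z z (\<lambda>w. P (f w))"
proof -
  obtain V where V: "openin (top_of_set Y) V" "f z \<in> V" "\<forall>w\<in>V. P w" using assms(1) by (auto simp: near_def)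
  have "openin (top_of_set Z) (Z \<inter> f -` V)"
    using continuous_openin_preimage[OF assms(2) _ V(1)] assms(3) by auto
  then show ?thesis using V assms(4) by (intro nearI[of Z "Z \<inter> f -` V"]) auto
qed

text \<open>The guard \<open>w \<in> Z\<close> compensates for enlarging the ambient set;
  \<open>parallel_Un\<close> glues two such guarded statements.\<close>

lemma near_superset: "near Z z P \<Longrightarrow> Z \<subseteq> Z' \<Longrightarrow> near Z' z (\<lambda>w. w \<in> Z \<longrightarrow> P w)"
proof -
  assume "near Z z P" "Z \<subseteq> Z'"
  then obtain V where V: "openin (top_of_set Z) V" "z \<in> V" "\<forall>w\<in>V. P w" by (auto simp: near_def)
  then obtain Op where Op: "open Op" "V = Z \<inter> Op" by (auto simp: openin_open)
  then show ?thesis using V \<open>Z \<subseteq> Z'\<close> openin_open_Int[OF Op(1), of Z']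
    by (intro nearI[of Z' "Z' \<inter> Op"]) auto
qed

lemma near_open: "openin (top_of_set Z) U \<Longrightarrow> z \<in> U \<Longrightarrow> near Z z (\<lambda>w. w \<in> U)"
  by (rule nearI)

text \<open>\<open>T x y\<close> is the holonomy of a flat connection along short paths from \<open>x\<close> to \<open>y\<close>.\<close>

locale germ_transport =
  fixes N :: "'p::topological_space set" and T :: "'p \<Rightarrow> 'p \<Rightarrow> dmat"
  assumes T_group: "T x y \<in> dgroup"
    and T_self: "x \<in> N \<Longrightarrow> T x x = 1"
    and T_cocycle: "x \<in> N \<Longrightarrow> near N x (\<lambda>y. near N y (\<lambda>w. T x w = T x y * T y w))"
    and T_tendsto: "x \<in> N \<Longrightarrow> (T x \<longlongrightarrow> 1) (at x within N)"
begin

text \<open>A germ condition on a merely continuous map \<open>H\<close> over an arbitrary space. It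
  serves for paths over an interval, for homotopies over a square and for boundary circles over the
  line.\<close>

definition parallel :: "'z::topological_space set \<Rightarrow> ('z \<Rightarrow> 'p) \<Rightarrow> ('z \<Rightarrow> dmat) \<Rightarrow> bool" where
  "parallel Z H G \<longleftrightarrow> (\<forall>z\<in>Z. G z \<in> dgroup \<and> near Z z (\<lambda>w. G w = G z * T (H z) (H w)))"

text \<open>The values of \<open>T\<close> are invertible, so near any \<open>z\<close> the two
  functions agree at one point exactly if they agree at \<open>z\<close>; connectedness does the
  rest.\<close>

lemma parallel_unique:
  assumes "parallel Z H G" "parallel Z H G'" "connected Z" "a \<in> Z" "b \<in> Z" "G a = G' a"
  shows "G b = G' b"
proof (rule connected_induction_simple[of Z a b "\<lambda>s. G s = G' s"])
  fix z assume z: "z \<in> Z"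
  have "near Z z (\<lambda>w. G w = G z * T (H z) (H w) \<and> G' w = G' z * T (H z) (H w))"
    using assms(1,2) z unfolding parallel_def by (intro near_conj) auto
  then obtain V where V: "openin (top_of_set Z) V" "z \<in> V"
    "\<And>w. w \<in> V \<Longrightarrow> G w = G z * T (H z) (H w) \<and> G' w = G' z * T (H z) (H w)"
    unfolding near_def by blast
  have iff: "G w = G' w \<longleftrightarrow> G z = G' z" if "w \<in> V" for w
  proof -
    have "G z = G w * dadj (T (H z) (H w))" "G' z = G' w * dadj (T (H z) (H w))"
      using V(3)[OF that] dgroup_left[OF T_group] by (simp_all add: mult.assoc)
    then show ?thesis using V(3)[OF that] by metis
  qed
  have imp: "G y = G' y" if "x \<in> V" "y \<in> V" "G x = G' x" for x y
    using iff[OF that(1)] iff[OF that(2)] that(3) by metis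
  show "\<exists>T. openin (top_of_set Z) T \<and> z \<in> T \<and> (\<forall>x\<in>T. \<forall>y\<in>T. G x = G' x \<longrightarrow> G y = G' y)"
    by (intro exI[of _ V] conjI V(1,2) ballI impI) (rule imp)
qed (use assms in auto)

lemma parallel_compose:
  assumes "parallel Z H G" "continuous_on Z' f" "f ` Z' \<subseteq> Z"
  shows "parallel Z' (\<lambda>z. H (f z)) (\<lambda>z. G (f z))"
  unfolding parallel_def
proof (intro ballI conjI)
  fix z assume z: "z \<in> Z'"
  then have fz: "f z \<in> Z" using assms(3) by auto
  then show "G (f z) \<in> dgroup" using assms(1) by (simp add: parallel_def)
  show "near Z' z (\<lambda>w. G (f w) = G (f z) * T (H (f z)) (H (f w)))"
    by (rule near_compose[OF _ assms(2,3) z]) (use assms(1) fz in \<open>simp add: parallel_def\<close>)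
qed

lemma parallel_subset: "parallel Z H G \<Longrightarrow> Z' \<subseteq> Z \<Longrightarrow> parallel Z' H G"
  using parallel_compose[of Z H G Z' "\<lambda>z. z"] by auto

lemma parallel_left_mult: "parallel Z H G \<Longrightarrow> h \<in> dgroup \<Longrightarrow> parallel Z H (\<lambda>z. h * G z)"
  unfolding parallel_def
proof (intro ballI conjI)
  fix z assume "\<forall>z\<in>Z. G z \<in> dgroup \<and> near Z z (\<lambda>w. G w = G z * T (H z) (H w))" "h \<in> dgroup" "z \<in> Z"
  then have "G z \<in> dgroup" "near Z z (\<lambda>w. G w = G z * T (H z) (H w))" by auto
  then show "h * G z \<in> dgroup" "near Z z (\<lambda>w. h * G w = h * G z * T (H z) (H w))"
    using dgroup_mult[OF \<open>h \<in> dgroup\<close>] by (auto elim: near_mono simp: mult.assoc)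
qed

lemma parallel_cong: "parallel Z H G \<Longrightarrow> (\<And>z. z \<in> Z \<Longrightarrow> G' z = G z) \<Longrightarrow> parallel Z H G'"
  unfolding parallel_def
proof (intro ballI conjI)
  fix z assume *: "\<forall>z\<in>Z. G z \<in> dgroup \<and> near Z z (\<lambda>w. G w = G z * T (H z) (H w))"
    "\<And>z. z \<in> Z \<Longrightarrow> G' z = G z" "z \<in> Z"
  then show "G' z \<in> dgroup" by simp
  have "near Z z (\<lambda>w. G w = G z * T (H z) (H w))" using * by blast
  then show "near Z z (\<lambda>w. G' w = G' z * T (H z) (H w))"
    by (rule near_mono) (use * in simp)
qed

text \<open>Each piece controls \<open>G\<close> only at its own points. A point outside one of the
  pieces has a neighbourhood missing it, because the piece is closed.\<close>

lemma parallel_Un: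
  assumes "parallel A H G" "parallel B H G" "closed A" "closed B"
  shows "parallel (A \<union> B) H G"
  unfolding parallel_def
proof (intro ballI conjI)
  fix z assume z: "z \<in> A \<union> B"
  then show "G z \<in> dgroup" using assms by (auto simp: parallel_def)
  have *: "near (A \<union> B) z (\<lambda>w. w \<in> C \<longrightarrow> G w = G z * T (H z) (H w))"
    if C: "parallel C H G" "closed C" "C \<subseteq> A \<union> B" for C
  proof (cases "z \<in> C")
    case True
    then show ?thesis using near_superset[of C z] C by (simp add: parallel_def)
  next
    case False
    then have "openin (top_of_set (A \<union> B)) ((A \<union> B) \<inter> - C)" using C by (intro openin_open_Int) auto
    then show ?thesis by (rule nearI) (use z False in auto)
  qed
  show "near (A \<union> B) z (\<lambda>w. G w = G z * T (H z) (H w))"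
    by (rule near_mono[OF near_conj[OF *[of A] *[of B]]]) (use assms in auto)
qed

lemma parallel_T:
  assumes "continuous_on Z H" "H ` Z \<subseteq> N" "\<And>z. z \<in> Z \<Longrightarrow> near N (H z) (\<lambda>w. T x w = T x (H z) * T (H z) w)"
  shows "parallel Z H (\<lambda>z. T x (H z))"
  unfolding parallel_def using T_group near_compose[OF assms(3) assms(1,2)] by blast

lemma T_domain:
  assumes "x \<in> N"
  obtains U where "openin (top_of_set N) U" "x \<in> U" "\<And>y. y \<in> U \<Longrightarrow> near N y (\<lambda>w. T x w = T x y * T y w)"
  using T_cocycle[OF assms] unfolding near_def[of N x] by blast

lemma parallel_continuous:
  assumes "parallel Z H G" "continuous_on Z H" "H ` Z \<subseteq> N"
  shows "continuous_on Z G"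
  unfolding continuous_on_def
proof
  fix z assume z: "z \<in> Z"
  have Hz: "H z \<in> N" using assms z by auto
  have H: "filterlim H (nhds (H z)) (at z within Z)"
    using assms(2) z by (auto simp: continuous_on_def)
  \<comment> \<open>The path may return to the value \<open>H z\<close> at other parameters, so the
    punctured filter at \<open>H z\<close> is too small; including the point is harmless because
    \<open>T (H z) (H z) = 1\<close>.\<close>
  have "filterlim H (inf (nhds (H z)) (principal N)) (at z within Z)"
    unfolding filterlim_inf filterlim_principal
  proof
    show "\<forall>\<^sub>F x in at z within Z. H x \<in> N"
      unfolding eventually_at_filter using assms(3) by (intro always_eventually) auto
  qed (rule H)
  moreover have "filterlim (T (H z)) (nhds 1) (inf (nhds (H z)) (principal N))"
    using T_tendsto[OF Hz] T_self[OF Hz] tendsto_at_within_iff_tendsto_nhds[of "T (H z)" "H z" N]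
      filterlim_cong by (simp add: inf_commute)
  ultimately have "filterlim (\<lambda>w. T (H z) (H w)) (nhds 1) (at z within Z)"
    by (rule filterlim_compose[rotated])
  then have tt: "((\<lambda>w. G z * T (H z) (H w)) \<longlongrightarrow> G z * 1) (at z within Z)"
    by (intro tendsto_mult tendsto_const)
  have "near Z z (\<lambda>w. G w = G z * T (H z) (H w))" using assms(1) z by (simp add: parallel_def)
  then obtain V where V: "openin (top_of_set Z) V" "z \<in> V" "\<forall>w\<in>V. G w = G z * T (H z) (H w)"
    unfolding near_def by blast
  from V(1) obtain Op where Op: "open Op" "V = Z \<inter> Op" by (auto simp: openin_open)
  have "eventually (\<lambda>w. G z * T (H z) (H w) = G w) (at z within Z)"
    unfolding eventually_at_topological
  proof (intro exI[of _ Op] conjI ballI impI)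
    show "z \<in> Op" using V(2) Op(2) by blast
    fix w assume "w \<in> Op" "w \<in> Z"
    then have "w \<in> V" using Op(2) by blast
    with V(3) show "G z * T (H z) (H w) = G w" by metis
  qed (rule Op(1))
  with tt have "(G \<longlongrightarrow> G z * 1) (at z within Z)"
    by (rule Lim_transform_eventually)
  then show "(G \<longlongrightarrow> G z) (at z within Z)" by simp
qed

text \<open>On a neighbourhood of \<open>s0\<close> the path stays where \<open>T (p s0)\<close>
  satisfies the cocycle identity, so a parallel function can be prolonged or cut back to any end
  point in that neighbourhood.\<close>

lemma parallel_lift_exists:
  assumes p: "path p" "path_image p \<subseteq> N"
  shows "\<exists>G. parallel {0..1} p G \<and> G 0 = 1"
proof (rule connected_induction_simple[of "{0..1::real}" 0 1 "\<lambda>s. \<exists>G. parallel {0..s} p G \<and> G 0 = 1"])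
  have c: "continuous_on {0..1} p" and pN: "\<And>t. t \<in> {0..1} \<Longrightarrow> p t \<in> N"
    using p by (auto simp: path_def path_image_def)
  have "parallel {0..0} p (\<lambda>_. 1)"
    using T_self[OF pN[of 0]] by (auto simp: parallel_def intro!: near_all)
  then show "\<exists>G. parallel {0..0} p G \<and> G 0 = 1" by (intro exI[of _ "\<lambda>_. 1"]) auto
  fix s0 :: real assume s0: "s0 \<in> {0..1}"
  let ?x = "p s0"
  obtain U where U: "openin (top_of_set N) U" "?x \<in> U" "\<And>y. y \<in> U \<Longrightarrow> near N y (\<lambda>w. T ?x w = T ?x y * T y w)"
    by (rule T_domain[OF pN[OF s0]]) blast
  have "openin (top_of_set {0..1}) ({0..1} \<inter> p -` U)"
    using continuous_openin_preimage[OF c _ U(1)] pN by auto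
  then obtain e where e: "e > 0" "ball s0 e \<inter> {0..1} \<subseteq> {0..1} \<inter> p -` U"
    unfolding openin_contains_ball using s0 U(2) by blast
  define V where "V = ball s0 e \<inter> {0..1}"
  have V: "openin (top_of_set {0..1}) V" "s0 \<in> V" "is_interval V" "V \<subseteq> {0..1}"
    using openin_open_Int[of "ball s0 e" "{0..1}"] s0 e
    by (auto simp: V_def Int_commute is_interval_convex_1 intro!: convex_Int)
  have pU: "p z \<in> U" if "z \<in> V" for z using e that by (auto simp: V_def)
  have step: "\<exists>G. parallel {0..t} p G \<and> G 0 = 1"
    if s: "s \<in> V" and t: "t \<in> V" and ex: "\<exists>G. parallel {0..s} p G \<and> G 0 = 1" for s t
  proof -
    obtain G where G: "parallel {0..s} p G" "G 0 = 1" using ex by blast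
    show ?thesis
    proof (cases "t \<le> s")
      case True
      then show ?thesis using parallel_subset[OF G(1), of "{0..t}"] G(2) by auto
    next
      case False
      have st: "{s..t} \<subseteq> V" using mem_is_interval_1_I[OF V(3) s t] by auto
      \<comment> \<open>The left factor \<open>h\<close> makes the new piece agree with
        \<open>G\<close> at \<open>s\<close>; left multiplication preserves parallelism.\<close>
      define h where "h = G s * dadj (T ?x (p s))"
      define G' where "G' r = (if r \<le> s then G r else h * T ?x (p r))" for r
      have s01: "s \<in> {0..1}" "t \<in> {0..1}" using s t V by auto
      have "G s \<in> dgroup" using G(1) s01 by (auto simp: parallel_def)
      then have h: "h \<in> dgroup" unfolding h_def by (intro dgroup_mult dgroup_dadj T_group)
      have "parallel {s..t} p (\<lambda>r. T ?x (p r))"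
      proof (rule parallel_T)
        show "continuous_on {s..t} p" by (rule continuous_on_subset[OF c]) (use st V(4) in blast)
        show "p ` {s..t} \<subseteq> N" using pN st V by blast
        show "near N (p z) (\<lambda>w. T ?x w = T ?x (p z) * T (p z) w)" if "z \<in> {s..t}" for z
          by (rule U(3)[OF pU]) (use st that in blast)
      qed
      then have "parallel {s..t} p (\<lambda>r. h * T ?x (p r))" using h by (rule parallel_left_mult)
      then have B: "parallel {s..t} p G'"
        by (rule parallel_cong)
           (auto simp: G'_def h_def mult.assoc dgroup_right[OF T_group])
      have A: "parallel {0..s} p G'" by (rule parallel_cong[OF G(1)]) (auto simp: G'_def)
      have "{0..t} = {0..s} \<union> {s..t}" using s01 False by auto
      then have "parallel {0..t} p G'" using parallel_Un[OF A B] by simp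
      moreover have "G' 0 = 1" using G s01 by (simp add: G'_def)
      ultimately show ?thesis by blast
    qed
  qed
  show "\<exists>T. openin (top_of_set {0..1}) T \<and> s0 \<in> T \<and>
      (\<forall>x\<in>T. \<forall>y\<in>T. (\<exists>G. parallel {0..x} p G \<and> G 0 = 1) \<longrightarrow> (\<exists>G. parallel {0..y} p G \<and> G 0 = 1))"
    by (intro exI[of _ V] conjI V(1,2) ballI impI) (rule step)
qed auto

text \<open>For a fixed path of the homotopy, the set of those \<open>s\<close> at which the transports along
  the neighbouring paths are related by \<open>T\<close> is both open and closed.\<close>

lemma parallel_homotopy:
  fixes H :: "real \<times> real \<Rightarrow> 'p"
  assumes H: "continuous_on ({0..1} \<times> {0..1}) H" "H ` ({0..1} \<times> {0..1}) \<subseteq> N"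
    and G: "\<And>\<tau>. \<tau> \<in> {0..1} \<Longrightarrow> parallel {0..1} (\<lambda>s. H (\<tau>, s)) (G \<tau>)"
    and G0: "\<And>\<tau>. \<tau> \<in> {0..1} \<Longrightarrow> G \<tau> 0 = 1" and H0: "\<And>\<tau>. \<tau> \<in> {0..1} \<Longrightarrow> H (\<tau>, 0) = x0"
  shows "parallel ({0..1} \<times> {0..1}) H (\<lambda>z. G (fst z) (snd z))"
proof -
  let ?I = "{0..1::real}"
  have HN: "H (\<tau>, s) \<in> N" if "\<tau> \<in> ?I" "s \<in> ?I" for \<tau> s using H(2) that by auto
  have Gg: "G \<tau> s \<in> dgroup" if "\<tau> \<in> ?I" "s \<in> ?I" for \<tau> s using G[OF that(1)] that(2) by (simp add: parallel_def)
  have contH: "continuous_on ?I (\<lambda>\<tau>. H (\<tau>, s))" "continuous_on ?I (\<lambda>\<tau>. H (s, \<tau>))" if "s \<in> ?I" for s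
    by (rule continuous_on_compose2[OF H(1)]; use that in \<open>auto intro!: continuous_intros\<close>)+
  define C where "C \<tau>0 s \<longleftrightarrow> near ?I \<tau>0 (\<lambda>\<tau>. G \<tau> s = G \<tau>0 s * T (H (\<tau>0, s)) (H (\<tau>, s)))" for \<tau>0 s
  \<comment> \<open>Inside a small box, uniqueness in \<open>s\<close> gives
    \<open>G \<tau> s = D \<tau> * T (H (\<tau>0, s0)) (H (\<tau>, s))\<close> with \<open>D\<close>
    independent of \<open>s\<close>. Hence \<open>C \<tau>0 s\<close> amounts, for all
    \<open>s\<close> in the box alike, to constancy of \<open>D\<close> near
    \<open>\<tau>0\<close>.\<close>
  have box: "\<exists>A B. openin (top_of_set ?I) A \<and> \<tau>0 \<in> A \<and> openin (top_of_set ?I) B \<and> s0 \<in> B \<and>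
      (\<forall>s\<in>B. C \<tau>0 s \<longleftrightarrow> near ?I \<tau>0 (\<lambda>\<tau>. \<tau> \<in> A \<and> D \<tau> = D \<tau>0)) \<and>
      (\<forall>\<tau>\<in>A. \<forall>s\<in>B. G \<tau> s = D \<tau> * T (H (\<tau>0, s0)) (H (\<tau>, s)))"
    if D: "D = (\<lambda>\<tau>. G \<tau> s0 * dadj (T (H (\<tau>0, s0)) (H (\<tau>, s0))))" and t0: "\<tau>0 \<in> ?I" and s0: "s0 \<in> ?I" for \<tau>0 s0 D
  proof -
    let ?x = "H (\<tau>0, s0)"
    obtain U where U: "openin (top_of_set N) U" "?x \<in> U" "\<And>y. y \<in> U \<Longrightarrow> near N y (\<lambda>w. T ?x w = T ?x y * T y w)"
      by (rule T_domain[OF HN[OF t0 s0]]) blast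
    have "openin (top_of_set (?I \<times> ?I)) ((?I \<times> ?I) \<inter> H -` U)"
      using continuous_openin_preimage[OF H(1) _ U(1)] H(2) by auto
    moreover have "(\<tau>0, s0) \<in> (?I \<times> ?I) \<inter> H -` U" using U t0 s0 by auto
    ultimately obtain Op where Op: "open Op" "(\<tau>0, s0) \<in> Op" "(?I \<times> ?I) \<inter> Op \<subseteq> H -` U"
      unfolding openin_open by blast
    obtain A0 B0 where AB: "open A0" "open B0" "\<tau>0 \<in> A0" "s0 \<in> B0" "A0 \<times> B0 \<subseteq> Op"
      using Op(1,2) by (auto elim!: open_prod_elim)
    obtain e where e: "e > 0" "ball s0 e \<subseteq> B0" using AB openE by blast
    define A where "A = ?I \<inter> A0"
    define B where "B = ?I \<inter> ball s0 e"
    have A: "openin (top_of_set ?I) A" "\<tau>0 \<in> A" "A \<subseteq> ?I" using AB t0 by (auto simp: A_def openin_open_Int)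
    have B: "openin (top_of_set ?I) B" "s0 \<in> B" "B \<subseteq> ?I" "connected B"
      using e s0 by (auto simp: B_def openin_open_Int intro!: convex_connected convex_Int)
    have HU: "H (\<tau>, s) \<in> U" if "\<tau> \<in> A" "s \<in> B" for \<tau> s
    proof -
      have "(\<tau>, s) \<in> (?I \<times> ?I) \<inter> Op" using that AB(5) e(2) unfolding A_def B_def by blast
      then show ?thesis using Op(3) by blast
    qed
    have GD: "G \<tau> s = D \<tau> * T ?x (H (\<tau>, s))" if \<tau>: "\<tau> \<in> A" and s: "s \<in> B" for \<tau> s
    proof -
      have \<tau>1: "\<tau> \<in> ?I" using \<tau> A by blast
      have Dg: "D \<tau> \<in> dgroup" unfolding D by (intro dgroup_mult dgroup_dadj T_group Gg \<tau>1 s0)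
      have "parallel B (\<lambda>s. H (\<tau>, s)) (\<lambda>s. T ?x (H (\<tau>, s)))"
        by (rule parallel_T) (use continuous_on_subset[OF contH(2)[OF \<tau>1] B(3)] HN \<tau>1 B(3) U(3) HU[OF \<tau>] in auto)
      then have 1: "parallel B (\<lambda>s. H (\<tau>, s)) (\<lambda>s. D \<tau> * T ?x (H (\<tau>, s)))" using Dg by (rule parallel_left_mult)
      have 2: "parallel B (\<lambda>s. H (\<tau>, s)) (G \<tau>)" by (rule parallel_subset[OF G[OF \<tau>1] B(3)])
      show ?thesis
        by (rule parallel_unique[OF 2 1 B(4) B(2) s]) (simp add: D mult.assoc dgroup_right[OF T_group])
    qed
    have "C \<tau>0 s \<longleftrightarrow> near ?I \<tau>0 (\<lambda>\<tau>. \<tau> \<in> A \<and> D \<tau> = D \<tau>0)" if s: "s \<in> B" for s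
    proof -
      have s1: "s \<in> ?I" using s B by blast
      have "near ?I \<tau>0 (\<lambda>\<tau>. T ?x (H (\<tau>, s)) = T ?x (H (\<tau>0, s)) * T (H (\<tau>0, s)) (H (\<tau>, s)))"
        by (rule near_compose[OF U(3)[OF HU[OF A(2) s]] contH(1)[OF s1] _ t0]) (use HN s1 in auto)
      then have n: "near ?I \<tau>0 (\<lambda>\<tau>. \<tau> \<in> A \<and> T ?x (H (\<tau>, s)) = T ?x (H (\<tau>0, s)) * T (H (\<tau>0, s)) (H (\<tau>, s)))"
        by (intro near_conj near_open A(1,2))
      have iff: "G \<tau> s = G \<tau>0 s * T (H (\<tau>0, s)) (H (\<tau>, s)) \<longleftrightarrow> D \<tau> = D \<tau>0"
        if "\<tau> \<in> A \<and> T ?x (H (\<tau>, s)) = T ?x (H (\<tau>0, s)) * T (H (\<tau>0, s)) (H (\<tau>, s))" for \<tau>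
      proof -
        have "G \<tau>0 s * T (H (\<tau>0, s)) (H (\<tau>, s)) = D \<tau>0 * T ?x (H (\<tau>, s))"
          using GD[OF A(2) s] that by (simp add: mult.assoc)
        moreover have "D \<tau> * T ?x (H (\<tau>, s)) = D \<tau>0 * T ?x (H (\<tau>, s)) \<longleftrightarrow> D \<tau> = D \<tau>0"
          using dgroup_left[OF T_group] by (metis mult.assoc mult_1_right)
        ultimately show ?thesis using GD that s by metis
      qed
      show ?thesis
        unfolding C_def
      proof
        assume "near ?I \<tau>0 (\<lambda>\<tau>. G \<tau> s = G \<tau>0 s * T (H (\<tau>0, s)) (H (\<tau>, s)))"
        from near_conj[OF n this] show "near ?I \<tau>0 (\<lambda>\<tau>. \<tau> \<in> A \<and> D \<tau> = D \<tau>0)"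
          by (rule near_mono) (use iff in blast)
      next
        assume "near ?I \<tau>0 (\<lambda>\<tau>. \<tau> \<in> A \<and> D \<tau> = D \<tau>0)"
        from near_conj[OF n this] show "near ?I \<tau>0 (\<lambda>\<tau>. G \<tau> s = G \<tau>0 s * T (H (\<tau>0, s)) (H (\<tau>, s)))"
          by (rule near_mono) (use iff in blast)
      qed
    qed
    then show ?thesis using A(1,2) B(1,2) GD by blast
  qed
  have C: "C \<tau>0 s" if t0: "\<tau>0 \<in> ?I" and s: "s \<in> ?I" for \<tau>0 s
  proof (rule connected_induction_simple[of ?I 0 s "C \<tau>0"])
    show "C \<tau>0 0" unfolding C_def
      by (rule near_all[OF t0]) (use G0 H0 t0 T_self HN[OF t0, of 0] in simp)
    fix s0 assume s0: "s0 \<in> ?I"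
    obtain A B where B: "openin (top_of_set ?I) B" "s0 \<in> B"
      "\<forall>s\<in>B. C \<tau>0 s \<longleftrightarrow> near ?I \<tau>0 (\<lambda>\<tau>. \<tau> \<in> A \<and>
         G \<tau> s0 * dadj (T (H (\<tau>0, s0)) (H (\<tau>, s0))) = G \<tau>0 s0 * dadj (T (H (\<tau>0, s0)) (H (\<tau>0, s0))))"
      using box[OF refl t0 s0] by blast
    show "\<exists>V. openin (top_of_set ?I) V \<and> s0 \<in> V \<and> (\<forall>x\<in>V. \<forall>y\<in>V. C \<tau>0 x \<longrightarrow> C \<tau>0 y)"
      by (rule exI[of _ B]) (use B in simp)
  qed (use s in auto)
  show ?thesis
    unfolding parallel_def
  proof (clarify, intro conjI)
    fix \<tau>0 s0 :: real assume t0: "\<tau>0 \<in> ?I" and s0: "s0 \<in> ?I"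
    show "G (fst (\<tau>0, s0)) (snd (\<tau>0, s0)) \<in> dgroup" using Gg t0 s0 by simp
    define D where "D = (\<lambda>\<tau>. G \<tau> s0 * dadj (T (H (\<tau>0, s0)) (H (\<tau>, s0))))"
    obtain A B where AB: "openin (top_of_set ?I) A" "\<tau>0 \<in> A" "openin (top_of_set ?I) B" "s0 \<in> B"
      "\<forall>s\<in>B. C \<tau>0 s \<longleftrightarrow> near ?I \<tau>0 (\<lambda>\<tau>. \<tau> \<in> A \<and> D \<tau> = D \<tau>0)"
      "\<forall>\<tau>\<in>A. \<forall>s\<in>B. G \<tau> s = D \<tau> * T (H (\<tau>0, s0)) (H (\<tau>, s))"
      using box[OF D_def t0 s0] by blast
    have "near ?I \<tau>0 (\<lambda>\<tau>. \<tau> \<in> A \<and> D \<tau> = D \<tau>0)" using AB(4,5) C[OF t0 s0] by blast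
    then obtain A' where A': "openin (top_of_set ?I) A'" "\<tau>0 \<in> A'" "\<forall>\<tau>\<in>A'. \<tau> \<in> A \<and> D \<tau> = D \<tau>0"
      unfolding near_def by blast
    have D0: "D \<tau>0 = G \<tau>0 s0" using T_self[OF HN[OF t0 s0]] by (simp add: D_def)
    have "openin (top_of_set (?I \<times> ?I)) (A' \<times> B)"
      using A'(1) AB(3) by (rule openin_Times)
    then show "near (?I \<times> ?I) (\<tau>0, s0) (\<lambda>w. G (fst w) (snd w) =
        G (fst (\<tau>0, s0)) (snd (\<tau>0, s0)) * T (H (\<tau>0, s0)) (H w))"
    proof (rule nearI)
      fix w assume "w \<in> A' \<times> B"
      then obtain \<tau> s where w: "w = (\<tau>, s)" "\<tau> \<in> A'" "s \<in> B" by blast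
      have "G \<tau> s = D \<tau> * T (H (\<tau>0, s0)) (H (\<tau>, s))" "D \<tau> = D \<tau>0" using AB(6) A'(3) w by blast+
      then show "G (fst w) (snd w) = G (fst (\<tau>0, s0)) (snd (\<tau>0, s0)) * T (H (\<tau>0, s0)) (H w)"
        by (simp add: w D0)
    qed (use A'(2) AB(4) in simp)
  qed
qed

section \<open>Transport along a path and its dependence on the path\<close>

definition plift :: "(real \<Rightarrow> 'p) \<Rightarrow> real \<Rightarrow> dmat" where
  "plift p = (SOME G. parallel {0..1} p G \<and> G 0 = 1)"

lemma plift:
  assumes "path p" "path_image p \<subseteq> N"
  shows "parallel {0..1} p (plift p)" "plift p 0 = 1"
  using someI_ex[OF parallel_lift_exists[OF assms]] unfolding plift_def by auto

lemma plift_eqI: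
  assumes "path p" "path_image p \<subseteq> N" "parallel {0..1} p G" "G 0 = 1" "s \<in> {0..1}"
  shows "plift p s = G s"
  by (rule parallel_unique[OF plift(1)[OF assms(1,2)] assms(3), of 0 s])
     (use assms plift(2) in auto)

lemma plift_group: "path p \<Longrightarrow> path_image p \<subseteq> N \<Longrightarrow> s \<in> {0..1} \<Longrightarrow> plift p s \<in> dgroup"
  using plift(1) by (simp add: parallel_def)

lemma plift_continuous: "path p \<Longrightarrow> path_image p \<subseteq> N \<Longrightarrow> continuous_on {0..1} (plift p)"
  by (rule parallel_continuous[OF plift(1)]) (auto simp: path_def path_image_def)

text \<open>The transports of all paths of a homotopy form one parallel function on the square. Its
  continuity provides the homotopy in SL(2), and it is constant on the edge of final points, because
  \<open>H\<close> is constant there.\<close>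

lemma plift_homotopic:
  assumes "homotopic_paths N p q"
  shows "plift p 1 = plift q 1"
    "homotopic_paths SL2 (\<lambda>s. dre (plift p s)) (\<lambda>s. dre (plift q s))"
proof -
  let ?I = "{0..1::real}"
  obtain H where H: "continuous_on (?I \<times> ?I) H" "H \<in> (?I \<times> ?I) \<rightarrow> N"
    and H01: "\<forall>x\<in>?I. H (0, x) = p x" "\<forall>x\<in>?I. H (1, x) = q x"
    and He: "\<forall>t\<in>?I. pathstart (H \<circ> Pair t) = pathstart p \<and> pathfinish (H \<circ> Pair t) = pathfinish p"
    using assms unfolding homotopic_paths by blast
  have HN: "H ` (?I \<times> ?I) \<subseteq> N" using H(2) by auto
  have Hp: "path (\<lambda>s. H (t, s))" "path_image (\<lambda>s. H (t, s)) \<subseteq> N" if "t \<in> ?I" for t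
  proof -
    show "path (\<lambda>s. H (t, s))" unfolding path_def
      by (rule continuous_on_compose2[OF H(1)]) (use that in \<open>auto intro!: continuous_intros\<close>)
    show "path_image (\<lambda>s. H (t, s)) \<subseteq> N" using H(2) that by (auto simp: path_image_def)
  qed
  define G where "G t = plift (\<lambda>s. H (t, s))" for t
  have G: "parallel ?I (\<lambda>s. H (t, s)) (G t)" "G t 0 = 1" if "t \<in> ?I" for t
    unfolding G_def using plift[OF Hp[OF that]] by auto
  have H0: "H (t, 0) = pathstart p" and H1: "H (t, 1) = pathfinish p" if "t \<in> ?I" for t
    using He that by (auto simp: pathstart_def pathfinish_def)
  have par: "parallel (?I \<times> ?I) H (\<lambda>z. G (fst z) (snd z))"
    by (rule parallel_homotopy[OF H(1) HN G(1) G(2) H0])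
  have cont: "continuous_on (?I \<times> ?I) (\<lambda>z. G (fst z) (snd z))"
    by (rule parallel_continuous[OF par H(1) HN])
  have pq: "path p" "path_image p \<subseteq> N" "path q" "path_image q \<subseteq> N"
    using homotopic_paths_imp_path[OF assms] homotopic_paths_imp_subset[OF assms] by auto
  have congr: "plift r s = G t s" if "path r" "path_image r \<subseteq> N" "\<forall>x\<in>?I. H (t, x) = r x" "t \<in> ?I" "s \<in> ?I" for r s t
  proof (rule plift_eqI[where G = "G t"])
    show "parallel ?I r (G t)"
      using G(1)[OF that(4)] that(3) unfolding parallel_def
      by (auto elim!: near_mono)
  qed (use that G(2) in auto)
  have "parallel ?I (\<lambda>t. H (t, 1)) (\<lambda>t. G t 1)"
  proof -
    have "continuous_on ?I (\<lambda>t. (t, 1::real))" "(\<lambda>t. (t, 1)) ` ?I \<subseteq> ?I \<times> ?I"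
      by (auto intro!: continuous_intros)
    from parallel_compose[OF par this] show ?thesis by simp
  qed
  moreover have "parallel ?I (\<lambda>t. H (t, 1)) (\<lambda>t. G 0 1)"
    using G(1)[of 0] H1 HN T_self[of "pathfinish p"] pathfinish_in_path_image[of p] pq(2)
    by (auto simp: parallel_def intro!: near_all)
  ultimately have const: "G t 1 = G 0 1" if "t \<in> ?I" for t
    by (rule parallel_unique[of ?I _ _ _ 0]) (use that in auto)
  show "plift p 1 = plift q 1"
    using congr[OF pq(1,2) H01(1)] congr[OF pq(3,4) H01(2)] const[of 1] by auto
  show "homotopic_paths SL2 (\<lambda>s. dre (plift p s)) (\<lambda>s. dre (plift q s))"
    unfolding homotopic_paths
  proof (intro exI[of _ "\<lambda>z. dre (G (fst z) (snd z))"] conjI ballI)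
    show "continuous_on (?I \<times> ?I) (\<lambda>z. dre (G (fst z) (snd z)))"
      by (rule bounded_linear.continuous_on[OF bounded_linear_dre cont])
    show "(\<lambda>z. dre (G (fst z) (snd z))) \<in> ?I \<times> ?I \<rightarrow> SL2"
      using par dgroup_dre by (auto simp: parallel_def)
    show "dre (G (fst (0, s)) (snd (0, s))) = dre (plift p s)" if "s \<in> ?I" for s
      using congr[OF pq(1,2) H01(1) _ that] by simp
    show "dre (G (fst (1, s)) (snd (1, s))) = dre (plift q s)" if "s \<in> ?I" for s
      using congr[OF pq(3,4) H01(2) _ that] by simp
    fix t assume t: "t \<in> ?I"
    show "pathstart ((\<lambda>z. dre (G (fst z) (snd z))) \<circ> Pair t) = pathstart (\<lambda>s. dre (plift p s))"
      using G(2)[OF t] plift(2)[OF pq(1,2)] by (simp add: pathstart_def)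
    show "pathfinish ((\<lambda>z. dre (G (fst z) (snd z))) \<circ> Pair t) = pathfinish (\<lambda>s. dre (plift p s))"
      using const[OF t] congr[OF pq(1,2) H01(1), of 1] by (simp add: pathfinish_def)
  qed
qed

text \<open>Composition with \<open>f\<close> keeps the function parallel; only the value at 0 must
  be renormalized, by a left factor. The halves of a concatenation and the restriction to a
  subinterval are of this form.\<close>

lemma plift_compose:
  assumes "path p" "path_image p \<subseteq> N" "continuous_on {0..1} f" "f ` {0..1} \<subseteq> {0..1}" "s \<in> {0..1}"
  shows "plift (\<lambda>s. p (f s)) s = dadj (plift p (f 0)) * plift p (f s)"
proof (rule plift_eqI)
  have c: "continuous_on {0..1} p" "p ` {0..1} \<subseteq> N" using assms by (auto simp: path_def path_image_def)
  show "path (\<lambda>s. p (f s))" unfolding path_def using c(1) assms(3,4) by (rule continuous_on_compose2)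
  show "path_image (\<lambda>s. p (f s)) \<subseteq> N" using c(2) assms(4) by (auto simp: path_image_def)
  have "f 0 \<in> f ` {0..1}" by simp
  then have f0: "f 0 \<in> {0..1}" using assms(4) by blast
  show "parallel {0..1} (\<lambda>s. p (f s)) (\<lambda>s. dadj (plift p (f 0)) * plift p (f s))"
    by (intro parallel_left_mult parallel_compose[OF plift(1)] dgroup_dadj plift_group assms f0)
  show "dadj (plift p (f 0)) * plift p (f 0) = 1"
    by (intro dgroup_right plift_group assms f0)
qed (use assms in auto)

lemma plift_cong:
  assumes "path p" "path_image p \<subseteq> N" "\<And>s. s \<in> {0..1} \<Longrightarrow> q s = p s" "s \<in> {0..1}"
  shows "plift q s = plift p s"
proof (rule plift_eqI)
  show "path q" using assms(1) unfolding path_def by (rule continuous_on_eq) (use assms in auto)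
  show "path_image q \<subseteq> N" using assms(2,3) by (auto simp: path_image_def)
  have "near {0..1} z (\<lambda>w. plift p w = plift p z * T (q z) (q w))" if "z \<in> {0..1}" for z
  proof -
    have "near {0..1} z (\<lambda>w. plift p w = plift p z * T (p z) (p w))"
      using plift(1)[OF assms(1,2)] that by (simp add: parallel_def)
    then show ?thesis by (rule near_mono) (use that assms(3) in simp)
  qed
  then show "parallel {0..1} q (plift p)" using plift(1)[OF assms(1,2)] by (simp add: parallel_def)
qed (use plift(2) assms in auto)

text \<open>The clamps write both halves as one product: the second factor is 1 on the first half,
  and the first factor is frozen on the second. In this form concatenation is compared with the
  pointwise product that defines the group law of the cover of SL(2).\<close>

lemma plift_join:
  assumes p: "path p" "path_image p \<subseteq> N" and q: "path q" "path_image q \<subseteq> N" and pq: "pathfinish p = pathstart q"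
    and s: "s \<in> {0..1}"
  shows "plift (p +++ q) s = plift p (min 1 (2 * s)) * plift q (max 0 (2 * s - 1))"
proof -
  have j: "path (p +++ q)" "path_image (p +++ q) \<subseteq> N" using p q pq by (auto simp: path_image_join)
  have 1: "plift p r = plift (p +++ q) (r / 2)" if r: "r \<in> {0..1}" for r
  proof -
    have "plift p r = plift (\<lambda>s. (p +++ q) (s / 2)) r"
      by (rule plift_cong[symmetric]) (use p r in \<open>auto simp: joinpaths_def\<close>)
    also have "\<dots> = dadj (plift (p +++ q) (0 / 2)) * plift (p +++ q) (r / 2)"
      by (rule plift_compose[OF j]) (use r in \<open>auto intro!: continuous_intros\<close>)
    finally show ?thesis using plift(2)[OF j] by simp
  qed
  have 2: "plift q r = dadj (plift p 1) * plift (p +++ q) ((1 + r) / 2)" if r: "r \<in> {0..1}" for r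
  proof -
    have "(p +++ q) ((1 + s) / 2) = q s" if "s \<in> {0..1}" for s
    proof -
      have e: "2 * ((1 + s) / 2) - 1 = s" "2 * ((1 + s) / 2) = 1 + s" by (simp_all add: field_simps)
      show ?thesis using that pq unfolding joinpaths_def e by (auto simp: pathfinish_def pathstart_def)
    qed
    then have "plift q r = plift (\<lambda>s. (p +++ q) ((1 + s) / 2)) r"
      by (intro plift_cong[symmetric] q r)
    also have "\<dots> = dadj (plift (p +++ q) ((1 + 0) / 2)) * plift (p +++ q) ((1 + r) / 2)"
      by (rule plift_compose[OF j]) (use r in \<open>auto intro!: continuous_intros\<close>)
    finally show ?thesis using 1[of 1] by simp
  qed
  show ?thesis
  proof (cases "s \<le> 1 / 2")
    case True
    then have "max 0 (2 * s - 1) = 0" "min 1 (2 * s) = 2 * s" by auto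
    then show ?thesis using 1[of "2 * s"] plift(2)[OF q] s True by simp
  next
    case False
    then have "max 0 (2 * s - 1) = 2 * s - 1" "min 1 (2 * s) = 1" by auto
    then show ?thesis
      using 2[of "2 * s - 1"] s False dgroup_cancel(2)[OF plift_group[OF p, of 1]] by simp
  qed
qed

lemma plift_T:
  assumes "path q" "path_image q \<subseteq> U" "U \<subseteq> N" "\<And>y. y \<in> U \<Longrightarrow> near N y (\<lambda>w. T x w = T x y * T y w)"
    and "pathstart q = x" "s \<in> {0..1}"
  shows "plift q s = T x (q s)"
proof (rule plift_eqI)
  show "path_image q \<subseteq> N" using assms by auto
  show "parallel {0..1} q (\<lambda>s. T x (q s))"
  proof (rule parallel_T)
    show "continuous_on {0..1} q" using assms(1) by (simp add: path_def)
    show "q ` {0..1} \<subseteq> N" using assms(2,3) by (auto simp: path_image_def)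
    show "near N (q z) (\<lambda>w. T x w = T x (q z) * T (q z) w)" if "z \<in> {0..1}" for z
      by (rule assms(4)) (use assms(2) that in \<open>auto simp: path_image_def\<close>)
  qed
  have "x \<in> N" using assms pathstart_in_path_image[of q] by auto
  then show "T x (q 0) = 1" using T_self assms(5) by (simp add: pathstart_def)
qed (use assms in auto)

end

section \<open>Pointwise products and local homotopies in SL(2)\<close>

lemma homotopic_paths_mult:
  assumes "homotopic_paths SL2 p p'" "homotopic_paths SL2 q q'"
  shows "homotopic_paths SL2 (\<lambda>s. p s ** q s) (\<lambda>s. p' s ** q' s)"
proof -
  obtain h where h: "continuous_on ({0..1} \<times> {0..1}) h" "h \<in> ({0..1} \<times> {0..1}) \<rightarrow> SL2"
    "\<forall>x\<in>{0..1}. h (0, x) = p x" "\<forall>x\<in>{0..1}. h (1, x) = p' x"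
    "\<forall>t\<in>{0..1::real}. pathstart (h \<circ> Pair t) = pathstart p \<and> pathfinish (h \<circ> Pair t) = pathfinish p"
    using assms(1) unfolding homotopic_paths by blast
  obtain k where k: "continuous_on ({0..1} \<times> {0..1}) k" "k \<in> ({0..1} \<times> {0..1}) \<rightarrow> SL2"
    "\<forall>x\<in>{0..1}. k (0, x) = q x" "\<forall>x\<in>{0..1}. k (1, x) = q' x"
    "\<forall>t\<in>{0..1::real}. pathstart (k \<circ> Pair t) = pathstart q \<and> pathfinish (k \<circ> Pair t) = pathfinish q"
    using assms(2) unfolding homotopic_paths by blast
  show ?thesis
    unfolding homotopic_paths
  proof (intro exI[of _ "\<lambda>z. h z ** k z"] conjI ballI)
    show "continuous_on ({0..1} \<times> {0..1}) (\<lambda>z. h z ** k z)"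
      by (rule bounded_bilinear.continuous_on[OF bounded_bilinear_matrix_mult h(1) k(1)])
    show "(\<lambda>z. h z ** k z) \<in> {0..1} \<times> {0..1} \<rightarrow> SL2"
      using h(2) k(2) SL2_mult by (auto simp: Pi_iff)
  qed (use h k in \<open>auto simp: pathstart_def pathfinish_def\<close>)
qed

lemma SLt_mult_hclass:
  assumes "path p" "path_image p \<subseteq> SL2" "path q" "path_image q \<subseteq> SL2"
  shows "SLt_mult (hclass SL2 p) (hclass SL2 q) = hclass SL2 (\<lambda>s. p s ** q s)"
proof -
  have *: "hclass SL2 (\<lambda>s. p' s ** q' s) = hclass SL2 (\<lambda>s. p s ** q s)" if "p' \<in> hclass SL2 p" "q' \<in> hclass SL2 q" for p' q'
    by (rule hclass_eqI[OF homotopic_paths_sym[OF homotopic_paths_mult]]) (use that in \<open>auto simp: hclass_def\<close>)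
  have "p \<in> hclass SL2 p" "q \<in> hclass SL2 q" using assms hclass_self by auto
  then have ne: "hclass SL2 p \<noteq> {}" "hclass SL2 q \<noteq> {}" by blast+
  have "SLt_mult (hclass SL2 p) (hclass SL2 q) =
      (\<Union>p'\<in>hclass SL2 p. \<Union>q'\<in>hclass SL2 q. hclass SL2 (\<lambda>s. p s ** q s))"
    unfolding SLt_mult_def by (intro SUP_cong refl) (rule *)
  then show ?thesis by (simp only: UN_constant ne if_False)
qed

text \<open>Nearby matrices are joined by line segments of matrices of positive determinant, which can be
  rescaled to determinant one.\<close>

lemma SL2_thin:
  assumes y: "y \<in> SL2"
  shows "\<exists>U. openin (top_of_set SL2) U \<and> y \<in> U \<and> thin SL2 U"
proof -
  have cd: "continuous_on UNIV (det :: real^2^2 \<Rightarrow> real)"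
    unfolding det_2 by (intro continuous_intros)
  have "open {M :: real^2^2. 0 < det M}"
    using open_Collect_less[OF continuous_on_const cd] .
  moreover have "y \<in> {M. 0 < det M}" using y by (simp add: SL2_def)
  ultimately obtain r where r: "r > 0" "ball y r \<subseteq> {M. 0 < det M}" by (rule openE)
  \<comment> \<open>In dimension two the determinant scales quadratically, hence the square root;
    matrices in \<open>SL2\<close> are fixed by \<open>\<rho>\<close>.\<close>
  define \<rho> where "\<rho> M = (1 / sqrt (det M)) *\<^sub>R M" for M :: "real^2^2"
  have "thin SL2 (SL2 \<inter> ball y r)"
    unfolding thin_def
  proof (intro allI impI, elim conjE)
    fix p q assume p: "path p" "path_image p \<subseteq> SL2 \<inter> ball y r" and q: "path q" "path_image q \<subseteq> SL2 \<inter> ball y r"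
      and e: "pathstart p = pathstart q" "pathfinish p = pathfinish q"
    have pq: "homotopic_paths SL2 (\<rho> \<circ> p) (\<rho> \<circ> q)"
    proof (rule homotopic_paths_convex_image[of "ball y r"])
      show "continuous_on (ball y r) \<rho>"
        unfolding \<rho>_def
        by (intro continuous_intros continuous_on_subset[OF cd]) (use r in force)+
      have "\<rho> M \<in> SL2" if "M \<in> ball y r" for M
      proof -
        have "det M > 0" using that r by auto
        then show ?thesis by (simp add: \<rho>_def SL2_def det_2 field_simps)
      qed
      then show "\<rho> ` ball y r \<subseteq> SL2" by auto
    qed (use p q e in auto)
    have *: "homotopic_paths SL2 p (\<rho> \<circ> p)" if "path p" "path_image p \<subseteq> SL2 \<inter> ball y r" for p
      by (rule homotopic_paths_eq) (use that in \<open>auto simp: \<rho>_def path_image_def SL2_def subset_iff\<close>)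
    show "homotopic_paths SL2 p q"
      by (rule homotopic_paths_trans[OF homotopic_paths_trans[OF *[OF p] pq] homotopic_paths_sym[OF *[OF q]]])
  qed
  then show ?thesis
    using y r openin_open_Int[of "ball y r" SL2] by (intro exI[of _ "SL2 \<inter> ball y r"]) auto
qed

section \<open>Charts and patches\<close>

lemma convex_half_plane: "convex half_plane" and closed_half_plane: "closed half_plane"
proof -
  have *: "half_plane = {z. axis 2 1 \<bullet> z \<ge> 0}" by (simp add: half_plane_def inner_axis')
  show "convex half_plane" "closed half_plane" unfolding * by (rule convex_halfspace_ge closed_halfspace_ge)+
qed

lemma ample_half_plane:
  assumes "openin (top_of_set half_plane) S"
  shows "ample S"
proof -
  have "ample half_plane"
    unfolding ample_def
  proof (intro ballI allI impI)
    fix x i :: "real^2" and e :: real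
    assume "x \<in> half_plane" "i \<in> Basis" "e > 0"
    then show "\<exists>d. 0 < \<bar>d\<bar> \<and> \<bar>d\<bar> < e \<and> x + d *\<^sub>R i \<in> half_plane"
      by (intro exI[of _ "e / 2"]) (auto simp: half_plane_def Basis_vec_def axis_def)
  qed
  moreover obtain U where "open U" "S = half_plane \<inter> U" using assms by (auto simp: openin_open)
  ultimately show ?thesis by (simp add: ample_Int_open)
qed

lemma has_derivative_cong_on:
  assumes "x \<in> S" "\<And>y. y \<in> S \<Longrightarrow> f y = g y"
  shows "(f has_derivative D) (at x within S) \<longleftrightarrow> (g has_derivative D) (at x within S)"
proof
  show "(f has_derivative D) (at x within S) \<Longrightarrow> (g has_derivative D) (at x within S)"
    by (rule has_derivative_transform[OF assms(1)]) (simp_all add: assms(2))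
  show "(g has_derivative D) (at x within S) \<Longrightarrow> (f has_derivative D) (at x within S)"
    by (rule has_derivative_transform[OF assms(1)]) (simp_all add: assms(2))
qed

locale surface =
  fixes N :: "'p::topological_space set" and A :: "'p chart set"
  assumes surf: "smooth_surface (top_of_set N) A"
begin

abbreviation ic :: "'p chart \<Rightarrow> real^2 \<Rightarrow> 'p" where "ic c \<equiv> inv_into (fst c) (snd c)"

lemma chart_openin: "c \<in> A \<Longrightarrow> openin (top_of_set N) (fst c)"
  and chart_openin_image: "c \<in> A \<Longrightarrow> openin (top_of_set half_plane) (snd c ` fst c)"
  using surf by (auto simp: smooth_surface_def smooth_atlas_def is_chart_def)

lemma chart_subset: "c \<in> A \<Longrightarrow> fst c \<subseteq> N"
  using chart_openin openin_imp_subset by blast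

lemma chart_covers: assumes "x \<in> N" obtains c where "c \<in> A" "x \<in> fst c"
  using surf assms by (auto simp: smooth_surface_def smooth_atlas_def)

lemma chart_homeo:
  assumes "c \<in> A"
  shows "inj_on (snd c) (fst c)" "continuous_on (fst c) (snd c)" "continuous_on (snd c ` fst c) (ic c)"
proof -
  have "homeomorphic_map (subtopology (top_of_set N) (fst c)) (top_of_set (snd c ` fst c)) (snd c)"
    using surf assms by (auto simp: smooth_surface_def smooth_atlas_def is_chart_def)
  then have "homeomorphic_map (top_of_set (fst c)) (top_of_set (snd c ` fst c)) (snd c)"
    using chart_subset[OF assms] by (simp add: subtopology_subtopology Int_absorb1)
  then obtain g where g: "homeomorphic_maps (top_of_set (fst c)) (top_of_set (snd c ` fst c)) (snd c) g"
    by (auto simp: homeomorphic_map_maps)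
  then have gi: "g (snd c x) = x" if "x \<in> fst c" for x using that by (simp add: homeomorphic_maps_def)
  then show inj: "inj_on (snd c) (fst c)" by (metis inj_onI)
  show "continuous_on (fst c) (snd c)" using g by (simp add: homeomorphic_maps_def)
  have "continuous_on (snd c ` fst c) g" using g by (simp add: homeomorphic_maps_def)
  then show "continuous_on (snd c ` fst c) (ic c)"
    by (rule continuous_on_eq) (use gi inj in \<open>auto simp: inv_into_f_f\<close>)
qed

lemma ic_snd: "c \<in> A \<Longrightarrow> x \<in> fst c \<Longrightarrow> ic c (snd c x) = x"
  by (simp add: chart_homeo(1) inv_into_f_f)

lemma snd_ic: "z \<in> snd c ` fst c \<Longrightarrow> snd c (ic c z) = z"
  by (rule f_inv_into_f)

lemma ic_in: "z \<in> snd c ` fst c \<Longrightarrow> ic c z \<in> fst c"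
  by (rule inv_into_into)

lemma chart_ample: "c \<in> A \<Longrightarrow> ample (snd c ` fst c)"
  by (intro ample_half_plane chart_openin_image)

lemma chart_preimage_openin:
  assumes "c \<in> A" "openin (top_of_set N) W"
  shows "openin (top_of_set half_plane) (snd c ` (fst c \<inter> W))"
proof -
  have "openin (top_of_set (fst c)) (fst c \<inter> W)"
    using assms(2) chart_subset[OF assms(1)] by (auto simp: openin_open)
  then have "openin (top_of_set (snd c ` fst c)) (snd c ` fst c \<inter> ic c -` (fst c \<inter> W))"
    by (rule continuous_openin_preimage[OF chart_homeo(3)[OF assms(1)], rotated]) (auto simp: ic_in)
  moreover have "snd c ` fst c \<inter> ic c -` (fst c \<inter> W) = snd c ` (fst c \<inter> W)"
    using assms(1) by (auto simp: ic_snd)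
  ultimately show ?thesis using openin_trans chart_openin_image[OF assms(1)] by metis
qed

lemma chart_ball:
  assumes "c \<in> A" "x \<in> fst c" "openin (top_of_set N) W" "x \<in> W"
  obtains r where "r > 0" "cball (snd c x) r \<inter> half_plane \<subseteq> snd c ` (fst c \<inter> W)"
proof -
  have "openin (top_of_set half_plane) (snd c ` (fst c \<inter> W))" "snd c x \<in> snd c ` (fst c \<inter> W)"
    using assms chart_preimage_openin by auto
  then show ?thesis using that unfolding openin_contains_cball by blast
qed

text \<open>The coordinate image is a half-ball or a ball, convex in either case, so interior and
  boundary points need no separate treatment.\<close>

definition patch :: "'p chart \<Rightarrow> 'p \<Rightarrow> real \<Rightarrow> 'p set" where
  "patch c x r = ic c ` (ball (snd c x) r \<inter> half_plane)"

lemma chart_in_half_plane: "c \<in> A \<Longrightarrow> x \<in> fst c \<Longrightarrow> snd c x \<in> half_plane"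
  using openin_imp_subset[OF chart_openin_image] by blast

lemma patch:
  assumes c: "c \<in> A" "x \<in> fst c" and r: "r > 0" "ball (snd c x) r \<inter> half_plane \<subseteq> snd c ` fst c"
  shows "patch c x r = fst c \<inter> snd c -` ball (snd c x) r"
    "openin (top_of_set N) (patch c x r)" "x \<in> patch c x r" "patch c x r \<subseteq> fst c" "nice N (patch c x r)"
proof -
  let ?Z = "ball (snd c x) r \<inter> half_plane"
  show eq: "patch c x r = fst c \<inter> snd c -` ball (snd c x) r"
  proof
    show "patch c x r \<subseteq> fst c \<inter> snd c -` ball (snd c x) r"
    proof
      fix y assume "y \<in> patch c x r"
      then obtain z where z: "y = ic c z" "z \<in> ?Z" unfolding patch_def by blast
      then have "z \<in> snd c ` fst c" using r(2) by blast
      then show "y \<in> fst c \<inter> snd c -` ball (snd c x) r" using snd_ic ic_in z by auto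
    qed
    show "fst c \<inter> snd c -` ball (snd c x) r \<subseteq> patch c x r"
    proof
      fix y assume y: "y \<in> fst c \<inter> snd c -` ball (snd c x) r"
      then have "snd c y \<in> ?Z" using chart_in_half_plane[OF c(1)] by auto
      moreover have "y = ic c (snd c y)" using ic_snd c y by simp
      ultimately show "y \<in> patch c x r" unfolding patch_def by blast
    qed
  qed
  have "openin (top_of_set (fst c)) (fst c \<inter> snd c -` ball (snd c x) r)"
    by (rule continuous_openin_preimage_gen[OF chart_homeo(2)[OF c(1)]]) simp
  then show o: "openin (top_of_set N) (patch c x r)"
    using openin_trans chart_openin[OF c(1)] unfolding eq by blast
  show "x \<in> patch c x r" "patch c x r \<subseteq> fst c" unfolding eq using c r by auto
  have Z: "convex ?Z" using convex_half_plane by (intro convex_Int) auto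
  have contZ: "continuous_on ?Z (ic c)" using chart_homeo(3)[OF c(1)] r(2) continuous_on_subset by blast
  have "path_connected ?Z" using Z by (rule convex_imp_path_connected)
  then have pc: "path_connected (patch c x r)"
    unfolding patch_def by (rule path_connected_continuous_image[OF contZ])
  have cs: "continuous_on (patch c x r) (snd c)"
    using chart_homeo(2)[OF c(1)] continuous_on_subset unfolding eq by blast
  have "thin N (patch c x r)"
    unfolding thin_def
  proof (intro allI impI, elim conjE)
    fix p q assume p: "path p" "path_image p \<subseteq> patch c x r" and q: "path q" "path_image q \<subseteq> patch c x r"
      and e: "pathstart p = pathstart q" "pathfinish p = pathfinish q"
    have l: "path (snd c \<circ> p)" "path_image (snd c \<circ> p) \<subseteq> ?Z" "homotopic_paths N p (ic c \<circ> (snd c \<circ> p))"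
      if "path p" "path_image p \<subseteq> patch c x r" for p
    proof -
      show "path (snd c \<circ> p)" using that cs continuous_on_subset by (intro path_continuous_image) blast+
      show "path_image (snd c \<circ> p) \<subseteq> ?Z"
        using that(2) chart_in_half_plane[OF c(1)] unfolding eq path_image_compose by auto
      show "homotopic_paths N p (ic c \<circ> (snd c \<circ> p))"
      proof (rule homotopic_paths_eq[OF that(1)])
        show "path_image p \<subseteq> N" using that(2) openin_imp_subset[OF o] by blast
        fix t :: real assume "t \<in> {0..1}"
        then have "p t \<in> fst c" using that(2) unfolding eq by (auto simp: path_image_def)
        then show "p t = (ic c \<circ> (snd c \<circ> p)) t" using ic_snd[OF c(1)] by simp
      qed
    qed
    have "homotopic_paths N (ic c \<circ> (snd c \<circ> p)) (ic c \<circ> (snd c \<circ> q))"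
    proof (rule homotopic_paths_convex_image[OF Z contZ])
      show "ic c ` ?Z \<subseteq> N" using openin_imp_subset[OF o] by (simp add: patch_def)
    qed (use l p q e in \<open>auto simp: pathstart_compose pathfinish_compose\<close>)
    from homotopic_paths_trans[OF homotopic_paths_trans[OF l(3)[OF p] this] homotopic_paths_sym[OF l(3)[OF q]]]
    show "homotopic_paths N p q" .
  qed
  with o pc show "nice N (patch c x r)" by (simp add: nice_def)
qed

lemma patch_exists:
  assumes "c \<in> A" "x \<in> fst c" "openin (top_of_set N) W" "x \<in> W"
  obtains r where "r > 0" "cball (snd c x) r \<inter> half_plane \<subseteq> snd c ` fst c" "ball (snd c x) r \<inter> half_plane \<subseteq> snd c ` fst c"
    "patch c x r \<subseteq> W"
proof -
  obtain r where r: "r > 0" "cball (snd c x) r \<inter> half_plane \<subseteq> snd c ` (fst c \<inter> W)"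
    using chart_ball[OF assms] .
  have s: "ball (snd c x) r \<inter> half_plane \<subseteq> snd c ` (fst c \<inter> W)" using r(2) ball_subset_cball by blast
  have "ic c z \<in> W" if "z \<in> snd c ` (fst c \<inter> W)" for z using that ic_snd[OF assms(1)] by auto
  then have "patch c x r \<subseteq> W" using s by (auto simp: patch_def)
  then show ?thesis using that[OF r(1)] r(2) s by blast
qed

lemma nice_basis:
  assumes "y \<in> N" "openin (top_of_set N) V" "y \<in> V"
  shows "\<exists>U\<subseteq>V. nice N U \<and> y \<in> U"
proof -
  obtain c where c: "c \<in> A" "y \<in> fst c" using chart_covers[OF assms(1)] .
  obtain r where r: "r > 0" "ball (snd c y) r \<inter> half_plane \<subseteq> snd c ` fst c" "patch c y r \<subseteq> V"
    using patch_exists[OF c assms(2,3)] by metis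
  then show ?thesis using patch[OF c r(1,2)] by blast
qed

lemma path_connected_N: "connected N \<Longrightarrow> path_connected N"
  unfolding path_connected_component
proof (intro ballI)
  fix a b assume "connected N" "a \<in> N" "b \<in> N"
  then show "path_component N a b"
  proof (rule connected_equivalence_relation)
    fix y assume y: "y \<in> N"
    obtain U where U: "nice N U" "y \<in> U" using nice_basis[OF y openin_subtopology_self y] by blast
    have "path_component N y z" if "z \<in> U" for z
      using U that path_connected_component openin_imp_subset path_component_of_subset
      unfolding nice_def by metis
    then show "\<exists>T. openin (top_of_set N) T \<and> y \<in> T \<and> (\<forall>x\<in>T. path_component N y x)"
      using U by (intro exI[of _ U]) (simp add: nice_def)
  qed (auto intro: path_component_sym path_component_trans)
qed

section \<open>Piecewise smooth representatives\<close>

lemma transition_smooth: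
  "c \<in> A \<Longrightarrow> d \<in> A \<Longrightarrow> smooth_on (snd c ` (fst c \<inter> fst d)) (snd d \<circ> ic c)"
  using surf by (auto simp: smooth_surface_def smooth_atlas_def)

lemma Ck_on_linepath: "Ck_on k S (linepath a b)" for a b :: "real^2"
proof -
  have "Ck_on k S (\<lambda>s. a + s *\<^sub>R (b - a))"
    by (intro Ck_on_add Ck_on_const Ck_on_linear bounded_linear_scaleR_left)
  moreover have "linepath a b = (\<lambda>s. a + s *\<^sub>R (b - a))" by (auto simp: linepath_def algebra_simps)
  ultimately show ?thesis by simp
qed

text \<open>A segment is affine in the chart \<open>c\<close>; in any other chart it becomes its
  composition with a smooth transition map.\<close>

lemma pc1_line:
  assumes c: "c \<in> A" and Z: "convex Z" "Z \<subseteq> snd c ` fst c" "a \<in> Z" "b \<in> Z"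
  shows "piecewise_C1_path N A (ic c \<circ> linepath a b)" "path_image (ic c \<circ> linepath a b) \<subseteq> ic c ` Z"
    "pathstart (ic c \<circ> linepath a b) = ic c a" "pathfinish (ic c \<circ> linepath a b) = ic c b"
proof -
  have cont: "continuous_on Z (ic c)" using chart_homeo(3)[OF c] Z(2) continuous_on_subset by blast
  note l = path_compose_linepath[OF Z(1) cont Z(3,4)]
  show "path_image (ic c \<circ> linepath a b) \<subseteq> ic c ` Z" "pathstart (ic c \<circ> linepath a b) = ic c a"
    "pathfinish (ic c \<circ> linepath a b) = ic c b" using l by auto
  have li: "linepath a b s \<in> Z" if "s \<in> {0..1}" for s
    using closed_segment_subset[OF Z(3,4,1)] that linepath_image_01 by blast
  show "piecewise_C1_path N A (ic c \<circ> linepath a b)"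
    unfolding piecewise_C1_path_def
  proof (intro conjI exI[of _ "{0, 1}"] ballI impI)
    show "path_image (ic c \<circ> linepath a b) \<subseteq> N"
      using l(2) Z(2) ic_in chart_subset[OF c] by blast
    fix a' b' d assume "a' \<in> {0, 1::real}" "b' \<in> {0, 1::real}" "a' < b' \<and> {a'<..<b'} \<inter> {0, 1} = {}" and d: "d \<in> A"
    then have ab: "a' = 0" "b' = 1" by auto
    let ?S = "{s \<in> {a'..b'}. (ic c \<circ> linepath a b) s \<in> fst d}"
    have "Ck_on 1 ?S (\<lambda>s. (snd d \<circ> ic c) (linepath a b s))"
    proof (rule Ck_on_compose[OF Ck_on_linepath smooth_onD[OF transition_smooth[OF c d]]])
      show "linepath a b ` ?S \<subseteq> snd c ` (fst c \<inter> fst d)"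
      proof clarify
        fix s assume s: "s \<in> {a'..b'}" "(ic c \<circ> linepath a b) s \<in> fst d"
        then have z: "linepath a b s \<in> snd c ` fst c" using li Z(2) ab by auto
        then show "linepath a b s \<in> snd c ` (fst c \<inter> fst d)"
          using s snd_ic[OF z] ic_in[OF z] by (intro image_eqI[of _ _ "ic c (linepath a b s)"]) auto
      qed
    qed
    then show "Ck_on 1 ?S (snd d \<circ> (ic c \<circ> linepath a b))" by (simp only: o_def)
  qed (use l in auto)
qed

text \<open>The breakpoints of \<open>p\<close> are compressed into the left half and those of
  \<open>q\<close> into the right half; both sets contribute 1/2.\<close>

lemma pc1_join:
  assumes "piecewise_C1_path N A p" "piecewise_C1_path N A q" "pathfinish p = pathstart q"
  shows "piecewise_C1_path N A (p +++ q)"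
proof -
  obtain T1 where T1: "finite T1" "{0, 1} \<subseteq> T1" "T1 \<subseteq> {0..1}"
    "\<forall>a\<in>T1. \<forall>b\<in>T1. a < b \<and> {a<..<b} \<inter> T1 = {} \<longrightarrow> (\<forall>c\<in>A. Ck_on 1 {s\<in>{a..b}. p s \<in> fst c} (snd c \<circ> p))"
    using assms(1) unfolding piecewise_C1_path_def by (elim conjE exE) (rule that)
  obtain T2 where T2: "finite T2" "{0, 1} \<subseteq> T2" "T2 \<subseteq> {0..1}"
    "\<forall>a\<in>T2. \<forall>b\<in>T2. a < b \<and> {a<..<b} \<inter> T2 = {} \<longrightarrow> (\<forall>c\<in>A. Ck_on 1 {s\<in>{a..b}. q s \<in> fst c} (snd c \<circ> q))"
    using assms(2) unfolding piecewise_C1_path_def by (elim conjE exE) (rule that)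
  define T where "T = (\<lambda>s. s / 2) ` T1 \<union> (\<lambda>s. (s + 1) / 2) ` T2"
  have T1I: "s / 2 \<in> T" if "s \<in> T1" for s using that by (auto simp: T_def)
  have T2I: "(s + 1) / 2 \<in> T" if "s \<in> T2" for s using that by (auto simp: T_def)
  have half: "1 / 2 \<in> T" using T1I[of 1] T1(2) by auto
  have left: "2 * s \<in> T1" if "s \<in> T" "s \<le> 1 / 2" for s
    using that(1) unfolding T_def
  proof
    assume "s \<in> (\<lambda>s. s / 2) ` T1"
    then obtain s1 where s1: "s1 \<in> T1" "s = s1 / 2" by blast
    then have "2 * s = s1" by simp
    then show ?thesis using s1(1) by metis
  next
    assume "s \<in> (\<lambda>s. (s + 1) / 2) ` T2"
    then obtain s2 where "s2 \<in> T2" "s = (s2 + 1) / 2" by blast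
    then have "2 * s = 1" using T2(3) that(2) by (auto simp: field_simps)
    then show ?thesis using T1(2) by simp
  qed
  have right: "2 * s - 1 \<in> T2" if "s \<in> T" "s \<ge> 1 / 2" for s
    using that(1) unfolding T_def
  proof
    assume "s \<in> (\<lambda>s. s / 2) ` T1"
    then obtain s1 where "s1 \<in> T1" "s = s1 / 2" by blast
    then have "2 * s - 1 = 0" using T1(3) that(2) by (auto simp: field_simps)
    then show ?thesis using T2(2) by simp
  next
    assume "s \<in> (\<lambda>s. (s + 1) / 2) ` T2"
    then obtain s2 where s2: "s2 \<in> T2" "s = (s2 + 1) / 2" by blast
    then have "2 * s - 1 = s2" by (simp add: field_simps)
    then show ?thesis using s2(1) by metis
  qed
  show ?thesis
    unfolding piecewise_C1_path_def
  proof (intro conjI exI[of _ T] ballI impI)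
    show "path (p +++ q)" "path_image (p +++ q) \<subseteq> N"
      using assms by (auto simp: piecewise_C1_path_def path_image_join)
    show "finite T" using T1 T2 by (simp add: T_def)
    show "{0, 1} \<subseteq> T" using T1I[of 0] T2I[of 1] T1 T2 by auto
    show "T \<subseteq> {0..1}" using T1(3) T2(3) by (auto simp: T_def)
    fix a b c assume ab: "a \<in> T" "b \<in> T" "a < b \<and> {a<..<b} \<inter> T = {}" and c: "c \<in> A"
    let ?S = "{s \<in> {a..b}. (p +++ q) s \<in> fst c}"
    \<comment> \<open>Because 1/2 is itself a breakpoint, an interval between consecutive
      breakpoints lies in one half, where \<open>p +++ q\<close> is an affine reparametrization of
      \<open>p\<close> or of \<open>q\<close>.\<close>
    have n: "\<not> (a < 1 / 2 \<and> 1 / 2 < b)" using ab(3) half by (meson disjoint_iff greaterThanLessThan_iff)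
    show "Ck_on 1 ?S (snd c \<circ> (p +++ q))"
    proof (cases "b \<le> 1 / 2")
      case True
      have gap: "{2 * a<..<2 * b} \<inter> T1 = {}"
      proof -
        have False if "s \<in> T1" "2 * a < s" "s < 2 * b" for s
        proof -
          have "s / 2 \<in> {a<..<b} \<inter> T" using T1I[OF that(1)] that by auto
          then show False using ab(3) by blast
        qed
        then show ?thesis by auto
      qed
      have "Ck_on 1 {s\<in>{2 * a..2 * b}. p s \<in> fst c} (snd c \<circ> p)"
        by (rule T1(4)[rule_format, OF left left _ c]) (use ab True gap in auto)
      note ck = this
      have j: "(p +++ q) s = p (2 * s)" if "s \<le> 1 / 2" for s
        using that by (simp add: joinpaths_def)
      have "Ck_on 1 ?S (\<lambda>s. (snd c \<circ> p) (2 * s))"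
        by (rule Ck_on_compose[OF Ck_on_linear[OF bounded_linear_mult_right] ck]) (use True j in auto)
      then show ?thesis by (rule Ck_on_cong_imp) (use True j in auto)
    next
      case False
      then have a: "1 / 2 \<le> a" using n by auto
      have j: "(p +++ q) s = q (2 * s - 1)" if "s \<ge> 1 / 2" for s
      proof (cases "s = 1 / 2")
        case True
        show ?thesis unfolding True using assms(3) by (simp add: joinpaths_def pathfinish_def pathstart_def)
      next
        case False
        then show ?thesis using that by (simp add: joinpaths_def)
      qed
      have gap: "{2 * a - 1<..<2 * b - 1} \<inter> T2 = {}"
      proof -
        have False if "s \<in> T2" "2 * a - 1 < s" "s < 2 * b - 1" for s
        proof -
          have "(s + 1) / 2 \<in> {a<..<b} \<inter> T" using T2I[OF that(1)] that by auto
          then show False using ab(3) by blast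
        qed
        then show ?thesis by auto
      qed
      have ck: "Ck_on 1 {s\<in>{2 * a - 1..2 * b - 1}. q s \<in> fst c} (snd c \<circ> q)"
        by (rule T2(4)[rule_format, OF right right _ c]) (use ab a gap in auto)
      have lc: "Ck_on 1 ?S (\<lambda>s. 2 * s + (- 1))"
        by (intro Ck_on_add Ck_on_const Ck_on_linear bounded_linear_mult_right)
      have "Ck_on 1 ?S (\<lambda>s. (snd c \<circ> q) (2 * s + (- 1)))"
        by (rule Ck_on_compose[OF lc ck]) (use a j in auto)
      then show ?thesis by (rule Ck_on_cong_imp) (use a j in auto)
    qed
  qed
qed

text \<open>Moving along a continuous representative, each short piece inside a patch is replaced by
  a coordinate segment with the same ends; since the patch is thin, the class does not
  change.\<close>

lemma pc1_exists:
  assumes \<alpha>: "\<alpha> \<in> ucover N x0"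
  shows "\<exists>p\<in>\<alpha>. piecewise_C1_path N A p"
proof -
  obtain p where p: "p \<in> \<alpha>" using \<alpha> by (rule ucover_nonempty)
  note pD = ucoverD[OF \<alpha> p]
  note pl = path_lift[OF pD(1,2)]
  have c: "continuous_on {0..1} p" and pN: "\<And>t. t \<in> {0..1} \<Longrightarrow> p t \<in> N"
    using pD by (auto simp: path_def path_image_def)
  have "\<exists>q\<in>path_lift N p 1. piecewise_C1_path N A q"
  proof (rule connected_induction_simple[of "{0..1::real}" 0 1 "\<lambda>s. \<exists>q\<in>path_lift N p s. piecewise_C1_path N A q"])
    have x0: "x0 \<in> N" using pN[of 0] pD(3) by (simp add: pathstart_def)
    obtain k where k: "k \<in> A" "x0 \<in> fst k" using chart_covers[OF x0] .
    have "piecewise_C1_path N A (ic k \<circ> linepath (snd k x0) (snd k x0))"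
      by (rule pc1_line(1)[OF k(1), of "{snd k x0}"]) (use k in auto)
    moreover have "ic k \<circ> linepath (snd k x0) (snd k x0) = (\<lambda>_. x0)"
      using ic_snd[OF k] by (simp add: o_def linepath_refl)
    moreover have "(\<lambda>_. x0) \<in> path_lift N p 0"
      unfolding pl(3) pD(3) using x0 by (intro hclass_self) (auto simp: path_def path_image_def)
    ultimately show "\<exists>q\<in>path_lift N p 0. piecewise_C1_path N A q" by auto
  next
    fix s0 :: real assume s0: "s0 \<in> {0..1}"
    obtain k where k: "k \<in> A" "p s0 \<in> fst k" using chart_covers[OF pN[OF s0]] .
    obtain r where r: "r > 0" "ball (snd k (p s0)) r \<inter> half_plane \<subseteq> snd k ` fst k"
      using patch_exists[OF k openin_subtopology_self pN[OF s0]] by metis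
    let ?Z = "ball (snd k (p s0)) r \<inter> half_plane" and ?U = "patch k (p s0) r"
    note pt = patch[OF k r]
    have thin: "thin N ?U" and US: "?U \<subseteq> N" using pt(5) openin_imp_subset[OF pt(2)] by (auto simp: nice_def)
    have "openin (top_of_set {0..1}) ({0..1} \<inter> p -` ?U)"
      using continuous_openin_preimage[OF c _ pt(2)] pN by auto
    then obtain e where e: "e > 0" "ball s0 e \<inter> {0..1} \<subseteq> {0..1} \<inter> p -` ?U"
      unfolding openin_contains_ball using s0 pt(3) by blast
    define V where "V = ball s0 e \<inter> {0..1}"
    have V: "openin (top_of_set {0..1}) V" "s0 \<in> V" "convex V" "V \<subseteq> {0..1}"
      using openin_open_Int[of "ball s0 e" "{0..1}"] s0 e by (auto simp: V_def Int_commute intro!: convex_Int)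
    have pU: "p z \<in> ?U" if "z \<in> V" for z using e that by (auto simp: V_def)
    have step: "\<exists>q\<in>path_lift N p t. piecewise_C1_path N A q"
      if s: "s \<in> V" and t: "t \<in> V" and ex: "\<exists>q\<in>path_lift N p s. piecewise_C1_path N A q" for s t
    proof -
      obtain q where q: "q \<in> path_lift N p s" "piecewise_C1_path N A q" using ex by blast
      have st: "s \<in> {0..1}" "t \<in> {0..1}" using s t V by auto
      define l where "l = ic k \<circ> linepath (snd k (p s)) (snd k (p t))"
      have zz: "snd k (p s) \<in> ?Z" "snd k (p t) \<in> ?Z"
        using pU[OF s] pU[OF t] chart_in_half_plane[OF k(1)] unfolding pt(1) by auto
      have Z: "convex ?Z" using convex_half_plane by (intro convex_Int) auto
      note l = pc1_line[OF k(1) Z r(2) zz, folded l_def]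
      have ks: "ic k (snd k (p s)) = p s" "ic k (snd k (p t)) = p t"
        using ic_snd[OF k(1)] pU[OF s] pU[OF t] pt(4) by auto
      have cV: "continuous_on V p" using c V(4) continuous_on_subset by blast
      note m = path_compose_linepath[OF V(3) cV s t]
      have mU: "path_image (p \<circ> linepath s t) \<subseteq> ?U" using m(2) pU by auto
      have lU: "path_image l \<subseteq> ?U" using l(2) by (simp add: patch_def)
      have lp: "path l" using l(1) by (simp add: piecewise_C1_path_def)
      have hom: "homotopic_paths N (p \<circ> linepath s t) l"
        by (rule thinD[OF thin m(1) mU lp lU]) (use m l ks in auto)
      have up: "path_lift N p s \<in> ucover N (pathstart p)" by (rule pl(1)[OF st(1)])
      note qD = ucoverD[OF up q(1)]
      have adm: "admissible N (path_lift N p s) (p \<circ> linepath s t)" "admissible N (path_lift N p s) l"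
        using m mU lU lp l ks US pl(2)[OF st(1)] by (auto simp: admissible_def)
      have "path_lift N p t = extend N (path_lift N p s) (p \<circ> linepath s t)" by (rule pl(5)[OF st])
      also have "\<dots> = extend N (path_lift N p s) l" by (rule extend_cong[OF up adm(1) hom])
      also have "\<dots> = hclass N (q +++ l)" by (rule extend_eq[OF up q(1) adm(2)])
      finally have eq: "path_lift N p t = hclass N (q +++ l)" .
      have fin: "pathfinish q = pathstart l" using qD(5) pl(2)[OF st(1)] l(3) ks by simp
      have "piecewise_C1_path N A (q +++ l)" by (rule pc1_join[OF q(2) l(1) fin])
      moreover from this have "q +++ l \<in> hclass N (q +++ l)" by (intro hclass_self) (auto simp: piecewise_C1_path_def)
      ultimately show ?thesis unfolding eq by blast
    qed
    show "\<exists>T. openin (top_of_set {0..1}) T \<and> s0 \<in> T \<and> (\<forall>x\<in>T. \<forall>y\<in>T.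
        (\<exists>q\<in>path_lift N p x. piecewise_C1_path N A q) \<longrightarrow> (\<exists>q\<in>path_lift N p y. piecewise_C1_path N A q))"
      by (intro exI[of _ V] conjI V(1,2) ballI impI) (rule step)
  qed auto
  then show ?thesis using pl(4) pD(4) by simp
qed

section \<open>Sheets\<close>

lemma lifted_chart_exists:
  assumes "k \<in> A" "\<alpha> \<in> ucover N x0" "endpt \<alpha> \<in> fst k"
  shows "\<exists>K\<in>lifted_charts N x0 k. \<alpha> \<in> fst K"
proof -
  have e: "endpt \<alpha> \<in> N" by (rule endpt_in[OF assms(2)])
  obtain r where r: "r > 0" "ball (snd k (endpt \<alpha>)) r \<inter> half_plane \<subseteq> snd k ` fst k"
    using patch_exists[OF assms(1,3) openin_subtopology_self e] by metis
  let ?U = "patch k (endpt \<alpha>) r"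
  note pt = patch[OF assms(1,3) r]
  have US: "?U \<subseteq> N" using openin_imp_subset[OF pt(2)] .
  have im: "endpt ` cover_nbhd N \<alpha> ?U = ?U"
    by (rule endpt_cover_nbhd(2)[OF assms(2) US]) (use pt in \<open>auto simp: nice_def\<close>)
  have "homeomorphic_map (subtopology (ucover_topology N x0) (cover_nbhd N \<alpha> ?U)) (top_of_set ?U) endpt"
    by (rule sheet_homeomorphic[OF nice_basis assms(2) pt(5,3)])
  then have "(cover_nbhd N \<alpha> ?U, snd k \<circ> endpt) \<in> lifted_charts N x0 k"
    unfolding lifted_charts_def mem_Collect_eq
    using openin_cover_nbhd[OF assms(2) pt(2)] pt(2,4) by (intro exI[of _ "cover_nbhd N \<alpha> ?U"]) (simp add: im)
  moreover have "\<alpha> \<in> cover_nbhd N \<alpha> ?U" by (rule cover_nbhd_self[OF assms(2) pt(3)])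
  ultimately show ?thesis by force
qed

lemma lifted_chart:
  assumes k: "k \<in> A" and K: "K \<in> lifted_charts N x0 k"
  shows "snd K = snd k \<circ> endpt" "openin (ucover_topology N x0) (fst K)" "fst K \<subseteq> ucover N x0"
    "endpt ` fst K \<subseteq> fst k" "inj_on endpt (fst K)" "inj_on (snd K) (fst K)"
    "openin (top_of_set half_plane) (snd K ` fst K)" "ample (snd K ` fst K)" "snd K ` fst K \<subseteq> snd k ` fst k"
proof -
  obtain W where W: "K = (W, snd k \<circ> endpt)" "openin (ucover_topology N x0) W"
    "openin (top_of_set N) (endpt ` W)" "endpt ` W \<subseteq> fst k"
    "homeomorphic_map (subtopology (ucover_topology N x0) W) (top_of_set (endpt ` W)) endpt"
    using K by (auto simp: lifted_charts_def)
  show "snd K = snd k \<circ> endpt" "openin (ucover_topology N x0) (fst K)" "endpt ` fst K \<subseteq> fst k" using W by auto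
  show Wu: "fst K \<subseteq> ucover N x0" using openin_subset[OF W(2)] W(1) by simp
  have ts: "topspace (subtopology (ucover_topology N x0) W) = W" using Wu W(1) by auto
  show inj: "inj_on endpt (fst K)"
    using homeomorphic_imp_injective_map[OF W(5)] unfolding ts by (simp add: W(1))
  have "inj_on (snd k) (endpt ` W)" using chart_homeo(1)[OF k] W(4) inj_on_subset by blast
  then show "inj_on (snd K) (fst K)" using inj by (simp add: W(1) comp_inj_on)
  have "snd K ` fst K = snd k ` (fst k \<inter> endpt ` W)" using W(4) by (auto simp: W(1))
  then show o: "openin (top_of_set half_plane) (snd K ` fst K)"
    using chart_preimage_openin[OF k W(3)] by simp
  then show "ample (snd K ` fst K)" by (rule ample_half_plane)
  show "snd K ` fst K \<subseteq> snd k ` fst k" using W(4) by (auto simp: W(1))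
qed

text \<open>Differentiation is local, and over a small neighbourhood the coordinate expressions of
  \<open>F\<close> on the sheet and of \<open>P\<close> on the surface coincide. This is the bridge
  between the cover and the surface.\<close>

lemma sheet_derivative_iff:
  assumes k: "k \<in> A" and K: "K \<in> lifted_charts N x0 k" and \<alpha>: "\<alpha> \<in> fst K"
    and U: "openin (top_of_set N) U" "endpt \<alpha> \<in> U"
    and F: "\<And>\<beta>. \<beta> \<in> cover_nbhd N \<alpha> U \<Longrightarrow> F \<beta> = P (endpt \<beta>)"
  shows "((F \<circ> inv_into (fst K) (snd K)) has_derivative D) (at (snd K \<alpha>) within snd K ` fst K) \<longleftrightarrow>
    ((P \<circ> ic k) has_derivative D) (at (snd k (endpt \<alpha>)) within snd k ` fst k)"
proof -
  note L = lifted_chart[OF k K]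
  have a: "\<alpha> \<in> ucover N x0" using \<alpha> L(3) by blast
  define W where "W = fst K \<inter> cover_nbhd N \<alpha> U"
  have W: "openin (ucover_topology N x0) W" unfolding W_def
    by (intro openin_Int L(2) openin_cover_nbhd a U)
  have aW: "\<alpha> \<in> W" unfolding W_def using \<alpha> cover_nbhd_self[OF a U(2)] by blast
  define E where "E = snd k ` (fst k \<inter> endpt ` W)"
  have "openin (top_of_set half_plane) E"
    unfolding E_def by (rule chart_preimage_openin[OF k open_map_endpt[OF nice_basis W]])
  \<comment> \<open>One open \<open>Q\<close> cuts both coordinate images down to the same set
    \<open>E\<close>, so all three within-filters at the point are equal.\<close>
  then obtain Q where Q: "open Q" "E = half_plane \<inter> Q" by (auto simp: openin_open)
  have Wk: "endpt ` W \<subseteq> fst k" using L(4) by (auto simp: W_def)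
  have E1: "snd K ` fst K \<inter> Q = E"
  proof
    show "snd K ` fst K \<inter> Q \<subseteq> E" using openin_imp_subset[OF L(7)] Q(2) by blast
    have "E \<subseteq> snd K ` fst K" unfolding E_def L(1) by (auto simp: W_def)
    then show "E \<subseteq> snd K ` fst K \<inter> Q" using Q(2) by blast
  qed
  have E2: "snd k ` fst k \<inter> Q = E"
  proof
    show "snd k ` fst k \<inter> Q \<subseteq> E" using openin_imp_subset[OF chart_openin_image[OF k]] Q(2) by blast
    show "E \<subseteq> snd k ` fst k \<inter> Q" using Q(2) by (auto simp: E_def)
  qed
  have z: "snd K \<alpha> = snd k (endpt \<alpha>)" by (simp add: L(1))
  have zE: "snd K \<alpha> \<in> E" unfolding z E_def using aW Wk by blast
  have "((F \<circ> inv_into (fst K) (snd K)) has_derivative D) (at (snd K \<alpha>) within snd K ` fst K) \<longleftrightarrow>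
      ((F \<circ> inv_into (fst K) (snd K)) has_derivative D) (at (snd K \<alpha>) within E)"
    using at_within_Int_open[OF Q(1), of "snd K \<alpha>" "snd K ` fst K"] zE Q(2) E1 by auto
  also have "\<dots> \<longleftrightarrow> ((P \<circ> ic k) has_derivative D) (at (snd K \<alpha>) within E)"
  proof (rule has_derivative_cong_on[OF zE])
    fix y assume "y \<in> E"
    then obtain \<beta> where b: "\<beta> \<in> W" "y = snd k (endpt \<beta>)" "endpt \<beta> \<in> fst k" unfolding E_def by blast
    then have "y = snd K \<beta>" "\<beta> \<in> fst K" "\<beta> \<in> cover_nbhd N \<alpha> U" by (auto simp: L(1) W_def)
    then have "inv_into (fst K) (snd K) y = \<beta>" "F \<beta> = P (endpt \<beta>)" using inv_into_f_f[OF L(6)] F by auto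
    then show "(F \<circ> inv_into (fst K) (snd K)) y = (P \<circ> ic k) y" using b ic_snd[OF k] by simp
  qed
  also have "\<dots> \<longleftrightarrow> ((P \<circ> ic k) has_derivative D) (at (snd k (endpt \<alpha>)) within snd k ` fst k)"
    using at_within_Int_open[OF Q(1), of "snd K \<alpha>" "snd k ` fst k"] zE Q(2) E2 z by auto
  finally show ?thesis .
qed

end

section \<open>Primitives of flat forms on the surface\<close>

definition pform :: "('p chart \<Rightarrow> 2 \<Rightarrow> 'p \<Rightarrow> dmat) \<Rightarrow> 'p chart \<Rightarrow> 'p \<Rightarrow> real^2 \<Rightarrow> dmat" where
  "pform \<Omega> c x h = (\<Sum>i\<in>UNIV. h $ i *\<^sub>R \<Omega> c i x)"

lemma pform_axis [simp]: "pform \<Omega> c x (axis i 1) = \<Omega> c i x"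
  using exhaust_2[of i] by (auto simp: pform_def sum_2 axis_def)

text \<open>Skewness under \<open>dadj\<close> says that the values lie in the Lie algebra
  (\<open>dadj_eq_minus_iff\<close>); the last clause is the Maurer-Cartan equation in the
  coordinates of each chart.\<close>

definition (in surface) flat_form :: "('p chart \<Rightarrow> 2 \<Rightarrow> 'p \<Rightarrow> dmat) \<Rightarrow> bool" where
  "flat_form \<Omega> \<longleftrightarrow>
     (\<forall>c\<in>A. \<forall>i. smooth_in_chart c (\<Omega> c i)) \<and>
     (\<forall>c\<in>A. \<forall>i. \<forall>x\<in>fst c. dadj (\<Omega> c i x) = - \<Omega> c i x) \<and>
     (\<forall>c\<in>A. \<forall>d\<in>A. \<forall>x\<in>fst c \<inter> fst d. \<forall>i. \<Omega> c i x = (\<Sum>j\<in>UNIV. jacobian_matrix c d x $ j $ i *\<^sub>R \<Omega> d j x)) \<and>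
     (\<forall>c\<in>A. \<forall>x\<in>fst c. \<forall>i j. chart_deriv c i (\<Omega> c j) x - chart_deriv c j (\<Omega> c i) x
        + \<Omega> c i x * \<Omega> c j x - \<Omega> c j x * \<Omega> c i x = 0)"

text \<open>By skewness the derivative of the second factor contributes
  \<open>- P z * w h * dadj (Q z)\<close>, which cancels the contribution of the first.\<close>

lemma has_derivative_mult_dadj:
  assumes P: "(P has_derivative (\<lambda>h. P z * w h)) (at z within S)"
    and Q: "(Q has_derivative (\<lambda>h. Q z * w h)) (at z within S)"
    and w: "\<And>h. dadj (w h) = - w h"
  shows "((\<lambda>z. P z * dadj (Q z)) has_derivative (\<lambda>h. 0)) (at z within S)"
proof -
  have "((\<lambda>z. dadj (Q z)) has_derivative (\<lambda>h. dadj (Q z * w h))) (at z within S)"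
    by (rule bounded_linear.has_derivative[OF bounded_linear_dadj Q])
  from has_derivative_mult[OF P this]
  have "((\<lambda>z. P z * dadj (Q z)) has_derivative (\<lambda>h. P z * dadj (Q z * w h) + P z * w h * dadj (Q z))) (at z within S)" .
  moreover have "P z * dadj (Q z * w h) + P z * w h * dadj (Q z) = 0" for h
    by (simp add: dadj_mult w mult.assoc)
  ultimately show ?thesis by simp
qed

lemma dadj_sum: "dadj (\<Sum>i\<in>I. f i) = (\<Sum>i\<in>I. dadj (f i))"
  and dadj_scaleR: "dadj (r *\<^sub>R X) = r *\<^sub>R dadj X"
  by (simp_all add: bounded_linear.linear[OF bounded_linear_dadj] linear_sum linear_cmul)

context surface
begin

lemma chart_within:
  assumes "c \<in> A" "openin (top_of_set N) W" "y \<in> fst c" "y \<in> W"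
  shows "at (snd c y) within snd c ` fst c = at (snd c y) within snd c ` (fst c \<inter> W)"
proof -
  obtain Q where Q: "open Q" "snd c ` (fst c \<inter> W) = half_plane \<inter> Q"
    using chart_preimage_openin[OF assms(1,2)] by (auto simp: openin_open)
  have e: "snd c ` fst c \<inter> Q = snd c ` (fst c \<inter> W)"
    using Q(2) openin_imp_subset[OF chart_openin_image[OF assms(1)]] by blast
  have "snd c y \<in> Q" using Q(2) assms by blast
  then show ?thesis using at_within_Int_open[OF Q(1), of "snd c y" "snd c ` fst c"] e by simp
qed

text \<open>\<open>jacobian_matrix\<close> is built entry by entry from the inverse of the
  restricted chart. Ampleness identifies these entries with those of the derivative of the actual
  transition map.\<close>

lemma transition_derivative:
  assumes c: "c \<in> A" "d \<in> A" and y: "y \<in> fst c \<inter> fst d"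
  shows "((snd c \<circ> ic d) has_derivative (\<lambda>h. jacobian_matrix d c y *v h)) (at (snd d y) within snd d ` (fst d \<inter> fst c))"
proof -
  let ?E = "snd d ` (fst d \<inter> fst c)"
  have am: "ample ?E" by (rule ample_half_plane[OF chart_preimage_openin[OF c(2) chart_openin[OF c(1)]]])
  have yE: "snd d y \<in> ?E" using y by blast
  obtain f' where "\<forall>z\<in>?E. ((snd c \<circ> ic d) has_derivative f' z) (at z within ?E)"
    using smooth_onD[OF transition_smooth[OF c(2,1)], of "Suc 0"] unfolding Ck_on.simps by blast
  then obtain D where D: "((snd c \<circ> ic d) has_derivative D) (at (snd d y) within ?E)"
    using yE by blast
  have "jacobian_matrix d c y $ j $ i = D (axis i 1) $ j" for i j
  proof -
    have D': "((\<lambda>z. (snd c \<circ> ic d) z $ j) has_derivative (\<lambda>h. D h $ j)) (at (snd d y) within ?E)"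
      by (rule bounded_linear.has_derivative[OF bounded_linear_vec_nth D])
    have eq: "(snd c \<circ> ic d) z $ j = ((\<lambda>y. snd c y $ j) \<circ> inv_into (fst d \<inter> fst c) (snd d)) z" if z: "z \<in> ?E" for z
    proof -
      obtain x where x: "x \<in> fst d \<inter> fst c" "z = snd d x" using z by blast
      have "inj_on (snd d) (fst d \<inter> fst c)" using chart_homeo(1)[OF c(2)] inj_on_subset by blast
      then show ?thesis using x ic_snd[OF c(2)] by (simp add: inv_into_f_f)
    qed
    have "(((\<lambda>y. snd c y $ j) \<circ> inv_into (fst d \<inter> fst c) (snd d)) has_derivative (\<lambda>h. D h $ j)) (at (snd d y) within ?E)"
      by (rule has_derivative_transform[OF yE _ D']) (simp only: eq)
    from ample_frechet_derivative[OF am yE this]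
    show ?thesis by (simp add: jacobian_matrix_def chart_deriv_def)
  qed
  then have "jacobian_matrix d c y = matrix D" by (simp add: vec_eq_iff matrix_def)
  then show ?thesis using D has_derivative_linear[OF D] by (simp add: matrix_works)
qed

lemma chart_change_derivative:
  assumes c: "c \<in> A" "d \<in> A" and y: "y \<in> fst c \<inter> fst d"
    and F: "((F \<circ> ic c) has_derivative D) (at (snd c y) within snd c ` fst c)"
  shows "((F \<circ> ic d) has_derivative (\<lambda>h. D (jacobian_matrix d c y *v h))) (at (snd d y) within snd d ` fst d)"
proof -
  let ?E = "snd d ` (fst d \<inter> fst c)"
  have yE: "snd d y \<in> ?E" using y by blast
  have im: "(snd c \<circ> ic d) ` ?E \<subseteq> snd c ` fst c" using ic_snd[OF c(2)] by auto
  have e: "(snd c \<circ> ic d) (snd d y) = snd c y" using ic_snd[OF c(2)] y by simp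
  have "((F \<circ> ic c) has_derivative D) (at ((snd c \<circ> ic d) (snd d y)) within (snd c \<circ> ic d) ` ?E)"
    unfolding e by (rule has_derivative_subset[OF F im])
  from diff_chain_within[OF transition_derivative[OF c y] this]
  have "((F \<circ> ic c) \<circ> (snd c \<circ> ic d) has_derivative D \<circ> (\<lambda>h. jacobian_matrix d c y *v h)) (at (snd d y) within ?E)" .
  moreover have "((F \<circ> ic c) \<circ> (snd c \<circ> ic d)) z = (F \<circ> ic d) z" if "z \<in> ?E" for z
    using that ic_snd[OF c(2)] ic_snd[OF c(1)] by auto
  ultimately have "((F \<circ> ic d) has_derivative D \<circ> (\<lambda>h. jacobian_matrix d c y *v h)) (at (snd d y) within ?E)"
    using has_derivative_cong_on[OF yE, of "(F \<circ> ic c) \<circ> (snd c \<circ> ic d)" "F \<circ> ic d"] by blast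
  then show ?thesis
    using chart_within[OF c(2) chart_openin[OF c(1)], of y] y by (simp add: o_def)
qed

definition covariant :: "('p chart \<Rightarrow> 2 \<Rightarrow> 'p \<Rightarrow> dmat) \<Rightarrow> bool" where
  "covariant \<Omega> \<longleftrightarrow> (\<forall>c\<in>A. \<forall>d\<in>A. \<forall>x\<in>fst c \<inter> fst d. \<forall>i. \<Omega> c i x = (\<Sum>j\<in>UNIV. jacobian_matrix c d x $ j $ i *\<^sub>R \<Omega> d j x))"

lemma pform_change:
  assumes "covariant \<Omega>" "c \<in> A" "d \<in> A" "x \<in> fst c \<inter> fst d"
  shows "pform \<Omega> d x h = pform \<Omega> c x (jacobian_matrix d c x *v h)"
proof -
  have "\<Omega> d i x = (\<Sum>j\<in>UNIV. jacobian_matrix d c x $ j $ i *\<^sub>R \<Omega> c j x)" for i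
    using assms unfolding covariant_def by blast
  then show ?thesis by (simp add: pform_def sum_2 matrix_vector_mult_def algebra_simps)
qed

text \<open>A condition at the single point \<open>y\<close>. For germs it suffices to know it for
  \<open>T y\<close> at \<open>y\<close>: the cocycle identity carries it to \<open>T x\<close> at
  points \<open>y\<close> near \<open>x\<close>.\<close>

definition prim_at :: "('p chart \<Rightarrow> 2 \<Rightarrow> 'p \<Rightarrow> dmat) \<Rightarrow> ('p \<Rightarrow> dmat) \<Rightarrow> 'p \<Rightarrow> bool" where
  "prim_at \<Omega> P y \<longleftrightarrow> (\<forall>c\<in>A. y \<in> fst c \<longrightarrow>
     ((P \<circ> ic c) has_derivative (\<lambda>h. P y * pform \<Omega> c y h)) (at (snd c y) within snd c ` fst c))"

lemma prim_atI:
  assumes "covariant \<Omega>" "c \<in> A" "y \<in> fst c"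
    and "((P \<circ> ic c) has_derivative (\<lambda>h. P y * pform \<Omega> c y h)) (at (snd c y) within snd c ` fst c)"
  shows "prim_at \<Omega> P y"
  unfolding prim_at_def
proof (intro ballI impI)
  fix d assume d: "d \<in> A" "y \<in> fst d"
  then have y: "y \<in> fst c \<inter> fst d" using assms by blast
  show "((P \<circ> ic d) has_derivative (\<lambda>h. P y * pform \<Omega> d y h)) (at (snd d y) within snd d ` fst d)"
    using chart_change_derivative[OF assms(2) d(1) y assms(4)]
    by (simp add: pform_change[OF assms(1,2) d(1) y])
qed

lemma prim_at_cong:
  assumes P: "prim_at \<Omega> P y" and U: "openin (top_of_set N) U" "y \<in> U" and e: "\<And>w. w \<in> U \<Longrightarrow> Q w = P w"
  shows "prim_at \<Omega> Q y"
  unfolding prim_at_def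
proof (intro ballI impI)
  fix c assume c: "c \<in> A" "y \<in> fst c"
  have "((P \<circ> ic c) has_derivative (\<lambda>h. P y * pform \<Omega> c y h)) (at (snd c y) within snd c ` (fst c \<inter> U))"
  proof -
    have "((P \<circ> ic c) has_derivative (\<lambda>h. P y * pform \<Omega> c y h)) (at (snd c y) within snd c ` fst c)"
      using P c unfolding prim_at_def by blast
    then show ?thesis by (simp only: chart_within[OF c(1) U(1) c(2) U(2)])
  qed
  then have "((Q \<circ> ic c) has_derivative (\<lambda>h. P y * pform \<Omega> c y h)) (at (snd c y) within snd c ` (fst c \<inter> U))"
    by (rule has_derivative_transform[rotated 2]) (use c U e ic_snd[OF c(1)] in auto)
  then show "((Q \<circ> ic c) has_derivative (\<lambda>h. Q y * pform \<Omega> c y h)) (at (snd c y) within snd c ` fst c)"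
    unfolding chart_within[OF c(1) U(1) c(2) U(2)] e[OF U(2)] .
qed

lemma prim_at_left_mult:
  assumes "prim_at \<Omega> P y" shows "prim_at \<Omega> (\<lambda>w. X * P w) y"
  unfolding prim_at_def
proof (intro ballI impI)
  fix c assume c: "c \<in> A" "y \<in> fst c"
  have "((P \<circ> ic c) has_derivative (\<lambda>h. P y * pform \<Omega> c y h)) (at (snd c y) within snd c ` fst c)"
    using assms c unfolding prim_at_def by blast
  from has_derivative_mult_right[OF this, of X]
  show "((\<lambda>w. X * P w) \<circ> ic c has_derivative (\<lambda>h. X * P y * pform \<Omega> c y h)) (at (snd c y) within snd c ` fst c)"
    by (simp add: o_def mult.assoc)
qed

definition skew :: "('p chart \<Rightarrow> 2 \<Rightarrow> 'p \<Rightarrow> dmat) \<Rightarrow> bool" where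
  "skew \<Omega> \<longleftrightarrow> (\<forall>c\<in>A. \<forall>i. \<forall>x\<in>fst c. dadj (\<Omega> c i x) = - \<Omega> c i x)"

lemma skew_pform: "skew \<Omega> \<Longrightarrow> c \<in> A \<Longrightarrow> x \<in> fst c \<Longrightarrow> dadj (pform \<Omega> c x h) = - pform \<Omega> c x h"
  by (simp add: skew_def pform_def dadj_sum dadj_scaleR sum_negf)

text \<open>In coordinates the patch is convex, so the quotient of the two primitives, having
  derivative zero, is constant on it.\<close>

lemma prim_unique_patch:
  assumes sk: "skew \<Omega>" and c: "c \<in> A" "x \<in> fst c"
    and r: "r > 0" "ball (snd c x) r \<inter> half_plane \<subseteq> snd c ` fst c"
    and P: "\<And>y. y \<in> patch c x r \<Longrightarrow> prim_at \<Omega> P y" and Q: "\<And>y. y \<in> patch c x r \<Longrightarrow> prim_at \<Omega> Q y"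
    and y: "y \<in> patch c x r"
  shows "P y * dadj (Q y) = P x * dadj (Q x)"
proof -
  let ?Z = "ball (snd c x) r \<inter> half_plane"
  have Z: "convex ?Z" using convex_half_plane by (intro convex_Int) auto
  have d: "((\<lambda>z. (P \<circ> ic c) z * dadj ((Q \<circ> ic c) z)) has_derivative (\<lambda>h. 0)) (at z within ?Z)" if z: "z \<in> ?Z" for z
  proof -
    have zc: "z \<in> snd c ` fst c" using r(2) z by blast
    have i: "ic c z \<in> fst c" "snd c (ic c z) = z" using ic_in[OF zc] snd_ic[OF zc] by auto
    have ip: "ic c z \<in> patch c x r" using z by (simp add: patch_def)
    have 1: "(P \<circ> ic c has_derivative (\<lambda>h. (P \<circ> ic c) z * pform \<Omega> c (ic c z) h)) (at z within ?Z)"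
      using P[OF ip] c(1) i r(2) has_derivative_subset unfolding prim_at_def by fastforce
    have 2: "(Q \<circ> ic c has_derivative (\<lambda>h. (Q \<circ> ic c) z * pform \<Omega> c (ic c z) h)) (at z within ?Z)"
      using Q[OF ip] c(1) i r(2) has_derivative_subset unfolding prim_at_def by fastforce
    show ?thesis by (rule has_derivative_mult_dadj[OF 1 2 skew_pform[OF sk c(1) i(1)]])
  qed
  obtain k where k: "\<And>z. z \<in> ?Z \<Longrightarrow> (P \<circ> ic c) z * dadj ((Q \<circ> ic c) z) = k"
    using has_derivative_zero_constant[OF Z d] by blast
  have "snd c x \<in> ?Z" "snd c y \<in> ?Z" "y \<in> fst c"
    using y chart_in_half_plane[OF c(1)] c r(1) unfolding patch(1)[OF c r] by auto
  then show ?thesis using k[of "snd c x"] k[of "snd c y"] ic_snd[OF c(1)] c(2) by simp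
qed

lemma flat_form_parts:
  "flat_form \<Omega> \<Longrightarrow> covariant \<Omega>" "flat_form \<Omega> \<Longrightarrow> skew \<Omega>"
  "flat_form \<Omega> \<Longrightarrow> c \<in> A \<Longrightarrow> smooth_on (snd c ` fst c) (\<Omega> c i \<circ> ic c)"
  unfolding flat_form_def covariant_def skew_def smooth_in_chart_def by blast+

text \<open>A closed half-ball in a chart is compact and convex, as \<open>flat_primitive\<close>
  demands. The solution found there is then restricted to an open patch, where derivatives within
  the half-ball are derivatives within the whole chart.\<close>

lemma prim_exists:
  assumes \<Omega>: "flat_form \<Omega>" and x: "x \<in> N"
  shows "\<exists>U P. nice N U \<and> x \<in> U \<and> P x = 1 \<and> (\<forall>y\<in>U. P y \<in> dgroup \<and> prim_at \<Omega> P y)"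
proof -
  obtain c where c: "c \<in> A" "x \<in> fst c" using chart_covers[OF x] .
  obtain r0 where r0: "r0 > 0" "cball (snd c x) r0 \<inter> half_plane \<subseteq> snd c ` fst c"
    using patch_exists[OF c openin_subtopology_self x] by metis
  define S where "S = cball (snd c x) r0 \<inter> half_plane"
  define W where "W i = \<Omega> c i \<circ> ic c" for i
  define W' where "W' i z = frechet_derivative (W i) (at z within snd c ` fst c)" for i z
  note am = chart_ample[OF c(1)]
  have S: "compact S" "convex S" "snd c x \<in> S" "S \<subseteq> snd c ` fst c"
    using r0 closed_half_plane convex_half_plane chart_in_half_plane[OF c]
    by (auto simp: S_def intro!: convex_Int compact_Int_closed)
  have "Ck_on (Suc 0) (snd c ` fst c) (W i)" for i
    unfolding W_def by (rule smooth_onD[OF flat_form_parts(3)[OF \<Omega> c(1)]])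
  then have "\<exists>f'. (\<forall>z\<in>snd c ` fst c. (W i has_derivative f' z) (at z within snd c ` fst c)) \<and>
      (\<forall>v. continuous_on (snd c ` fst c) (\<lambda>z. f' z v))" for i
    by (simp only: Ck_on.simps)
  then obtain f' where f': "\<And>i z. z \<in> snd c ` fst c \<Longrightarrow> (W i has_derivative f' i z) (at z within snd c ` fst c)"
    "\<And>i v. continuous_on (snd c ` fst c) (\<lambda>z. f' i z v)" by metis
  have e: "W' i z = f' i z" if "z \<in> snd c ` fst c" for i z
    unfolding W'_def by (rule ample_frechet_derivative[OF am that f'(1)[OF that]])
  have W'c: "(W i has_derivative W' i z) (at z within snd c ` fst c)" if "z \<in> snd c ` fst c" for i z
    unfolding e[OF that] by (rule f'(1)[OF that])
  have cW'c: "continuous_on (snd c ` fst c) (\<lambda>z. W' i z v)" for i v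
    by (rule continuous_on_eq[OF f'(2)[of i v]]) (simp add: e)
  have flat: "W' 2 z (axis 1 1) - W' 1 z (axis 2 1) + W 1 z * W 2 z - W 2 z * W 1 z = 0" if "z \<in> S" for z
  proof -
    have z: "z \<in> snd c ` fst c" using S(4) that by blast
    have "chart_deriv c 1 (\<Omega> c 2) (ic c z) - chart_deriv c 2 (\<Omega> c 1) (ic c z)
        + \<Omega> c 1 (ic c z) * \<Omega> c 2 (ic c z) - \<Omega> c 2 (ic c z) * \<Omega> c 1 (ic c z) = 0"
      using \<Omega> c(1) ic_in[OF z] unfolding flat_form_def by blast
    then show ?thesis by (simp add: chart_deriv_def snd_ic[OF z] W'_def W_def)
  qed
  have W'S: "(W i has_derivative W' i z) (at z within S)" if "z \<in> S" for i z
    by (rule has_derivative_subset[OF W'c S(4)]) (use that S(4) in blast)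
  have cS: "continuous_on S (\<lambda>z. W' i z v)" for i v
    by (rule continuous_on_subset[OF cW'c S(4)])
  obtain r g where r: "r > 0" and g1: "g (snd c x) = 1"
    and g: "\<And>z. z \<in> S \<inter> cball (snd c x) r \<Longrightarrow>
      (g has_derivative (\<lambda>h. g z * (\<Sum>i\<in>UNIV. h $ i *\<^sub>R W i z))) (at z within S \<inter> cball (snd c x) r)"
    using flat_primitive[OF S(1-3) W'S cS flat] by blast
  define r1 where "r1 = min r r0"
  have r1: "r1 > 0" "ball (snd c x) r1 \<inter> half_plane \<subseteq> snd c ` fst c"
    using r r0 by (auto simp: r1_def)
  define S1 where "S1 = S \<inter> cball (snd c x) r"
  have S1: "convex S1" "snd c x \<in> S1" using S r by (auto simp: S1_def convex_Int)
  have pf: "(\<Sum>i\<in>UNIV. h $ i *\<^sub>R W i z) = pform \<Omega> c (ic c z) h" for h z by (simp add: pform_def W_def)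
  \<comment> \<open>The primitive is a priori only an element of the algebra. Because the form is
    skew, \<open>g z * dadj (g z)\<close> is constant, and it equals 1 at the centre; so the values
    lie in the group.\<close>
  have d: "((\<lambda>z. g z * dadj (g z)) has_derivative (\<lambda>h. 0)) (at z within S1)" if z: "z \<in> S1" for z
  proof -
    have "ic c z \<in> fst c" using z S(4) ic_in by (auto simp: S1_def)
    then show ?thesis
      using has_derivative_mult_dadj[OF g g skew_pform[OF flat_form_parts(2)[OF \<Omega>] c(1), of "ic c z", folded pf]] z
      by (simp add: S1_def)
  qed
  obtain k where k: "\<And>z. z \<in> S1 \<Longrightarrow> g z * dadj (g z) = k"
    using has_derivative_zero_constant[OF S1(1) d] by blast
  then have gg: "g z \<in> dgroup" if "z \<in> S1" for z using k[OF that] k[OF S1(2)] g1 by (simp add: dgroup_def)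
  define P where "P y = g (snd c y)" for y
  note pt = patch[OF c r1]
  show ?thesis
  proof (intro exI[of _ "patch c x r1"] exI[of _ P] conjI ballI)
    show "nice N (patch c x r1)" "x \<in> patch c x r1" using pt by auto
    show "P x = 1" using g1 by (simp add: P_def)
    fix y assume y: "y \<in> patch c x r1"
    then have yc: "y \<in> fst c" "snd c y \<in> ball (snd c x) r1" unfolding pt(1) by auto
    then have yS: "snd c y \<in> S1" using chart_in_half_plane[OF c(1) yc(1)] by (auto simp: S1_def S_def r1_def)
    then show "P y \<in> dgroup" using gg by (simp add: P_def)
    have eq: "S1 \<inter> ball (snd c x) r1 = snd c ` fst c \<inter> ball (snd c x) r1"
      using r1(2) S(4) openin_imp_subset[OF chart_openin_image[OF c(1)]]
      by (auto simp: S1_def S_def r1_def)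
    have w: "at (snd c y) within S1 = at (snd c y) within snd c ` fst c"
      using at_within_Int_open[of "ball (snd c x) r1" "snd c y" S1]
        at_within_Int_open[of "ball (snd c x) r1" "snd c y" "snd c ` fst c"] yc(2) eq by simp
    have "(g has_derivative (\<lambda>h. g (snd c y) * pform \<Omega> c (ic c (snd c y)) h)) (at (snd c y) within snd c ` fst c)"
      using g yS unfolding w[symmetric] by (simp add: S1_def pf)
    then have "(g has_derivative (\<lambda>h. P y * pform \<Omega> c y h)) (at (snd c y) within snd c ` fst c)"
      by (simp add: P_def ic_snd[OF c(1) yc(1)])
    then have "((P \<circ> ic c) has_derivative (\<lambda>h. P y * pform \<Omega> c y h)) (at (snd c y) within snd c ` fst c)"
      by (rule has_derivative_transform[rotated 2]) (use yc in \<open>auto simp: P_def snd_ic\<close>)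
    then show "prim_at \<Omega> P y" by (rule prim_atI[OF flat_form_parts(1)[OF \<Omega>] c(1) yc(1)])
  qed
qed

lemma prim_at_tendsto:
  assumes "prim_at \<Omega> P x" "x \<in> N"
  shows "(P \<longlongrightarrow> P x) (at x within N)"
proof -
  obtain c where c: "c \<in> A" "x \<in> fst c" using chart_covers[OF assms(2)] .
  have "((P \<circ> ic c) has_derivative (\<lambda>h. P x * pform \<Omega> c x h)) (at (snd c x) within snd c ` fst c)"
    using assms(1) c unfolding prim_at_def by blast
  then have 1: "continuous (at (snd c x) within snd c ` fst c) (P \<circ> ic c)"
    by (rule has_derivative_continuous)
  have 2: "filterlim (snd c) (at (snd c x) within snd c ` fst c) (at x within fst c)"
    unfolding filterlim_at
  proof
    show "\<forall>\<^sub>F y in at x within fst c. snd c y \<in> snd c ` fst c \<and> snd c y \<noteq> snd c x"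
      unfolding eventually_at_filter
      using inj_onD[OF chart_homeo(1)[OF c(1)] _ _ c(2)] by (intro always_eventually) auto
    show "(snd c \<longlongrightarrow> snd c x) (at x within fst c)"
      using chart_homeo(2)[OF c(1)] c(2) by (simp add: continuous_on_def)
  qed
  have "((\<lambda>y. (P \<circ> ic c) (snd c y)) \<longlongrightarrow> P x) (at x within fst c)"
    using filterlim_compose[OF 1[unfolded continuous_within] 2] ic_snd[OF c] by simp
  moreover have "eventually (\<lambda>y. (P \<circ> ic c) (snd c y) = P y) (at x within fst c)"
    unfolding eventually_at_filter using ic_snd[OF c(1)] by (intro always_eventually) simp
  ultimately have "(P \<longlongrightarrow> P x) (at x within fst c)" by (rule Lim_transform_eventually)
  moreover obtain Q where "open Q" "fst c = N \<inter> Q" using chart_openin[OF c(1)] by (auto simp: openin_open)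
  then have "at x within fst c = at x within N" using at_within_Int_open[of Q x N] c(2) by simp
  ultimately show ?thesis by simp
qed

text \<open>The cocycle identity is uniqueness of primitives: near \<open>y\<close> both
  \<open>T x\<close> and \<open>T x y * T y\<close> are primitives, and they agree at
  \<open>y\<close>.\<close>

lemma germ_exists:
  assumes \<Omega>: "flat_form \<Omega>"
  shows "\<exists>T. germ_transport N T \<and> (\<forall>x\<in>N. prim_at \<Omega> (T x) x)"
proof -
  have "\<forall>x\<in>N. \<exists>U P. nice N U \<and> x \<in> U \<and> P x = 1 \<and> (\<forall>y\<in>U. P y \<in> dgroup \<and> prim_at \<Omega> P y)"
    using prim_exists[OF \<Omega>] by blast
  from bchoice[OF this] obtain U where
    "\<forall>x\<in>N. \<exists>P. nice N (U x) \<and> x \<in> U x \<and> P x = 1 \<and> (\<forall>y\<in>U x. P y \<in> dgroup \<and> prim_at \<Omega> P y)" ..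
  from bchoice[OF this] obtain P where
    "\<forall>x\<in>N. nice N (U x) \<and> x \<in> U x \<and> P x x = 1 \<and> (\<forall>y\<in>U x. P x y \<in> dgroup \<and> prim_at \<Omega> (P x) y)" ..
  then have UP: "\<And>x. x \<in> N \<Longrightarrow> nice N (U x)" "\<And>x. x \<in> N \<Longrightarrow> x \<in> U x" "\<And>x. x \<in> N \<Longrightarrow> P x x = 1"
    "\<And>x y. x \<in> N \<Longrightarrow> y \<in> U x \<Longrightarrow> P x y \<in> dgroup" "\<And>x y. x \<in> N \<Longrightarrow> y \<in> U x \<Longrightarrow> prim_at \<Omega> (P x) y"
    by blast+
  have Uo: "openin (top_of_set N) (U x)" if "x \<in> N" for x using UP(1)[OF that] by (simp add: nice_def)
  \<comment> \<open>The default value 1 outside the domain keeps \<open>T\<close> in the group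
    everywhere, as the locale demands.\<close>
  define T where "T x y = (if x \<in> N \<and> y \<in> U x then P x y else 1)" for x y
  have prim: "prim_at \<Omega> (T x) y" if "x \<in> N" "y \<in> U x" for x y
    by (rule prim_at_cong[OF UP(5)[OF that] Uo[OF that(1)] that(2)]) (simp add: T_def that)
  have coc: "near N y (\<lambda>w. T x w = T x y * T y w)" if x: "x \<in> N" and y: "y \<in> U x" for x y
  proof -
    have yN: "y \<in> N" using openin_imp_subset[OF Uo[OF x]] y by blast
    obtain c where c: "c \<in> A" "y \<in> fst c" using chart_covers[OF yN] .
    have o: "openin (top_of_set N) (U x \<inter> U y)" using Uo x yN by blast
    have "y \<in> U x \<inter> U y" using y UP(2)[OF yN] by blast
    then obtain r where r: "r > 0" "ball (snd c y) r \<inter> half_plane \<subseteq> snd c ` fst c" "patch c y r \<subseteq> U x \<inter> U y"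
      using patch_exists[OF c o] by metis
    note pt = patch[OF c r(1,2)]
    show ?thesis
    proof (rule nearI[OF pt(2,3)])
      fix w assume w: "w \<in> patch c y r"
      have "T x w * dadj (T y w) = T x y * dadj (T y y)"
        by (rule prim_unique_patch[OF flat_form_parts(2)[OF \<Omega>] c r(1,2) prim[OF x] prim[OF yN] w]) (use r(3) in blast)+
      moreover have "T y w \<in> dgroup" using w r(3) UP(4)[OF yN] by (auto simp: T_def)
      moreover have "T y y = 1" using UP(2,3)[OF yN] by (simp add: T_def)
      ultimately show "T x w = T x y * T y w" by (metis dadj_one dgroup_right mult.assoc mult_1_right)
    qed
  qed
  have "germ_transport N T"
  proof
    show "T x y \<in> dgroup" for x y using UP(4) by (simp add: T_def)
    fix x assume x: "x \<in> N"
    show T1: "T x x = 1" using UP(2,3)[OF x] by (simp add: T_def)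
    show "near N x (\<lambda>y. near N y (\<lambda>w. T x w = T x y * T y w))"
      by (rule nearI[OF Uo[OF x] UP(2)[OF x]]) (rule coc[OF x])
    show "(T x \<longlongrightarrow> 1) (at x within N)"
      using prim_at_tendsto[OF prim[OF x UP(2)[OF x]] x] T1 by simp
  qed
  then show ?thesis using prim UP(2) by blast
qed

lemma curve_derivative:
  fixes p :: "real \<Rightarrow> 'p" and P :: "'p \<Rightarrow> 'b::real_normed_vector"
  assumes c: "c \<in> A" and p: "continuous_on I p" "p ` I \<subseteq> N" and s: "s \<in> I" "p s \<in> fst c"
    and v: "((snd c \<circ> p) has_vector_derivative v) (at s within I)"
    and P: "((P \<circ> ic c) has_derivative D) (at (snd c (p s)) within snd c ` fst c)"
  shows "((\<lambda>t. P (p t)) has_vector_derivative D v) (at s within I)"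
proof -
  have "openin (top_of_set I) (I \<inter> p -` fst c)"
    using continuous_openin_preimage[OF p(1) _ chart_openin[OF c]] p(2) by auto
  then obtain Q where Q: "open Q" "I \<inter> p -` fst c = I \<inter> Q" by (auto simp: openin_open)
  have sQ: "s \<in> Q" "s \<in> I \<inter> Q" using Q(2) s by blast+
  have w: "at s within I \<inter> Q = at s within I" by (rule at_within_Int_open[OF Q(1) sQ(1)])
  have "((snd c \<circ> p) has_derivative (\<lambda>h. h *\<^sub>R v)) (at s within I \<inter> Q)"
    using v unfolding w has_vector_derivative_def .
  moreover have "((P \<circ> ic c) has_derivative D) (at ((snd c \<circ> p) s) within (snd c \<circ> p) ` (I \<inter> Q))"
    by (simp, rule has_derivative_subset[OF P]) (use Q(2) in auto)
  ultimately have "((P \<circ> ic c) \<circ> (snd c \<circ> p) has_derivative D \<circ> (\<lambda>h. h *\<^sub>R v)) (at s within I \<inter> Q)"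
    by (rule diff_chain_within)
  moreover have "P (p t) = ((P \<circ> ic c) \<circ> (snd c \<circ> p)) t" if "t \<in> I \<inter> Q" for t
  proof -
    have "p t \<in> fst c" using Q(2) that by blast
    then show ?thesis using ic_snd[OF c] by simp
  qed
  ultimately have "((\<lambda>t. P (p t)) has_derivative D \<circ> (\<lambda>h. h *\<^sub>R v)) (at s within I \<inter> Q)"
    by (rule has_derivative_transform[OF sQ(2), rotated])
  moreover have "D \<circ> (\<lambda>h. h *\<^sub>R v) = (\<lambda>h. h *\<^sub>R D v)"
    using has_derivative_linear[OF P] by (auto simp: linear_cmul)
  ultimately show ?thesis unfolding w has_vector_derivative_def by simp
qed

end

section \<open>Flat sections over the universal cover\<close>

definition (in germ_transport) flat_section :: "'p \<Rightarrow> ((real \<Rightarrow> 'p) set \<Rightarrow> dmat) \<Rightarrow> bool" where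
  "flat_section x0 G \<longleftrightarrow> (\<forall>\<alpha>\<in>ucover N x0. G \<alpha> \<in> dgroup \<and>
     (\<exists>U. openin (top_of_set N) U \<and> endpt \<alpha> \<in> U \<and> (\<forall>\<beta>\<in>cover_nbhd N \<alpha> U. G \<beta> = G \<alpha> * T (endpt \<alpha>) (endpt \<beta>))))"

context germ_transport
begin

lemma flat_section_compose:
  assumes G: "flat_section x0 G" and f: "continuous_map (top_of_set I) (ucover_topology N x0) f"
  shows "parallel I (\<lambda>s. endpt (f s)) (\<lambda>s. G (f s))"
  unfolding parallel_def
proof (intro ballI conjI)
  fix s assume s: "s \<in> I"
  then have fs: "f s \<in> ucover N x0" using continuous_map_image_subset_topspace[OF f] by auto
  then show "G (f s) \<in> dgroup" using G by (simp add: flat_section_def)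
  obtain U where U: "openin (top_of_set N) U" "endpt (f s) \<in> U"
    "\<forall>\<beta>\<in>cover_nbhd N (f s) U. G \<beta> = G (f s) * T (endpt (f s)) (endpt \<beta>)"
    using G fs unfolding flat_section_def by blast
  have "openin (top_of_set I) {t \<in> topspace (top_of_set I). f t \<in> cover_nbhd N (f s) U}"
    by (rule openin_continuous_map_preimage[OF f openin_cover_nbhd[OF fs U(1)]])
  then show "near I s (\<lambda>t. G (f t) = G (f s) * T (endpt (f s)) (endpt (f t)))"
  proof (rule nearI)
    show "s \<in> {t \<in> topspace (top_of_set I). f t \<in> cover_nbhd N (f s) U}"
      using s cover_nbhd_self[OF fs U(2)] by simp
    fix t assume "t \<in> {t \<in> topspace (top_of_set I). f t \<in> cover_nbhd N (f s) U}"
    then have "f t \<in> cover_nbhd N (f s) U" by simp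
    then show "G (f t) = G (f s) * T (endpt (f s)) (endpt (f t))" by (rule bspec[OF U(3)])
  qed
qed

text \<open>Along the lift of \<open>p\<close> a flat section is parallel and starts at 1, so
  uniqueness of parallel functions identifies it with the transport. Flat sections normalized at the
  constant loop are thereby determined.\<close>

lemma flat_section_plift:
  assumes G: "flat_section x0 G" "G (hclass N (\<lambda>_. x0)) = 1"
    and p: "path p" "path_image p \<subseteq> N" "pathstart p = x0" and s: "s \<in> {0..1}"
  shows "G (path_lift N p s) = plift p s"
proof -
  note pl = path_lift[OF p(1,2), unfolded p(3)]
  have "parallel {0..1} (\<lambda>s. endpt (path_lift N p s)) (\<lambda>s. G (path_lift N p s))"
    by (rule flat_section_compose[OF G(1) pl(6)])
  moreover have "near {0..1} z (\<lambda>w. G (path_lift N p w) = G (path_lift N p z) * T (p z) (p w))"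
    if "near {0..1} z (\<lambda>w. G (path_lift N p w) = G (path_lift N p z) * T (endpt (path_lift N p z)) (endpt (path_lift N p w)))"
      "z \<in> {0..1}" for z
    using that(1) by (rule near_mono) (use pl(2) that(2) in simp)
  ultimately have "parallel {0..1} p (\<lambda>s. G (path_lift N p s))" unfolding parallel_def by blast
  then show ?thesis
    by (rule plift_eqI[OF p(1,2), symmetric]) (use pl(3) G(2) s in auto)
qed

definition holo :: "(real \<Rightarrow> 'p) set \<Rightarrow> dmat" where
  "holo \<alpha> = plift (SOME p. p \<in> \<alpha>) 1"

lemma holo_eq:
  assumes "\<alpha> \<in> ucover N x0" "p \<in> \<alpha>"
  shows "holo \<alpha> = plift p 1" "hclass SL2 (\<lambda>s. dre (plift (SOME p. p \<in> \<alpha>) s)) = hclass SL2 (\<lambda>s. dre (plift p s))"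
proof -
  have s: "(SOME p. p \<in> \<alpha>) \<in> \<alpha>" using someI[of "\<lambda>p. p \<in> \<alpha>", OF assms(2)] .
  have h: "homotopic_paths N (SOME p. p \<in> \<alpha>) p"
    using hclass_eqD ucoverD[OF assms(1) s] ucoverD[OF assms(1,2)] by metis
  show "holo \<alpha> = plift p 1" unfolding holo_def by (rule plift_homotopic(1)[OF h])
  show "hclass SL2 (\<lambda>s. dre (plift (SOME p. p \<in> \<alpha>) s)) = hclass SL2 (\<lambda>s. dre (plift p s))"
    by (rule hclass_eqI[OF plift_homotopic(2)[OF h]])
qed

lemma holo_flat_section: "flat_section x0 holo"
  unfolding flat_section_def
proof (intro ballI conjI)
  fix \<alpha> assume \<alpha>: "\<alpha> \<in> ucover N x0"
  obtain p where p: "p \<in> \<alpha>" using \<alpha> by (rule ucover_nonempty)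
  note pD = ucoverD[OF \<alpha> p]
  show "holo \<alpha> \<in> dgroup" unfolding holo_eq(1)[OF \<alpha> p] by (rule plift_group[OF pD(1,2)]) simp
  obtain U where U: "openin (top_of_set N) U" "endpt \<alpha> \<in> U"
    "\<And>y. y \<in> U \<Longrightarrow> near N y (\<lambda>w. T (endpt \<alpha>) w = T (endpt \<alpha>) y * T y w)"
    using T_domain[OF endpt_in[OF \<alpha>]] by metis
  have UN: "U \<subseteq> N" using openin_imp_subset[OF U(1)] .
  have "holo \<beta> = holo \<alpha> * T (endpt \<alpha>) (endpt \<beta>)" if \<beta>: "\<beta> \<in> cover_nbhd N \<alpha> U" for \<beta>
  proof -
    obtain q where q: "\<beta> = extend N \<alpha> q" "path q" "path_image q \<subseteq> U" "pathstart q = endpt \<alpha>"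
      using \<beta> unfolding cover_nbhd_def by blast
    have adm: "admissible N \<alpha> q" using admissible_subset[OF q(2,3) UN q(4)] .
    have e: "endpt \<beta> = pathfinish q" unfolding q(1) by (rule extend_in_ucover(2)[OF \<alpha> adm])
    have \<beta>u: "\<beta> \<in> ucover N x0" unfolding q(1) by (rule extend_in_ucover(1)[OF \<alpha> adm])
    have b: "\<beta> = hclass N (p +++ q)" unfolding q(1) by (rule extend_eq[OF \<alpha> p adm])
    have j: "path (p +++ q)" "path_image (p +++ q) \<subseteq> N"
      using pD q UN by (auto simp: path_image_join)
    have "p +++ q \<in> \<beta>" unfolding b by (rule hclass_self[OF j])
    then have "holo \<beta> = plift (p +++ q) 1" by (rule holo_eq(1)[OF \<beta>u])
    also have "\<dots> = plift p 1 * plift q 1"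
      using plift_join[OF pD(1,2) q(2) _ _, of 1] q(3,4) UN pD(5) by auto
    also have "plift q 1 = T (endpt \<alpha>) (q 1)" by (rule plift_T[OF q(2,3) UN U(3) q(4)]) auto
    finally show ?thesis unfolding holo_eq(1)[OF \<alpha> p] e by (simp add: pathfinish_def)
  qed
  then show "\<exists>U. openin (top_of_set N) U \<and> endpt \<alpha> \<in> U \<and> (\<forall>\<beta>\<in>cover_nbhd N \<alpha> U. holo \<beta> = holo \<alpha> * T (endpt \<alpha>) (endpt \<beta>))"
    using U by blast
qed

end

context surface
begin

lemma flat_section_derivative:
  assumes T: "germ_transport N T" "\<forall>x\<in>N. prim_at \<Omega> (T x) x" and G: "germ_transport.flat_section N T x0 G"
    and k: "k \<in> A" "K \<in> lifted_charts N x0 k" "\<alpha> \<in> fst K"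
  shows "((G \<circ> inv_into (fst K) (snd K)) has_derivative (\<lambda>h. G \<alpha> * pform \<Omega> k (endpt \<alpha>) h)) (at (snd K \<alpha>) within snd K ` fst K)"
proof -
  interpret germ_transport N T by (rule T(1))
  note L = lifted_chart[OF k(1,2)]
  have \<alpha>: "\<alpha> \<in> ucover N x0" using L(3) k(3) by blast
  note eN = endpt_in[OF \<alpha>]
  obtain U where U: "openin (top_of_set N) U" "endpt \<alpha> \<in> U"
    "\<forall>\<beta>\<in>cover_nbhd N \<alpha> U. G \<beta> = G \<alpha> * T (endpt \<alpha>) (endpt \<beta>)"
    using G \<alpha> unfolding flat_section_def by blast
  have ek: "endpt \<alpha> \<in> fst k" using L(4) k(3) by blast
  have "prim_at \<Omega> (\<lambda>y. G \<alpha> * T (endpt \<alpha>) y) (endpt \<alpha>)"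
    using prim_at_left_mult T(2) eN by blast
  then have "((\<lambda>y. G \<alpha> * T (endpt \<alpha>) y) \<circ> ic k has_derivative (\<lambda>h. G \<alpha> * T (endpt \<alpha>) (endpt \<alpha>) * pform \<Omega> k (endpt \<alpha>) h))
      (at (snd k (endpt \<alpha>)) within snd k ` fst k)"
    using k(1) ek unfolding prim_at_def by blast
  then show ?thesis
    using sheet_derivative_iff[OF k U(1,2), of G "\<lambda>y. G \<alpha> * T (endpt \<alpha>) y"] U(3) T_self[OF eN] by simp
qed

text \<open>The converse of \<open>flat_section_derivative\<close>: read on the surface through one
  sheet, \<open>G\<close> and \<open>T (endpt \<alpha>)\<close> are primitives on a common patch,
  hence proportional by a constant left factor.\<close>

lemma flat_sectionI:
  assumes \<Omega>: "covariant \<Omega>" "skew \<Omega>"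
    and T: "germ_transport N T" "\<forall>x\<in>N. prim_at \<Omega> (T x) x"
    and Gg: "\<And>\<alpha>. \<alpha> \<in> ucover N x0 \<Longrightarrow> G \<alpha> \<in> dgroup"
    and G: "\<And>k K \<alpha>. k \<in> A \<Longrightarrow> K \<in> lifted_charts N x0 k \<Longrightarrow> \<alpha> \<in> fst K \<Longrightarrow>
      ((G \<circ> inv_into (fst K) (snd K)) has_derivative (\<lambda>h. G \<alpha> * pform \<Omega> k (endpt \<alpha>) h)) (at (snd K \<alpha>) within snd K ` fst K)"
  shows "germ_transport.flat_section N T x0 G"
proof -
  interpret germ_transport N T by (rule T(1))
  show ?thesis
    unfolding flat_section_def
  proof (intro ballI conjI Gg)
    fix \<alpha> assume \<alpha>: "\<alpha> \<in> ucover N x0"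
    let ?x = "endpt \<alpha>"
    have x: "?x \<in> N" by (rule endpt_in[OF \<alpha>])
    obtain U0 where U0: "openin (top_of_set N) U0" "?x \<in> U0"
      "\<And>y. y \<in> U0 \<Longrightarrow> near N y (\<lambda>w. T ?x w = T ?x y * T y w)"
      using T_domain[OF x] by metis
    obtain k where k: "k \<in> A" "?x \<in> fst k" using chart_covers[OF x] .
    obtain K where K: "K \<in> lifted_charts N x0 k" "\<alpha> \<in> fst K" using lifted_chart_exists[OF k(1) \<alpha> k(2)] by blast
    note L = lifted_chart[OF k(1) K(1)]
    obtain U1 where U1: "openin (top_of_set N) U1" "?x \<in> U1" "cover_nbhd N \<alpha> U1 \<subseteq> fst K"
      using L(2) K(2) unfolding openin_ucover_iff by blast
    obtain r where r: "r > 0" "ball (snd k ?x) r \<inter> half_plane \<subseteq> snd k ` fst k" "patch k ?x r \<subseteq> U0 \<inter> U1"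
      using patch_exists[OF k openin_Int[OF U0(1) U1(1)]] U0(2) U1(2) by (metis IntI)
    let ?U = "patch k ?x r"
    note pt = patch[OF k r(1,2)]
    have UN: "?U \<subseteq> N" using openin_imp_subset[OF pt(2)] .
    have sub: "cover_nbhd N \<alpha> ?U \<subseteq> fst K" using cover_nbhd_mono[of ?U U1] r(3) U1(3) by blast
    \<comment> \<open>\<open>P\<close> is \<open>G\<close> pushed down along the sheet, on which
      \<open>endpt\<close> is injective.\<close>
    define P where "P y = G (inv_into (fst K) endpt y)" for y
    have PG: "P (endpt \<beta>) = G \<beta>" if "\<beta> \<in> fst K" for \<beta>
      unfolding P_def using inv_into_f_f[OF L(5) that] by simp
    have im: "endpt ` cover_nbhd N \<alpha> ?U = ?U"
      by (rule endpt_cover_nbhd(2)[OF \<alpha> UN]) (use pt in \<open>auto simp: nice_def\<close>)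
    have primP: "prim_at \<Omega> P y" if "y \<in> ?U" for y
    proof -
      have "y \<in> endpt ` cover_nbhd N \<alpha> ?U" unfolding im by (rule that)
      then obtain \<beta> where b: "\<beta> \<in> cover_nbhd N \<alpha> ?U" "y = endpt \<beta>" by blast
      have bK: "\<beta> \<in> fst K" using b(1) sub by blast
      have s2: "cover_nbhd N \<beta> ?U \<subseteq> fst K" using cover_nbhd_trans[OF \<alpha> UN b(1)] sub by blast
      have bU: "endpt \<beta> \<in> ?U" using that b(2) by simp
      have GP: "G \<gamma> = P (endpt \<gamma>)" if "\<gamma> \<in> cover_nbhd N \<beta> ?U" for \<gamma>
        by (rule PG[symmetric]) (use s2 that in blast)
      have "((P \<circ> ic k) has_derivative (\<lambda>h. G \<beta> * pform \<Omega> k (endpt \<beta>) h)) (at (snd k (endpt \<beta>)) within snd k ` fst k)"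
        using G[OF k(1) K(1) bK] sheet_derivative_iff[OF k(1) K(1) bK pt(2) bU, of G P, OF GP] by simp
      then show ?thesis
        using prim_atI[OF \<Omega>(1) k(1), of "endpt \<beta>" P] PG[OF bK] pt(4) that b(2) by auto
    qed
    have primT: "prim_at \<Omega> (T ?x) y" if "y \<in> ?U" for y
    proof -
      have y0: "y \<in> U0" "y \<in> N" using that r(3) UN by auto
      obtain V where V: "openin (top_of_set N) V" "y \<in> V" "\<forall>w\<in>V. T ?x w = T ?x y * T y w"
        using U0(3)[OF y0(1)] unfolding near_def by blast
      have "prim_at \<Omega> (\<lambda>w. T ?x y * T y w) y" using prim_at_left_mult T(2) y0(2) by blast
      then show ?thesis by (rule prim_at_cong[OF _ V(1,2)]) (use V(3) in blast)
    qed
    have "G \<beta> = G \<alpha> * T ?x (endpt \<beta>)" if "\<beta> \<in> cover_nbhd N \<alpha> ?U" for \<beta>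
    proof -
      have eU: "endpt \<beta> \<in> ?U" using im that by blast
      have "P (endpt \<beta>) * dadj (T ?x (endpt \<beta>)) = P ?x * dadj (T ?x ?x)"
        by (rule prim_unique_patch[OF \<Omega>(2) k r(1,2) primP primT eU])
      then have "G \<beta> * dadj (T ?x (endpt \<beta>)) = G \<alpha>"
        using PG[of \<beta>] PG[OF K(2)] that sub T_self[OF x] by auto
      then show ?thesis using dgroup_right[OF T_group[of ?x "endpt \<beta>"]] by (metis mult.assoc mult_1_right)
    qed
    then show "\<exists>U. openin (top_of_set N) U \<and> ?x \<in> U \<and> (\<forall>\<beta>\<in>cover_nbhd N \<alpha> U. G \<beta> = G \<alpha> * T ?x (endpt \<beta>))"
      using pt(2,3) by blast
  qed
qed

end

section \<open>Coordinates of the flat section\<close>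

lemma bounded_linear_adj2: "bounded_linear adj2"
  by (rule linear_conv_bounded_linear[THEN iffD1], rule linearI) (simp_all add: adj2_add adj2_scaleR)

lemma dre_sum: "dre (\<Sum>i\<in>I. f i) = (\<Sum>i\<in>I. dre (f i))" and deps_sum: "deps (\<Sum>i\<in>I. f i) = (\<Sum>i\<in>I. deps (f i))"
  by (simp_all add: bounded_linear.linear[OF bounded_linear_dre] bounded_linear.linear[OF bounded_linear_deps] linear_sum)

lemma dre_derivative:
  assumes "(G has_derivative (\<lambda>h. G x * w h)) (at x within S)"
  shows "((\<lambda>z. dre (G z)) has_derivative (\<lambda>h. dre (G x) ** dre (w h))) (at x within S)"
  using bounded_linear.has_derivative[OF bounded_linear_dre assms] by simp

text \<open>The real part of \<open>w h\<close> is skew, so the two terms that contain the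
  derivative of \<open>dre (G x)\<close> cancel. What remains is the formula df = g \<gamma> g^-1 of
  the inverse map.\<close>

lemma dtrans_derivative:
  assumes G: "(G has_derivative (\<lambda>h. G x * w h)) (at x within S)" and w: "\<And>h. dadj (w h) = - w h"
  shows "((\<lambda>z. dtrans (G z)) has_derivative (\<lambda>h. dre (G x) ** deps (w h) ** adj2 (dre (G x)))) (at x within S)"
proof -
  have 1: "((\<lambda>z. deps (G z)) has_derivative (\<lambda>h. dre (G x) ** deps (w h) + deps (G x) ** dre (w h))) (at x within S)"
    using bounded_linear.has_derivative[OF bounded_linear_deps G] by simp
  have 2: "((\<lambda>z. adj2 (dre (G z))) has_derivative (\<lambda>h. adj2 (dre (G x) ** dre (w h)))) (at x within S)"
    by (rule bounded_linear.has_derivative[OF bounded_linear_adj2 dre_derivative[OF G]])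
  have wa: "adj2 (dre (w h)) = - dre (w h)" for h using w[of h] by (simp add: dmat_eq_iff)
  have "deps (G x) ** adj2 (dre (G x) ** dre (w h)) + (dre (G x) ** deps (w h) + deps (G x) ** dre (w h)) ** adj2 (dre (G x))
      = dre (G x) ** deps (w h) ** adj2 (dre (G x))" for h
    by (simp add: adj2_mult wa matrix2_distribs matrix_mul_assoc)
  with bounded_bilinear.FDERIV[OF bounded_bilinear_matrix_mult 1 2] show ?thesis
    by (simp add: dtrans_def)
qed

lemma dmat_vector_derivative:
  assumes "(G has_vector_derivative G t * a) (at t within I)" "dadj a = - a"
  shows "((\<lambda>t. dre (G t)) has_vector_derivative dre (G t) ** dre a) (at t within I)"
    "((\<lambda>t. dtrans (G t)) has_vector_derivative dre (G t) ** deps a ** adj2 (dre (G t))) (at t within I)"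
proof -
  have G: "(G has_derivative (\<lambda>h. G t * (h *\<^sub>R a))) (at t within I)"
    using assms(1) by (simp add: has_vector_derivative_def)
  have w: "dadj (h *\<^sub>R a) = - (h *\<^sub>R a)" for h using assms(2) by (simp add: dadj_scaleR)
  show "((\<lambda>t. dre (G t)) has_vector_derivative dre (G t) ** dre a) (at t within I)"
    using dre_derivative[OF G] by (simp add: has_vector_derivative_def matrix2_distribs)
  show "((\<lambda>t. dtrans (G t)) has_vector_derivative dre (G t) ** deps a ** adj2 (dre (G t))) (at t within I)"
    using dtrans_derivative[OF G w] by (simp add: has_vector_derivative_def matrix2_distribs)
qed

text \<open>The two boundary conditions are the real and the epsilon part of the single equation X'
  = X a for \<open>X = dpair u v\<close>.\<close>

lemma dpair_vector_derivative:
  assumes u: "(u has_vector_derivative u') (at t)" and v: "(v has_vector_derivative v') (at t)" and "u t \<in> SL2"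
    and e: "matrix_inv (u t) ** u' = dre a" "matrix_inv (u t) ** v' ** u t = deps a"
  shows "((\<lambda>t. dpair (u t) (v t)) has_vector_derivative dpair (u t) (v t) * a) (at t)"
proof -
  have i: "u t ** matrix_inv (u t) = mat 1" using assms(3) by (simp add: matrix_inv_SL2 mult_adj2 SL2_def)
  have u': "u' = u t ** dre a" unfolding e(1)[symmetric] by (simp add: matrix_mul_assoc i)
  have v': "v' ** u t = u t ** deps a" unfolding e(2)[symmetric] by (simp add: matrix_mul_assoc i)
  have "((\<lambda>t. v t ** u t) has_derivative (\<lambda>h. v t ** (h *\<^sub>R u') + (h *\<^sub>R v') ** u t)) (at t)"
    using bounded_bilinear.FDERIV[OF bounded_bilinear_matrix_mult] u v unfolding has_vector_derivative_def by blast
  moreover have "v t ** (h *\<^sub>R u') + (h *\<^sub>R v') ** u t = h *\<^sub>R (v t ** u t ** dre a + u t ** deps a)" for h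
    by (simp add: matrix2_distribs v' u' matrix_mul_assoc algebra_simps)
  ultimately have vu: "((\<lambda>t. v t ** u t) has_derivative (\<lambda>h. h *\<^sub>R (v t ** u t ** dre a + u t ** deps a))) (at t)" by simp
  have "((\<lambda>t. DM (u t) (v t ** u t)) has_derivative (\<lambda>h. DM (h *\<^sub>R u') (h *\<^sub>R (v t ** u t ** dre a + u t ** deps a)))) (at t)"
    using u vu unfolding has_vector_derivative_def by (rule has_derivative_DM)
  moreover have "DM (h *\<^sub>R u') (h *\<^sub>R (v t ** u t ** dre a + u t ** deps a)) = h *\<^sub>R (dpair (u t) (v t) * a)" for h
    by (simp add: dmat_eq_iff dpair_def u' add.commute)
  ultimately show ?thesis by (simp add: has_vector_derivative_def dpair_def)
qed

lemma dtrans_dadj: "X \<in> dgroup \<Longrightarrow> dtrans (dadj X) = - (adj2 (dre X) ** dtrans X ** dre X)"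
proof -
  assume X: "X \<in> dgroup"
  have "dtrans (dadj X * X) = dtrans (dadj X) + adj2 (dre X) ** dtrans X ** dre X"
    using dtrans_mult[OF dgroup_dadj[OF X] X] by simp
  moreover have "dtrans (dadj X * X) = 0" by (simp add: dgroup_right[OF X] dtrans_def matrix2_distribs)
  ultimately show ?thesis by (simp add: eq_neg_iff_add_eq_0)
qed

text \<open>Bootstrapping: the derivative is a product of \<open>G\<close> with smooth coefficients,
  so each order of differentiability of \<open>G\<close> yields the next.\<close>

lemma smooth_on_linear_ode:
  fixes G :: "real^2 \<Rightarrow> dmat"
  assumes G: "\<And>z. z \<in> S \<Longrightarrow> (G has_derivative (\<lambda>h. G z * (\<Sum>i\<in>UNIV. h $ i *\<^sub>R w i z))) (at z within S)"
    and w: "\<And>i. smooth_on S (w i)"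
  shows "smooth_on S G"
  unfolding smooth_on_def
proof
  fix k show "Ck_on k S G"
  proof (induction k)
    case 0
    then show ?case using has_derivative_continuous_on[OF G] by simp
  next
    case (Suc k)
    show ?case
    proof (rule Ck_on_SucI)
      show "z \<in> S \<Longrightarrow> (G has_derivative (\<lambda>h. G z * (\<Sum>i\<in>UNIV. h $ i *\<^sub>R w i z))) (at z within S)" for z
        by (rule G)
      show "Ck_on k S (\<lambda>z. G z * (\<Sum>i\<in>UNIV. v $ i *\<^sub>R w i z))" for v
        by (intro Ck_on_bilinear[OF bounded_bilinear_mult] Suc Ck_on_sum
            Ck_on_bounded_linear[OF bounded_linear_scaleR_right] smooth_onD w)
    qed
  qed
qed

definition dform :: "'p mform \<Rightarrow> 'p mform \<Rightarrow> 'p chart \<Rightarrow> 2 \<Rightarrow> 'p \<Rightarrow> dmat" where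
  "dform \<omega> \<gamma> c i x = DM (\<omega> c i x) (\<gamma> c i x)"

lemma dform_sel [simp]: "dre (dform \<omega> \<gamma> c i x) = \<omega> c i x" "deps (dform \<omega> \<gamma> c i x) = \<gamma> c i x"
  by (simp_all add: dform_def)

lemma smooth_on_DM_iff: "smooth_on S (\<lambda>z. DM (f z) (g z)) \<longleftrightarrow> smooth_on S f \<and> smooth_on S g"
proof
  assume "smooth_on S (\<lambda>z. DM (f z) (g z))"
  then show "smooth_on S f \<and> smooth_on S g"
    using Ck_on_bounded_linear[OF bounded_linear_dre, of _ S "\<lambda>z. DM (f z) (g z)"]
      Ck_on_bounded_linear[OF bounded_linear_deps, of _ S "\<lambda>z. DM (f z) (g z)"]
    by (simp add: smooth_on_def)
next
  assume "smooth_on S f \<and> smooth_on S g"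
  then show "smooth_on S (\<lambda>z. DM (f z) (g z))"
    using Ck_on_bounded_linear[OF bounded_linear_DM Ck_on_Pair[of _ S f g]] by (simp add: smooth_on_def)
qed

text \<open>The definition provides a possibly different derivative for each order; ampleness shows
  that they are the same function.\<close>

lemma smooth_on_imp_derivative:
  assumes "smooth_on S f"
  obtains f' where "\<And>z. z \<in> S \<Longrightarrow> (f has_derivative f' z) (at z within S)" "\<And>k v. ample S \<Longrightarrow> Ck_on k S (\<lambda>z. f' z v)"
proof -
  have "\<exists>f'. (\<forall>z\<in>S. (f has_derivative f' z) (at z within S)) \<and> (\<forall>v. Ck_on k S (\<lambda>z. f' z v))" for k
    using smooth_onD[OF assms, of "Suc k"] by (simp only: Ck_on.simps)
  then obtain g where g: "\<And>k. (\<forall>z\<in>S. (f has_derivative g k z) (at z within S)) \<and> (\<forall>v. Ck_on k S (\<lambda>z. g k z v))"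
    by metis
  show ?thesis
  proof (rule that[of "g 0"])
    show "(f has_derivative g 0 z) (at z within S)" if "z \<in> S" for z using g that by blast
    fix k v assume am: "ample S"
    have "g 0 z = g k z" if "z \<in> S" for z
      by (rule ample_unique[OF am that]) (use g that in blast)+
    then have eq: "g 0 z v = g k z v" if "z \<in> S" for z using that by simp
    show "Ck_on k S (\<lambda>z. g 0 z v)" by (rule Ck_on_cong_imp[OF _ eq]) (use g in blast)
  qed
qed

context surface
begin

lemma chart_deriv_DM:
  assumes c: "c \<in> A" "x \<in> fst c" and "smooth_in_chart c f" "smooth_in_chart c g"
  shows "chart_deriv c i (\<lambda>y. DM (f y) (g y)) x = DM (chart_deriv c i f x) (chart_deriv c i g x)"
proof -
  have z: "snd c x \<in> snd c ` fst c" using c by blast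
  obtain f' where f': "(f \<circ> ic c has_derivative f') (at (snd c x) within snd c ` fst c)"
    using assms(3) z unfolding smooth_in_chart_def by (metis smooth_on_imp_derivative)
  obtain g' where g': "(g \<circ> ic c has_derivative g') (at (snd c x) within snd c ` fst c)"
    using assms(4) z unfolding smooth_in_chart_def by (metis smooth_on_imp_derivative)
  have "((\<lambda>y. DM (f y) (g y)) \<circ> ic c has_derivative (\<lambda>h. DM (f' h) (g' h))) (at (snd c x) within snd c ` fst c)"
    using has_derivative_DM[OF f' g'] by (simp add: o_def)
  note fr = ample_frechet_derivative[OF chart_ample[OF c(1)] z]
  show ?thesis unfolding chart_deriv_def fr[OF f'] fr[OF g'] fr[OF \<open>(_ has_derivative (\<lambda>h. DM (f' h) (g' h))) _\<close>] ..
qed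

text \<open>The real part of dual flatness is the equation for \<open>\<omega>\<close> and the
  epsilon part is the equation for \<open>\<gamma>\<close>. The assumption on
  \<open>undefined\<close> is part of \<open>sl2_form\<close> and invisible to
  \<open>flat_form\<close>, which speaks only about points of charts.\<close>

lemma flat_form_dform_iff:
  assumes "\<forall>c i x. \<not> (c \<in> A \<and> x \<in> fst c) \<longrightarrow> \<omega> c i x = undefined \<and> \<gamma> c i x = undefined"
  shows "flat_form (dform \<omega> \<gamma>) \<longleftrightarrow> sl2_form A \<omega> \<and> sl2_form A \<gamma> \<and>
     (\<forall>c\<in>A. \<forall>x\<in>fst c. \<forall>i j.
        chart_deriv c i (\<omega> c j) x - chart_deriv c j (\<omega> c i) x + comm (\<omega> c i x) (\<omega> c j x) = 0) \<and>
     (\<forall>c\<in>A. \<forall>x\<in>fst c.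
        (\<Sum>i\<in>UNIV. \<Sum>j\<in>UNIV. levi_civita i j *\<^sub>R
           (chart_deriv c i (\<gamma> c j) x + comm (\<omega> c i x) (\<gamma> c j x))) = 0)" (is "?F \<longleftrightarrow> ?R")
proof -
  let ?\<Omega> = "dform \<omega> \<gamma>"
  define SM where "SM \<longleftrightarrow> (\<forall>c\<in>A. \<forall>i. smooth_in_chart c (\<omega> c i) \<and> smooth_in_chart c (\<gamma> c i))"
  have sm: "(\<forall>c\<in>A. \<forall>i. smooth_in_chart c (?\<Omega> c i)) \<longleftrightarrow> SM"
    unfolding SM_def smooth_in_chart_def smooth_on_DM_iff[symmetric] by (simp add: dform_def[abs_def] o_def)
  have sk: "dadj (?\<Omega> c i x) = - ?\<Omega> c i x \<longleftrightarrow> \<omega> c i x \<in> sl2 \<and> \<gamma> c i x \<in> sl2" for c i x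
    by (simp add: dadj_eq_minus_iff)
  have cov: "?\<Omega> c i x = (\<Sum>j\<in>UNIV. jacobian_matrix c d x $ j $ i *\<^sub>R ?\<Omega> d j x) \<longleftrightarrow>
      \<omega> c i x = (\<Sum>j\<in>UNIV. jacobian_matrix c d x $ j $ i *\<^sub>R \<omega> d j x) \<and>
      \<gamma> c i x = (\<Sum>j\<in>UNIV. jacobian_matrix c d x $ j $ i *\<^sub>R \<gamma> d j x)" for c d x i
    by (simp add: dmat_eq_iff dre_sum deps_sum)
  have fl: "(\<forall>i j. chart_deriv c i (?\<Omega> c j) x - chart_deriv c j (?\<Omega> c i) x + ?\<Omega> c i x * ?\<Omega> c j x - ?\<Omega> c j x * ?\<Omega> c i x = 0)
    \<longleftrightarrow> (\<forall>i j. chart_deriv c i (\<omega> c j) x - chart_deriv c j (\<omega> c i) x + comm (\<omega> c i x) (\<omega> c j x) = 0) \<and>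
      (\<Sum>i\<in>UNIV. \<Sum>j\<in>UNIV. levi_civita i j *\<^sub>R (chart_deriv c i (\<gamma> c j) x + comm (\<omega> c i x) (\<gamma> c j x))) = 0"
    if S: "SM" and c: "c \<in> A" "x \<in> fst c" for c x
  proof -
    have d: "chart_deriv c i (?\<Omega> c j) x = DM (chart_deriv c i (\<omega> c j) x) (chart_deriv c i (\<gamma> c j) x)" for i j
      using chart_deriv_DM[OF c, of "\<omega> c j" "\<gamma> c j" i] S c(1) by (simp add: SM_def dform_def[abs_def])
    have e: "chart_deriv c i (?\<Omega> c j) x - chart_deriv c j (?\<Omega> c i) x + ?\<Omega> c i x * ?\<Omega> c j x - ?\<Omega> c j x * ?\<Omega> c i x = 0
      \<longleftrightarrow> chart_deriv c i (\<omega> c j) x - chart_deriv c j (\<omega> c i) x + comm (\<omega> c i x) (\<omega> c j x) = 0 \<and>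
        (chart_deriv c i (\<gamma> c j) x + comm (\<omega> c i x) (\<gamma> c j x)) - (chart_deriv c j (\<gamma> c i) x + comm (\<omega> c j x) (\<gamma> c i x)) = 0"
      for i j
      unfolding d by (simp add: dmat_eq_iff comm_def algebra_simps)
    \<comment> \<open>In two dimensions an antisymmetric array has one independent entry, so the
      contraction with \<open>levi_civita\<close> is equivalent to the whole family of
      equations.\<close>
    define L where "L i j = chart_deriv c i (\<gamma> c j) x + comm (\<omega> c i x) (\<gamma> c j x)" for i j
    have "(\<forall>i j. L i j - L j i = 0) \<longleftrightarrow> L 1 2 - L 2 1 = 0" unfolding forall_2 by auto
    moreover have "(\<Sum>i\<in>UNIV. \<Sum>j\<in>UNIV. levi_civita i j *\<^sub>R L i j) = L 1 2 - L 2 1"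
      by (simp add: sum_2 levi_civita_def)
    ultimately show ?thesis unfolding e L_def[symmetric] by auto
  qed
  define E1 where "E1 c d x i \<longleftrightarrow> \<omega> c i x = (\<Sum>j\<in>UNIV. jacobian_matrix c d x $ j $ i *\<^sub>R \<omega> d j x)" for c d x i
  define E2 where "E2 c d x i \<longleftrightarrow> \<gamma> c i x = (\<Sum>j\<in>UNIV. jacobian_matrix c d x $ j $ i *\<^sub>R \<gamma> d j x)" for c d x i
  define C1 where "C1 c x \<longleftrightarrow> (\<forall>i j. chart_deriv c i (\<omega> c j) x - chart_deriv c j (\<omega> c i) x + comm (\<omega> c i x) (\<omega> c j x) = 0)" for c x
  define C2 where "C2 c x \<longleftrightarrow> (\<Sum>i\<in>UNIV. \<Sum>j\<in>UNIV. levi_civita i j *\<^sub>R (chart_deriv c i (\<gamma> c j) x + comm (\<omega> c i x) (\<gamma> c j x))) = 0" for c x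
  have "?F \<longleftrightarrow> SM \<and> (\<forall>c\<in>A. \<forall>i. \<forall>x\<in>fst c. \<omega> c i x \<in> sl2 \<and> \<gamma> c i x \<in> sl2) \<and>
     (\<forall>c\<in>A. \<forall>d\<in>A. \<forall>x\<in>fst c \<inter> fst d. \<forall>i. E1 c d x i \<and> E2 c d x i) \<and> (\<forall>c\<in>A. \<forall>x\<in>fst c. C1 c x \<and> C2 c x)"
    unfolding flat_form_def sm sk cov E1_def C1_def E2_def C2_def
    by (intro conj_cong refl ball_cong fl) assumption+
  also have "\<dots> \<longleftrightarrow> ?R"
  proof -
    define U where "U \<xi> \<longleftrightarrow> (\<forall>c i x. \<not> (c \<in> A \<and> x \<in> fst c) \<longrightarrow> \<xi> c i x = undefined)" for \<xi> :: "'p mform"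
    have "U \<omega>" "U \<gamma>" using assms by (simp_all add: U_def)
    then show ?thesis
      unfolding SM_def sl2_form_def E1_def[symmetric] E2_def[symmetric] C1_def[symmetric] C2_def[symmetric]
        U_def[symmetric]
      by blast
  qed
  finally show ?thesis .
qed

text \<open>The chart is selected by the same choice expression as in \<open>form_along\<close>, so
  that real and epsilon part are literally the components of the two forms.\<close>

definition dalong :: "('p chart \<Rightarrow> 2 \<Rightarrow> 'p \<Rightarrow> dmat) \<Rightarrow> real set \<Rightarrow> (real \<Rightarrow> 'p) \<Rightarrow> real \<Rightarrow> dmat" where
  "dalong \<Omega> I p s = (let c = (SOME c. c \<in> A \<and> p s \<in> fst c)
     in pform \<Omega> c (p s) (vector_derivative (snd c \<circ> p) (at s within I)))"

lemma dalong_dform: "dre (dalong (dform \<omega> \<gamma>) I p s) = form_along A \<omega> I p s"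
  "deps (dalong (dform \<omega> \<gamma>) I p s) = form_along A \<gamma> I p s"
  by (simp_all add: dalong_def form_along_def Let_def pform_def dre_sum deps_sum)

lemma some_chart:
  assumes "x \<in> N"
  shows "(SOME c. c \<in> A \<and> x \<in> fst c) \<in> A" "x \<in> fst (SOME c. c \<in> A \<and> x \<in> fst c)"
proof -
  have "\<exists>c. c \<in> A \<and> x \<in> fst c" using chart_covers[OF assms] by metis
  from someI_ex[OF this] show "(SOME c. c \<in> A \<and> x \<in> fst c) \<in> A" "x \<in> fst (SOME c. c \<in> A \<and> x \<in> fst c)" by auto
qed

lemma skew_dalong: "skew \<Omega> \<Longrightarrow> p s \<in> N \<Longrightarrow> dadj (dalong \<Omega> I p s) = - dalong \<Omega> I p s"
  unfolding dalong_def Let_def using some_chart skew_pform by blast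

text \<open>Near \<open>s\<close> the function \<open>G\<close> equals
  \<open>G s * T (p s) (p t)\<close>, and \<open>T (p s)\<close> is a primitive at the point
  \<open>p s\<close>; the chain rule at this one point gives the transport equation.\<close>

lemma parallel_derivative:
  assumes T: "germ_transport N T" "\<forall>x\<in>N. prim_at \<Omega> (T x) x" and G: "germ_transport.parallel T I p G"
    and p: "continuous_on I p" "p ` I \<subseteq> N" and s: "s \<in> I"
    and diff: "\<And>c. c \<in> A \<Longrightarrow> p s \<in> fst c \<Longrightarrow> (snd c \<circ> p) differentiable (at s within I)"
  shows "(G has_vector_derivative G s * dalong \<Omega> I p s) (at s within I)"
proof -
  interpret germ_transport N T by (rule T(1))
  have x: "p s \<in> N" using p s by auto
  define c where "c = (SOME c. c \<in> A \<and> p s \<in> fst c)"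
  have c: "c \<in> A" "p s \<in> fst c" unfolding c_def using some_chart[OF x] by auto
  have v: "((snd c \<circ> p) has_vector_derivative vector_derivative (snd c \<circ> p) (at s within I)) (at s within I)"
    using diff[OF c] by (simp add: vector_derivative_works)
  have "((T (p s) \<circ> ic c) has_derivative (\<lambda>h. pform \<Omega> c (p s) h)) (at (snd c (p s)) within snd c ` fst c)"
    using T(2) x c T_self[OF x] unfolding prim_at_def by fastforce
  from curve_derivative[OF c(1) p s c(2) v this]
  have "((\<lambda>t. T (p s) (p t)) has_vector_derivative dalong \<Omega> I p s) (at s within I)"
    by (simp add: dalong_def c_def Let_def)
  then have d: "((\<lambda>t. G s * T (p s) (p t)) has_vector_derivative G s * dalong \<Omega> I p s) (at s within I)"
    by (rule has_vector_derivative_mult_right)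
  obtain V where V: "openin (top_of_set I) V" "s \<in> V" "\<forall>w\<in>V. G w = G s * T (p s) (p w)"
    using G s unfolding parallel_def near_def by blast
  obtain Q where Q: "open Q" "V = I \<inter> Q" using V(1) by (auto simp: openin_open)
  have w: "at s within I \<inter> Q = at s within I" by (rule at_within_Int_open[OF Q(1)]) (use V(2) Q(2) in blast)
  have "(G has_vector_derivative G s * dalong \<Omega> I p s) (at s within I \<inter> Q)"
  proof (rule has_vector_derivative_transform[OF _ _ d[folded w]])
    show "s \<in> I \<inter> Q" using V(2) Q(2) by blast
    show "x \<in> I \<inter> Q \<Longrightarrow> G x = G s * T (p s) (p x)" for x using V(3) Q(2) by blast
  qed
  then show ?thesis unfolding w .
qed

section \<open>Transport operator and distance\<close>

lemma pc1_differentiable: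
  assumes "piecewise_C1_path N A p"
  obtains S where "finite S" "\<And>s c. s \<in> {0..1} - S \<Longrightarrow> c \<in> A \<Longrightarrow> p s \<in> fst c \<Longrightarrow> (snd c \<circ> p) differentiable (at s within {0..1})"
proof -
  obtain S where S: "finite S" "{0, 1} \<subseteq> S" "S \<subseteq> {0..1}"
    "\<forall>a\<in>S. \<forall>b\<in>S. a < b \<and> {a<..<b} \<inter> S = {} \<longrightarrow> (\<forall>c\<in>A. Ck_on 1 {s\<in>{a..b}. p s \<in> fst c} (snd c \<circ> p))"
    using assms unfolding piecewise_C1_path_def by (elim conjE exE) (rule that)
  have p: "continuous_on {0..1} p" "p ` {0..1} \<subseteq> N"
    using assms by (auto simp: piecewise_C1_path_def path_def path_image_def)
  show ?thesis
  proof (rule that[OF S(1)])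
    fix s c assume s: "s \<in> {0..1} - S" and c: "c \<in> A" "p s \<in> fst c"
    \<comment> \<open>\<open>a\<close> and \<open>b\<close> are the breakpoints adjacent to
      \<open>s\<close>; between them \<open>p\<close> is C1 in every chart.\<close>
    define a where "a = Max {t \<in> S. t < s}"
    define b where "b = Min {t \<in> S. s < t}"
    have s01: "0 < s" "s < 1" using s S(2) by (auto simp: less_le)
    have fa: "finite {t \<in> S. t < s}" "{t \<in> S. t < s} \<noteq> {}" using S(1,2) s01 by auto
    have fb: "finite {t \<in> S. s < t}" "{t \<in> S. s < t} \<noteq> {}" using S(1,2) s01 by auto
    have a: "a \<in> S" "a < s" and am: "\<And>t. t \<in> S \<Longrightarrow> t < s \<Longrightarrow> t \<le> a"
      using Max_in[OF fa] Max_ge[OF fa(1)] by (auto simp: a_def)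
    have b: "b \<in> S" "s < b" and bm: "\<And>t. t \<in> S \<Longrightarrow> s < t \<Longrightarrow> b \<le> t"
      using Min_in[OF fb] Min_le[OF fb(1)] by (auto simp: b_def)
    have gap: "{a<..<b} \<inter> S = {}"
    proof -
      have False if "t \<in> S" "a < t" "t < b" for t
        using am[OF that(1)] bm[OF that(1)] that s by (cases "t < s") (auto simp: not_less le_less)
      then show ?thesis by auto
    qed
    have ab: "a < b" "{a..b} \<subseteq> {0..1}" using a b S(3) by (auto simp: subset_iff)
    let ?C = "{s\<in>{a..b}. p s \<in> fst c}"
    have "Ck_on (Suc 0) ?C (snd c \<circ> p)"
      using S(4)[rule_format, OF a(1) b(1) _ c(1)] ab gap by simp
    then obtain f' where f': "\<forall>x\<in>?C. ((snd c \<circ> p) has_derivative f' x) (at x within ?C)"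
      unfolding Ck_on.simps by blast
    have sC: "s \<in> ?C" using a b c by auto
    have "openin (top_of_set {0..1}) ({0..1} \<inter> p -` fst c)"
      using continuous_openin_preimage[OF p(1) _ chart_openin[OF c(1)]] p(2) by auto
    then obtain Q where Q: "open Q" "{0..1} \<inter> p -` fst c = {0..1} \<inter> Q" by (auto simp: openin_open)
    have mem: "t \<in> Q \<longleftrightarrow> p t \<in> fst c" if "t \<in> {0..1}" for t using Q(2) that by blast
    have "s \<in> {0..1}" using s by blast
    then have "s \<in> Q" using mem c(2) by blast
    then have Q': "open (Q \<inter> {a<..<b})" "s \<in> Q \<inter> {a<..<b}"
      using Q(1) a(2) b(2) by auto
    have "?C \<inter> (Q \<inter> {a<..<b}) = {0..1} \<inter> (Q \<inter> {a<..<b})"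
      using ab(2) mem by (auto simp: subset_iff)
    then have "at s within ?C = at s within {0..1}"
      using at_within_Int_open[OF Q', of ?C] at_within_Int_open[OF Q', of "{0..1}"] by simp
    moreover have "((snd c \<circ> p) has_derivative f' s) (at s within ?C)"
      by (rule bspec[OF f' sC])
    ultimately show "(snd c \<circ> p) differentiable (at s within {0..1})"
      unfolding differentiable_def by auto
  qed
qed

text \<open>\<open>transport\<close> is only a choice, so it must be shown that every admissible
  solution coincides with the one built from \<open>plift\<close>. The distance is then the integral
  of a derivative.\<close>

lemma transport_plift:
  assumes T: "germ_transport N T" "\<forall>x\<in>N. prim_at (dform \<omega> \<gamma>) (T x) x" and sk: "skew (dform \<omega> \<gamma>)"
    and p: "piecewise_C1_path N A p"
  shows "\<And>a s. a \<in> {0..1} \<Longrightarrow> s \<in> {0..1} \<Longrightarrow>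
      transport A \<omega> p a s = adj2 (dre (germ_transport.plift T p a)) ** dre (germ_transport.plift T p s)"
    and "dist_V A \<omega> \<gamma> p = dtrans (germ_transport.plift T p 1)"
proof -
  interpret germ_transport N T by (rule T(1))
  have pp: "path p" "path_image p \<subseteq> N" using p by (auto simp: piecewise_C1_path_def)
  then have pc: "continuous_on {0..1} p" "p ` {0..1} \<subseteq> N" by (auto simp: path_def path_image_def)
  obtain S where S: "finite S" "\<And>s c. s \<in> {0..1} - S \<Longrightarrow> c \<in> A \<Longrightarrow> p s \<in> fst c \<Longrightarrow> (snd c \<circ> p) differentiable (at s within {0..1})"
    using pc1_differentiable[OF p] by blast
  let ?\<Omega> = "dform \<omega> \<gamma>"
  define W where "W s = dre (plift p s)" for s
  have pg: "plift p s \<in> dgroup" if "s \<in> {0..1}" for s by (rule plift_group[OF pp that])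
  have WS: "W s \<in> SL2" if "s \<in> {0..1}" for s unfolding W_def by (rule dgroup_dre[OF pg[OF that]])
  have WW: "W s ** adj2 (W s) = mat 1" "adj2 (W s) ** W s = mat 1" if "s \<in> {0..1}" for s
    using WS[OF that] by (simp_all add: SL2_def mult_adj2 adj2_mult_self)
  have der: "(plift p has_vector_derivative plift p s * dalong ?\<Omega> {0..1} p s) (at s within {0..1})" if "s \<in> {0..1} - S" for s
    by (rule parallel_derivative[OF T plift(1)[OF pp] pc]) (use that S(2) in auto)
  have ska: "dadj (dalong ?\<Omega> {0..1} p s) = - dalong ?\<Omega> {0..1} p s" if "s \<in> {0..1}" for s
    by (rule skew_dalong[OF sk]) (use pc that in auto)
  have Wd: "(W has_vector_derivative W s ** form_along A \<omega> {0..1} p s) (at s within {0..1})" if "s \<in> {0..1} - S" for s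
    using dmat_vector_derivative(1)[OF der[OF that] ska] that unfolding W_def[abs_def] dalong_dform by simp
  have fd: "((\<lambda>s. dtrans (plift p s)) has_vector_derivative W s ** form_along A \<gamma> {0..1} p s ** adj2 (W s)) (at s within {0..1})"
    if "s \<in> {0..1} - S" for s
    using dmat_vector_derivative(2)[OF der[OF that] ska] that unfolding W_def[abs_def] dalong_dform by simp
  have Wc: "continuous_on {0..1} W"
    unfolding W_def[abs_def] by (rule bounded_linear.continuous_on[OF bounded_linear_dre plift_continuous[OF pp]])
  have aW: "adj2 (form_along A \<omega> {0..1} p s) = - form_along A \<omega> {0..1} p s" if "s \<in> {0..1}" for s
    using ska[OF that] by (simp add: dmat_eq_iff dalong_dform)
  have tr: "transport A \<omega> p a s = adj2 (W a) ** W s" if a: "a \<in> {0..1}" and s: "s \<in> {0..1}" for a s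
  proof -
    let ?Q = "\<lambda>U. \<forall>a\<in>{0..1}. U a a = mat 1 \<and> continuous_on {0..1} (U a) \<and>
        (\<exists>S. finite S \<and> (\<forall>s\<in>{0..1} - S.
           (U a has_vector_derivative U a s ** form_along A \<omega> {0..1} p s) (at s within {0..1})))"
    have "?Q (\<lambda>a s. adj2 (W a) ** W s)"
    proof (intro ballI conjI exI[of _ S] S(1))
      fix a :: real assume a: "a \<in> {0..1}"
      show "adj2 (W a) ** W a = mat 1" by (rule WW(2)[OF a])
      show "continuous_on {0..1} (\<lambda>s. adj2 (W a) ** W s)"
        by (rule bounded_bilinear.continuous_on[OF bounded_bilinear_matrix_mult continuous_on_const Wc])
      fix s assume "s \<in> {0..1} - S"
      from bounded_linear.has_vector_derivative[OF bounded_bilinear.bounded_linear_right[OF bounded_bilinear_matrix_mult] Wd[OF this], of "adj2 (W a)"]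
      show "((\<lambda>s. adj2 (W a) ** W s) has_vector_derivative adj2 (W a) ** W s ** form_along A \<omega> {0..1} p s) (at s within {0..1})"
        by (simp add: matrix_mul_assoc)
    qed
    from someI[of ?Q, OF this] have Q: "?Q (transport A \<omega> p)" unfolding transport_def .
    define U where "U = transport A \<omega> p a"
    from Q a have U: "U a = mat 1" "continuous_on {0..1} U"
      and "\<exists>S. finite S \<and> (\<forall>s\<in>{0..1} - S. (U has_vector_derivative U s ** form_along A \<omega> {0..1} p s) (at s within {0..1}))"
      unfolding U_def by blast+
    then obtain S' where S': "finite S'"
      "\<forall>s\<in>{0..1} - S'. (U has_vector_derivative U s ** form_along A \<omega> {0..1} p s) (at s within {0..1})" by blast
    \<comment> \<open>The quotient of the chosen solution by \<open>W\<close>; its derivative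
      vanishes outside finitely many points, and continuity bridges these.\<close>
    define E where "E s = U s ** adj2 (W s)" for s
    have Ec: "continuous_on {0..1} E"
      unfolding E_def[abs_def]
      by (rule bounded_bilinear.continuous_on[OF bounded_bilinear_matrix_mult U(2) bounded_linear.continuous_on[OF bounded_linear_adj2 Wc]])
    have Ed: "(E has_derivative (\<lambda>h. 0)) (at s within {0..1})" if s: "s \<in> {0..1} - (S \<union> S')" for s
    proof -
      let ?w = "form_along A \<omega> {0..1} p s"
      have 1: "(U has_derivative (\<lambda>h. h *\<^sub>R (U s ** ?w))) (at s within {0..1})"
        using S'(2) s unfolding has_vector_derivative_def by blast
      have "(W has_derivative (\<lambda>h. h *\<^sub>R (W s ** ?w))) (at s within {0..1})"
        using Wd s unfolding has_vector_derivative_def by blast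
      from bounded_linear.has_derivative[OF bounded_linear_adj2 this]
      have 2: "((\<lambda>s. adj2 (W s)) has_derivative (\<lambda>h. adj2 (h *\<^sub>R (W s ** ?w)))) (at s within {0..1})" .
      have "U s ** adj2 (h *\<^sub>R (W s ** ?w)) + h *\<^sub>R (U s ** ?w) ** adj2 (W s) = 0" for h
        using aW[of s] s by (simp add: adj2_scaleR adj2_mult matrix2_distribs matrix_mul_assoc)
      with bounded_bilinear.FDERIV[OF bounded_bilinear_matrix_mult 1 2] show ?thesis
        by (simp add: E_def[abs_def])
    qed
    have "E t = E 0" if "t \<in> {0..1}" for t
      by (rule has_derivative_zero_unique_strong_interval[of "S \<union> S'" 0 1 E]) (use S S' Ec Ed that in auto)
    then have "E s = E a" using a s by metis
    then have "U s ** adj2 (W s) ** W s = adj2 (W a) ** W s" using U(1) by (simp add: E_def)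
    then show ?thesis using WW(2)[OF s] by (simp add: U_def flip: matrix_mul_assoc)
  qed
  then show "\<And>a s. a \<in> {0..1} \<Longrightarrow> s \<in> {0..1} \<Longrightarrow> transport A \<omega> p a s = adj2 (dre (plift p a)) ** dre (plift p s)"
    by (simp add: W_def)
  have W0: "W 0 = mat 1" using plift(2)[OF pp] by (simp add: W_def)
  \<comment> \<open>The integrand of \<open>dist_V\<close> is the derivative of
    \<open>dtrans (plift p s)\<close>. The corners of the path form a finite exceptional set,
    admissible in this form of the fundamental theorem.\<close>
  have "((\<lambda>s. W s ** form_along A \<gamma> {0..1} p s ** adj2 (W s)) has_integral (dtrans (plift p 1) - dtrans (plift p 0))) {0..1}"
  proof (rule fundamental_theorem_of_calculus_interior_strong[OF S(1)])
    have "continuous_on {0..1} (\<lambda>s. deps (plift p s))"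
      by (rule bounded_linear.continuous_on[OF bounded_linear_deps plift_continuous[OF pp]])
    then show "continuous_on {0..1} (\<lambda>s. dtrans (plift p s))"
      unfolding dtrans_def
      by (rule bounded_bilinear.continuous_on[OF bounded_bilinear_matrix_mult _ bounded_linear.continuous_on[OF bounded_linear_adj2 Wc[unfolded W_def[abs_def]]]])
    fix x :: real assume x: "x \<in> {0<..<1} - S"
    then have "at x within {0..1} = at x" by (intro at_within_interior) (simp add: interior_atLeastAtMost_real)
    then show "((\<lambda>s. dtrans (plift p s)) has_vector_derivative W x ** form_along A \<gamma> {0..1} p x ** adj2 (W x)) (at x)"
      using fd[of x] x by auto
  qed simp
  moreover have "dtrans (plift p 0) = 0" using plift(2)[OF pp] by (simp add: dtrans_def matrix2_distribs)
  ultimately have "integral {0..1} (\<lambda>s. W s ** form_along A \<gamma> {0..1} p s ** adj2 (W s)) = dtrans (plift p 1)"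
    by (simp add: integral_unique)
  moreover have "dist_V A \<omega> \<gamma> p = integral {0..1} (\<lambda>s. W s ** form_along A \<gamma> {0..1} p s ** adj2 (W s))"
    unfolding dist_V_def by (rule integral_cong) (simp add: tr W0 adj2_one)
  ultimately show "dist_V A \<omega> \<gamma> p = dtrans (plift p 1)" by simp
qed

end

section \<open>From fields to functions on the cover\<close>

lemma ucover_over_point:
  assumes "path_connected N" "x0 \<in> N" "x \<in> N"
  obtains \<alpha> where "\<alpha> \<in> ucover N x0" "endpt \<alpha> = x"
proof -
  obtain p where p: "path p" "path_image p \<subseteq> N" "pathstart p = x0" "pathfinish p = x"
    using assms unfolding path_connected_def by blast
  show ?thesis
    by (rule that[OF hclass_in_ucover[OF p(1-3)]]) (simp add: endpt_hclass[OF p(1,2)] p(4))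
qed

lemma concat_class_eq:
  assumes \<kappa>: "\<kappa> \<in> ucover N x0" "endpt \<kappa> = x0" and \<alpha>: "\<alpha> \<in> ucover N x0" and p: "p \<in> \<kappa>" and q: "q \<in> \<alpha>"
  shows "concat_class N \<kappa> \<alpha> = hclass N (p +++ q)" "path (p +++ q)" "path_image (p +++ q) \<subseteq> N"
    "pathfinish p = pathstart q" "concat_class N \<kappa> \<alpha> \<in> ucover N x0" "p +++ q \<in> concat_class N \<kappa> \<alpha>"
    "endpt (concat_class N \<kappa> \<alpha>) = endpt \<alpha>"
proof -
  note pD = ucoverD[OF \<kappa>(1) p] and qD = ucoverD[OF \<alpha> q]
  show f: "pathfinish p = pathstart q" using pD(5) qD(3) \<kappa>(2) by simp
  show j: "path (p +++ q)" "path_image (p +++ q) \<subseteq> N" using pD qD f by (auto simp: path_image_join)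
  have *: "hclass N (p' +++ q') = hclass N (p +++ q)" if "p' \<in> \<kappa>" "q' \<in> \<alpha>" for p' q'
  proof (rule hclass_join_cong)
    show "homotopic_paths N p' p" using hclass_eqD ucoverD[OF \<kappa>(1) that(1)] pD(4) by metis
    show "homotopic_paths N q' q" using hclass_eqD ucoverD[OF \<alpha> that(2)] qD(4) by metis
    show "pathfinish p' = pathstart q'" using ucoverD[OF \<kappa>(1) that(1)] ucoverD[OF \<alpha> that(2)] \<kappa>(2) by simp
  qed
  have "concat_class N \<kappa> \<alpha> = (\<Union>p'\<in>\<kappa>. \<Union>q'\<in>\<alpha>. hclass N (p +++ q))"
    unfolding concat_class_def by (intro SUP_cong refl) (rule *)
  moreover have "\<kappa> \<noteq> {}" "\<alpha> \<noteq> {}" using p q by blast+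
  ultimately show e: "concat_class N \<kappa> \<alpha> = hclass N (p +++ q)" by (simp only: UN_constant if_False)
  show "concat_class N \<kappa> \<alpha> \<in> ucover N x0" unfolding e by (rule hclass_in_ucover[OF j]) (use pD in simp)
  show "p +++ q \<in> concat_class N \<kappa> \<alpha>" unfolding e by (rule hclass_self[OF j])
  show "endpt (concat_class N \<kappa> \<alpha>) = endpt \<alpha>" unfolding e endpt_hclass[OF j] using qD(5) by simp
qed

context germ_transport
begin

lemma dre_plift_path:
  assumes "path p" "path_image p \<subseteq> N"
  shows "path (\<lambda>s. dre (plift p s))" "path_image (\<lambda>s. dre (plift p s)) \<subseteq> SL2"
    "pathstart (\<lambda>s. dre (plift p s)) = mat 1" "pathfinish (\<lambda>s. dre (plift p s)) = dre (plift p 1)"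
proof -
  show "path (\<lambda>s. dre (plift p s))"
    unfolding path_def by (rule bounded_linear.continuous_on[OF bounded_linear_dre plift_continuous[OF assms]])
  show "path_image (\<lambda>s. dre (plift p s)) \<subseteq> SL2"
    using dgroup_dre[OF plift_group[OF assms]] by (auto simp: path_image_def)
qed (simp_all add: pathstart_def pathfinish_def plift(2)[OF assms])

text \<open>By \<open>plift_join\<close> the transport of a concatenation is a pointwise product of
  two reparametrized paths. Undoing the reparametrizations is a homotopy, and the pointwise product
  defines the group law.\<close>

lemma plift_class_join:
  assumes p: "path p" "path_image p \<subseteq> N" and q: "path q" "path_image q \<subseteq> N" and pq: "pathfinish p = pathstart q"
  shows "hclass SL2 (\<lambda>s. dre (plift (p +++ q) s)) = SLt_mult (hclass SL2 (\<lambda>s. dre (plift p s))) (hclass SL2 (\<lambda>s. dre (plift q s)))"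
proof -
  define a b where "a = (\<lambda>s. dre (plift p s))" and "b = (\<lambda>s. dre (plift q s))"
  have a: "path a" "path_image a \<subseteq> SL2" and b: "path b" "path_image b \<subseteq> SL2"
    using dre_plift_path[OF p] dre_plift_path[OF q] by (simp_all add: a_def b_def)
  have j: "path (p +++ q)" "path_image (p +++ q) \<subseteq> N" using p q pq by (auto simp: path_image_join)
  have ha: "homotopic_paths SL2 a (\<lambda>s. a (min 1 (2 * s)))"
    by (rule homotopic_paths_reparametrize[OF a, where f = "\<lambda>s. min 1 (2 * s)"]) (auto intro!: continuous_intros)
  have hb: "homotopic_paths SL2 b (\<lambda>s. b (max 0 (2 * s - 1)))"
    by (rule homotopic_paths_reparametrize[OF b, where f = "\<lambda>s. max 0 (2 * s - 1)"]) (auto intro!: continuous_intros)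
  note jp = dre_plift_path[OF j]
  have "homotopic_paths SL2 (\<lambda>s. dre (plift (p +++ q) s)) (\<lambda>s. a (min 1 (2 * s)) ** b (max 0 (2 * s - 1)))"
    by (rule homotopic_paths_eq[OF jp(1,2)]) (simp add: plift_join[OF p q pq] a_def b_def)
  also have "homotopic_paths SL2 \<dots> (\<lambda>s. a s ** b s)"
    by (rule homotopic_paths_sym[OF homotopic_paths_mult[OF ha hb]])
  finally have "hclass SL2 (\<lambda>s. dre (plift (p +++ q) s)) = hclass SL2 (\<lambda>s. a s ** b s)" by (rule hclass_eqI)
  also have "\<dots> = SLt_mult (hclass SL2 a) (hclass SL2 b)" by (rule SLt_mult_hclass[OF a b, symmetric])
  finally show ?thesis by (simp add: a_def b_def)
qed

text \<open>The same transport, now written as a concatenation with a left translate. This form fits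
  the topology of the cover of SL(2), whose neighbourhoods consist of extensions.\<close>

lemma plift_class_extend:
  assumes p: "path p" "path_image p \<subseteq> N" and q: "path q" "path_image q \<subseteq> N" and pq: "pathfinish p = pathstart q"
  shows "hclass SL2 (\<lambda>s. dre (plift (p +++ q) s)) =
    hclass SL2 ((\<lambda>s. dre (plift p s)) +++ (\<lambda>s. dre (plift p 1 * plift q s)))"
proof -
  have j: "path (p +++ q)" "path_image (p +++ q) \<subseteq> N" using p q pq by (auto simp: path_image_join)
  have "homotopic_paths SL2 (\<lambda>s. dre (plift (p +++ q) s)) ((\<lambda>s. dre (plift p s)) +++ (\<lambda>s. dre (plift p 1 * plift q s)))"
  proof (rule homotopic_paths_eq[OF dre_plift_path(1,2)[OF j]])
    fix s :: real assume s: "s \<in> {0..1}"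
    show "dre (plift (p +++ q) s) = ((\<lambda>s. dre (plift p s)) +++ (\<lambda>s. dre (plift p 1 * plift q s))) s"
    proof (cases "s \<le> 1 / 2")
      case True
      then have m: "min 1 (2 * s) = 2 * s" "max 0 (2 * s - 1) = 0" by auto
      have "((\<lambda>s. dre (plift p s)) +++ (\<lambda>s. dre (plift p 1 * plift q s))) s = dre (plift p (2 * s))"
        using True unfolding joinpaths_def by (rule if_P)
      then show ?thesis unfolding plift_join[OF p q pq s] m plift(2)[OF q] by (simp only: mult_1_right)
    next
      case False
      then have m: "min 1 (2 * s) = 1" "max 0 (2 * s - 1) = 2 * s - 1" by auto
      have "((\<lambda>s. dre (plift p s)) +++ (\<lambda>s. dre (plift p 1 * plift q s))) s = dre (plift p 1 * plift q (2 * s - 1))"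
        using False unfolding joinpaths_def by (rule if_not_P)
      then show ?thesis unfolding plift_join[OF p q pq s] m by (rule sym)
    qed
  qed
  then show ?thesis by (rule hclass_eqI)
qed

definition cover_map :: "(real \<Rightarrow> 'p) set \<Rightarrow> (real \<Rightarrow> real^2^2) set \<times> (real^2^2)" where
  "cover_map \<alpha> = (hclass SL2 (\<lambda>s. dre (plift (SOME p. p \<in> \<alpha>) s)), dtrans (holo \<alpha>))"

lemma cover_map_eq:
  assumes "\<alpha> \<in> ucover N x0" "p \<in> \<alpha>"
  shows "cover_map \<alpha> = (hclass SL2 (\<lambda>s. dre (plift p s)), dtrans (plift p 1))"
  unfolding cover_map_def holo_eq(2)[OF assms] holo_eq(1)[OF assms] ..

lemma cover_map_props:
  assumes \<alpha>: "\<alpha> \<in> ucover N x0"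
  shows "endpt (fst (cover_map \<alpha>)) = dre (holo \<alpha>)" "snd (cover_map \<alpha>) = dtrans (holo \<alpha>)" "holo \<alpha> \<in> dgroup"
    "cover_map \<alpha> \<in> carrier ISOt"
proof -
  obtain p where p: "p \<in> \<alpha>" using \<alpha> by (rule ucover_nonempty)
  note pD = ucoverD[OF \<alpha> p] and ce = cover_map_eq[OF \<alpha> p] and he = holo_eq(1)[OF \<alpha> p]
  note dp = dre_plift_path[OF pD(1,2)]
  show "endpt (fst (cover_map \<alpha>)) = dre (holo \<alpha>)"
    unfolding ce he fst_conv endpt_hclass[OF dp(1,2)] by (rule dp(4))
  show "snd (cover_map \<alpha>) = dtrans (holo \<alpha>)" by (simp add: ce he)
  show g: "holo \<alpha> \<in> dgroup" unfolding he by (rule plift_group[OF pD(1,2)]) simp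
  show "cover_map \<alpha> \<in> carrier ISOt"
    using hclass_in_ucover[OF dp(1-3)] dgroup_dtrans[OF g] by (simp add: ce he ISOt_def)
qed

lemma cover_map_mult:
  assumes \<kappa>: "\<kappa> \<in> ucover N x0" "endpt \<kappa> = x0" and \<alpha>: "\<alpha> \<in> ucover N x0"
  shows "cover_map (concat_class N \<kappa> \<alpha>) = cover_map \<kappa> \<otimes>\<^bsub>ISOt\<^esub> cover_map \<alpha>"
proof -
  obtain p where p: "p \<in> \<kappa>" using \<kappa>(1) by (rule ucover_nonempty)
  obtain q where q: "q \<in> \<alpha>" using \<alpha> by (rule ucover_nonempty)
  note pD = ucoverD[OF \<kappa>(1) p] and qD = ucoverD[OF \<alpha> q] and cc = concat_class_eq[OF \<kappa> \<alpha> p q]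
  have g: "plift p 1 \<in> dgroup" "plift q 1 \<in> dgroup"
    using plift_group[OF pD(1,2)] plift_group[OF qD(1,2)] by auto
  have m: "plift (p +++ q) 1 = plift p 1 * plift q 1"
    using plift_join[OF pD(1,2) qD(1,2) cc(4), of 1] by simp
  note dp = dre_plift_path[OF pD(1,2)]
  have e: "endpt (hclass SL2 (\<lambda>s. dre (plift p s))) = dre (plift p 1)"
    unfolding endpt_hclass[OF dp(1,2)] by (rule dp(4))
  show ?thesis
    unfolding cover_map_eq[OF cc(5,6)] cover_map_eq[OF \<kappa>(1) p] cover_map_eq[OF \<alpha> q]
    by (simp add: ISOt_def plift_class_join[OF pD(1,2) qD(1,2) cc(4)] m dtrans_mult[OF g] e
        matrix_inv_SL2[OF dgroup_dre[OF g(1)]])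
qed

lemma T_continuous_on:
  assumes "U \<subseteq> N" "\<And>y. y \<in> U \<Longrightarrow> near N y (\<lambda>w. T x w = T x y * T y w)"
  shows "continuous_on U (T x)"
proof -
  have "parallel U (\<lambda>y. y) (\<lambda>y. T x y)" by (rule parallel_T) (use assms in auto)
  then show ?thesis by (rule parallel_continuous) (use assms in auto)
qed

text \<open>Over the open set of points \<open>y\<close> at which the real part of
  \<open>plift p 1 * T x y\<close> lies in \<open>V\<close>, an extension by a path in that set is
  sent to an extension by a path in \<open>V\<close>.\<close>

lemma cover_map_continuous:
  "continuous_map (ucover_topology N x0) (ucover_topology SL2 (mat 1)) (\<lambda>\<alpha>. fst (cover_map \<alpha>))"
proof (rule continuous_map_into_ucover)
  show "fst (cover_map \<alpha>) \<in> ucover SL2 (mat 1)" if "\<alpha> \<in> topspace (ucover_topology N x0)" for \<alpha>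
    using cover_map_props(4)[of \<alpha> x0] that by (simp add: ISOt_def mem_Times_iff)
  fix \<alpha> V assume "\<alpha> \<in> topspace (ucover_topology N x0)" and V: "openin (top_of_set SL2) V" "endpt (fst (cover_map \<alpha>)) \<in> V"
  then have \<alpha>: "\<alpha> \<in> ucover N x0" by simp
  obtain p where p: "p \<in> \<alpha>" using \<alpha> by (rule ucover_nonempty)
  note pD = ucoverD[OF \<alpha> p]
  let ?x = "endpt \<alpha>" and ?X = "plift p 1"
  have Xg: "?X \<in> dgroup" by (rule plift_group[OF pD(1,2)]) simp
  have XV: "dre ?X \<in> V" using V(2) cover_map_props(1)[OF \<alpha>] holo_eq(1)[OF \<alpha> p] by simp
  have x: "?x \<in> N" by (rule endpt_in[OF \<alpha>])
  obtain U0 where U0: "openin (top_of_set N) U0" "?x \<in> U0" "\<And>y. y \<in> U0 \<Longrightarrow> near N y (\<lambda>w. T ?x w = T ?x y * T y w)"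
    using T_domain[OF x] by metis
  have U0N: "U0 \<subseteq> N" by (rule openin_imp_subset[OF U0(1)])
  have "continuous_on U0 (\<lambda>y. dre (?X * T ?x y))"
    by (intro bounded_linear.continuous_on[OF bounded_linear_dre] continuous_intros T_continuous_on U0N U0(3))
  then have "openin (top_of_set U0) (U0 \<inter> (\<lambda>y. dre (?X * T ?x y)) -` V)"
    by (rule continuous_openin_preimage[OF _ _ V(1)]) (use dgroup_dre[OF dgroup_mult[OF Xg T_group]] in auto)
  then have o: "openin (top_of_set N) (U0 \<inter> (\<lambda>y. dre (?X * T ?x y)) -` V)" (is "openin _ ?U")
    using openin_trans U0(1) by blast
  have xU: "?x \<in> ?U" using U0(2) T_self[OF x] XV by simp
  have UN: "?U \<subseteq> N" using U0N by blast
  show "\<exists>W. openin (ucover_topology N x0) W \<and> \<alpha> \<in> W \<and> (\<lambda>\<alpha>. fst (cover_map \<alpha>)) ` W \<subseteq> cover_nbhd SL2 (fst (cover_map \<alpha>)) V"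
  proof (intro exI[of _ "cover_nbhd N \<alpha> ?U"] conjI)
    show "openin (ucover_topology N x0) (cover_nbhd N \<alpha> ?U)" by (rule openin_cover_nbhd[OF \<alpha> o])
    show "\<alpha> \<in> cover_nbhd N \<alpha> ?U" by (rule cover_nbhd_self[OF \<alpha> xU])
    show "(\<lambda>\<alpha>. fst (cover_map \<alpha>)) ` cover_nbhd N \<alpha> ?U \<subseteq> cover_nbhd SL2 (fst (cover_map \<alpha>)) V"
    proof clarify
      fix \<beta> assume \<beta>: "\<beta> \<in> cover_nbhd N \<alpha> ?U"
      obtain q where q: "\<beta> = extend N \<alpha> q" "path q" "path_image q \<subseteq> ?U" "pathstart q = ?x"
        using \<beta> unfolding cover_nbhd_def by blast
      have qN: "path_image q \<subseteq> N" using q(3) UN by blast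
      have adm: "admissible N \<alpha> q" using admissible_subset[OF q(2,3) UN q(4)] .
      have \<beta>u: "\<beta> \<in> ucover N x0" unfolding q(1) by (rule extend_in_ucover(1)[OF \<alpha> adm])
      have b: "\<beta> = hclass N (p +++ q)" unfolding q(1) by (rule extend_eq[OF \<alpha> p adm])
      have pq: "pathfinish p = pathstart q" using pD(5) q(4) by simp
      have j: "path (p +++ q)" "path_image (p +++ q) \<subseteq> N" using pD q qN pq by (auto simp: path_image_join)
      have jb: "p +++ q \<in> \<beta>" unfolding b by (rule hclass_self[OF j])
      \<comment> \<open>\<open>r\<close> is the path in SL(2) by which the class of
        \<open>\<alpha>\<close> is extended to the class of \<open>\<beta>\<close>.\<close>
      define r where "r s = dre (?X * plift q s)" for s
      have rV: "r s \<in> V" if "s \<in> {0..1}" for s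
      proof -
        have "q s \<in> path_image q" unfolding path_image_def by (rule imageI[OF that])
        then have qs: "q s \<in> ?U" by (rule subsetD[OF q(3)])
        have qU: "path_image q \<subseteq> U0" by (rule order.trans[OF q(3) Int_lower1])
        have "plift q s = T ?x (q s)" by (rule plift_T[OF q(2) qU U0N U0(3) q(4) that])
        moreover have "dre (?X * T ?x (q s)) \<in> V" by (rule vimageD[OF IntD2[OF qs]])
        ultimately show ?thesis by (simp only: r_def)
      qed
      have r: "path r" "path_image r \<subseteq> V" "pathstart r = dre ?X"
      proof -
        show "path r" unfolding path_def r_def
          by (intro bounded_linear.continuous_on[OF bounded_linear_dre] continuous_intros plift_continuous[OF q(2) qN])
        show "path_image r \<subseteq> V" using rV by (auto simp: path_image_def)
        show "pathstart r = dre ?X" by (simp add: pathstart_def r_def plift(2)[OF q(2) qN])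
      qed
      note dp = dre_plift_path[OF pD(1,2)]
      have "fst (cover_map \<beta>) = hclass SL2 ((\<lambda>s. dre (plift p s)) +++ r)"
        unfolding cover_map_eq[OF \<beta>u jb] fst_conv plift_class_extend[OF pD(1,2) q(2) qN pq] r_def ..
      also have "\<dots> = extend SL2 (fst (cover_map \<alpha>)) r"
        unfolding cover_map_eq[OF \<alpha> p] fst_conv
        by (rule extend_hclass[symmetric, OF dp(1,2) r(1)]) (use r dp openin_imp_subset[OF V(1)] in auto)
      finally show "fst (cover_map \<beta>) \<in> cover_nbhd SL2 (fst (cover_map \<alpha>)) V"
        unfolding cover_nbhd_def using r cover_map_props(1)[OF \<alpha>] holo_eq(1)[OF \<alpha> p] by auto
    qed
  qed
qed

end

lemma normalized_quasiperiodicI: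
  assumes "\<And>\<alpha>. \<alpha> \<in> ucover N x0 \<Longrightarrow> F \<alpha> \<in> carrier G"
    and "\<And>\<kappa> \<alpha>. \<kappa> \<in> loops N x0 \<Longrightarrow> \<alpha> \<in> ucover N x0 \<Longrightarrow> F (concat_class N \<kappa> \<alpha>) = F \<kappa> \<otimes>\<^bsub>G\<^esub> F \<alpha>"
  shows "normalized_quasiperiodic N x0 G F"
  unfolding normalized_quasiperiodic_def quasiperiodic_with_def
  by (rule exI[of _ F]) (use assms in \<open>auto simp: loops_def\<close>)

context surface
begin

lemma sheet_smooth:
  assumes \<Omega>: "flat_form \<Omega>" and T: "germ_transport N T" "\<forall>x\<in>N. prim_at \<Omega> (T x) x"
    and G: "germ_transport.flat_section N T x0 G" and k: "k \<in> A" "K \<in> lifted_charts N x0 k"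
  shows "smooth_on (snd K ` fst K) (G \<circ> inv_into (fst K) (snd K))"
proof (rule smooth_on_linear_ode)
  note L = lifted_chart[OF k]
  show "smooth_on (snd K ` fst K) (\<Omega> k i \<circ> ic k)" for i
    by (rule smooth_on_subset[OF flat_form_parts(3)[OF \<Omega> k(1)] L(9)])
  fix z assume "z \<in> snd K ` fst K"
  then obtain \<alpha> where a: "\<alpha> \<in> fst K" "z = snd K \<alpha>" by blast
  have e: "inv_into (fst K) (snd K) z = \<alpha>" unfolding a(2) by (rule inv_into_f_f[OF L(6) a(1)])
  have z: "z = snd k (endpt \<alpha>)" "endpt \<alpha> \<in> fst k" using a L(1,4) by auto
  have i: "ic k z = endpt \<alpha>" unfolding z(1) by (rule ic_snd[OF k(1) z(2)])
  show "(G \<circ> inv_into (fst K) (snd K) has_derivative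
      (\<lambda>h. (G \<circ> inv_into (fst K) (snd K)) z * (\<Sum>i\<in>UNIV. h $ i *\<^sub>R (\<Omega> k i \<circ> ic k) z))) (at z within snd K ` fst K)"
    using flat_section_derivative[OF T G k a(1)] by (simp add: e i pform_def a(2)[symmetric])
qed

lemma sheet_comp_cong:
  assumes "smooth_on (snd K ` fst K) (H \<circ> inv_into (fst K) (snd K))" "\<And>\<alpha>. \<alpha> \<in> fst K \<Longrightarrow> F \<alpha> = H \<alpha>"
  shows "smooth_in_chart K F"
proof -
  have "(F \<circ> inv_into (fst K) (snd K)) z = (H \<circ> inv_into (fst K) (snd K)) z" if "z \<in> snd K ` fst K" for z
    using assms(2) inv_into_into[OF that] by simp
  then show ?thesis unfolding smooth_in_chart_def using assms(1) smooth_on_cong by metis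
qed

lemma smooth_on_dre_dtrans:
  assumes "smooth_on S G"
  shows "smooth_on S (\<lambda>z. dre (G z))" "smooth_on S (\<lambda>z. dtrans (G z))"
proof -
  show 1: "smooth_on S (\<lambda>z. dre (G z))"
    using Ck_on_bounded_linear[OF bounded_linear_dre] assms by (auto simp: smooth_on_def)
  show "smooth_on S (\<lambda>z. dtrans (G z))"
    unfolding dtrans_def smooth_on_def
    by (intro allI Ck_on_bilinear[OF bounded_bilinear_matrix_mult] Ck_on_bounded_linear[OF bounded_linear_adj2]
        Ck_on_bounded_linear[OF bounded_linear_deps] smooth_onD[OF 1] smooth_onD[OF assms])
qed

lemma cover_map_smooth:
  assumes \<Omega>: "flat_form \<Omega>" and T: "germ_transport N T" "\<forall>x\<in>N. prim_at \<Omega> (T x) x"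
  shows "smooth_ISOt_valued N A x0 (restrict (germ_transport.cover_map T) (ucover N x0))"
    "normalized_quasiperiodic N x0 ISOt (restrict (germ_transport.cover_map T) (ucover N x0))"
proof -
  interpret germ_transport N T by (rule T(1))
  show "smooth_ISOt_valued N A x0 (restrict cover_map (ucover N x0))"
    unfolding smooth_ISOt_valued_def smooth_on_cover_def
  proof (intro conjI ballI)
    show "continuous_map (ucover_topology N x0) (ucover_topology SL2 (mat 1)) (\<lambda>\<alpha>. fst (restrict cover_map (ucover N x0) \<alpha>))"
      by (rule continuous_map_eq[OF cover_map_continuous]) simp
    fix k K assume k: "k \<in> A" "K \<in> lifted_charts N x0 k"
    note L = lifted_chart[OF k]
    have "smooth_on (snd K ` fst K) (\<lambda>z. holo (inv_into (fst K) (snd K) z))"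
      using sheet_smooth[OF \<Omega> T holo_flat_section k] by (simp add: o_def)
    note S = smooth_on_dre_dtrans[OF this]
    show "smooth_in_chart K (\<lambda>\<alpha>. endpt (fst (restrict cover_map (ucover N x0) \<alpha>)))"
    proof (rule sheet_comp_cong[where H = "\<lambda>\<alpha>. dre (holo \<alpha>)"])
      show "smooth_on (snd K ` fst K) ((\<lambda>\<alpha>. dre (holo \<alpha>)) \<circ> inv_into (fst K) (snd K))" using S(1) by (simp add: o_def)
      fix \<alpha> assume "\<alpha> \<in> fst K"
      then have "\<alpha> \<in> ucover N x0" using L(3) by blast
      then show "endpt (fst (restrict cover_map (ucover N x0) \<alpha>)) = dre (holo \<alpha>)" using cover_map_props(1) by simp
    qed
    show "smooth_in_chart K (\<lambda>\<alpha>. snd (restrict cover_map (ucover N x0) \<alpha>))"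
    proof (rule sheet_comp_cong[where H = "\<lambda>\<alpha>. dtrans (holo \<alpha>)"])
      show "smooth_on (snd K ` fst K) ((\<lambda>\<alpha>. dtrans (holo \<alpha>)) \<circ> inv_into (fst K) (snd K))" using S(2) by (simp add: o_def)
      fix \<alpha> assume "\<alpha> \<in> fst K"
      then have "\<alpha> \<in> ucover N x0" using L(3) by blast
      then show "snd (restrict cover_map (ucover N x0) \<alpha>) = dtrans (holo \<alpha>)" using cover_map_props(2) by simp
    qed
  qed
  show "normalized_quasiperiodic N x0 ISOt (restrict cover_map (ucover N x0))"
  proof (rule normalized_quasiperiodicI)
    show "restrict cover_map (ucover N x0) \<alpha> \<in> carrier ISOt" if "\<alpha> \<in> ucover N x0" for \<alpha>
      using cover_map_props(4)[OF that] that by simp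
    fix \<kappa> \<alpha> assume k: "\<kappa> \<in> loops N x0" and \<alpha>: "\<alpha> \<in> ucover N x0"
    then have \<kappa>: "\<kappa> \<in> ucover N x0" "endpt \<kappa> = x0" by (auto simp: loops_def)
    obtain p where p: "p \<in> \<kappa>" using \<kappa>(1) by (rule ucover_nonempty)
    obtain q where q: "q \<in> \<alpha>" using \<alpha> by (rule ucover_nonempty)
    have "concat_class N \<kappa> \<alpha> \<in> ucover N x0" by (rule concat_class_eq(5)[OF \<kappa> \<alpha> p q])
    then show "restrict cover_map (ucover N x0) (concat_class N \<kappa> \<alpha>) =
        restrict cover_map (ucover N x0) \<kappa> \<otimes>\<^bsub>ISOt\<^esub> restrict cover_map (ucover N x0) \<alpha>"
      using cover_map_mult[OF \<kappa> \<alpha>] \<kappa> \<alpha> by simp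
  qed
qed

text \<open>On a sheet dg = g \<omega> and df = g \<gamma> g^-1, by \<open>dre_derivative\<close>
  and \<open>dtrans_derivative\<close>; solving for the forms gives the formulas of the inverse
  map.\<close>

lemma sheet_forms:
  assumes \<Omega>: "skew (dform \<omega> \<gamma>)" and T: "germ_transport N T" "\<forall>x\<in>N. prim_at (dform \<omega> \<gamma>) (T x) x"
    and G: "germ_transport.flat_section N T x0 G" and k: "k \<in> A" "K \<in> lifted_charts N x0 k" "\<alpha> \<in> fst K"
    and g: "\<And>\<beta>. \<beta> \<in> fst K \<Longrightarrow> g \<beta> = dre (G \<beta>)" and f: "\<And>\<beta>. \<beta> \<in> fst K \<Longrightarrow> f \<beta> = dtrans (G \<beta>)"
  shows "\<omega> k i (endpt \<alpha>) = matrix_inv (g \<alpha>) ** chart_deriv K i g \<alpha>"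
    "\<gamma> k i (endpt \<alpha>) = matrix_inv (g \<alpha>) ** chart_deriv K i f \<alpha> ** g \<alpha>"
proof -
  interpret germ_transport N T by (rule T(1))
  note L = lifted_chart[OF k(1,2)]
  let ?i = "inv_into (fst K) (snd K)" and ?S = "snd K ` fst K" and ?z = "snd K \<alpha>"
  have e: "?i ?z = \<alpha>" by (rule inv_into_f_f[OF L(6) k(3)])
  have z: "?z \<in> ?S" using k(3) by blast
  have ek: "endpt \<alpha> \<in> fst k" using L(4) k(3) by blast
  have ins: "?i z \<in> fst K" if "z \<in> ?S" for z by (rule inv_into_into[OF that])
  have "\<alpha> \<in> ucover N x0" using L(3) k(3) by blast
  then have Gg: "G \<alpha> \<in> dgroup" using G unfolding flat_section_def by blast
  have D: "((G \<circ> ?i) has_derivative (\<lambda>h. (G \<circ> ?i) ?z * pform (dform \<omega> \<gamma>) k (endpt \<alpha>) h)) (at ?z within ?S)"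
    using flat_section_derivative[OF T G k] by (simp add: e)
  have "((\<lambda>z. dre ((G \<circ> ?i) z)) has_derivative (\<lambda>h. dre (G \<alpha>) ** dre (pform (dform \<omega> \<gamma>) k (endpt \<alpha>) h))) (at ?z within ?S)"
    using dre_derivative[OF D] by (simp add: e)
  then have dg: "((g \<circ> ?i) has_derivative (\<lambda>h. dre (G \<alpha>) ** dre (pform (dform \<omega> \<gamma>) k (endpt \<alpha>) h))) (at ?z within ?S)"
    by (rule has_derivative_transform[OF z, rotated]) (use g ins in simp)
  have "((\<lambda>z. dtrans ((G \<circ> ?i) z)) has_derivative
      (\<lambda>h. dre (G \<alpha>) ** deps (pform (dform \<omega> \<gamma>) k (endpt \<alpha>) h) ** adj2 (dre (G \<alpha>)))) (at ?z within ?S)"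
    using dtrans_derivative[OF D skew_pform[OF \<Omega> k(1) ek]] by (simp add: e)
  then have df: "((f \<circ> ?i) has_derivative
      (\<lambda>h. dre (G \<alpha>) ** deps (pform (dform \<omega> \<gamma>) k (endpt \<alpha>) h) ** adj2 (dre (G \<alpha>)))) (at ?z within ?S)"
    by (rule has_derivative_transform[OF z, rotated]) (use f ins in simp)
  have cg: "chart_deriv K i g \<alpha> = dre (G \<alpha>) ** \<omega> k i (endpt \<alpha>)"
    unfolding chart_deriv_def ample_frechet_derivative[OF L(8) z dg] by simp
  have cf: "chart_deriv K i f \<alpha> = dre (G \<alpha>) ** \<gamma> k i (endpt \<alpha>) ** adj2 (dre (G \<alpha>))"
    unfolding chart_deriv_def ample_frechet_derivative[OF L(8) z df] by simp
  have ga: "g \<alpha> = dre (G \<alpha>)" "dre (G \<alpha>) \<in> SL2" using g[OF k(3)] dgroup_dre[OF Gg] by auto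
  have i: "adj2 (dre (G \<alpha>)) ** dre (G \<alpha>) = mat 1" using ga(2) by (simp add: adj2_mult_self SL2_def)
  show "\<omega> k i (endpt \<alpha>) = matrix_inv (g \<alpha>) ** chart_deriv K i g \<alpha>"
    unfolding cg ga(1) matrix_inv_SL2[OF ga(2)] by (simp add: matrix_mul_assoc i)
  show "\<gamma> k i (endpt \<alpha>) = matrix_inv (g \<alpha>) ** chart_deriv K i f \<alpha> ** g \<alpha>"
  proof -
    have "adj2 (dre (G \<alpha>)) ** (dre (G \<alpha>) ** \<gamma> k i (endpt \<alpha>) ** adj2 (dre (G \<alpha>))) ** dre (G \<alpha>) =
      (adj2 (dre (G \<alpha>)) ** dre (G \<alpha>)) ** \<gamma> k i (endpt \<alpha>) ** (adj2 (dre (G \<alpha>)) ** dre (G \<alpha>))"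
      by (simp only: matrix_mul_assoc)
    then show ?thesis unfolding cf ga(1) matrix_inv_SL2[OF ga(2)] by (simp add: i)
  qed
qed

end

section \<open>The map from field configurations to data on the cover\<close>

locale bounded_surface = surface N A for N :: "'p::topological_space set" and A :: "'p chart set" +
  fixes x0 :: 'p and L :: "'l set" and circ :: "'l \<Rightarrow> real \<Rightarrow> 'p" and bfam :: "'l \<Rightarrow> real \<Rightarrow> (real \<Rightarrow> 'p) set"
  assumes conn: "connected N" and bc: "boundary_circles A L circ" and x0: "x0 \<in> N"
    and bf: "\<And>l. l \<in> L \<Longrightarrow> boundary_family N x0 (circ l) (bfam l)"
begin

lemma circ_in: "l \<in> L \<Longrightarrow> circ l \<phi> \<in> N"
proof -
  assume l: "l \<in> L"
  then have "circ l \<phi> \<in> surface_boundary A" using bc by (auto simp: boundary_circles_def)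
  then show ?thesis using chart_subset by (auto simp: surface_boundary_def)
qed

lemma circ_chart:
  assumes "l \<in> L" "c \<in> A"
  shows "open {\<phi>. circ l \<phi> \<in> fst c}" "smooth_on {\<phi>. circ l \<phi> \<in> fst c} (snd c \<circ> circ l)"
  using bc assms unfolding boundary_circles_def by blast+

lemma circ_periodic: "l \<in> L \<Longrightarrow> circ l (\<phi> + 2 * pi) = circ l \<phi>"
proof -
  assume l: "l \<in> L"
  have "circ l (\<phi> + 2 * pi) = circ l \<phi> \<longleftrightarrow> (\<exists>n::int. \<phi> + 2 * pi - \<phi> = 2 * pi * of_int n)"
    using bc l unfolding boundary_circles_def by blast
  moreover have "\<phi> + 2 * pi - \<phi> = 2 * pi * of_int 1" by simp
  ultimately show ?thesis by blast
qed

lemma circ_differentiable: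
  assumes "l \<in> L" "c \<in> A" "circ l \<phi> \<in> fst c"
  shows "(snd c \<circ> circ l) differentiable (at \<phi>)"
proof -
  obtain f' where "\<And>z. z \<in> {\<phi>. circ l \<phi> \<in> fst c} \<Longrightarrow> (snd c \<circ> circ l has_derivative f' z) (at z within {\<phi>. circ l \<phi> \<in> fst c})"
    using smooth_on_imp_derivative[OF circ_chart(2)[OF assms(1,2)]] by metis
  then have "(snd c \<circ> circ l has_derivative f' \<phi>) (at \<phi> within {\<phi>. circ l \<phi> \<in> fst c})" using assms(3) by blast
  then show ?thesis
    using at_within_open[OF _ circ_chart(1)[OF assms(1,2)], of \<phi>] assms(3) unfolding differentiable_def by auto
qed

lemma circ_continuous:
  assumes l: "l \<in> L" shows "continuous_on UNIV (circ l)"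
proof -
  have "continuous_on (\<Union>c\<in>A. {\<phi>. circ l \<phi> \<in> fst c}) (circ l)"
  proof (rule continuous_on_open_UN)
    fix c assume c: "c \<in> A"
    show "open {\<phi>. circ l \<phi> \<in> fst c}" by (rule circ_chart(1)[OF l c])
    have "continuous_on {\<phi>. circ l \<phi> \<in> fst c} (snd c \<circ> circ l)"
      by (rule Ck_on_continuous[OF smooth_onD[OF circ_chart(2)[OF l c], of 0]])
    then have "continuous_on {\<phi>. circ l \<phi> \<in> fst c} (\<lambda>\<phi>. ic c ((snd c \<circ> circ l) \<phi>))"
      by (rule continuous_on_compose2[OF chart_homeo(3)[OF c]]) auto
    then show "continuous_on {\<phi>. circ l \<phi> \<in> fst c} (circ l)"
      by (rule continuous_on_eq) (use ic_snd[OF c] in simp)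
  qed
  moreover have "(\<Union>c\<in>A. {\<phi>. circ l \<phi> \<in> fst c}) = UNIV" using chart_covers[OF circ_in[OF l]] by blast
  ultimately show ?thesis by simp
qed

lemma bfam_props:
  assumes l: "l \<in> L"
  shows "continuous_map (top_of_set UNIV) (ucover_topology N x0) (bfam l)" "endpt (bfam l \<phi>) = circ l \<phi>"
    "bfam l \<phi> \<in> ucover N x0"
proof -
  show c: "continuous_map (top_of_set UNIV) (ucover_topology N x0) (bfam l)" and "endpt (bfam l \<phi>) = circ l \<phi>"
    using bf[OF l] by (auto simp: boundary_family_def)
  show "bfam l \<phi> \<in> ucover N x0" using continuous_map_image_subset_topspace[OF c] by auto
qed

lemma boundary_section_derivative:
  assumes l: "l \<in> L" and T: "germ_transport N T" "\<forall>x\<in>N. prim_at \<Omega> (T x) x"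
    and G: "germ_transport.flat_section N T x0 G"
  shows "((\<lambda>\<phi>. G (bfam l \<phi>)) has_vector_derivative G (bfam l \<phi>) * dalong \<Omega> UNIV (circ l) \<phi>) (at \<phi>)"
proof -
  interpret germ_transport N T by (rule T(1))
  have "parallel UNIV (\<lambda>\<phi>. endpt (bfam l \<phi>)) (\<lambda>\<phi>. G (bfam l \<phi>))"
    by (rule flat_section_compose[OF G bfam_props(1)[OF l]])
  then have "parallel UNIV (circ l) (\<lambda>\<phi>. G (bfam l \<phi>))"
    unfolding bfam_props(2)[OF l] by simp
  from parallel_derivative[OF T this circ_continuous[OF l]] show ?thesis
    using circ_in[OF l] circ_differentiable[OF l] by (auto simp: image_subset_iff)
qed

lemma zero_derivative_constant:
  fixes P Q :: "real \<Rightarrow> dmat"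
  assumes P: "\<And>t. (P has_vector_derivative P t * a t) (at t)" and Q: "\<And>t. (Q has_vector_derivative Q t * a t) (at t)"
    and a: "\<And>t. dadj (a t) = - a t"
  shows "P s * dadj (Q s) = P t * dadj (Q t)"
proof -
  have "((\<lambda>t. P t * dadj (Q t)) has_derivative (\<lambda>h. 0)) (at t within UNIV)" for t
    by (rule has_derivative_mult_dadj[where w = "\<lambda>h. h *\<^sub>R a t"])
       (use P[of t] Q[of t] a[of t] in \<open>simp_all add: has_vector_derivative_def dadj_scaleR\<close>)
  then show ?thesis
    using has_derivative_zero_constant[OF convex_UNIV, of "\<lambda>t. P t * dadj (Q t)"] by (metis UNIV_I)
qed

definition field_transport :: "'p mform \<Rightarrow> 'p mform \<Rightarrow> 'p \<Rightarrow> 'p \<Rightarrow> dmat" where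
  "field_transport \<omega> \<gamma> = (SOME T. germ_transport N T \<and> (\<forall>x\<in>N. prim_at (dform \<omega> \<gamma>) (T x) x))"

lemma field_transport:
  assumes "flat_form (dform \<omega> \<gamma>)"
  shows "germ_transport N (field_transport \<omega> \<gamma>)" "\<forall>x\<in>N. prim_at (dform \<omega> \<gamma>) (field_transport \<omega> \<gamma> x) x"
  using someI_ex[OF germ_exists[OF assms]] unfolding field_transport_def by blast+

text \<open>The dual form of the pair (b, c). The angle 0 is arbitrary, by
  \<open>boundary_constant\<close>.\<close>

definition boundary_offset :: "'p mform \<Rightarrow> 'p mform \<Rightarrow> ('l \<Rightarrow> real \<Rightarrow> real^2^2) \<Rightarrow> ('l \<Rightarrow> real \<Rightarrow> real^2^2) \<Rightarrow> 'l \<Rightarrow> dmat" where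
  "boundary_offset \<omega> \<gamma> u v l = germ_transport.holo (field_transport \<omega> \<gamma>) (bfam l 0) * dadj (dpair (u l 0) (v l 0))"

definition \<Phi> where
  "\<Phi> = (\<lambda>(\<omega>, \<gamma>, u, v). (restrict (germ_transport.cover_map (field_transport \<omega> \<gamma>)) (ucover N x0),
     restrict (\<lambda>l. dre (boundary_offset \<omega> \<gamma> u v l)) L, restrict (\<lambda>l. dtrans (boundary_offset \<omega> \<gamma> u v l)) L))"

lemma physicalD:
  assumes "(\<omega>, \<gamma>, u, v) \<in> physical_configs A L circ"
  shows "flat_form (dform \<omega> \<gamma>)" "u \<in> extensional L" "v \<in> extensional L"
    "\<forall>c i x. \<not> (c \<in> A \<and> x \<in> fst c) \<longrightarrow> \<omega> c i x = undefined \<and> \<gamma> c i x = undefined"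
    "\<And>l \<phi>. l \<in> L \<Longrightarrow> u l \<phi> \<in> SL2" "\<And>l \<phi>. l \<in> L \<Longrightarrow> v l \<phi> \<in> sl2"
    "\<And>l. l \<in> L \<Longrightarrow> smooth_on UNIV (u l)" "\<And>l. l \<in> L \<Longrightarrow> smooth_on UNIV (v l)"
    "\<And>l \<phi>. l \<in> L \<Longrightarrow> matrix_inv (u l \<phi>) ** vector_derivative (u l) (at \<phi>) = form_along A \<omega> UNIV (circ l) \<phi>"
    "\<And>l \<phi>. l \<in> L \<Longrightarrow> matrix_inv (u l \<phi>) ** vector_derivative (v l) (at \<phi>) ** u l \<phi> = form_along A \<gamma> UNIV (circ l) \<phi>"
proof -
  show U: "\<forall>c i x. \<not> (c \<in> A \<and> x \<in> fst c) \<longrightarrow> \<omega> c i x = undefined \<and> \<gamma> c i x = undefined"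
    using assms by (simp add: physical_configs_def field_configs_def sl2_form_def)
  show "flat_form (dform \<omega> \<gamma>)"
    unfolding flat_form_dform_iff[OF U] using assms by (simp add: physical_configs_def field_configs_def)
qed (use assms in \<open>simp_all add: physical_configs_def field_configs_def\<close>)

text \<open>The holonomy along the boundary family and \<open>dpair u v\<close> solve the same
  linear equation along the circle, so their quotient does not depend on the angle.\<close>

lemma boundary_constant:
  assumes ph: "(\<omega>, \<gamma>, u, v) \<in> physical_configs A L circ" and l: "l \<in> L"
  shows "germ_transport.holo (field_transport \<omega> \<gamma>) (bfam l \<phi>) * dadj (dpair (u l \<phi>) (v l \<phi>)) = boundary_offset \<omega> \<gamma> u v l"
    "boundary_offset \<omega> \<gamma> u v l \<in> dgroup"
proof -
  note P = physicalD[OF ph]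
  note T = field_transport[OF P(1)]
  interpret germ_transport N "field_transport \<omega> \<gamma>" by (rule T(1))
  let ?a = "\<lambda>\<phi>. dalong (dform \<omega> \<gamma>) UNIV (circ l) \<phi>"
  have dv: "(f has_vector_derivative vector_derivative f (at \<phi>)) (at \<phi>)" if sm: "smooth_on UNIV f" for f :: "real \<Rightarrow> real^2^2" and \<phi>
  proof -
    obtain f' where "\<And>z. z \<in> UNIV \<Longrightarrow> (f has_derivative f' z) (at z within UNIV)"
      using smooth_on_imp_derivative[OF sm] by metis
    then have "f differentiable (at \<phi>)" unfolding differentiable_def by auto
    then show ?thesis by (simp add: vector_derivative_works)
  qed
  have 1: "((\<lambda>\<phi>. dpair (u l \<phi>) (v l \<phi>)) has_vector_derivative dpair (u l \<phi>) (v l \<phi>) * ?a \<phi>) (at \<phi>)" for \<phi>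
    by (rule dpair_vector_derivative[OF dv[OF P(7)[OF l]] dv[OF P(8)[OF l]] P(5)[OF l]])
       (simp_all add: dalong_dform P(9,10)[OF l])
  have 2: "((\<lambda>\<phi>. holo (bfam l \<phi>)) has_vector_derivative holo (bfam l \<phi>) * ?a \<phi>) (at \<phi>)" for \<phi>
    by (rule boundary_section_derivative[OF l T holo_flat_section])
  show "holo (bfam l \<phi>) * dadj (dpair (u l \<phi>) (v l \<phi>)) = boundary_offset \<omega> \<gamma> u v l"
    unfolding boundary_offset_def
    by (rule zero_derivative_constant[OF 2 1 skew_dalong[OF flat_form_parts(2)[OF P(1)] circ_in[OF l]]])
  show "boundary_offset \<omega> \<gamma> u v l \<in> dgroup"
    unfolding boundary_offset_def
    by (intro dgroup_mult dgroup_dadj dpair_dgroup cover_map_props(3)[OF bfam_props(3)[OF l]] P(5,6)[OF l])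
qed

lemma \<Phi>_in_cover_data:
  assumes ph: "x \<in> physical_configs A L circ"
  shows "\<Phi> x \<in> cover_data N A x0 L"
proof -
  obtain \<omega> \<gamma> u v where x: "x = (\<omega>, \<gamma>, u, v)" by (cases x)
  note P = physicalD[OF ph[unfolded x]]
  note T = field_transport[OF P(1)]
  show ?thesis
    unfolding x \<Phi>_def cover_data_def
    using cover_map_smooth[OF P(1) T, of x0] dgroup_dre dgroup_dtrans boundary_constant(2)[OF ph[unfolded x]]
    by (auto simp: PiE_def)
qed

lemma \<Phi>_transport:
  assumes ph: "(\<omega>, \<gamma>, u, v) \<in> physical_configs A L circ" and eq: "\<Phi> (\<omega>, \<gamma>, u, v) = (F, b, c)"
  shows "\<forall>\<alpha>\<in>ucover N x0. \<forall>p\<in>\<alpha>. piecewise_C1_path N A p \<longrightarrow>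
      fst (F \<alpha>) = hclass SL2 (\<lambda>s. transport A \<omega> p 0 s) \<and> snd (F \<alpha>) = dist_V A \<omega> \<gamma> p"
    and "\<forall>l\<in>L. \<forall>\<phi>. \<forall>p\<in>bfam l \<phi>. piecewise_C1_path N A p \<longrightarrow>
      b l = transport A \<omega> p 0 1 ** matrix_inv (u l \<phi>) \<and>
      c l = dist_V A \<omega> \<gamma> p - transport A \<omega> p 0 1 ** matrix_inv (u l \<phi>) ** v l \<phi> ** u l \<phi> ** matrix_inv (transport A \<omega> p 0 1)"
proof -
  note P = physicalD[OF ph]
  note T = field_transport[OF P(1)]
  interpret germ_transport N "field_transport \<omega> \<gamma>" by (rule T(1))
  have F: "F = restrict cover_map (ucover N x0)" and b: "b = restrict (\<lambda>l. dre (boundary_offset \<omega> \<gamma> u v l)) L"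
    and c: "c = restrict (\<lambda>l. dtrans (boundary_offset \<omega> \<gamma> u v l)) L"
    using eq by (auto simp: \<Phi>_def)
  have tp: "transport A \<omega> p 0 s = dre (plift p s)" if "s \<in> {0..1}" "piecewise_C1_path N A p" for p s
  proof -
    have "path p" "path_image p \<subseteq> N" using that(2) by (auto simp: piecewise_C1_path_def)
    then have "plift p 0 = 1" by (rule plift(2))
    then show ?thesis using transport_plift(1)[OF T flat_form_parts(2)[OF P(1)] that(2), of 0 s] that(1) by (simp add: adj2_one)
  qed
  have dV: "dist_V A \<omega> \<gamma> p = dtrans (plift p 1)" if "piecewise_C1_path N A p" for p
    by (rule transport_plift(2)[OF T flat_form_parts(2)[OF P(1)] that])
  show "\<forall>\<alpha>\<in>ucover N x0. \<forall>p\<in>\<alpha>. piecewise_C1_path N A p \<longrightarrow>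
      fst (F \<alpha>) = hclass SL2 (\<lambda>s. transport A \<omega> p 0 s) \<and> snd (F \<alpha>) = dist_V A \<omega> \<gamma> p"
  proof (intro ballI impI conjI)
    fix \<alpha> p assume \<alpha>: "\<alpha> \<in> ucover N x0" and p: "p \<in> \<alpha>" and pc: "piecewise_C1_path N A p"
    note pD = ucoverD[OF \<alpha> p]
    have "homotopic_paths SL2 (\<lambda>s. dre (plift p s)) (\<lambda>s. transport A \<omega> p 0 s)"
      by (rule homotopic_paths_eq[OF dre_plift_path(1,2)[OF pD(1,2)]]) (simp add: tp[OF _ pc])
    then show "fst (F \<alpha>) = hclass SL2 (\<lambda>s. transport A \<omega> p 0 s)"
      using \<alpha> hclass_eqI by (simp add: F cover_map_eq[OF \<alpha> p])
    show "snd (F \<alpha>) = dist_V A \<omega> \<gamma> p" using \<alpha> by (simp add: F cover_map_eq[OF \<alpha> p] dV[OF pc])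
  qed
  show "\<forall>l\<in>L. \<forall>\<phi>. \<forall>p\<in>bfam l \<phi>. piecewise_C1_path N A p \<longrightarrow>
      b l = transport A \<omega> p 0 1 ** matrix_inv (u l \<phi>) \<and>
      c l = dist_V A \<omega> \<gamma> p - transport A \<omega> p 0 1 ** matrix_inv (u l \<phi>) ** v l \<phi> ** u l \<phi> ** matrix_inv (transport A \<omega> p 0 1)"
  proof (intro ballI allI impI)
    fix l \<phi> p assume l: "l \<in> L" and p: "p \<in> bfam l \<phi>" and pc: "piecewise_C1_path N A p"
    note \<beta> = bfam_props(3)[OF l, of \<phi>]
    note pD = ucoverD[OF \<beta> p]
    let ?X = "plift p 1" and ?u = "dpair (u l \<phi>) (v l \<phi>)"
    have X: "?X \<in> dgroup" by (rule plift_group[OF pD(1,2)]) simp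
    have u: "?u \<in> dgroup" by (rule dpair_dgroup[OF P(5,6)[OF l]])
    \<comment> \<open>Because the offset is the same at every angle, it may be computed at the given
      \<open>\<phi>\<close> and with the given representative \<open>p\<close>; expanding
      \<open>dtrans\<close> of the product yields the formula for \<open>c\<close>.\<close>
    have B: "boundary_offset \<omega> \<gamma> u v l = ?X * dadj ?u"
      using boundary_constant(1)[OF ph l, of \<phi>] holo_eq(1)[OF \<beta> p] by simp
    have t1: "transport A \<omega> p 0 1 = dre ?X" by (rule tp[OF _ pc]) simp
    show "b l = transport A \<omega> p 0 1 ** matrix_inv (u l \<phi>) \<and>
      c l = dist_V A \<omega> \<gamma> p - transport A \<omega> p 0 1 ** matrix_inv (u l \<phi>) ** v l \<phi> ** u l \<phi> ** matrix_inv (transport A \<omega> p 0 1)"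
      unfolding t1 dV[OF pc] matrix_inv_SL2[OF P(5)[OF l]] matrix_inv_SL2[OF dgroup_dre[OF X]]
      using l by (simp add: b c B dtrans_mult[OF X dgroup_dadj[OF u]] dtrans_dadj[OF u] dtrans_dpair[OF P(5)[OF l]]
          matrix2_distribs matrix_mul_assoc)
  qed
qed

lemma \<Phi>_inverse:
  assumes ph: "(\<omega>, \<gamma>, u, v) \<in> physical_configs A L circ" and eq: "\<Phi> (\<omega>, \<gamma>, u, v) = (F, b, c)"
    and g: "g = (\<lambda>\<alpha>. endpt (fst (F \<alpha>)))" and f: "f = (\<lambda>\<alpha>. snd (F \<alpha>))"
  shows "\<forall>k\<in>A. \<forall>K\<in>lifted_charts N x0 k. \<forall>\<alpha>\<in>fst K. \<forall>i.
      \<omega> k i (endpt \<alpha>) = matrix_inv (g \<alpha>) ** chart_deriv K i g \<alpha> \<and>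
      \<gamma> k i (endpt \<alpha>) = matrix_inv (g \<alpha>) ** chart_deriv K i f \<alpha> ** g \<alpha>"
    and "\<forall>l\<in>L. \<forall>\<phi>. u l \<phi> = matrix_inv (b l) ** g (bfam l \<phi>) \<and>
      v l \<phi> = matrix_inv (b l) ** (f (bfam l \<phi>) - c l) ** b l"
proof -
  note P = physicalD[OF ph]
  note T = field_transport[OF P(1)]
  interpret germ_transport N "field_transport \<omega> \<gamma>" by (rule T(1))
  have F: "F = restrict cover_map (ucover N x0)" and b: "b = restrict (\<lambda>l. dre (boundary_offset \<omega> \<gamma> u v l)) L"
    and c: "c = restrict (\<lambda>l. dtrans (boundary_offset \<omega> \<gamma> u v l)) L"
    using eq by (auto simp: \<Phi>_def)
  have ga: "g \<alpha> = dre (holo \<alpha>)" "f \<alpha> = dtrans (holo \<alpha>)" if "\<alpha> \<in> ucover N x0" for \<alpha>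
    using cover_map_props(1,2)[OF that] that by (simp_all add: g f F)
  show "\<forall>k\<in>A. \<forall>K\<in>lifted_charts N x0 k. \<forall>\<alpha>\<in>fst K. \<forall>i.
      \<omega> k i (endpt \<alpha>) = matrix_inv (g \<alpha>) ** chart_deriv K i g \<alpha> \<and>
      \<gamma> k i (endpt \<alpha>) = matrix_inv (g \<alpha>) ** chart_deriv K i f \<alpha> ** g \<alpha>"
  proof (intro ballI allI)
    fix k K \<alpha> i assume k: "k \<in> A" "K \<in> lifted_charts N x0 k" "\<alpha> \<in> fst K"
    have K: "\<beta> \<in> ucover N x0" if "\<beta> \<in> fst K" for \<beta> using lifted_chart(3)[OF k(1,2)] that by blast
    show "\<omega> k i (endpt \<alpha>) = matrix_inv (g \<alpha>) ** chart_deriv K i g \<alpha> \<and>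
      \<gamma> k i (endpt \<alpha>) = matrix_inv (g \<alpha>) ** chart_deriv K i f \<alpha> ** g \<alpha>"
      using sheet_forms[OF flat_form_parts(2)[OF P(1)] T holo_flat_section k ga(1)[OF K] ga(2)[OF K], of i] by blast
  qed
  show "\<forall>l\<in>L. \<forall>\<phi>. u l \<phi> = matrix_inv (b l) ** g (bfam l \<phi>) \<and>
      v l \<phi> = matrix_inv (b l) ** (f (bfam l \<phi>) - c l) ** b l"
  proof (intro ballI allI)
    fix l \<phi> assume l: "l \<in> L"
    let ?B = "boundary_offset \<omega> \<gamma> u v l" and ?u = "dpair (u l \<phi>) (v l \<phi>)" and ?X = "holo (bfam l \<phi>)"
    note \<beta> = bfam_props(3)[OF l, of \<phi>]
    have B: "?B \<in> dgroup" by (rule boundary_constant(2)[OF ph l])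
    have u: "?u \<in> dgroup" by (rule dpair_dgroup[OF P(5,6)[OF l]])
    have X: "?X \<in> dgroup" by (rule cover_map_props(3)[OF \<beta>])
    have "?B * ?u = ?X"
      using boundary_constant(1)[OF ph l, of \<phi>] dgroup_right[OF u] by (metis mult.assoc mult_1_right)
    then have e: "?u = dadj ?B * ?X" using dgroup_cancel(1)[OF B, of ?u] by simp
    have "u l \<phi> = dre (dadj ?B * ?X)" unfolding e[symmetric] by simp
    moreover have "v l \<phi> = dtrans (dadj ?B * ?X)" unfolding e[symmetric] using P(5)[OF l] by simp
    ultimately show "u l \<phi> = matrix_inv (b l) ** g (bfam l \<phi>) \<and>
      v l \<phi> = matrix_inv (b l) ** (f (bfam l \<phi>) - c l) ** b l"
      using l by (simp add: b c ga[OF \<beta>] matrix_inv_SL2[OF dgroup_dre[OF B]] dtrans_mult[OF dgroup_dadj[OF B] X]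
          dtrans_dadj[OF B] matrix2_distribs)
  qed
qed

text \<open>The formulas of \<open>\<Phi>_inverse\<close> express a configuration through its image.
  They reach every point of a chart, since by path connectedness some class ends there and lies on a
  sheet over that chart.\<close>

lemma \<Phi>_inj: "inj_on \<Phi> (physical_configs A L circ)"
proof (rule inj_onI)
  fix x y assume x: "x \<in> physical_configs A L circ" and y: "y \<in> physical_configs A L circ" and e: "\<Phi> x = \<Phi> y"
  obtain \<omega> \<gamma> u v where xe: "x = (\<omega>, \<gamma>, u, v)" by (cases x)
  obtain \<omega>' \<gamma>' u' v' where ye: "y = (\<omega>', \<gamma>', u', v')" by (cases y)
  obtain F b c where Fx: "\<Phi> (\<omega>, \<gamma>, u, v) = (F, b, c)" by (cases "\<Phi> (\<omega>, \<gamma>, u, v)")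
  have Fy: "\<Phi> (\<omega>', \<gamma>', u', v') = (F, b, c)" using e Fx xe ye by simp
  note I = \<Phi>_inverse[OF x[unfolded xe] Fx refl refl] and J = \<Phi>_inverse[OF y[unfolded ye] Fy refl refl]
  note P = physicalD[OF x[unfolded xe]] and Q = physicalD[OF y[unfolded ye]]
  have "\<omega> k i z = \<omega>' k i z \<and> \<gamma> k i z = \<gamma>' k i z" for k i z
  proof (cases "k \<in> A \<and> z \<in> fst k")
    case True
    then have zN: "z \<in> N" using chart_subset by blast
    obtain \<alpha> where a: "\<alpha> \<in> ucover N x0" "endpt \<alpha> = z" using ucover_over_point[OF path_connected_N[OF conn] x0 zN] .
    obtain K where K: "K \<in> lifted_charts N x0 k" "\<alpha> \<in> fst K"
      using lifted_chart_exists[of k \<alpha> x0] True a by auto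
    show ?thesis
      using I(1)[rule_format, of k K \<alpha> i] J(1)[rule_format, of k K \<alpha> i] True K a(2) by simp
  next
    case False
    show ?thesis
      using P(4)[rule_format, OF False, of i] Q(4)[rule_format, OF False, of i] by presburger
  qed
  then have "\<omega> = \<omega>'" "\<gamma> = \<gamma>'" by (auto intro!: ext)
  moreover have "u = u'"
    by (rule extensionalityI[OF P(2) Q(2)]) (rule ext, use I(2) J(2) in simp)
  moreover have "v = v'"
    by (rule extensionalityI[OF P(3) Q(3)]) (rule ext, use I(2) J(2) in simp)
  ultimately show "x = y" by (simp add: xe ye)
qed

end

section \<open>From functions on the cover to fields\<close>

text \<open>Associativity of concatenation: the action of a loop on the left commutes with extension
  on the right.\<close>

lemma concat_class_extend:
  assumes \<kappa>: "\<kappa> \<in> ucover N x0" "endpt \<kappa> = x0" and \<alpha>: "\<alpha> \<in> ucover N x0" and q: "admissible N \<alpha> q"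
  shows "concat_class N \<kappa> (extend N \<alpha> q) = extend N (concat_class N \<kappa> \<alpha>) q"
proof -
  obtain p where p: "p \<in> \<kappa>" using \<kappa>(1) by (rule ucover_nonempty)
  obtain a where a: "a \<in> \<alpha>" using \<alpha> by (rule ucover_nonempty)
  note pD = ucoverD[OF \<kappa>(1) p] and aD = ucoverD[OF \<alpha> a] and cc = concat_class_eq[OF \<kappa> \<alpha> p a]
  have qD: "path q" "path_image q \<subseteq> N" "pathstart q = pathfinish a" using q aD(5) by (auto simp: admissible_def)
  have e: "extend N \<alpha> q = hclass N (a +++ q)" by (rule extend_eq[OF \<alpha> a q])
  have j: "path (a +++ q)" "path_image (a +++ q) \<subseteq> N" using aD qD by (auto simp: path_image_join)
  have i: "a +++ q \<in> extend N \<alpha> q" unfolding e by (rule hclass_self[OF j])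
  have adm: "admissible N (concat_class N \<kappa> \<alpha>) q" using q cc(7) by (simp add: admissible_def)
  have "concat_class N \<kappa> (extend N \<alpha> q) = hclass N (p +++ (a +++ q))"
    by (rule concat_class_eq(1)[OF \<kappa> extend_in_ucover(1)[OF \<alpha> q] p i])
  also have "\<dots> = hclass N ((p +++ a) +++ q)"
    by (rule hclass_eqI, rule homotopic_paths_assoc) (use pD aD qD cc(4) in auto)
  also have "\<dots> = extend N (concat_class N \<kappa> \<alpha>) q" by (rule extend_eq[OF cc(5,6) adm, symmetric])
  finally show ?thesis .
qed

text \<open>The loop is \<open>\<beta>\<close> followed by the reverse of a path in
  \<open>\<alpha>\<close>; deck transformations thus act transitively on each fibre.\<close>

lemma loop_between:
  assumes \<alpha>: "\<alpha> \<in> ucover N x0" and \<beta>: "\<beta> \<in> ucover N x0" and e: "endpt \<alpha> = endpt \<beta>"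
  obtains \<kappa> where "\<kappa> \<in> loops N x0" "\<kappa> \<in> ucover N x0" "endpt \<kappa> = x0" "concat_class N \<kappa> \<alpha> = \<beta>"
proof -
  obtain p where p: "p \<in> \<alpha>" using \<alpha> by (rule ucover_nonempty)
  note pD = ucoverD[OF \<alpha> p]
  have adm: "admissible N \<beta> (reversepath p)" using pD e by (simp add: admissible_def)
  define \<kappa> where "\<kappa> = extend N \<beta> (reversepath p)"
  have \<kappa>: "\<kappa> \<in> ucover N x0" "endpt \<kappa> = x0"
    using extend_in_ucover[OF \<beta> adm] pD(3) by (simp_all add: \<kappa>_def)
  obtain q where q: "q \<in> \<kappa>" using \<kappa>(1) by (rule ucover_nonempty)
  have adm': "admissible N \<kappa> p" using pD \<kappa>(2) by (simp add: admissible_def)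
  have "concat_class N \<kappa> \<alpha> = extend N \<kappa> p"
    unfolding concat_class_eq(1)[OF \<kappa> \<alpha> q p] by (rule extend_eq[OF \<kappa>(1) q adm', symmetric])
  also have "\<dots> = \<beta>" using extend_reverse[OF \<beta> adm] by (simp add: \<kappa>_def)
  finally show ?thesis using \<kappa> by (intro that[of \<kappa>]) (auto simp: loops_def)
qed

lemma const_loop:
  assumes "x0 \<in> N"
  shows "hclass N (\<lambda>_. x0) \<in> ucover N x0" "endpt (hclass N (\<lambda>_. x0)) = x0"
    "concat_class N (hclass N (\<lambda>_. x0)) (hclass N (\<lambda>_. x0)) = hclass N (\<lambda>_. x0)"
proof -
  have p: "path (\<lambda>_. x0)" "path_image (\<lambda>_. x0) \<subseteq> N" using assms by (auto simp: path_def path_image_def)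
  show u: "hclass N (\<lambda>_. x0) \<in> ucover N x0" by (rule hclass_in_ucover[OF p]) (simp add: pathstart_def)
  show e: "endpt (hclass N (\<lambda>_. x0)) = x0" unfolding endpt_hclass[OF p] by (simp add: pathfinish_def)
  have j: "(\<lambda>_. x0) +++ (\<lambda>_. x0) = (\<lambda>_. x0)" by (simp add: joinpaths_def)
  show "concat_class N (hclass N (\<lambda>_. x0)) (hclass N (\<lambda>_. x0)) = hclass N (\<lambda>_. x0)"
    unfolding concat_class_eq(1)[OF u e u hclass_self[OF p] hclass_self[OF p]] j ..
qed

text \<open>The data are replaced by the single matrix-valued \<open>G\<close>, for which normalized
  quasiperiodicity of the pair becomes \<open>Gm\<close>. The class in the cover of SL(2) is
  forgotten here and restored in \<open>\<Phi>_surj\<close>.\<close>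

locale cover_function = surface N A for N :: "'p::topological_space set" and A :: "'p chart set" +
  fixes x0 :: 'p and G :: "(real \<Rightarrow> 'p) set \<Rightarrow> dmat"
  assumes pc: "path_connected N" and x0_in: "x0 \<in> N"
    and Gg: "\<And>\<alpha>. \<alpha> \<in> ucover N x0 \<Longrightarrow> G \<alpha> \<in> dgroup"
    and Gm: "\<And>\<kappa> \<alpha>. \<kappa> \<in> loops N x0 \<Longrightarrow> \<alpha> \<in> ucover N x0 \<Longrightarrow> G (concat_class N \<kappa> \<alpha>) = G \<kappa> * G \<alpha>"
    and Gs: "\<And>k K. k \<in> A \<Longrightarrow> K \<in> lifted_charts N x0 k \<Longrightarrow> smooth_on (snd K ` fst K) (G \<circ> inv_into (fst K) (snd K))"
begin

lemma G_unit: "G (hclass N (\<lambda>_. x0)) = 1"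
proof -
  note c = const_loop[OF x0_in]
  let ?h = "hclass N (\<lambda>_. x0)"
  have "?h \<in> loops N x0" using c(1,2) by (simp add: loops_def)
  from Gm[OF this c(1)] have "G ?h = G ?h * G ?h" unfolding c(3) .
  then show ?thesis using dgroup_cancel(1)[OF Gg[OF c(1)], of "G ?h"] dgroup_right[OF Gg[OF c(1)]] by simp
qed

text \<open>Passing from \<open>\<alpha>\<close> to \<open>\<beta>\<close> multiplies both values of
  \<open>G\<close> by the same left factor \<open>G \<kappa>\<close>, which cancels in the
  quotient.\<close>

lemma G_ratio:
  assumes \<alpha>: "\<alpha> \<in> ucover N x0" and \<beta>: "\<beta> \<in> ucover N x0" and e: "endpt \<alpha> = endpt \<beta>" and q: "admissible N \<alpha> q"
  shows "dadj (G \<beta>) * G (extend N \<beta> q) = dadj (G \<alpha>) * G (extend N \<alpha> q)"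
proof -
  obtain \<kappa> where \<kappa>: "\<kappa> \<in> loops N x0" "\<kappa> \<in> ucover N x0" "endpt \<kappa> = x0" "concat_class N \<kappa> \<alpha> = \<beta>"
    using loop_between[OF \<alpha> \<beta> e] .
  have 1: "G \<beta> = G \<kappa> * G \<alpha>" using Gm[OF \<kappa>(1) \<alpha>] by (simp add: \<kappa>(4))
  have 2: "G (extend N \<beta> q) = G \<kappa> * G (extend N \<alpha> q)"
    using Gm[OF \<kappa>(1) extend_in_ucover(1)[OF \<alpha> q]] concat_class_extend[OF \<kappa>(2,3) \<alpha> q] by (simp add: \<kappa>(4))
  show ?thesis unfolding 1 2 dadj_mult by (simp only: mult.assoc dgroup_cancel(1)[OF Gg[OF \<kappa>(2)]])
qed

text \<open>The quotient of \<open>G\<close> by its value over \<open>x\<close> does not depend on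
  the sheet, by \<open>G_ratio\<close>. It is therefore a function on the surface near
  \<open>x\<close>, read here from one sheet over a thin neighbourhood.\<close>

lemma local_quotient_exists:
  assumes x: "x \<in> N"
  shows "\<exists>P U. openin (top_of_set N) U \<and> x \<in> U \<and>
    (\<forall>\<alpha>\<in>ucover N x0. endpt \<alpha> = x \<longrightarrow> (\<forall>\<beta>\<in>cover_nbhd N \<alpha> U. G \<beta> = G \<alpha> * P (endpt \<beta>)))"
proof -
  obtain \<alpha> where \<alpha>: "\<alpha> \<in> ucover N x0" "endpt \<alpha> = x" using ucover_over_point[OF pc x0_in x] .
  obtain U where U: "nice N U" "x \<in> U" using nice_basis[OF x openin_subtopology_self x] by blast
  have Uo: "openin (top_of_set N) U" "thin N U" using U(1) by (auto simp: nice_def)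
  have UN: "U \<subseteq> N" by (rule openin_imp_subset[OF Uo(1)])
  define P where "P y = dadj (G \<alpha>) * G (inv_into (cover_nbhd N \<alpha> U) endpt y)" for y
  have inj: "inj_on endpt (cover_nbhd N \<alpha> U)"
    by (rule inj_onI) (rule cover_nbhd_inj[OF \<alpha>(1) UN Uo(2)])
  have "G \<beta> = G \<alpha>' * P (endpt \<beta>)" if \<alpha>': "\<alpha>' \<in> ucover N x0" "endpt \<alpha>' = x" and \<beta>: "\<beta> \<in> cover_nbhd N \<alpha>' U" for \<alpha>' \<beta>
  proof -
    obtain q where q: "\<beta> = extend N \<alpha>' q" "path q" "path_image q \<subseteq> U" "pathstart q = endpt \<alpha>'"
      using \<beta> unfolding cover_nbhd_def by blast
    have qa: "pathstart q = endpt \<alpha>" using q(4) \<alpha>(2) \<alpha>'(2) by simp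
    have adm: "admissible N \<alpha> q" "admissible N \<alpha>' q"
      using admissible_subset[OF q(2,3) UN] qa q(4) by blast+
    have b: "extend N \<alpha> q \<in> cover_nbhd N \<alpha> U" unfolding cover_nbhd_def using q(2,3) qa by blast
    have "endpt \<beta> = endpt (extend N \<alpha> q)"
      unfolding q(1) extend_in_ucover(2)[OF \<alpha>(1) adm(1)] by (rule extend_in_ucover(2)[OF \<alpha>'(1) adm(2)])
    then have "P (endpt \<beta>) = dadj (G \<alpha>) * G (extend N \<alpha> q)"
      by (simp only: P_def inv_into_f_f[OF inj b])
    also have "\<dots> = dadj (G \<alpha>') * G \<beta>"
      unfolding q(1) by (rule G_ratio[OF \<alpha>(1) \<alpha>'(1) _ adm(1), symmetric]) (simp add: \<alpha>(2) \<alpha>'(2))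
    finally show ?thesis by (simp only: dgroup_cancel(2)[OF Gg[OF \<alpha>'(1)]])
  qed
  then show ?thesis using Uo(1) U(2) by blast
qed

definition quotient :: "'p \<Rightarrow> 'p \<Rightarrow> dmat" where
  "quotient x = (SOME P. \<exists>U. openin (top_of_set N) U \<and> x \<in> U \<and>
    (\<forall>\<alpha>\<in>ucover N x0. endpt \<alpha> = x \<longrightarrow> (\<forall>\<beta>\<in>cover_nbhd N \<alpha> U. G \<beta> = G \<alpha> * P (endpt \<beta>))))"

lemma quotient:
  assumes "x \<in> N"
  obtains U where "openin (top_of_set N) U" "x \<in> U"
    "\<And>\<alpha> \<beta>. \<alpha> \<in> ucover N x0 \<Longrightarrow> endpt \<alpha> = x \<Longrightarrow> \<beta> \<in> cover_nbhd N \<alpha> U \<Longrightarrow> G \<beta> = G \<alpha> * quotient x (endpt \<beta>)"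
  using someI_ex[OF local_quotient_exists[OF assms]] unfolding quotient_def[symmetric] by blast

text \<open>The quotient has value 1 at \<open>x\<close>, so its derivative there is the logarithmic
  derivative of \<open>G\<close> on any sheet. The default gives both components the value
  \<open>undefined\<close> that \<open>sl2_form\<close> prescribes.\<close>

definition log_deriv :: "'p chart \<Rightarrow> 2 \<Rightarrow> 'p \<Rightarrow> dmat" where
  "log_deriv c i x = (if c \<in> A \<and> x \<in> fst c then chart_deriv c i (quotient x) x else DM undefined undefined)"

lemma linear_axis_sum:
  fixes D :: "real^2 \<Rightarrow> dmat"
  assumes "linear D"
  shows "D h = (\<Sum>i\<in>UNIV. h $ i *\<^sub>R D (axis i 1))"
proof -
  have "h = (\<Sum>i\<in>UNIV. h $ i *\<^sub>R axis i 1)" using basis_expansion[of h] by (simp add: scalar_mult_eq_scaleR)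
  then have "D h = D (\<Sum>i\<in>UNIV. h $ i *\<^sub>R axis i 1)" by simp
  also have "\<dots> = (\<Sum>i\<in>UNIV. h $ i *\<^sub>R D (axis i 1))"
    by (simp only: linear_sum[OF assms] linear_cmul[OF assms])
  finally show ?thesis .
qed

lemma quotient_derivative:
  assumes k: "k \<in> A" "x \<in> fst k"
  shows "((quotient x \<circ> ic k) has_derivative pform log_deriv k x) (at (snd k x) within snd k ` fst k)"
proof -
  have x: "x \<in> N" using chart_subset k by blast
  obtain \<alpha> where \<alpha>: "\<alpha> \<in> ucover N x0" "endpt \<alpha> = x" using ucover_over_point[OF pc x0_in x] .
  have "\<exists>K\<in>lifted_charts N x0 k. \<alpha> \<in> fst K" by (rule lifted_chart_exists[OF k(1) \<alpha>(1)]) (simp add: \<alpha>(2) k(2))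
  then obtain K where K: "K \<in> lifted_charts N x0 k" "\<alpha> \<in> fst K" by blast
  obtain U where U: "openin (top_of_set N) U" "x \<in> U"
    "\<And>\<alpha> \<beta>. \<alpha> \<in> ucover N x0 \<Longrightarrow> endpt \<alpha> = x \<Longrightarrow> \<beta> \<in> cover_nbhd N \<alpha> U \<Longrightarrow> G \<beta> = G \<alpha> * quotient x (endpt \<beta>)"
    using quotient[OF x] by blast
  have zK: "snd K \<alpha> \<in> snd K ` fst K" using K(2) by (rule imageI)
  obtain f' where f': "\<And>z. z \<in> snd K ` fst K \<Longrightarrow> (G \<circ> inv_into (fst K) (snd K) has_derivative f' z) (at z within snd K ` fst K)"
    by (rule smooth_on_imp_derivative[OF Gs[OF k(1) K(1)]]) (rule that)
  have "((\<lambda>y. G \<alpha> * quotient x y) \<circ> ic k has_derivative f' (snd K \<alpha>)) (at (snd k (endpt \<alpha>)) within snd k ` fst k)"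
    by (rule sheet_derivative_iff[OF k(1) K U(1), THEN iffD1, OF _ _ f'[OF zK]]) (simp_all only: \<alpha>(2) U(2) U(3)[OF \<alpha>])
  from has_derivative_mult_right[OF this, of "dadj (G \<alpha>)"]
  have d: "(quotient x \<circ> ic k has_derivative (\<lambda>h. dadj (G \<alpha>) * f' (snd K \<alpha>) h)) (at (snd k x) within snd k ` fst k)"
    unfolding \<alpha>(2) by (simp add: o_def dgroup_cancel(1)[OF Gg[OF \<alpha>(1)]])
  let ?D = "\<lambda>h. dadj (G \<alpha>) * f' (snd K \<alpha>) h"
  have z: "snd k x \<in> snd k ` fst k" using k(2) by (rule imageI)
  have "log_deriv k i x = ?D (axis i 1)" for i
    using k ample_frechet_derivative[OF chart_ample[OF k(1)] z d] by (simp add: log_deriv_def chart_deriv_def)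
  then have "pform log_deriv k x h = ?D h" for h
    unfolding pform_def linear_axis_sum[OF has_derivative_linear[OF d], of h] by simp
  then have "pform log_deriv k x = ?D" by (rule ext)
  with d show ?thesis by simp
qed

lemma sheet_log_deriv:
  assumes k: "k \<in> A" "K \<in> lifted_charts N x0 k" "\<alpha> \<in> fst K"
  shows "((G \<circ> inv_into (fst K) (snd K)) has_derivative (\<lambda>h. G \<alpha> * pform log_deriv k (endpt \<alpha>) h)) (at (snd K \<alpha>) within snd K ` fst K)"
proof -
  note L = lifted_chart[OF k(1,2)]
  have \<alpha>: "\<alpha> \<in> ucover N x0" and ek: "endpt \<alpha> \<in> fst k" using L(3,4) k(3) by blast+
  obtain U where U: "openin (top_of_set N) U" "endpt \<alpha> \<in> U"
    "\<And>\<alpha>' \<beta>. \<alpha>' \<in> ucover N x0 \<Longrightarrow> endpt \<alpha>' = endpt \<alpha> \<Longrightarrow> \<beta> \<in> cover_nbhd N \<alpha>' U \<Longrightarrow> G \<beta> = G \<alpha>' * quotient (endpt \<alpha>) (endpt \<beta>)"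
    using quotient[OF endpt_in[OF \<alpha>]] by blast
  have "((\<lambda>y. G \<alpha> * quotient (endpt \<alpha>) y) \<circ> ic k has_derivative (\<lambda>h. G \<alpha> * pform log_deriv k (endpt \<alpha>) h))
      (at (snd k (endpt \<alpha>)) within snd k ` fst k)"
    using has_derivative_mult_right[OF quotient_derivative[OF k(1) ek], of "G \<alpha>"] by (simp add: o_def)
  then show ?thesis
    by (rule sheet_derivative_iff[OF k U(1,2), THEN iffD2, rotated]) (rule U(3)[OF \<alpha> refl])
qed

lemma sheet_coordinates:
  assumes k: "k \<in> A" "K \<in> lifted_charts N x0 k" and z: "z \<in> snd K ` fst K"
  shows "inv_into (fst K) (snd K) z \<in> fst K" "endpt (inv_into (fst K) (snd K) z) = ic k z"
    "inv_into (fst K) (snd K) z \<in> ucover N x0" "ic k z \<in> fst k"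
    "((G \<circ> inv_into (fst K) (snd K)) has_derivative (\<lambda>h. (G \<circ> inv_into (fst K) (snd K)) z * pform log_deriv k (ic k z) h))
       (at z within snd K ` fst K)"
proof -
  note L = lifted_chart[OF k]
  let ?\<alpha> = "inv_into (fst K) (snd K) z"
  show i: "?\<alpha> \<in> fst K" by (rule inv_into_into[OF z])
  have s: "snd K ?\<alpha> = z" by (rule f_inv_into_f[OF z])
  have ek: "endpt ?\<alpha> \<in> fst k" using L(4) i by blast
  have "ic k (snd k (endpt ?\<alpha>)) = endpt ?\<alpha>" by (rule ic_snd[OF k(1) ek])
  then show e: "endpt ?\<alpha> = ic k z" using s unfolding L(1) by simp
  show "?\<alpha> \<in> ucover N x0" using L(3) i by blast
  show "ic k z \<in> fst k" using ek unfolding e .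
  show "((G \<circ> inv_into (fst K) (snd K)) has_derivative (\<lambda>h. (G \<circ> inv_into (fst K) (snd K)) z * pform log_deriv k (ic k z) h))
       (at z within snd K ` fst K)"
    using sheet_log_deriv[OF k i] unfolding s e by simp
qed

lemma sheet_over:
  assumes k: "k \<in> A" "x \<in> fst k"
  obtains K where "K \<in> lifted_charts N x0 k" "snd k x \<in> snd K ` fst K"
proof -
  have x: "x \<in> N" using chart_subset k by blast
  obtain \<alpha> where \<alpha>: "\<alpha> \<in> ucover N x0" "endpt \<alpha> = x" using ucover_over_point[OF pc x0_in x] .
  have "\<exists>K\<in>lifted_charts N x0 k. \<alpha> \<in> fst K" by (rule lifted_chart_exists[OF k(1) \<alpha>(1)]) (simp add: \<alpha>(2) k(2))
  then obtain K where K: "K \<in> lifted_charts N x0 k" "\<alpha> \<in> fst K" by blast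
  have "snd K \<alpha> = snd k x" using lifted_chart(1)[OF k(1) K(1)] \<alpha>(2) by simp
  then show ?thesis using that[OF K(1)] K(2) by (metis imageI)
qed

lemma sheet_open:
  assumes k: "k \<in> A" "K \<in> lifted_charts N x0 k"
  obtains Q where "open Q" "snd K ` fst K = snd k ` fst k \<inter> Q"
proof -
  note L = lifted_chart[OF k]
  obtain Q where Q: "open Q" "snd K ` fst K = half_plane \<inter> Q" using L(7) unfolding openin_open by blast
  have "snd K ` fst K = snd k ` fst k \<inter> Q"
    using Q(2) L(9) openin_imp_subset[OF chart_openin_image[OF k(1)]] by blast
  then show ?thesis using that Q(1) by blast
qed

text \<open>The functions \<open>quotient x\<close> change with \<open>x\<close>, so their pointwise
  derivatives say nothing about smoothness in \<open>x\<close>. On a fixed sheet, however, the form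
  is \<open>dadj G\<close> times a partial derivative of \<open>G\<close>, both smooth.\<close>

lemma sheet_log_deriv_smooth:
  assumes k: "k \<in> A" "K \<in> lifted_charts N x0 k"
  shows "smooth_on (snd K ` fst K) (log_deriv k i \<circ> ic k)"
  unfolding smooth_on_def
proof
  fix n
  note L = lifted_chart[OF k] and S = sheet_coordinates[OF k]
  let ?g = "G \<circ> inv_into (fst K) (snd K)" and ?S = "snd K ` fst K"
  obtain f' where f': "\<And>z. z \<in> ?S \<Longrightarrow> (?g has_derivative f' z) (at z within ?S)"
    and s: "\<And>n v. ample ?S \<Longrightarrow> Ck_on n ?S (\<lambda>z. f' z v)"
    using smooth_on_imp_derivative[OF Gs[OF k]] by blast
  have eq: "(log_deriv k i \<circ> ic k) z = dadj (?g z) * f' z (axis i 1)" if z: "z \<in> ?S" for z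
  proof -
    have "f' z = (\<lambda>h. ?g z * pform log_deriv k (ic k z) h)"
      by (rule ample_unique[OF L(8) z f'[OF z] S(5)[OF z]])
    then have "f' z (axis i 1) = ?g z * log_deriv k i (ic k z)" by simp
    then show ?thesis using dgroup_cancel(1)[OF Gg[OF S(3)[OF z]]] by simp
  qed
  have "Ck_on n ?S (\<lambda>z. dadj (?g z) * f' z (axis i 1))"
    by (rule Ck_on_bilinear[OF bounded_bilinear_mult Ck_on_bounded_linear[OF bounded_linear_dadj smooth_onD[OF Gs[OF k]]] s[OF L(8)]])
  then show "Ck_on n ?S (log_deriv k i \<circ> ic k)" by (rule Ck_on_cong_imp) (rule eq)
qed

lemma log_deriv_smooth:
  assumes k: "k \<in> A"
  shows "smooth_in_chart k (log_deriv k i)"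
  unfolding smooth_in_chart_def smooth_on_def
proof
  fix n
  show "Ck_on n (snd k ` fst k) (log_deriv k i \<circ> ic k)"
  proof (rule Ck_on_local[OF chart_ample[OF k]])
    fix z assume "z \<in> snd k ` fst k"
    then obtain x where x: "x \<in> fst k" "z = snd k x" by blast
    obtain K where K: "K \<in> lifted_charts N x0 k" "z \<in> snd K ` fst K" using sheet_over[OF k x(1)] x(2) by blast
    obtain Q where Q: "open Q" "snd K ` fst K = snd k ` fst k \<inter> Q" using sheet_open[OF k K(1)] .
    show "\<exists>Q. open Q \<and> z \<in> Q \<and> Ck_on n (snd k ` fst k \<inter> Q) (log_deriv k i \<circ> ic k)"
      using Q K(2) smooth_onD[OF sheet_log_deriv_smooth[OF k K(1)], of n i] by auto
  qed
qed

text \<open>Differentiation of \<open>G * dadj G = 1\<close>, followed by cancellation of the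
  invertible outer factors.\<close>

lemma log_deriv_skew: "skew log_deriv"
  unfolding skew_def
proof (intro ballI allI)
  fix k i x assume k: "k \<in> A" and x: "x \<in> fst k"
  obtain K where K: "K \<in> lifted_charts N x0 k" "snd k x \<in> snd K ` fst K" using sheet_over[OF k x] .
  note L = lifted_chart[OF k K(1)] and S = sheet_coordinates[OF k K(1)]
  let ?g = "G \<circ> inv_into (fst K) (snd K)" and ?S = "snd K ` fst K" and ?z = "snd k x" and ?w = "pform log_deriv k x"
  have i: "ic k ?z = x" by (rule ic_snd[OF k x])
  have D: "(?g has_derivative (\<lambda>h. ?g ?z * ?w h)) (at ?z within ?S)" using S(5)[OF K(2)] unfolding i .
  have "((\<lambda>z. ?g z * dadj (?g z)) has_derivative (\<lambda>h. ?g ?z * dadj (?g ?z * ?w h) + ?g ?z * ?w h * dadj (?g ?z))) (at ?z within ?S)"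
    by (rule has_derivative_mult[OF D bounded_linear.has_derivative[OF bounded_linear_dadj D]])
  moreover have "((\<lambda>z. ?g z * dadj (?g z)) has_derivative (\<lambda>h. 0)) (at ?z within ?S)"
  proof (rule has_derivative_transform[OF K(2) _ has_derivative_const])
    fix z assume "z \<in> ?S"
    then show "?g z * dadj (?g z) = 1" using dgroup_left[OF Gg[OF S(3)]] by simp
  qed
  ultimately have "(\<lambda>h. ?g ?z * dadj (?g ?z * ?w h) + ?g ?z * ?w h * dadj (?g ?z)) = (\<lambda>h. 0)"
    by (rule ample_unique[OF L(8) K(2)])
  then have 0: "?g ?z * dadj (?g ?z * ?w (axis i 1)) + ?g ?z * ?w (axis i 1) * dadj (?g ?z) = 0" by (rule fun_cong)
  have gz: "?g ?z \<in> dgroup" using Gg[OF S(3)[OF K(2)]] by simp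
  define g where "g = ?g ?z"
  have g: "g \<in> dgroup" using gz by (simp add: g_def)
  have "g * (dadj (log_deriv k i x) + log_deriv k i x) * dadj g = 0"
    using 0 unfolding g_def[symmetric] by (simp add: dadj_mult algebra_simps)
  then have "dadj g * (g * (dadj (log_deriv k i x) + log_deriv k i x) * dadj g) * g = 0" by simp
  then have "(dadj g * g) * (dadj (log_deriv k i x) + log_deriv k i x) * (dadj g * g) = 0" by (simp only: mult.assoc)
  then show "dadj (log_deriv k i x) = - log_deriv k i x" by (simp add: dgroup_right[OF g] eq_neg_iff_add_eq_0)
qed

text \<open>The function \<open>quotient x\<close> involves no chart, so its components in two
  charts are related by the chain rule.\<close>

lemma log_deriv_covariant: "covariant log_deriv"
  unfolding covariant_def
proof (intro ballI allI)
  fix c d x i assume c: "c \<in> A" "d \<in> A" and x: "x \<in> fst c \<inter> fst d"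
  then have xc: "x \<in> fst c" and xd: "x \<in> fst d" and x': "x \<in> fst d \<inter> fst c" by auto
  have "(quotient x \<circ> ic c has_derivative (\<lambda>h. pform log_deriv d x (jacobian_matrix c d x *v h))) (at (snd c x) within snd c ` fst c)"
    by (rule chart_change_derivative[OF c(2,1) x' quotient_derivative[OF c(2) xd]])
  from ample_unique[OF chart_ample[OF c(1)] imageI[OF xc] quotient_derivative[OF c(1) xc] this]
  have "pform log_deriv c x (axis i 1) = pform log_deriv d x (jacobian_matrix c d x *v axis i 1)" by (rule fun_cong)
  then show "log_deriv c i x = (\<Sum>j\<in>UNIV. jacobian_matrix c d x $ j $ i *\<^sub>R log_deriv d j x)"
    unfolding pform_axis by (simp add: pform_def matrix_vector_mult_basis column_def)
qed

text \<open>Positive multiples of the coordinate vectors never leave the half-plane. This supplies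
  the square needed by \<open>mixed_derivatives_eq\<close> at boundary points too.\<close>

lemma corner:
  assumes S: "openin (top_of_set half_plane) S" and z: "z \<in> S"
  obtains r where "r > 0" "\<And>s t. s \<in> {0..r} \<Longrightarrow> t \<in> {0..r} \<Longrightarrow> z + s *\<^sub>R axis i 1 + t *\<^sub>R axis j 1 \<in> S"
proof -
  obtain e where e: "e > 0" "ball z e \<inter> half_plane \<subseteq> S" using S z unfolding openin_contains_ball by blast
  have zh: "z \<in> half_plane" using openin_imp_subset[OF S] z by blast
  show ?thesis
  proof (rule that[of "e / 3"])
    show "e / 3 > 0" using e(1) by simp
    fix s t assume st: "s \<in> {0..e / 3}" "t \<in> {0..e / 3}"
    let ?d = "s *\<^sub>R axis i 1 + t *\<^sub>R axis j 1 :: real^2"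
    have "norm ?d \<le> norm (s *\<^sub>R axis i 1 :: real^2) + norm (t *\<^sub>R axis j 1 :: real^2)" by (rule norm_triangle_ineq)
    also have "\<dots> = s + t" using st by (simp add: norm_axis_1)
    also have "\<dots> < e" using st e(1) by simp
    finally have "dist (z + ?d) z < e" by (simp add: dist_norm)
    then have "z + ?d \<in> ball z e" by (simp only: mem_ball dist_commute)
    moreover have "z + ?d \<in> half_plane" using zh st by (simp add: half_plane_def axis_def)
    ultimately show "z + s *\<^sub>R axis i 1 + t *\<^sub>R axis j 1 \<in> S" using e(2) by (auto simp: add.assoc)
  qed
qed

text \<open>Flatness is the symmetry of the second derivatives of \<open>G\<close> on a sheet.\<close>

lemma log_deriv_flat:
  assumes k: "k \<in> A" and x: "x \<in> fst k"
  shows "chart_deriv k i (log_deriv k j) x - chart_deriv k j (log_deriv k i) x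
     + log_deriv k i x * log_deriv k j x - log_deriv k j x * log_deriv k i x = 0"
proof -
  obtain K where K: "K \<in> lifted_charts N x0 k" "snd k x \<in> snd K ` fst K" using sheet_over[OF k x] .
  note L = lifted_chart[OF k K(1)] and S = sheet_coordinates[OF k K(1)]
  let ?S = "snd K ` fst K" and ?z = "snd k x"
  define g where "g = G \<circ> inv_into (fst K) (snd K)"
  define w where "w i = log_deriv k i \<circ> ic k" for i
  have "\<exists>D. (\<forall>z\<in>?S. (w i has_derivative D z) (at z within ?S)) \<and> (\<forall>v. Ck_on 0 ?S (\<lambda>z. D z v))" for i
    using smooth_onD[OF sheet_log_deriv_smooth[OF k K(1), of i], of "Suc 0"] unfolding w_def Ck_on.simps(2) .
  then obtain D where D: "\<And>i z. z \<in> ?S \<Longrightarrow> (w i has_derivative D i z) (at z within ?S)"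
    and Dc: "\<And>i v. continuous_on ?S (\<lambda>z. D i z v)"
    unfolding Ck_on.simps(1) by metis
  define g' where "g' z h = g z * (\<Sum>i\<in>UNIV. h $ i *\<^sub>R w i z)" for z h
  have g': "(g has_derivative g' z) (at z within ?S)" if "z \<in> ?S" for z
    using S(5)[OF that] unfolding g_def[symmetric] g'_def[abs_def] pform_def w_def by simp
  have ax: "g' z (axis i 1) = g z * w i z" for z i
    using pform_axis[of log_deriv k "ic k z" i] unfolding g'_def pform_def w_def o_def by simp
  have gc: "continuous_on ?S g" by (rule has_derivative_continuous_on[OF g'])
  have wc: "continuous_on ?S (w i)" for i by (rule has_derivative_continuous_on[OF D])
  define g'' where "g'' i z h = g z * D i z h + g' z h * w i z" for i z h
  have g'': "((\<lambda>z. g' z (axis i 1)) has_derivative g'' i z) (at z within ?S)" if "z \<in> ?S" for z i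
    unfolding ax g''_def using has_derivative_mult[OF g'[OF that] D[OF that]] .
  have cc: "continuous_on ?S (\<lambda>z. g'' i z (axis j 1))" for i j
    unfolding g''_def ax by (intro continuous_intros gc wc Dc)
  obtain r where r: "r > 0" "\<And>s t. s \<in> {0..r} \<Longrightarrow> t \<in> {0..r} \<Longrightarrow> ?z + s *\<^sub>R axis i 1 + t *\<^sub>R axis j 1 \<in> ?S"
    using corner[OF L(7) K(2)] by blast
  have "g'' i ?z (axis j 1) = g'' j ?z (axis i 1)"
    by (rule mixed_derivatives_eq[OF K(2) r g' g'' g'' cc cc])
  then have "g ?z * D i ?z (axis j 1) + g ?z * w j ?z * w i ?z = g ?z * D j ?z (axis i 1) + g ?z * w i ?z * w j ?z"
    unfolding g''_def ax .
  then have e: "g ?z * (D j ?z (axis i 1) - D i ?z (axis j 1) + w i ?z * w j ?z - w j ?z * w i ?z) = 0"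
    by (simp add: algebra_simps)
  have gz: "g ?z \<in> dgroup" unfolding g_def using Gg[OF S(3)[OF K(2)]] by simp
  have f: "D j ?z (axis i 1) - D i ?z (axis j 1) + w i ?z * w j ?z - w j ?z * w i ?z = 0"
    using arg_cong[OF e, of "\<lambda>X. dadj (g ?z) * X"] unfolding dgroup_cancel(1)[OF gz] by simp
  obtain Q where Q: "open Q" "?S = snd k ` fst k \<inter> Q" using sheet_open[OF k K(1)] .
  have zQ: "?z \<in> Q" using K(2) Q(2) by blast
  have "chart_deriv k i (log_deriv k j) x = D j ?z (axis i 1)" for i j
  proof -
    have "(log_deriv k j \<circ> ic k has_derivative D j ?z) (at ?z within snd k ` fst k)"
      using D[OF K(2), of j] unfolding w_def Q(2) at_within_Int_open[OF Q(1) zQ] .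
    from ample_frechet_derivative[OF chart_ample[OF k] imageI[OF x] this]
    show ?thesis unfolding chart_deriv_def by simp
  qed
  moreover have "w i ?z = log_deriv k i x" for i unfolding w_def by (simp add: ic_snd[OF k x])
  ultimately show ?thesis using f by simp
qed

lemma log_deriv_flat_form: "flat_form log_deriv"
  unfolding flat_form_def
  using log_deriv_smooth log_deriv_skew log_deriv_covariant log_deriv_flat
  unfolding skew_def covariant_def by blast

lemma flat_section_G:
  assumes "germ_transport N T" "\<forall>x\<in>N. prim_at log_deriv (T x) x"
  shows "germ_transport.flat_section N T x0 G"
  by (rule flat_sectionI[OF log_deriv_covariant log_deriv_skew assms Gg sheet_log_deriv])

lemma G_path_lift:
  assumes T: "germ_transport N T" "\<forall>x\<in>N. prim_at log_deriv (T x) x"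
    and p: "path p" "path_image p \<subseteq> N" "pathstart p = x0" and s: "s \<in> {0..1}"
  shows "G (path_lift N p s) = germ_transport.plift T p s"
  by (rule germ_transport.flat_section_plift[OF T(1) flat_section_G[OF T] G_unit p s])

lemma G_holo:
  assumes T: "germ_transport N T" "\<forall>x\<in>N. prim_at log_deriv (T x) x" and \<alpha>: "\<alpha> \<in> ucover N x0"
  shows "germ_transport.holo T \<alpha> = G \<alpha>"
proof -
  obtain p where p: "p \<in> \<alpha>" using \<alpha> by (rule ucover_nonempty)
  note pD = ucoverD[OF \<alpha> p]
  have "germ_transport.holo T \<alpha> = germ_transport.plift T p 1" by (rule germ_transport.holo_eq(1)[OF T(1) \<alpha> p])
  also have "\<dots> = G (path_lift N p 1)" by (rule G_path_lift[OF T pD(1-3), symmetric]) simp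
  finally show ?thesis unfolding path_lift(4)[OF pD(1,2)] pD(4)[symmetric] .
qed

end

section \<open>The boundary fields and the bijection\<close>

lemma vector_derivative_shift:
  assumes "(f has_vector_derivative D) (at (t + a))"
  shows "((\<lambda>s. f (s + a)) has_vector_derivative D) (at t)"
proof -
  have "((\<lambda>s. s + a) has_vector_derivative 1) (at t)"
    by (auto intro!: derivative_eq_intros)
  from vector_diff_chain_at[OF this, of f D] assms show ?thesis by (simp add: o_def)
qed

text \<open>If \<open>p\<close> is homotopic to its pointwise square, multiplying the homotopy by
  the pointwise inverse of \<open>p\<close> contracts \<open>p\<close> to the constant path. This
  fixes the class at the constant loop and not only its end point.\<close>

lemma SLt_idempotent:
  assumes a: "a \<in> ucover SL2 (mat 1)" "SLt_mult a a = a"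
  shows "a = hclass SL2 (\<lambda>_. mat 1)"
proof -
  obtain p where p: "p \<in> a" using a(1) by (rule ucover_nonempty)
  note pD = ucoverD[OF a(1) p]
  let ?q = "\<lambda>s. adj2 (p s)"
  have pS: "p s \<in> SL2" if "s \<in> {0..1}" for s using pD(2) that by (auto simp: path_image_def)
  have q: "path ?q" "path_image ?q \<subseteq> SL2"
  proof -
    show "path ?q" using pD(1) unfolding path_def by (rule bounded_linear.continuous_on[OF bounded_linear_adj2])
    show "path_image ?q \<subseteq> SL2" using SL2_adj2 pS by (auto simp: path_image_def)
  qed
  have "hclass SL2 (\<lambda>s. p s ** p s) = hclass SL2 p"
    using SLt_mult_hclass[OF pD(1,2) pD(1,2)] a(2) unfolding pD(4)[symmetric] by simp
  from hclass_eqD[OF this[symmetric] pD(1,2)] have "homotopic_paths SL2 p (\<lambda>s. p s ** p s)" .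
  from homotopic_paths_mult[OF this, of ?q ?q] q
  have 1: "homotopic_paths SL2 (\<lambda>s. p s ** ?q s) (\<lambda>s. p s ** p s ** ?q s)" by simp
  have unit: "p s ** ?q s = mat 1" if "s \<in> {0..1}" for s using pS[OF that] by (simp add: SL2_def mult_adj2)
  have c: "path (\<lambda>_. mat 1 :: real^2^2)" "path_image (\<lambda>_. mat 1 :: real^2^2) \<subseteq> SL2" by (auto simp: path_def path_image_def)
  have 2: "homotopic_paths SL2 (\<lambda>_. mat 1) (\<lambda>s. p s ** ?q s)"
    by (rule homotopic_paths_eq[OF c]) (simp add: unit)
  have 3: "homotopic_paths SL2 p (\<lambda>s. p s ** p s ** ?q s)"
    by (rule homotopic_paths_eq[OF pD(1,2)]) (simp add: unit flip: matrix_mul_assoc)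
  have "homotopic_paths SL2 (\<lambda>_. mat 1) p"
    by (rule homotopic_paths_trans[OF homotopic_paths_trans[OF 2 1] homotopic_paths_sym[OF 3]])
  from hclass_eqI[OF this] show ?thesis unfolding pD(4)[symmetric] by (rule sym)
qed

context bounded_surface
begin

lemma circ_velocity_periodic:
  assumes l: "l \<in> L" and c: "c \<in> A" "circ l \<phi> \<in> fst c"
  shows "vector_derivative (snd c \<circ> circ l) (at (\<phi> + 2 * pi)) = vector_derivative (snd c \<circ> circ l) (at \<phi>)"
proof -
  have c': "circ l (\<phi> + 2 * pi) \<in> fst c" using c(2) by (simp add: circ_periodic[OF l])
  have "((snd c \<circ> circ l) has_vector_derivative vector_derivative (snd c \<circ> circ l) (at (\<phi> + 2 * pi))) (at (\<phi> + 2 * pi))"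
    using circ_differentiable[OF l c(1) c'] by (simp add: vector_derivative_works)
  from vector_derivative_shift[OF this]
  have "((snd c \<circ> circ l) has_vector_derivative vector_derivative (snd c \<circ> circ l) (at (\<phi> + 2 * pi))) (at \<phi>)"
    by (simp add: o_def circ_periodic[OF l])
  then show ?thesis by (rule vector_derivative_at[symmetric])
qed

lemma dalong_periodic:
  assumes l: "l \<in> L"
  shows "dalong \<Omega> UNIV (circ l) (\<phi> + 2 * pi) = dalong \<Omega> UNIV (circ l) \<phi>"
  using circ_velocity_periodic[OF l some_chart[OF circ_in[OF l, of \<phi>]]]
  by (simp add: dalong_def Let_def circ_periodic[OF l])

text \<open>The monodromy of \<open>X\<close> is constant because the form along the circle is periodic.\<close>

lemma boundary_field:
  assumes l: "l \<in> L" and sk: "skew (dform \<omega> \<gamma>)"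
    and X: "\<And>\<phi>. (X has_vector_derivative X \<phi> * dalong (dform \<omega> \<gamma>) UNIV (circ l) \<phi>) (at \<phi>)"
    and Xg: "\<And>\<phi>. X \<phi> \<in> dgroup" and u: "u = (\<lambda>\<phi>. dre (X \<phi>))" and v: "v = (\<lambda>\<phi>. dtrans (X \<phi>))"
  shows "\<exists>ul\<in>SL2. \<exists>vl\<in>sl2. \<forall>\<phi>. u (\<phi> + 2 * pi) = ul ** u \<phi> \<and> v (\<phi> + 2 * pi) = vl + ul ** v \<phi> ** matrix_inv ul"
    and "matrix_inv (u \<phi>) ** vector_derivative u (at \<phi>) = form_along A \<omega> UNIV (circ l) \<phi>"
    and "matrix_inv (u \<phi>) ** vector_derivative v (at \<phi>) ** u \<phi> = form_along A \<gamma> UNIV (circ l) \<phi>"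
proof -
  let ?a = "dalong (dform \<omega> \<gamma>) UNIV (circ l)"
  have ska: "dadj (?a \<phi>) = - ?a \<phi>" for \<phi> by (rule skew_dalong[OF sk circ_in[OF l]])
  \<comment> \<open>The monodromy of the circle; \<open>dre Y\<close> and \<open>dtrans Y\<close>
    are the constants of the quasiperiodic pair.\<close>
  define Y where "Y = X (0 + 2 * pi) * dadj (X 0)"
  have "((\<lambda>\<phi>. X (\<phi> + 2 * pi)) has_vector_derivative X (\<phi> + 2 * pi) * ?a \<phi>) (at \<phi>)" for \<phi>
    using vector_derivative_shift[OF X[of "\<phi> + 2 * pi"]] unfolding dalong_periodic[OF l] .
  from zero_derivative_constant[OF this X ska]
  have "X (\<phi> + 2 * pi) * dadj (X \<phi>) = Y" for \<phi> unfolding Y_def by blast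
  then have "X (\<phi> + 2 * pi) * dadj (X \<phi>) * X \<phi> = Y * X \<phi>" for \<phi> by simp
  then have sh: "X (\<phi> + 2 * pi) = Y * X \<phi>" for \<phi> by (simp add: mult.assoc dgroup_right[OF Xg])
  have Y: "Y \<in> dgroup" unfolding Y_def by (intro dgroup_mult dgroup_dadj Xg)
  show "\<exists>ul\<in>SL2. \<exists>vl\<in>sl2. \<forall>\<phi>. u (\<phi> + 2 * pi) = ul ** u \<phi> \<and> v (\<phi> + 2 * pi) = vl + ul ** v \<phi> ** matrix_inv ul"
  proof (intro bexI allI conjI)
    fix \<phi>
    show "u (\<phi> + 2 * pi) = dre Y ** u \<phi>" by (simp add: u sh)
    show "v (\<phi> + 2 * pi) = dtrans Y + dre Y ** v \<phi> ** matrix_inv (dre Y)"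
      by (simp add: v sh dtrans_mult[OF Y Xg] matrix_inv_SL2[OF dgroup_dre[OF Y]])
  qed (use dgroup_dre[OF Y] dgroup_dtrans[OF Y] in auto)
  have uS: "u \<phi> \<in> SL2" unfolding u by (rule dgroup_dre[OF Xg])
  have i: "adj2 (u \<phi>) ** u \<phi> = mat 1" using uS by (simp add: adj2_mult_self SL2_def)
  note d = dmat_vector_derivative[OF X ska, THEN vector_derivative_at, folded u v]
  have du: "vector_derivative u (at \<phi>) = u \<phi> ** form_along A \<omega> UNIV (circ l) \<phi>"
    using d(1)[of \<phi>] unfolding dalong_dform by (simp add: u)
  have dv: "vector_derivative v (at \<phi>) = u \<phi> ** form_along A \<gamma> UNIV (circ l) \<phi> ** adj2 (u \<phi>)"
    using d(2)[of \<phi>] unfolding dalong_dform by (simp add: u)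
  show "matrix_inv (u \<phi>) ** vector_derivative u (at \<phi>) = form_along A \<omega> UNIV (circ l) \<phi>"
    unfolding matrix_inv_SL2[OF uS] du by (simp add: matrix_mul_assoc i)
  have "adj2 (u \<phi>) ** (u \<phi> ** form_along A \<gamma> UNIV (circ l) \<phi> ** adj2 (u \<phi>)) ** u \<phi> =
      (adj2 (u \<phi>) ** u \<phi>) ** form_along A \<gamma> UNIV (circ l) \<phi> ** (adj2 (u \<phi>) ** u \<phi>)"
    by (simp only: matrix_mul_assoc)
  then show "matrix_inv (u \<phi>) ** vector_derivative v (at \<phi>) ** u \<phi> = form_along A \<gamma> UNIV (circ l) \<phi>"
    unfolding matrix_inv_SL2[OF uS] dv by (simp add: i)
qed

text \<open>Near each angle the boundary family stays on one sheet by continuity, and its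
  coordinates there are those of the circle, which are smooth.\<close>

lemma smooth_on_bfam:
  fixes G :: "(real \<Rightarrow> 'p) set \<Rightarrow> dmat"
  assumes l: "l \<in> L"
    and Gs: "\<And>k K. k \<in> A \<Longrightarrow> K \<in> lifted_charts N x0 k \<Longrightarrow> smooth_on (snd K ` fst K) (G \<circ> inv_into (fst K) (snd K))"
  shows "smooth_on UNIV (\<lambda>\<phi>. G (bfam l \<phi>))"
  unfolding smooth_on_def
proof
  fix n
  show "Ck_on n UNIV (\<lambda>\<phi>. G (bfam l \<phi>))"
  proof (rule Ck_on_local[OF ample_UNIV])
    fix \<phi> :: real
    note B = bfam_props[OF l]
    obtain k where k: "k \<in> A" "circ l \<phi> \<in> fst k" using chart_covers[OF circ_in[OF l]] .
    have "\<exists>K\<in>lifted_charts N x0 k. bfam l \<phi> \<in> fst K"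
      by (rule lifted_chart_exists[OF k(1) B(3)]) (simp add: B(2) k(2))
    then obtain K where K: "K \<in> lifted_charts N x0 k" "bfam l \<phi> \<in> fst K" by blast
    note LK = lifted_chart[OF k(1) K(1)]
    let ?Q = "{\<phi>. bfam l \<phi> \<in> fst K}"
    have "openin (top_of_set UNIV) {\<phi> \<in> topspace (top_of_set UNIV). bfam l \<phi> \<in> fst K}"
      by (rule openin_continuous_map_preimage[OF B(1) LK(2)])
    then have o: "open ?Q" by simp
    have e: "snd K (bfam l \<psi>) = (snd k \<circ> circ l) \<psi>" for \<psi> unfolding LK(1) by (simp add: B(2))
    have "?Q \<subseteq> {\<phi>. circ l \<phi> \<in> fst k}" using LK(4) B(2) by (auto simp: image_subset_iff)
    then have s: "Ck_on n ?Q (snd k \<circ> circ l)" by (rule Ck_on_subset[OF smooth_onD[OF circ_chart(2)[OF l k(1)]]])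
    have "Ck_on n ?Q (\<lambda>\<psi>. (G \<circ> inv_into (fst K) (snd K)) ((snd k \<circ> circ l) \<psi>))"
    proof (rule Ck_on_compose[OF s smooth_onD[OF Gs[OF k(1) K(1)]]])
      show "(snd k \<circ> circ l) ` ?Q \<subseteq> snd K ` fst K" unfolding e[symmetric] image_subset_iff by blast
    qed
    then have "Ck_on n ?Q (\<lambda>\<psi>. G (bfam l \<psi>))"
    proof (rule Ck_on_cong_imp)
      fix \<psi> assume "\<psi> \<in> ?Q"
      then have "inv_into (fst K) (snd K) (snd K (bfam l \<psi>)) = bfam l \<psi>" by (intro inv_into_f_f[OF LK(6)]) simp
      then show "G (bfam l \<psi>) = (G \<circ> inv_into (fst K) (snd K)) ((snd k \<circ> circ l) \<psi>)" by (simp only: e o_def)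
    qed
    then show "\<exists>T. open T \<and> \<phi> \<in> T \<and> Ck_on n (UNIV \<inter> T) (\<lambda>\<phi>. G (bfam l \<phi>))"
      using o K(2) by (intro exI[of _ ?Q]) simp
  qed
qed

lemma cover_dataD:
  assumes "(F, b, c) \<in> cover_data N A x0 L"
  defines "G \<equiv> \<lambda>\<alpha>. dpair (endpt (fst (F \<alpha>))) (snd (F \<alpha>))"
  shows "F \<in> extensional (ucover N x0)"
    "\<And>\<alpha>. \<alpha> \<in> ucover N x0 \<Longrightarrow> fst (F \<alpha>) \<in> ucover SL2 (mat 1) \<and> endpt (fst (F \<alpha>)) \<in> SL2 \<and> snd (F \<alpha>) \<in> sl2"
    "\<And>\<kappa> \<alpha>. \<kappa> \<in> loops N x0 \<Longrightarrow> \<alpha> \<in> ucover N x0 \<Longrightarrow> F (concat_class N \<kappa> \<alpha>) = F \<kappa> \<otimes>\<^bsub>ISOt\<^esub> F \<alpha>"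
    "continuous_map (ucover_topology N x0) (ucover_topology SL2 (mat 1)) (\<lambda>\<alpha>. fst (F \<alpha>))"
    "b \<in> L \<rightarrow>\<^sub>E SL2" "c \<in> L \<rightarrow>\<^sub>E sl2" "cover_function N A x0 G"
proof -
  from assms(1) have nq: "normalized_quasiperiodic N x0 ISOt F" and sm: "smooth_ISOt_valued N A x0 F"
    and *: "F \<in> extensional (ucover N x0)" "b \<in> L \<rightarrow>\<^sub>E SL2" "c \<in> L \<rightarrow>\<^sub>E sl2"
    by (simp_all add: cover_data_def)
  show "F \<in> extensional (ucover N x0)" "b \<in> L \<rightarrow>\<^sub>E SL2" "c \<in> L \<rightarrow>\<^sub>E sl2" by (rule *)+
  show "continuous_map (ucover_topology N x0) (ucover_topology SL2 (mat 1)) (\<lambda>\<alpha>. fst (F \<alpha>))"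
    using sm by (simp add: smooth_ISOt_valued_def)
  obtain Fl where Fl: "F \<in> ucover N x0 \<rightarrow> carrier ISOt"
    "\<forall>\<kappa>\<in>loops N x0. \<forall>\<alpha>\<in>ucover N x0. F (concat_class N \<kappa> \<alpha>) = Fl \<kappa> \<otimes>\<^bsub>ISOt\<^esub> F \<alpha>" "\<forall>\<kappa>\<in>loops N x0. Fl \<kappa> = F \<kappa>"
    using nq unfolding normalized_quasiperiodic_def quasiperiodic_with_def by blast
  show mult: "F (concat_class N \<kappa> \<alpha>) = F \<kappa> \<otimes>\<^bsub>ISOt\<^esub> F \<alpha>" if "\<kappa> \<in> loops N x0" "\<alpha> \<in> ucover N x0" for \<kappa> \<alpha>
    using Fl(2)[rule_format, OF that] Fl(3)[rule_format, OF that(1)] by simp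
  show val: "fst (F \<alpha>) \<in> ucover SL2 (mat 1) \<and> endpt (fst (F \<alpha>)) \<in> SL2 \<and> snd (F \<alpha>) \<in> sl2" if "\<alpha> \<in> ucover N x0" for \<alpha>
  proof -
    have "F \<alpha> \<in> ucover SL2 (mat 1) \<times> sl2" using Fl(1) that by (auto simp: ISOt_def Pi_def)
    then have "fst (F \<alpha>) \<in> ucover SL2 (mat 1)" "snd (F \<alpha>) \<in> sl2" by (simp_all add: mem_Times_iff)
    with endpt_in[OF this(1)] show ?thesis by blast
  qed
  show "cover_function N A x0 G"
  proof
    show "path_connected N" by (rule path_connected_N[OF conn])
    show "x0 \<in> N" by (rule x0)
    show Gg: "G \<alpha> \<in> dgroup" if "\<alpha> \<in> ucover N x0" for \<alpha>
      unfolding G_def using val[OF that] by (intro dpair_dgroup) auto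
    show "G (concat_class N \<kappa> \<alpha>) = G \<kappa> * G \<alpha>" if \<kappa>: "\<kappa> \<in> loops N x0" and \<alpha>: "\<alpha> \<in> ucover N x0" for \<kappa> \<alpha>
    proof -
      have \<kappa>u: "\<kappa> \<in> ucover N x0" using \<kappa> by (simp add: loops_def)
      note vk = val[OF \<kappa>u] and va = val[OF \<alpha>]
      obtain p where p: "p \<in> fst (F \<kappa>)" using vk by (meson ucover_nonempty)
      obtain q where q: "q \<in> fst (F \<alpha>)" using va by (meson ucover_nonempty)
      note pD = ucoverD[OF conjunct1[OF vk] p] and qD = ucoverD[OF conjunct1[OF va] q]
      have "path (\<lambda>s. p s ** q s)" using pD(1) qD(1) unfolding path_def
        by (rule bounded_bilinear.continuous_on[OF bounded_bilinear_matrix_mult])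
      moreover have "path_image (\<lambda>s. p s ** q s) \<subseteq> SL2"
        using pD(2) qD(2) SL2_mult unfolding path_image_def image_subset_iff by blast
      ultimately have "endpt (hclass SL2 (\<lambda>s. p s ** q s)) = pathfinish p ** pathfinish q"
        by (simp add: endpt_hclass pathfinish_def)
      then have ep: "endpt (SLt_mult (fst (F \<kappa>)) (fst (F \<alpha>))) = endpt (fst (F \<kappa>)) ** endpt (fst (F \<alpha>))"
        using SLt_mult_hclass[OF pD(1,2) qD(1,2)] pD(4,5) qD(4,5) by simp
      have "F (concat_class N \<kappa> \<alpha>) = (SLt_mult (fst (F \<kappa>)) (fst (F \<alpha>)),
          snd (F \<kappa>) + endpt (fst (F \<kappa>)) ** snd (F \<alpha>) ** matrix_inv (endpt (fst (F \<kappa>))))"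
        unfolding mult[OF \<kappa> \<alpha>] by (simp add: ISOt_def case_prod_unfold)
      then have e: "G (concat_class N \<kappa> \<alpha>) = dpair (endpt (fst (F \<kappa>)) ** endpt (fst (F \<alpha>)))
          (snd (F \<kappa>) + endpt (fst (F \<kappa>)) ** snd (F \<alpha>) ** adj2 (endpt (fst (F \<kappa>))))"
        using vk by (simp add: G_def ep matrix_inv_SL2)
      define g f g' f' where "g = endpt (fst (F \<kappa>))" and "f = snd (F \<kappa>)" and "g' = endpt (fst (F \<alpha>))" and "f' = snd (F \<alpha>)"
      have gs: "g \<in> SL2" "f \<in> sl2" "g' \<in> SL2" "f' \<in> sl2" using vk va by (simp_all add: g_def f_def g'_def f'_def)
      have m: "dpair g f * dpair g' f' \<in> dgroup" by (intro dgroup_mult dpair_dgroup gs)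
      have "dpair (g ** g') (f + g ** f' ** adj2 g) = dpair (dre (dpair g f * dpair g' f')) (dtrans (dpair g f * dpair g' f'))"
        by (simp add: dtrans_mult[OF dpair_dgroup[OF gs(1,2)] dpair_dgroup[OF gs(3,4)]] gs)
      also have "\<dots> = dpair g f * dpair g' f'" by (rule dpair_dtrans[OF m])
      finally show ?thesis unfolding e by (simp add: G_def g_def f_def g'_def f'_def)
    qed
    fix k K assume k: "k \<in> A" "K \<in> lifted_charts N x0 k"
    have 1: "smooth_on (snd K ` fst K) ((\<lambda>\<alpha>. endpt (fst (F \<alpha>))) \<circ> inv_into (fst K) (snd K))"
      and 2: "smooth_on (snd K ` fst K) ((\<lambda>\<alpha>. snd (F \<alpha>)) \<circ> inv_into (fst K) (snd K))"
      using sm k unfolding smooth_ISOt_valued_def smooth_on_cover_def smooth_in_chart_def by blast+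
    have "smooth_on (snd K ` fst K) (\<lambda>z. ((\<lambda>\<alpha>. snd (F \<alpha>)) \<circ> inv_into (fst K) (snd K)) z **
        ((\<lambda>\<alpha>. endpt (fst (F \<alpha>))) \<circ> inv_into (fst K) (snd K)) z)"
      unfolding smooth_on_def
      by (intro allI Ck_on_bilinear[OF bounded_bilinear_matrix_mult] smooth_onD[OF 1] smooth_onD[OF 2])
    with 1 have "smooth_on (snd K ` fst K) (\<lambda>z. DM (((\<lambda>\<alpha>. endpt (fst (F \<alpha>))) \<circ> inv_into (fst K) (snd K)) z)
       (((\<lambda>\<alpha>. snd (F \<alpha>)) \<circ> inv_into (fst K) (snd K)) z ** ((\<lambda>\<alpha>. endpt (fst (F \<alpha>))) \<circ> inv_into (fst K) (snd K)) z))"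
      unfolding smooth_on_DM_iff by blast
    then show "smooth_on (snd K ` fst K) (G \<circ> inv_into (fst K) (snd K))" by (simp add: G_def dpair_def o_def)
  qed
qed

text \<open>The form \<open>log_deriv\<close> gives fields whose holonomy is \<open>G\<close>. It
  remains to recover the class in the cover of SL(2), which \<open>G\<close> does not contain, and
  the boundary constants.\<close>

lemma \<Phi>_surj:
  assumes d: "(F, b, c) \<in> cover_data N A x0 L"
  shows "(F, b, c) \<in> \<Phi> ` physical_configs A L circ"
proof -
  define G where "G \<alpha> = dpair (endpt (fst (F \<alpha>))) (snd (F \<alpha>))" for \<alpha>
  note D = cover_dataD[OF d]
  interpret cover_function N A x0 G using D(7) unfolding G_def[abs_def] .
  define \<omega> where "\<omega> k i x = dre (log_deriv k i x)" for k i x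
  define \<gamma> where "\<gamma> k i x = deps (log_deriv k i x)" for k i x
  have df: "dform \<omega> \<gamma> = log_deriv" by (intro ext) (simp add: dform_def \<omega>_def \<gamma>_def)
  have flat: "flat_form (dform \<omega> \<gamma>)" unfolding df by (rule log_deriv_flat_form)
  note T = field_transport[OF flat, unfolded df]
  define B where "B l = dpair (b l) (c l)" for l
  have bc': "b l \<in> SL2" "c l \<in> sl2" if "l \<in> L" for l using D(5,6) that by auto
  have B: "B l \<in> dgroup" if "l \<in> L" for l unfolding B_def by (rule dpair_dgroup[OF bc'[OF that]])
  \<comment> \<open>The offset has to be \<open>B l\<close>, that is, \<open>G = B l * X l\<close>
    along the circle; this dictates \<open>X l\<close>, whose parts are \<open>u l\<close> and
    \<open>v l\<close>.\<close>
  define X where "X l \<phi> = dadj (B l) * G (bfam l \<phi>)" for l \<phi>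
  have Xg: "X l \<phi> \<in> dgroup" if "l \<in> L" for l \<phi>
    unfolding X_def by (intro dgroup_mult dgroup_dadj B Gg bfam_props(3) that)
  have Xd: "(X l has_vector_derivative X l \<phi> * dalong (dform \<omega> \<gamma>) UNIV (circ l) \<phi>) (at \<phi>)" if l: "l \<in> L" for l \<phi>
    using has_vector_derivative_mult_right[OF boundary_section_derivative[OF l T flat_section_G[OF T]], of "dadj (B l)" \<phi>]
    unfolding X_def[abs_def] df mult.assoc .
  have Xs: "smooth_on UNIV (X l)" if l: "l \<in> L" for l
    unfolding X_def[abs_def] smooth_on_def
    by (intro allI Ck_on_bilinear[OF bounded_bilinear_mult] Ck_on_const smooth_onD[OF smooth_on_bfam[OF l Gs]])
  define u where "u = restrict (\<lambda>l \<phi>. dre (X l \<phi>)) L"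
  define v where "v = restrict (\<lambda>l \<phi>. dtrans (X l \<phi>)) L"
  have ul: "u l = (\<lambda>\<phi>. dre (X l \<phi>))" and vl: "v l = (\<lambda>\<phi>. dtrans (X l \<phi>))" if "l \<in> L" for l
    using that by (simp_all add: u_def v_def)
  note bd = boundary_field[OF _ flat_form_parts(2)[OF flat] Xd Xg ul vl]
  have ph: "(\<omega>, \<gamma>, u, v) \<in> physical_configs A L circ"
  proof -
    have und: "\<forall>c i x. \<not> (c \<in> A \<and> x \<in> fst c) \<longrightarrow> \<omega> c i x = undefined \<and> \<gamma> c i x = undefined"
      unfolding \<omega>_def \<gamma>_def log_deriv_def by (intro allI impI) (simp only: if_False dre_DM deps_DM)
    note fl = flat[unfolded flat_form_dform_iff[OF und]]
    have "(\<forall>\<phi>. u l \<phi> \<in> SL2) \<and> (\<forall>\<phi>. v l \<phi> \<in> sl2) \<and> smooth_on UNIV (u l) \<and> smooth_on UNIV (v l)" if "l \<in> L" for l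
      using dgroup_dre[OF Xg[OF that]] dgroup_dtrans[OF Xg[OF that]] smooth_on_dre_dtrans[OF Xs[OF that]]
      unfolding ul[OF that] vl[OF that] by blast
    moreover have "u \<in> extensional L" "v \<in> extensional L" by (simp_all add: u_def v_def)
    ultimately have "(\<omega>, \<gamma>, u, v) \<in> field_configs A L"
      unfolding field_configs_def mem_Collect_eq prod.case using fl bd(1) by blast
    then show ?thesis
      unfolding physical_configs_def mem_Collect_eq prod.case using fl bd(2,3) by blast
  qed
  interpret germ_transport N "field_transport \<omega> \<gamma>" by (rule T(1))
  have hG: "holo \<alpha> = G \<alpha>" if "\<alpha> \<in> ucover N x0" for \<alpha> by (rule G_holo[OF T that])
  have "restrict cover_map (ucover N x0) = F"
  proof (rule extensionalityI[OF restrict_extensional D(1)])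
    fix \<alpha> assume \<alpha>: "\<alpha> \<in> ucover N x0"
    obtain p where p: "p \<in> \<alpha>" using \<alpha> by (rule ucover_nonempty)
    note pD = ucoverD[OF \<alpha> p]
    note dp = dre_plift_path[OF pD(1,2)]
    let ?r = "\<lambda>s. dre (plift p s)"
    note pl = path_lift[OF pD(1,2), unfolded pD(3)] and rl = path_lift[OF dp(1,2), unfolded dp(3)]
    note c = const_loop[OF x0]
    let ?h = "hclass N (\<lambda>_. x0)"
    have hl: "?h \<in> loops N x0" using c(1,2) by (simp add: loops_def)
    have "fst (F ?h) = SLt_mult (fst (F ?h)) (fst (F ?h))"
      using arg_cong[OF D(3)[OF hl c(1)], of fst] unfolding c(3) by (simp add: ISOt_def case_prod_unfold)
    then have Fh: "fst (F ?h) = hclass SL2 (\<lambda>_. mat 1)"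
      by (intro SLt_idempotent conjunct1[OF D(2)[OF c(1)]]) (rule sym)
    \<comment> \<open>Both sides are end values of continuous lifts of the same path in SL(2): one
      obtained by composing \<open>F\<close> with the lift of \<open>p\<close>, the other from the
      transport itself. They start at the unit class, so unique lifting applies.\<close>
    have "fst (F (path_lift N p 1)) = path_lift SL2 ?r 1"
    proof (rule ucover_lift_unique[OF SL2_thin _ rl(6)])
      show "continuous_map (top_of_set {0..1}) (ucover_topology SL2 (mat 1)) (\<lambda>s. fst (F (path_lift N p s)))"
        using continuous_map_compose[OF pl(6) D(4)] by (simp add: o_def)
      show "endpt (fst (F (path_lift N p s))) = endpt (path_lift SL2 ?r s)" if s: "s \<in> {0..1}" for s
      proof -
        have "endpt (fst (F (path_lift N p s))) = dre (G (path_lift N p s))" by (simp add: G_def)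
        also have "\<dots> = ?r s" by (simp only: G_path_lift[OF T pD(1-3) s])
        finally show ?thesis using rl(2)[OF s] by simp
      qed
      show "fst (F (path_lift N p 0)) = path_lift SL2 ?r 0" unfolding pl(3) rl(3) by (rule Fh)
    qed auto
    then have 1: "fst (F \<alpha>) = hclass SL2 ?r" unfolding pl(4) rl(4) pD(4)[symmetric] .
    have "dtrans (plift p 1) = dtrans (G \<alpha>)" using hG[OF \<alpha>] holo_eq(1)[OF \<alpha> p] by simp
    also have "\<dots> = snd (F \<alpha>)" unfolding G_def using D(2)[OF \<alpha>] by simp
    finally show "restrict cover_map (ucover N x0) \<alpha> = F \<alpha>"
      using \<alpha> 1 by (simp add: cover_map_eq[OF \<alpha> p] prod_eq_iff)
  qed
  moreover have "boundary_offset \<omega> \<gamma> u v l = B l" if l: "l \<in> L" for l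
  proof -
    note \<beta> = bfam_props(3)[OF l, of 0]
    have "dpair (u l 0) (v l 0) = X l 0" unfolding ul[OF l] vl[OF l] by (rule dpair_dtrans[OF Xg[OF l]])
    then have "boundary_offset \<omega> \<gamma> u v l = G (bfam l 0) * dadj (dadj (B l) * G (bfam l 0))"
      unfolding boundary_offset_def hG[OF \<beta>] X_def by simp
    also have "\<dots> = B l" by (simp add: dadj_mult dgroup_left[OF Gg[OF \<beta>]] flip: mult.assoc)
    finally show ?thesis .
  qed
  moreover have "b \<in> extensional L" "c \<in> extensional L" using D(5,6) by (auto simp: PiE_def)
  ultimately have "\<Phi> (\<omega>, \<gamma>, u, v) = (F, b, c)"
    unfolding \<Phi>_def prod.case
    by (auto simp: B_def bc' intro!: extensionalityI[of _ L])
  with ph show ?thesis by (metis image_eqI)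
qed

lemma \<Phi>_bij: "bij_betw \<Phi> (physical_configs A L circ) (cover_data N A x0 L)"
  unfolding bij_betw_def
proof
  show "\<Phi> ` physical_configs A L circ = cover_data N A x0 L"
  proof
    show "\<Phi> ` physical_configs A L circ \<subseteq> cover_data N A x0 L" using \<Phi>_in_cover_data by blast
    show "cover_data N A x0 L \<subseteq> \<Phi> ` physical_configs A L circ"
    proof
      fix y assume "y \<in> cover_data N A x0 L"
      then show "y \<in> \<Phi> ` physical_configs A L circ" using \<Phi>_surj by (cases y) simp
    qed
  qed
qed (rule \<Phi>_inj)

end

theorem theorem3p1:
  fixes N :: "'p::topological_space set"
    and A :: "'p chart set"
    and x0 :: 'p
    and L :: "'l set"
    and circ :: "'l \<Rightarrow> real \<Rightarrow> 'p"
    and bfam :: "'l \<Rightarrow> real \<Rightarrow> (real \<Rightarrow> 'p) set"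
  assumes "smooth_surface (top_of_set N) A"
    and "compact N" and "connected N"
    and "orientable (top_of_set N) A"
    and "trivial_tangent_bundle A"
    and "boundary_circles A L circ"
    and "x0 \<in> N"
    and "\<And>l. l \<in> L \<Longrightarrow> boundary_family N x0 (circ l) (bfam l)"
  shows "(\<forall>\<alpha>\<in>ucover N x0. \<exists>p\<in>\<alpha>. piecewise_C1_path N A p) \<and>
    (\<forall>k\<in>A. \<forall>\<alpha>\<in>ucover N x0. endpt \<alpha> \<in> fst k \<longrightarrow> (\<exists>K\<in>lifted_charts N x0 k. \<alpha> \<in> fst K)) \<and>
    (\<exists>\<Phi>. bij_betw \<Phi> (physical_configs A L circ) (cover_data N A x0 L) \<and>
      (\<forall>\<omega> \<gamma> u v F b c.
         (\<omega>, \<gamma>, u, v) \<in> physical_configs A L circ \<and> \<Phi> (\<omega>, \<gamma>, u, v) = (F, b, c) \<longrightarrow>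
           (\<forall>\<alpha>\<in>ucover N x0. \<forall>p\<in>\<alpha>. piecewise_C1_path N A p \<longrightarrow>
              fst (F \<alpha>) = hclass SL2 (\<lambda>s. transport A \<omega> p 0 s) \<and>
              snd (F \<alpha>) = dist_V A \<omega> \<gamma> p) \<and>
           (\<forall>l\<in>L. \<forall>\<phi>. \<forall>p\<in>bfam l \<phi>. piecewise_C1_path N A p \<longrightarrow>
              b l = transport A \<omega> p 0 1 ** matrix_inv (u l \<phi>) \<and>
              c l = dist_V A \<omega> \<gamma> p
                - transport A \<omega> p 0 1 ** matrix_inv (u l \<phi>) ** v l \<phi> ** u l \<phi>
                    ** matrix_inv (transport A \<omega> p 0 1))) \<and>
      (\<forall>F b c \<omega> \<gamma> u v.
         (F, b, c) \<in> cover_data N A x0 L \<and>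
         inv_into (physical_configs A L circ) \<Phi> (F, b, c) = (\<omega>, \<gamma>, u, v) \<longrightarrow>
           (let g = (\<lambda>\<alpha>. endpt (fst (F \<alpha>))); f = (\<lambda>\<alpha>. snd (F \<alpha>)) in
             (\<forall>k\<in>A. \<forall>K\<in>lifted_charts N x0 k. \<forall>\<alpha>\<in>fst K. \<forall>i.
                \<omega> k i (endpt \<alpha>) = matrix_inv (g \<alpha>) ** chart_deriv K i g \<alpha> \<and>
                \<gamma> k i (endpt \<alpha>) = matrix_inv (g \<alpha>) ** chart_deriv K i f \<alpha> ** g \<alpha>) \<and>
             (\<forall>l\<in>L. \<forall>\<phi>.
                u l \<phi> = matrix_inv (b l) ** g (bfam l \<phi>) \<and>
                v l \<phi> = matrix_inv (b l) ** (f (bfam l \<phi>) - c l) ** b l))))"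
proof -
  interpret bounded_surface N A x0 L circ bfam
    by (unfold_locales) (rule assms; assumption)+
  show ?thesis
  proof (intro conjI ballI impI exI[of _ \<Phi>] allI)
    fix \<alpha> assume "\<alpha> \<in> ucover N x0"
    then show "\<exists>p\<in>\<alpha>. piecewise_C1_path N A p" by (rule pc1_exists)
  next
    fix k \<alpha> assume "k \<in> A" "\<alpha> \<in> ucover N x0" "endpt \<alpha> \<in> fst k"
    then show "\<exists>K\<in>lifted_charts N x0 k. \<alpha> \<in> fst K" by (rule lifted_chart_exists)
  next
    show "bij_betw \<Phi> (physical_configs A L circ) (cover_data N A x0 L)" by (rule \<Phi>_bij)
  next
    fix \<omega> \<gamma> u v F b c \<alpha> p
    assume "(\<omega>, \<gamma>, u, v) \<in> physical_configs A L circ \<and> \<Phi> (\<omega>, \<gamma>, u, v) = (F, b, c)"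
      and a: "\<alpha> \<in> ucover N x0" "p \<in> \<alpha>" "piecewise_C1_path N A p"
    then have h: "(\<omega>, \<gamma>, u, v) \<in> physical_configs A L circ" "\<Phi> (\<omega>, \<gamma>, u, v) = (F, b, c)" by blast+
    show "fst (F \<alpha>) = hclass SL2 (\<lambda>s. transport A \<omega> p 0 s)" "snd (F \<alpha>) = dist_V A \<omega> \<gamma> p"
      using \<Phi>_transport(1)[OF h, rule_format, OF a] by (rule conjunct1, rule conjunct2)
  next
    fix \<omega> \<gamma> u v F b c l \<phi> p
    assume "(\<omega>, \<gamma>, u, v) \<in> physical_configs A L circ \<and> \<Phi> (\<omega>, \<gamma>, u, v) = (F, b, c)"
      and a: "l \<in> L" "p \<in> bfam l \<phi>" "piecewise_C1_path N A p"
    then have h: "(\<omega>, \<gamma>, u, v) \<in> physical_configs A L circ" "\<Phi> (\<omega>, \<gamma>, u, v) = (F, b, c)" by blast+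
    show "b l = transport A \<omega> p 0 1 ** matrix_inv (u l \<phi>)"
      "c l = dist_V A \<omega> \<gamma> p - transport A \<omega> p 0 1 ** matrix_inv (u l \<phi>) ** v l \<phi> ** u l \<phi> ** matrix_inv (transport A \<omega> p 0 1)"
      using \<Phi>_transport(2)[OF h, rule_format, OF a] by (rule conjunct1, rule conjunct2)
  next
    fix F b c \<omega> \<gamma> u v
    assume "(F, b, c) \<in> cover_data N A x0 L \<and> inv_into (physical_configs A L circ) \<Phi> (F, b, c) = (\<omega>, \<gamma>, u, v)"
    \<comment> \<open>Surjectivity makes \<open>inv_into\<close> a genuine preimage, so the formulas
      proved for a configuration and its image apply to it.\<close>
    then have d: "(F, b, c) \<in> \<Phi> ` physical_configs A L circ"
      and i: "inv_into (physical_configs A L circ) \<Phi> (F, b, c) = (\<omega>, \<gamma>, u, v)"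
      using \<Phi>_surj by blast+
    have h: "(\<omega>, \<gamma>, u, v) \<in> physical_configs A L circ" "\<Phi> (\<omega>, \<gamma>, u, v) = (F, b, c)"
      using inv_into_into[OF d] f_inv_into_f[OF d] unfolding i .
    show "let g = (\<lambda>\<alpha>. endpt (fst (F \<alpha>))); f = (\<lambda>\<alpha>. snd (F \<alpha>)) in
             (\<forall>k\<in>A. \<forall>K\<in>lifted_charts N x0 k. \<forall>\<alpha>\<in>fst K. \<forall>i.
                \<omega> k i (endpt \<alpha>) = matrix_inv (g \<alpha>) ** chart_deriv K i g \<alpha> \<and>
                \<gamma> k i (endpt \<alpha>) = matrix_inv (g \<alpha>) ** chart_deriv K i f \<alpha> ** g \<alpha>) \<and>
             (\<forall>l\<in>L. \<forall>\<phi>.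
                u l \<phi> = matrix_inv (b l) ** g (bfam l \<phi>) \<and>
                v l \<phi> = matrix_inv (b l) ** (f (bfam l \<phi>) - c l) ** b l)"
      unfolding Let_def by (intro conjI \<Phi>_inverse[OF h refl refl])
  qed
qed

end
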